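(* Let $k\ge 2$ be a fixed integer. The problem of deciding, given a temporal digraph $\mathcal{G}=(G,\gamma,\lambda)$ and subsets $R_1,\dots,R_k\subseteq V_T$, whether $\mathcal{G}$ has $k$ pairwise edge-disjoint temporal-spanning branchings rooted at $R_1,\dots,R_k$ respectively, is $\mathsf{NP}$-complete, even if $G$ is a DAG, each snapshot of $\mathcal{G}$ has constant size, and the underlying undirected graph of $G$ is a star. Furthermore, in this restricted case there is no algorithm solving the problem in time $O^*(2^{o(\mathsf{T})})$, where $\mathsf{T}$ is the lifetime of $\mathcal{G}$, unless the Exponential Time Hypothesis fails.
   Context: A temporal digraph is a triple $\mathcal{G}=(G,\gamma,\lambda)$ where $G$ is a finite digraph, $\gamma(v)\subseteq\mathbb{N}$ for each $v\in V(G)$, and $\lambda(e)\subseteq\mathbb{N}\times\mathbb{N}$ for each $e\in E(G)$, such that if $(t,t')\in\lambda(uv)$ then $t\le t'$, $t\in\gamma(u)$, $t'\in\gamma(v)$. The lifetime is $\mathsf{T}=\max\bigcup_v\gamma(v)$. The snapshot at time $t$ is the digraph of vertices active at $t$ (i.e. $t\in\gamma(v)$) and edges $uv$ with $(t,t)\in\lambda(uv)$. Temporal vertices: $V_T=\{(v,t):t\in\gamma(v)\}$; temporal edges: $(u,t)(v,t')$ for $uv\in E(G)$, $(t,t')\in\lambda(uv)$. A temporal walk is a sequence of temporal vertices and temporal edges in which each temporal edge goes from the preceding to the following temporal vertex, and any two consecutive temporal vertices are $(v,t),(v,t+1)$. A temporal subdigraph is $(G',\gamma',\lambda')$ with $G'\subseteq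 G,\gamma'\subseteq\gamma,\lambda'\subseteq\lambda$. For $R\subseteq V_T$, a temporal subdigraph $\mathcal{B}$ is a temporal-spanning branching with root $R$ if every $(u,i)\in V_T$ is the end of exactly one temporal walk in $\mathcal{B}$ starting at a vertex of $R$. Branchings $(G_1,\gamma_1,\lambda_1),(G_2,\gamma_2,\lambda_2)$ are edge-disjoint if $E(G_1)\cap E(G_2)=\emptyset$. $O^*$ suppresses polynomial factors in the input size. *)

theory Defs
  imports
    Complex_Main
    "HOL-Library.Landau_Symbols"
    "HOL-Computational_Algebra.Polynomial"
    "Graph_Theory.Pair_Digraph"
    "Graph_Theory.Digraph_Component"
begin

section \<open>Temporal digraphs and branchings\<close>

text \<open>
  The values of \<open>act\<close> and \<open>link\<close> outside the vertex set and the arc set are irrelevant.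
\<close>

record 'v tdigraph =
  base :: "'v pair_pre_digraph"
  act :: "'v \<Rightarrow> nat set"
  link :: "'v \<times> 'v \<Rightarrow> (nat \<times> nat) set"

definition temporal_digraph :: "'v tdigraph \<Rightarrow> bool" where
  "temporal_digraph D \<longleftrightarrow>
     pair_fin_digraph (base D) \<and>
     (\<forall>v\<in>pverts (base D). finite (act D v)) \<and>
     (\<forall>(u, v)\<in>parcs (base D). \<forall>(t, t')\<in>link D (u, v).
        t \<le> t' \<and> t \<in> act D u \<and> t' \<in> act D v)"

definition tverts :: "'v tdigraph \<Rightarrow> ('v \<times> nat) set" where
  "tverts D = {(v, t). v \<in> pverts (base D) \<and> t \<in> act D v}"

definition tedges :: "'v tdigraph \<Rightarrow> (('v \<times> nat) \<times> ('v \<times> nat)) set" where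
  "tedges D = {((u, t), (v, t')) | u t v t'. (u, v) \<in> parcs (base D) \<and> (t, t') \<in> link D (u, v)}"

text \<open>The element 0 only matters if no vertex is ever active; then the lifetime is 0.\<close>

definition lifetime :: "'v tdigraph \<Rightarrow> nat" where
  "lifetime D = Max (insert 0 (\<Union>v\<in>pverts (base D). act D v))"

definition snapshot :: "'v tdigraph \<Rightarrow> nat \<Rightarrow> 'v pair_pre_digraph" where
  "snapshot D t =
     \<lparr> pverts = {v \<in> pverts (base D). t \<in> act D v},
       parcs = {e \<in> parcs (base D). (t, t) \<in> link D e} \<rparr>"

text \<open>
  A temporal walk is the sequence of its temporal vertices and temporal edges. It begins and ends
  with a temporal vertex. Edges are recorded explicitly, so that waiting from \<open>(v, t)\<close> to
  \<open>(v, t + 1)\<close> differs from traversing a temporal edge between the same temporal vertices, which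
  is possible if \<open>v\<close> has a loop.
\<close>

datatype 'v titem = TV "'v \<times> nat" | TE "'v \<times> nat" "'v \<times> nat"

inductive twalk :: "'v tdigraph \<Rightarrow> 'v titem list \<Rightarrow> bool" for D where
  single: "p \<in> tverts D \<Longrightarrow> twalk D [TV p]"
| wait: "(v, t) \<in> tverts D \<Longrightarrow> twalk D (TV (v, t + 1) # W) \<Longrightarrow>
    twalk D (TV (v, t) # TV (v, t + 1) # W)"
| edge: "p \<in> tverts D \<Longrightarrow> (p, q) \<in> tedges D \<Longrightarrow> twalk D (TV q # W) \<Longrightarrow>
    twalk D (TV p # TE p q # TV q # W)"

definition temporal_subdigraph :: "'v tdigraph \<Rightarrow> 'v tdigraph \<Rightarrow> bool" where
  "temporal_subdigraph B D \<longleftrightarrow>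
     temporal_digraph B \<and>
     subgraph (with_proj (base B)) (with_proj (base D)) \<and>
     (\<forall>v\<in>pverts (base B). act B v \<subseteq> act D v) \<and>
     (\<forall>e\<in>parcs (base B). link B e \<subseteq> link D e)"

definition temporal_spanning_branching ::
    "'v tdigraph \<Rightarrow> ('v \<times> nat) set \<Rightarrow> 'v tdigraph \<Rightarrow> bool" where
  "temporal_spanning_branching D R B \<longleftrightarrow>
     temporal_subdigraph B D \<and>
     (\<forall>p\<in>tverts D. \<exists>!W. twalk B W \<and> (\<exists>r\<in>R. hd W = TV r) \<and> last W = TV p)"

definition edge_disjoint :: "'v tdigraph \<Rightarrow> 'v tdigraph \<Rightarrow> bool" where
  "edge_disjoint B B' \<longleftrightarrow> parcs (base B) \<inter> parcs (base B') = {}"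

definition has_disjoint_branchings :: "'v tdigraph \<Rightarrow> ('v \<times> nat) set list \<Rightarrow> bool" where
  "has_disjoint_branchings D Rs \<longleftrightarrow>
     (\<exists>Bs. length Bs = length Rs \<and>
        (\<forall>i<length Rs. temporal_spanning_branching D (Rs ! i) (Bs ! i)) \<and>
        (\<forall>i<length Rs. \<forall>j<length Rs. i \<noteq> j \<longrightarrow> edge_disjoint (Bs ! i) (Bs ! j)))"

definition underlying_star :: "'v pair_pre_digraph \<Rightarrow> bool" where
  "underlying_star G \<longleftrightarrow>
     (\<exists>c\<in>pverts G. {{u, v} | u v. (u, v) \<in> parcs G} = {{c, v} | v. v \<in> pverts G - {c}})"

definition digraph_size :: "'v pair_pre_digraph \<Rightarrow> nat" where
  "digraph_size G = card (pverts G) + card (parcs G)"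


section \<open>Turing machines\<close>

text \<open>
  Deterministic multi-tape machines over two-way infinite tapes. The states of \<open>M\<close> are
  \<open>0, \<dots>, states M\<close>, where 0 is initial and \<open>states M\<close> is the halting state. The tape symbols are
  \<open>0, \<dots>, symbols M - 1\<close>, where 0 is the blank and 1 and 2 stand for the bits 0 and 1. Tape 0 holds
  the input and tape 1 the output.
\<close>

datatype move = ToLeft | Stay | ToRight

record tm =
  tapes :: nat
  states :: nat
  symbols :: nat
  delta :: "nat \<Rightarrow> nat list \<Rightarrow> nat \<times> (nat \<times> move) list"

type_synonym tape = "(int \<Rightarrow> nat) \<times> int"
type_synonym config = "nat \<times> tape list"

definition wf_tm :: "tm \<Rightarrow> bool" where
  "wf_tm M \<longleftrightarrow> tapes M \<ge> 2 \<and> symbols M \<ge> 3 \<and>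
     (\<forall>q<states M. \<forall>ss. length ss = tapes M \<and> set ss \<subseteq> {..<symbols M} \<longrightarrow>
        (case delta M q ss of (q', as) \<Rightarrow>
           q' \<le> states M \<and> length as = tapes M \<and> fst ` set as \<subseteq> {..<symbols M}))"

fun tape_read :: "tape \<Rightarrow> nat" where
  "tape_read (cells, pos) = cells pos"

fun tape_act :: "nat \<times> move \<Rightarrow> tape \<Rightarrow> tape" where
  "tape_act (s, m) (cells, pos) =
     (cells(pos := s), case m of ToLeft \<Rightarrow> pos - 1 | Stay \<Rightarrow> pos | ToRight \<Rightarrow> pos + 1)"

fun tm_step :: "tm \<Rightarrow> config \<Rightarrow> config" where
  "tm_step M (q, ts) =
     (if q < states M
      then case delta M q (map tape_read ts) of (q', as) \<Rightarrow> (q', map2 tape_act as ts)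
      else (q, ts))"

definition bit_symbol :: "bool \<Rightarrow> nat" where
  "bit_symbol b = (if b then 2 else 1)"

definition input_tape :: "bool list \<Rightarrow> tape" where
  "input_tape w =
     (\<lambda>i. if 0 \<le> i \<and> i < int (length w) then bit_symbol (w ! nat i) else 0, 0)"

definition tm_init :: "tm \<Rightarrow> bool list \<Rightarrow> config" where
  "tm_init M w = (0, input_tape w # replicate (tapes M - 1) (\<lambda>_. 0, 0))"

text \<open>The output is the word on tape 1 that extends from cell 0 to the first blank.\<close>

definition has_output :: "config \<Rightarrow> bool list \<Rightarrow> bool" where
  "has_output c u \<longleftrightarrow>
     (let cells = fst (snd c ! 1) in
       (\<forall>i<length u. cells (int i) = bit_symbol (u ! i)) \<and> cells (int (length u)) = 0)"

definition outputs_within :: "tm \<Rightarrow> bool list \<Rightarrow> bool list \<Rightarrow> real \<Rightarrow> bool" where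
  "outputs_within M w u b \<longleftrightarrow>
     (\<exists>n. real n \<le> b \<and>
        (let c = (tm_step M ^^ n) (tm_init M w) in fst c = states M \<and> has_output c u))"


section \<open>NP-completeness\<close>

definition polytime_computable :: "(bool list \<Rightarrow> bool list) \<Rightarrow> bool" where
  "polytime_computable f \<longleftrightarrow>
     (\<exists>M (p :: nat poly). wf_tm M \<and>
        (\<forall>w. outputs_within M w (f w) (real (poly p (length w)))))"

definition class_P :: "bool list set set" where
  "class_P = {L. polytime_computable (\<lambda>w. [w \<in> L])}"

definition bit_pair :: "bool list \<Rightarrow> bool list \<Rightarrow> bool list" where
  "bit_pair x y = concat (map (\<lambda>b. [True, b]) x) @ [False] @ y"

definition class_NP :: "bool list set set" where
  "class_NP = {L. \<exists>V\<in>class_P. \<exists>p :: nat poly. \<forall>x.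
     x \<in> L \<longleftrightarrow> (\<exists>y. length y \<le> poly p (length x) \<and> bit_pair x y \<in> V)}"

definition polytime_reducible :: "bool list set \<Rightarrow> bool list set \<Rightarrow> bool" where
  "polytime_reducible L L' \<longleftrightarrow> (\<exists>f. polytime_computable f \<and> (\<forall>x. x \<in> L \<longleftrightarrow> f x \<in> L'))"

definition NP_hard :: "bool list set \<Rightarrow> bool" where
  "NP_hard L \<longleftrightarrow> (\<forall>L'\<in>class_NP. polytime_reducible L' L)"

definition NP_complete :: "bool list set \<Rightarrow> bool" where
  "NP_complete L \<longleftrightarrow> L \<in> class_NP \<and> NP_hard L"


section \<open>Encodings\<close>

text \<open>
  All encodings are self-delimiting: each bit of the binary representation of a number (least
  significant bit first) and each element of a list is preceded by \<open>True\<close>, and \<open>False\<close> marks the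
  end.
\<close>

fun bits_of_nat :: "nat \<Rightarrow> bool list" where
  "bits_of_nat n = (if n = 0 then [] else odd n # bits_of_nat (n div 2))"

declare bits_of_nat.simps [simp del]

definition enc_list :: "('a \<Rightarrow> bool list) \<Rightarrow> 'a list \<Rightarrow> bool list" where
  "enc_list f xs = concat (map (\<lambda>x. True # f x) xs) @ [False]"

definition enc_bool :: "bool \<Rightarrow> bool list" where
  "enc_bool b = [b]"

definition enc_nat :: "nat \<Rightarrow> bool list" where
  "enc_nat n = enc_list enc_bool (bits_of_nat n)"

definition enc_prod :: "('a \<Rightarrow> bool list) \<Rightarrow> ('b \<Rightarrow> bool list) \<Rightarrow> 'a \<times> 'b \<Rightarrow> bool list" where
  "enc_prod f g p = f (fst p) @ g (snd p)"

definition self_delimiting :: "('a \<Rightarrow> bool list) \<Rightarrow> bool" where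
  "self_delimiting f \<longleftrightarrow> (\<forall>x y s s'. f x @ s = f y @ s' \<longrightarrow> x = y \<and> s = s')"

lemma self_delimiting_bool: "self_delimiting enc_bool"
  by (simp add: self_delimiting_def enc_bool_def)

lemma self_delimiting_list:
  assumes "self_delimiting f"
  shows "self_delimiting (enc_list f)"
proof -
  have "enc_list f xs @ s = enc_list f ys @ s' \<Longrightarrow> xs = ys \<and> s = s'" for xs ys s s'
  proof (induction xs arbitrary: ys)
    case Nil
    then show ?case by (cases ys) (auto simp: enc_list_def)
  next
    case (Cons x xs)
    then obtain y ys' where ys: "ys = y # ys'" by (cases ys) (auto simp: enc_list_def)
    have "f x @ (enc_list f xs @ s) = f y @ (enc_list f ys' @ s')"
      using Cons.prems ys by (simp add: enc_list_def)
    then have "x = y" "enc_list f xs @ s = enc_list f ys' @ s'"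
      using assms unfolding self_delimiting_def by blast+
    then show ?case using Cons.IH ys by blast
  qed
  then show ?thesis unfolding self_delimiting_def by blast
qed

lemma self_delimiting_prod:
  assumes "self_delimiting f" "self_delimiting g"
  shows "self_delimiting (enc_prod f g)"
  unfolding self_delimiting_def
proof (intro allI impI)
  fix p q :: "'a \<times> 'b" and s s'
  assume eq: "enc_prod f g p @ s = enc_prod f g q @ s'"
  have "f (fst p) @ (g (snd p) @ s) = f (fst q) @ (g (snd q) @ s')"
    using eq by (simp add: enc_prod_def)
  then have "fst p = fst q" "g (snd p) @ s = g (snd q) @ s'"
    using assms(1) unfolding self_delimiting_def by blast+
  moreover from this have "snd p = snd q" "s = s'"
    using assms(2) unfolding self_delimiting_def by blast+
  ultimately show "p = q \<and> s = s'" by (simp add: prod_eq_iff)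
qed

lemma inj_bits_of_nat: "bits_of_nat m = bits_of_nat n \<Longrightarrow> m = n"
proof (induction m arbitrary: n rule: less_induct)
  case (less m)
  show ?case
  proof (cases "m = 0 \<or> n = 0")
    case True
    then show ?thesis using less.prems
      by (subst (asm) (1 2) bits_of_nat.simps) (auto split: if_splits)
  next
    case False
    then have "odd m = odd n" "bits_of_nat (m div 2) = bits_of_nat (n div 2)"
      using less.prems by (subst (asm) (1 2) bits_of_nat.simps; simp)+
    then have "m div 2 = n div 2" using less.IH[of "m div 2" "n div 2"] False by simp
    with \<open>odd m = odd n\<close> show ?thesis
      by (metis odd_two_times_div_two_succ dvd_mult_div_cancel)
  qed
qed

lemma self_delimiting_nat: "self_delimiting enc_nat"
  using self_delimiting_list[OF self_delimiting_bool] inj_bits_of_nat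
  unfolding self_delimiting_def enc_nat_def by blast


section \<open>The decision problem\<close>

text \<open>
  An instance lists the vertices with their activity times, the arcs with their pairs of times, and
  the root sets. Neither the order nor repetitions matter.
\<close>

type_synonym edtsb_instance =
  "(nat \<times> nat list) list \<times> ((nat \<times> nat) \<times> (nat \<times> nat) list) list \<times> (nat \<times> nat) list list"

fun inst_digraph :: "edtsb_instance \<Rightarrow> nat tdigraph" where
  "inst_digraph (vs, es, rs) =
     \<lparr> base = \<lparr> pverts = fst ` set vs, parcs = fst ` set es \<rparr>,
       act = (\<lambda>v. {t. \<exists>ts. (v, ts) \<in> set vs \<and> t \<in> set ts}),
       link = (\<lambda>e. {p. \<exists>ps. (e, ps) \<in> set es \<and> p \<in> set ps}) \<rparr>"

fun inst_roots :: "edtsb_instance \<Rightarrow> (nat \<times> nat) set list" where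
  "inst_roots (vs, es, rs) = map set rs"

definition enc_instance :: "edtsb_instance \<Rightarrow> bool list" where
  "enc_instance =
     enc_prod (enc_list (enc_prod enc_nat (enc_list enc_nat)))
       (enc_prod
         (enc_list (enc_prod (enc_prod enc_nat enc_nat) (enc_list (enc_prod enc_nat enc_nat))))
         (enc_list (enc_list (enc_prod enc_nat enc_nat))))"

lemma self_delimiting_instance: "self_delimiting enc_instance"
  unfolding enc_instance_def
  by (intro self_delimiting_prod self_delimiting_list self_delimiting_nat)

definition edtsb_instances :: "nat \<Rightarrow> edtsb_instance set" where
  "edtsb_instances k =
     {I. temporal_digraph (inst_digraph I) \<and> length (inst_roots I) = k \<and>
         (\<forall>R\<in>set (inst_roots I). R \<subseteq> tverts (inst_digraph I))}"

definition edtsb_yes :: "edtsb_instance \<Rightarrow> bool" where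
  "edtsb_yes I \<longleftrightarrow> has_disjoint_branchings (inst_digraph I) (inst_roots I)"

definition restricted_instances :: "nat \<Rightarrow> nat \<Rightarrow> edtsb_instance set" where
  "restricted_instances k c =
     {I \<in> edtsb_instances k.
        acyclic (parcs (base (inst_digraph I))) \<and>
        (\<forall>t. digraph_size (snapshot (inst_digraph I) t) \<le> c) \<and>
        underlying_star (base (inst_digraph I))}"

definition edtsb_language :: "edtsb_instance set \<Rightarrow> bool list set" where
  "edtsb_language \<I> = enc_instance ` {I \<in> \<I>. edtsb_yes I}"

text \<open>
  A running time of \<open>O\<^sup>*(2\<^bsup>o(T)\<^esup>)\<close>, where \<open>T\<close> is the lifetime. The algorithm only has to behave well
  on (encodings of) the given instances.
\<close>

definition solvable_subexp_lifetime :: "edtsb_instance set \<Rightarrow> bool" where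
  "solvable_subexp_lifetime \<I> \<longleftrightarrow>
     (\<exists>M (p :: nat poly) (f :: nat \<Rightarrow> real). wf_tm M \<and> f \<in> o(\<lambda>T. real T) \<and>
        (\<forall>I\<in>\<I>. outputs_within M (enc_instance I) [edtsb_yes I]
           (real (poly p (length (enc_instance I))) * 2 powr f (lifetime (inst_digraph I)))))"


section \<open>Exponential Time Hypothesis\<close>

text \<open>
  Formulas in conjunctive normal form; the literal \<open>(b, x)\<close> is true iff variable \<open>x\<close> has value \<open>b\<close>.
\<close>

type_synonym cnf = "(bool \<times> nat) list list"

definition satisfiable :: "cnf \<Rightarrow> bool" where
  "satisfiable \<phi> \<longleftrightarrow> (\<exists>\<sigma>. \<forall>C\<in>set \<phi>. \<exists>(b, x)\<in>set C. \<sigma> x = b)"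

definition cnf_vars :: "cnf \<Rightarrow> nat set" where
  "cnf_vars \<phi> = (\<Union>C\<in>set \<phi>. snd ` set C)"

definition three_cnf :: "cnf \<Rightarrow> bool" where
  "three_cnf \<phi> \<longleftrightarrow> (\<forall>C\<in>set \<phi>. length C \<le> 3)"

definition enc_cnf :: "cnf \<Rightarrow> bool list" where
  "enc_cnf = enc_list (enc_list (enc_prod enc_bool enc_nat))"

lemma self_delimiting_cnf: "self_delimiting enc_cnf"
  unfolding enc_cnf_def
  by (intro self_delimiting_prod self_delimiting_list self_delimiting_bool self_delimiting_nat)

text \<open>
  The hypothesis of Impagliazzo and Paturi: the infimum of all \<open>\<delta>\<close> such that 3-SAT on \<open>n\<close> variables
  can be solved in time \<open>2\<^bsup>\<delta>n\<^esup>\<close>, up to polynomial factors in the input size, is positive.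
\<close>

definition three_sat_solvable :: "real \<Rightarrow> bool" where
  "three_sat_solvable \<delta> \<longleftrightarrow>
     (\<exists>M (p :: nat poly). wf_tm M \<and>
        (\<forall>\<phi>. three_cnf \<phi> \<longrightarrow>
           outputs_within M (enc_cnf \<phi>) [satisfiable \<phi>]
             (real (poly p (length (enc_cnf \<phi>))) * 2 powr (\<delta> * real (card (cnf_vars \<phi>))))))"

definition ETH :: bool where
  "ETH \<longleftrightarrow> (\<exists>\<delta>>0. \<not> three_sat_solvable \<delta>)"

end

theory Submission
  imports Defs
begin

text \<open>
  In a temporal-spanning branching every temporal vertex outside the roots is entered exactly once,
  so a star whose arcs lead from the leaves (literals) to the centre, which is active at one time
  per clause, lets the first branching choose a set of true literals; a second branching that has to
  enter the centre at the times of the clauses \<open>x \<or> \<not> x\<close> needs the arc of \<open>x\<close> or of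
  \<open>\<not> x\<close>, which makes the choice consistent. Clauses of any width are allowed, so
  NP-hardness follows from the tableau of a computation.

  The lifetime of the instance is linear in the numbers of variables and clauses. For the
  Exponential Time Hypothesis, a formula in 3-CNF is first sparsified: as long as many clauses of
  the same width share a literal or a pair of literals (a heart), branch on whether the heart or all
  of the remaining parts (the petals) of these clauses are satisfied. A potential that is linear in
  the number \<open>n\<close> of variables drops by 1 in the first and by \<open>d\<^sup>4\<close> in the second case, so that
  there are only \<open>2\<^bsup>O(n / d)\<^esup>\<close> formulas to be solved, each with at most \<open>C\<^sub>d n + 1\<close> clauses.

  Time bounds are obtained from a class of functions on trees, computed by programs on stacks, that
  is closed under composition and bounded iteration.
\<close>

section \<open>Stack programs\<close>

text \<open>Two obstacles shape the instances. A spanning branching contains all temporal vertices,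
  so every possible wait belongs to it and cannot be avoided; hence all times are even, nothing can
  wait, and each temporal vertex is a root or needs exactly one temporal edge. Moreover no two
  temporal vertices share a time, so a snapshot is at most one vertex (\<open>c = 1\<close>). For
  the lower bound, the hypothetical algorithm is an arbitrary machine that is reliable only on the
  given instances and whose time bound \<open>f\<close> need not be computable. It is simulated
  without a clock, and its configurations may have size \<open>2 ^ (\<epsilon> n)\<close>, while a
  step of the search takes time polynomial in the size of the state. So \<epsilon> is chosen after
  the degrees of these polynomials are known; they depend on the machine, \<open>k\<close> and
  \<open>d\<close> only. The rest of the exponent is controlled by \<open>d\<close>: the potential
  starts at most at \<open>8 d^2 n\<close>, and drops by 1 and \<open>d^4\<close> allow a growth
  rate of \<open>1 + 1 / d^3\<close> per unit of potential, which gives an exponent of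
  \<open>16 n / d\<close>.\<close>

text \<open>
  A program works on stacks of tape symbols; stack 1 is special, since it is only appended to and
  becomes the output. A test compares the top of a stack, which is 0 for the empty stack.
\<close>

datatype com = Push nat nat | Pop nat | Out nat | Seq com com (infixr ";;" 60)
  | If_top nat "nat set" com com | While_top nat "nat set" com

type_synonym stacks = "nat \<Rightarrow> nat list"

definition top_of :: "nat list \<Rightarrow> nat" where
  "top_of xs = (case xs of [] \<Rightarrow> 0 | x # _ \<Rightarrow> x)"

lemma top_of_simps [simp]: "top_of [] = 0" "top_of (x # xs) = x"
  by (simp_all add: top_of_def)

text \<open>The costs bound the number of executed instructions of the compiled code: a test
  together with a jump counts 2, also in the branch that needs no jump.\<close>

inductive big :: "com \<Rightarrow> stacks \<Rightarrow> nat \<Rightarrow> stacks \<Rightarrow> bool" where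
  Push: "big (Push r a) s 1 (s(r := a # s r))"
| Pop: "big (Pop r) s 1 (s(r := tl (s r)))"
| Out: "big (Out a) s 1 (s(1 := s 1 @ [a]))"
| Seq: "big c s m t \<Longrightarrow> big c' t n u \<Longrightarrow> big (c ;; c') s (m + n) u"
| IfT: "top_of (s r) \<in> A \<Longrightarrow> big c s n t \<Longrightarrow> big (If_top r A c c') s (n + 2) t"
| IfF: "top_of (s r) \<notin> A \<Longrightarrow> big c' s n t \<Longrightarrow> big (If_top r A c c') s (n + 2) t"
| WhileF: "top_of (s r) \<notin> A \<Longrightarrow> big (While_top r A c) s 1 s"
| WhileT: "top_of (s r) \<in> A \<Longrightarrow> big c s m t \<Longrightarrow> big (While_top r A c) t n u \<Longrightarrow>
    big (While_top r A c) s (m + n + 2) u"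

text \<open>Five stacks for the five tapes of \<open>machine_of\<close>. Stack 1 is excluded from
  tests and pops because the head of its tape stands behind the last symbol.\<close>

fun wf_com :: "com \<Rightarrow> bool" where
  "wf_com (Push r a) \<longleftrightarrow> r < 5 \<and> r \<noteq> 1 \<and> a \<in> {1, 2}"
| "wf_com (Pop r) \<longleftrightarrow> r < 5 \<and> r \<noteq> 1"
| "wf_com (Out a) \<longleftrightarrow> a \<in> {1, 2}"
| "wf_com (c ;; c') \<longleftrightarrow> wf_com c \<and> wf_com c'"
| "wf_com (If_top r A c c') \<longleftrightarrow> r < 5 \<and> r \<noteq> 1 \<and> wf_com c \<and> wf_com c'"
| "wf_com (While_top r A c) \<longleftrightarrow> r < 5 \<and> r \<noteq> 1 \<and> wf_com c"

section \<open>Code with jumps\<close>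

datatype instr = IPush nat nat | IPop nat | IOut nat | ITest nat "nat set" nat | IJump nat

fun code_len :: "com \<Rightarrow> nat" where
  "code_len (c ;; c') = code_len c + code_len c'"
| "code_len (If_top r A c c') = code_len c + code_len c' + 2"
| "code_len (While_top r A c) = code_len c + 2"
| "code_len _ = 1"

fun code_of :: "com \<Rightarrow> nat \<Rightarrow> instr list" where
  "code_of (Push r a) b = [IPush r a]"
| "code_of (Pop r) b = [IPop r]"
| "code_of (Out a) b = [IOut a]"
| "code_of (c ;; c') b = code_of c b @ code_of c' (b + code_len c)"
| "code_of (If_top r A c c') b =
     ITest r A (b + code_len c + 2) # code_of c (b + 1) @
     IJump (b + code_len c + code_len c' + 2) # code_of c' (b + code_len c + 2)"
| "code_of (While_top r A c) b =
     ITest r A (b + code_len c + 2) # code_of c (b + 1) @ [IJump b]"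

lemma length_code_of [simp]: "length (code_of c b) = code_len c"
  by (induction c arbitrary: b) auto

fun exec_instr :: "instr \<Rightarrow> nat \<times> stacks \<Rightarrow> nat \<times> stacks" where
  "exec_instr (IPush r a) (pc, s) = (pc + 1, s(r := a # s r))"
| "exec_instr (IPop r) (pc, s) = (pc + 1, s(r := tl (s r)))"
| "exec_instr (IOut a) (pc, s) = (pc + 1, s(1 := s 1 @ [a]))"
| "exec_instr (ITest r A d) (pc, s) = (if top_of (s r) \<in> A then pc + 1 else d, s)"
| "exec_instr (IJump d) (pc, s) = (d, s)"

definition code_step :: "instr list \<Rightarrow> nat \<times> stacks \<Rightarrow> nat \<times> stacks" where
  "code_step P c = (if fst c < length P then exec_instr (P ! fst c) c else c)"

definition code_at :: "instr list \<Rightarrow> nat \<Rightarrow> instr list \<Rightarrow> bool" where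
  "code_at P b xs \<longleftrightarrow> (\<forall>i<length xs. b + i < length P \<and> P ! (b + i) = xs ! i)"

lemma code_at_Nil [simp]: "code_at P b []"
  by (simp add: code_at_def)

lemma code_at_Cons [simp]:
  "code_at P b (x # xs) \<longleftrightarrow> b < length P \<and> P ! b = x \<and> code_at P (Suc b) xs"
  by (auto simp: code_at_def less_Suc_eq_0_disj)

lemma code_at_append [simp]:
  "code_at P b (xs @ ys) \<longleftrightarrow> code_at P b xs \<and> code_at P (b + length xs) ys"
  by (induction xs arbitrary: b) auto

definition code_reach :: "instr list \<Rightarrow> nat \<times> stacks \<Rightarrow> nat \<Rightarrow> nat \<times> stacks \<Rightarrow> bool" where
  "code_reach P x n y \<longleftrightarrow> (\<exists>m\<le>n. (code_step P ^^ m) x = y)"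

lemma code_reach_step: "code_step P x = y \<Longrightarrow> 1 \<le> n \<Longrightarrow> code_reach P x n y"
  unfolding code_reach_def by (intro exI[of _ 1]) simp

lemma code_reach_trans:
  "code_reach P x m y \<Longrightarrow> code_reach P y n z \<Longrightarrow> m + n \<le> l \<Longrightarrow> code_reach P x l z"
proof -
  assume "code_reach P x m y" "code_reach P y n z" and l: "m + n \<le> l"
  then obtain i j where "i \<le> m" "(code_step P ^^ i) x = y" "j \<le> n" "(code_step P ^^ j) y = z"
    unfolding code_reach_def by blast
  then show ?thesis unfolding code_reach_def
    using l by (intro exI[of _ "j + i"]) (auto simp: funpow_add)
qed

text \<open>Induction on the run and not on the program, since a loop continues in its own code. The
  position \<open>b\<close> stays arbitrary because the body of a command is code inside the code of
  the command.\<close>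

lemma code_of_correct:
  "big c s n t \<Longrightarrow> code_at P b (code_of c b) \<Longrightarrow> code_reach P (b, s) n (b + code_len c, t)"
proof (induction arbitrary: b rule: big.induct)
  case (Seq c s m t c' n u)
  have "code_reach P (b, s) m (b + code_len c, t)"
    "code_reach P (b + code_len c, t) n (b + code_len c + code_len c', u)"
    using Seq.IH(1)[of b] Seq.IH(2)[of "b + code_len c"] Seq.prems by simp_all
  from code_reach_trans[OF this le_refl] show ?case by (simp add: add.assoc)
next
  case (IfT s r A c n t c')
  have "code_reach P (b, s) 1 (b + 1, s)"
    using IfT by (intro code_reach_step) (auto simp: code_step_def)
  moreover have "code_reach P (b + 1, s) n (b + 1 + code_len c, t)"
    using IfT.IH[of "b + 1"] IfT.prems by simp
  ultimately have "code_reach P (b, s) (1 + n) (b + 1 + code_len c, t)"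
    by (rule code_reach_trans[OF _ _ le_refl])
  moreover have "code_reach P (b + 1 + code_len c, t) 1 (b + code_len (If_top r A c c'), t)"
    using IfT by (intro code_reach_step) (auto simp: code_step_def add_ac)
  ultimately show ?case by (rule code_reach_trans) simp
next
  case (IfF s r A c' n t c)
  have "code_reach P (b, s) 1 (b + code_len c + 2, s)"
    using IfF by (intro code_reach_step) (auto simp: code_step_def)
  moreover have "code_reach P (b + code_len c + 2, s) n (b + code_len (If_top r A c c'), t)"
    using IfF.IH[of "b + code_len c + 2"] IfF.prems by (simp add: add_ac)
  ultimately show ?case by (rule code_reach_trans) simp
next
  case (WhileF s r A c)
  then show ?case by (intro code_reach_step) (auto simp: code_step_def)
next
  case (WhileT s r A c m t n u)
  have 1: "code_reach P (b, s) 1 (b + 1, s)"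
    using WhileT by (intro code_reach_step) (auto simp: code_step_def)
  have 2: "code_reach P (b + 1, s) m (b + 1 + code_len c, t)"
    using WhileT.IH(1)[of "b + 1"] WhileT.prems by simp
  have 3: "code_reach P (b + 1 + code_len c, t) 1 (b, t)"
    using WhileT by (intro code_reach_step) (auto simp: code_step_def add_ac)
  have 4: "code_reach P (b, t) n (b + code_len (While_top r A c), u)"
    using WhileT.IH(2)[of b] WhileT.prems by simp
  from code_reach_trans[OF code_reach_trans[OF code_reach_trans[OF 1 2 le_refl] 3 le_refl] 4 le_refl]
  show ?case by (simp add: add_ac)
qed (auto intro!: code_reach_step simp: code_step_def)

text \<open>
  An instruction takes two steps of the machine, since a push has to move before it writes. The
  cells to the left of a head are garbage, so that a pop is just a move.
\<close>

fun instr_phase1 :: "instr \<Rightarrow> nat list \<Rightarrow> (nat \<times> move) list" where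
  "instr_phase1 (IPush r a) ss = (map (\<lambda>x. (x, Stay)) ss)[r := (ss ! r, ToLeft)]"
| "instr_phase1 (IPop r) ss = (map (\<lambda>x. (x, Stay)) ss)[r := (ss ! r, ToRight)]"
| "instr_phase1 (IOut a) ss = (map (\<lambda>x. (x, Stay)) ss)[1 := (a, ToRight)]"
| "instr_phase1 _ ss = map (\<lambda>x. (x, Stay)) ss"

fun instr_phase2 :: "instr \<Rightarrow> nat \<Rightarrow> nat list \<Rightarrow> nat \<times> (nat \<times> move) list" where
  "instr_phase2 (IPush r a) pc ss = (pc + 1, (map (\<lambda>x. (x, Stay)) ss)[r := (a, Stay)])"
| "instr_phase2 (ITest r A d) pc ss =
    (if ss ! r \<in> A then pc + 1 else d, map (\<lambda>x. (x, Stay)) ss)"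
| "instr_phase2 (IJump d) pc ss = (d, map (\<lambda>x. (x, Stay)) ss)"
| "instr_phase2 _ pc ss = (pc + 1, map (\<lambda>x. (x, Stay)) ss)"

text \<open>The states \<open>2 * pc\<close> and \<open>2 * pc + 1\<close> are the two phases of
  instruction \<open>pc\<close>. A jump to the end of the code, \<open>pc = length P\<close>, leads
  to the halting state.\<close>

definition machine_of :: "instr list \<Rightarrow> tm" where
  "machine_of P =
     \<lparr> tapes = 5, states = 2 * length P, symbols = 3,
       delta = (\<lambda>q ss. if even q then (q + 1, instr_phase1 (P ! (q div 2)) ss)
         else case instr_phase2 (P ! (q div 2)) (q div 2) ss of (pc, as) \<Rightarrow> (2 * pc, as)) \<rparr>"

fun wf_instr :: "nat \<Rightarrow> instr \<Rightarrow> bool" where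
  "wf_instr n (IPush r a) \<longleftrightarrow> r < 5 \<and> r \<noteq> 1 \<and> a \<in> {1, 2}"
| "wf_instr n (IPop r) \<longleftrightarrow> r < 5 \<and> r \<noteq> 1"
| "wf_instr n (IOut a) \<longleftrightarrow> a \<in> {1, 2}"
| "wf_instr n (ITest r A d) \<longleftrightarrow> r < 5 \<and> r \<noteq> 1 \<and> d \<le> n"
| "wf_instr n (IJump d) \<longleftrightarrow> d \<le> n"

lemma wf_code_of:
  "wf_com c \<Longrightarrow> b + code_len c \<le> n \<Longrightarrow> i \<in> set (code_of c b) \<Longrightarrow> wf_instr n i"
proof (induction c arbitrary: b)
  case (Seq c1 c2)
  from Seq.prems Seq.IH(1)[of b] Seq.IH(2)[of "b + code_len c1"] show ?case by auto
next
  case (If_top r A c1 c2)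
  from If_top.prems If_top.IH(1)[of "b + 1"] If_top.IH(2)[of "b + code_len c1 + 2"]
  show ?case by auto
next
  case (While_top r A c)
  from While_top.prems While_top.IH[of "b + 1"] show ?case by auto
qed auto

lemma length_instr_phase [simp]:
  "length (instr_phase1 i ss) = length ss" "length (snd (instr_phase2 i pc ss)) = length ss"
  by (cases i; simp)+

lemma wf_machine_of:
  assumes "\<And>i. i \<in> set P \<Longrightarrow> wf_instr (length P) i"
  shows "wf_tm (machine_of P)"
proof -
  have 1: "fst ` set (instr_phase1 i ss) \<subseteq> {..<3}"
    if "wf_instr n i" "set ss \<subseteq> {..<3}" "length ss = 5" for i ss n
    using that by (cases i) (auto dest!: set_update_subset_insert[THEN subsetD] simp: subset_iff)
  have 2: "fst ` set (snd (instr_phase2 i pc ss)) \<subseteq> {..<3}"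
    if "wf_instr n i" "set ss \<subseteq> {..<3}" "length ss = 5" for i ss n pc
    using that by (cases i) (auto dest!: set_update_subset_insert[THEN subsetD] simp: subset_iff)
  have 3: "fst (instr_phase2 i pc ss) \<le> n" if "wf_instr n i" "pc < n" for i ss n pc
    using that by (cases i) auto
  show ?thesis
    unfolding wf_tm_def
  proof (intro conjI allI impI)
    fix q and ss :: "nat list"
    assume q: "q < states (machine_of P)"
      and ss: "length ss = tapes (machine_of P) \<and> set ss \<subseteq> {..<symbols (machine_of P)}"
    have q': "q div 2 < length P" using q by (simp add: machine_of_def)
    then have w: "wf_instr (length P) (P ! (q div 2))" using assms by simp
    have ss': "set ss \<subseteq> {..<3}" "length ss = 5" using ss by (auto simp: machine_of_def)
    have "q + 1 \<le> 2 * length P" using q by (simp add: machine_of_def)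
    then show "case delta (machine_of P) q ss of
       (q', as) \<Rightarrow> q' \<le> states (machine_of P) \<and> length as = tapes (machine_of P) \<and>
         fst ` set as \<subseteq> {..<symbols (machine_of P)}"
      using 1[OF w ss'] 2[OF w ss', of "q div 2"] 3[OF w q', of ss] ss'
        length_instr_phase(2)[of "P ! (q div 2)" "q div 2" ss]
      by (cases "instr_phase2 (P ! (q div 2)) (q div 2) ss") (auto simp: machine_of_def)
  qed (auto simp: machine_of_def)
qed

section \<open>Correctness of the compiled machines\<close>

definition holds_stack :: "nat list \<Rightarrow> tape \<Rightarrow> bool" where
  "holds_stack xs tp \<longleftrightarrow>
     (\<forall>i. fst tp (snd tp + int i) = (if i < length xs then xs ! i else 0))"

text \<open>This is the format that \<open>has_output\<close> reads: from cell 0 to the right up to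
  the first blank, on which the head stands.\<close>

definition holds_output :: "nat list \<Rightarrow> tape \<Rightarrow> bool" where
  "holds_output xs tp \<longleftrightarrow> snd tp = int (length xs) \<and>
     (\<forall>i. fst tp (int i) = (if i < length xs then xs ! i else 0))"

definition represents :: "stacks \<Rightarrow> tape list \<Rightarrow> bool" where
  "represents s ts \<longleftrightarrow> length ts = 5 \<and> (\<forall>r<5. r \<noteq> 1 \<longrightarrow> holds_stack (s r) (ts ! r)) \<and>
     holds_output (s 1) (ts ! 1)"

lemma tape_read_stack: "holds_stack xs tp \<Longrightarrow> tape_read tp = top_of xs"
  by (cases tp) (auto simp: holds_stack_def top_of_def split: list.splits dest!: spec[of _ 0])

lemma tape_act_read [simp]: "tape_act (tape_read tp, Stay) tp = tp"
  by (cases tp) auto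

lemma holds_stack_tl:
  assumes "holds_stack xs tp"
  shows "holds_stack (tl xs) (tape_act (tape_read tp, ToRight) tp)"
proof -
  obtain f p where tp: "tp = (f, p)" by (cases tp)
  have h: "f (p + int i) = (if i < length xs then xs ! i else 0)" for i
    using assms by (auto simp: holds_stack_def tp)
  have "f (p + 1 + int i) = (if i < length (tl xs) then tl xs ! i else 0)" for i
    using h[of "Suc i"] by (cases xs) (auto simp: add_ac)
  then show ?thesis by (auto simp: holds_stack_def tp)
qed

lemma holds_stack_push:
  assumes "holds_stack xs tp"
  shows "holds_stack (a # xs) (tape_act (a, Stay) (tape_act (tape_read tp, ToLeft) tp))"
proof -
  obtain f p where tp: "tp = (f, p)" by (cases tp)
  have h: "f (p + int i) = (if i < length xs then xs ! i else 0)" for i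
    using assms by (auto simp: holds_stack_def tp)
  have "(f(p - 1 := a)) (p - 1 + int i) = (if i < length (a # xs) then (a # xs) ! i else 0)" for i
  proof (cases i)
    case (Suc j)
    then show ?thesis using h[of j] by (auto simp: add_ac)
  qed auto
  then show ?thesis by (auto simp: holds_stack_def tp)
qed

lemma holds_output_snoc:
  assumes "holds_output xs tp"
  shows "holds_output (xs @ [a]) (tape_act (a, ToRight) tp)"
  using assms by (cases tp) (auto simp: holds_output_def nth_append less_Suc_eq)

lemma map2_tape_act_stay:
  "map2 tape_act (map (\<lambda>x. (x, Stay)) (map tape_read ts)) ts = ts"
  by (rule nth_equalityI) auto

lemma map2_tape_act_update:
  assumes "r < length ts"
  shows "map2 tape_act ((map (\<lambda>x. (x, Stay)) (map tape_read ts))[r := a]) ts =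
    ts[r := tape_act a (ts ! r)]"
  using assms by (intro nth_equalityI) (auto simp: nth_list_update)

lemma represents_update:
  assumes "represents s ts" "r < 5" "r \<noteq> 1" "holds_stack xs tp"
  shows "represents (s(r := xs)) (ts[r := tp])"
  using assms by (auto simp: represents_def nth_list_update)

lemma represents_output:
  assumes "represents s ts" "holds_output xs tp"
  shows "represents (s(1 := xs)) (ts[1 := tp])"
  using assms by (auto simp: represents_def nth_list_update)

lemma tm_step_even:
  assumes "pc < length P"
  shows "tm_step (machine_of P) (2 * pc, ts) =
    (2 * pc + 1, map2 tape_act (instr_phase1 (P ! pc) (map tape_read ts)) ts)"
  using assms by (simp add: machine_of_def)

lemma tm_step_odd:
  assumes "pc < length P"
  shows "tm_step (machine_of P) (2 * pc + 1, ts) =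
    (case instr_phase2 (P ! pc) pc (map tape_read ts) of
      (pc', as) \<Rightarrow> (2 * pc', map2 tape_act as ts))"
  using assms by (auto simp: machine_of_def split: prod.splits)

lemma machine_of_instr:
  assumes rep: "represents s ts" and pc: "pc < length P" and wf: "wf_instr (length P) (P ! pc)"
  shows "\<exists>ts'. (tm_step (machine_of P) ^^ 2) (2 * pc, ts) =
      (2 * fst (exec_instr (P ! pc) (pc, s)), ts') \<and>
    represents (snd (exec_instr (P ! pc) (pc, s))) ts'"
proof -
  have len: "length ts = 5" using rep by (simp add: represents_def)
  have two: "(tm_step (machine_of P) ^^ 2) (2 * pc, ts) =
    tm_step (machine_of P) (2 * pc + 1, map2 tape_act (instr_phase1 (P ! pc) (map tape_read ts)) ts)"
    using tm_step_even[OF pc, of ts] by (simp add: numeral_2_eq_2 del: tm_step.simps)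
  have st: "holds_stack (s r) (ts ! r)" if "r < 5" "r \<noteq> 1" for r
    using rep that by (auto simp: represents_def)
  show ?thesis
  proof (cases "P ! pc")
    case (IPush r a)
    then have r: "r < 5" "r \<noteq> 1" using wf by auto
    show ?thesis
      unfolding two tm_step_odd[OF pc] IPush
      using r len represents_update[OF rep r holds_stack_push[OF st[OF r], of a]]
      by (simp add: map2_tape_act_update map2_tape_act_update[of r, simplified] del: map_map)
  next
    case (IPop r)
    then have r: "r < 5" "r \<noteq> 1" using wf by auto
    show ?thesis
      unfolding two tm_step_odd[OF pc] IPop
      using r len represents_update[OF rep r holds_stack_tl[OF st[OF r]]]
      by (simp add: map2_tape_act_update map2_tape_act_stay del: map_map)
  next
    case (IOut a)
    have "holds_output (s 1) (ts ! 1)" using rep by (simp add: represents_def)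
    then show ?thesis
      unfolding two tm_step_odd[OF pc] IOut
      using len represents_output[OF rep holds_output_snoc]
      by (simp add: map2_tape_act_update map2_tape_act_stay del: map_map)
  next
    case (ITest r A d)
    then have r: "r < 5" "r \<noteq> 1" using wf by auto
    show ?thesis
      unfolding two tm_step_odd[OF pc] ITest
      using r len rep tape_read_stack[OF st[OF r]]
      by (simp add: map2_tape_act_stay del: map_map)
  next
    case (IJump d)
    show ?thesis
      unfolding two tm_step_odd[OF pc] IJump
      using len rep by (simp add: map2_tape_act_stay del: map_map)
  qed
qed

lemma machine_of_steps:
  assumes wf: "\<And>i. i \<in> set P \<Longrightarrow> wf_instr (length P) i"
    and rep: "represents s ts" and run: "(code_step P ^^ n) (pc, s) = (pc', s')"
  shows "\<exists>m\<le>2 * n. \<exists>ts'. (tm_step (machine_of P) ^^ m) (2 * pc, ts) = (2 * pc', ts') \<and>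
    represents s' ts'"
  using run rep
proof (induction n arbitrary: pc s ts)
  case 0
  then show ?case by (intro exI[of _ 0]) auto
next
  case (Suc n)
  obtain pc1 s1 where 1: "code_step P (pc, s) = (pc1, s1)" by fastforce
  then have n: "(code_step P ^^ n) (pc1, s1) = (pc', s')"
    using Suc.prems(1) by (simp add: funpow_Suc_right del: funpow.simps)
  show ?case
  proof (cases "pc < length P")
    case True
    obtain ts1 where ts1: "(tm_step (machine_of P) ^^ 2) (2 * pc, ts) = (2 * pc1, ts1)"
        "represents s1 ts1"
      using machine_of_instr[OF Suc.prems(2) True wf] True 1 by (auto simp: code_step_def)
    obtain m ts' where m: "m \<le> 2 * n" "(tm_step (machine_of P) ^^ m) (2 * pc1, ts1) = (2 * pc', ts')"
        "represents s' ts'"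
      using Suc.IH[OF n ts1(2)] by blast
    have "(tm_step (machine_of P) ^^ (m + 2)) (2 * pc, ts) = (2 * pc', ts')"
      using m(2) ts1(1) by (simp only: funpow_add comp_apply)
    then show ?thesis using m by (intro exI[of _ "m + 2"]) auto
  next
    \<comment> \<open>Behind the end of the code, a step of the code is idle and has no counterpart
      on the machine; hence only \<open>m \<le> 2 * n\<close>.\<close>
    case False
    then have "pc1 = pc" "s1 = s" using 1 by (auto simp: code_step_def)
    then obtain m ts' where "m \<le> 2 * n" "(tm_step (machine_of P) ^^ m) (2 * pc, ts) = (2 * pc', ts')"
        "represents s' ts'"
      using Suc.IH[OF n, of ts] Suc.prems(2) by auto
    then show ?thesis by (intro exI[of _ m]) auto
  qed
qed

definition com_machine :: "com \<Rightarrow> tm" where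
  "com_machine c = machine_of (code_of c 0)"

lemma wf_com_machine: "wf_com c \<Longrightarrow> wf_tm (com_machine c)"
  unfolding com_machine_def by (rule wf_machine_of) (auto intro: wf_code_of)

definition raw_stacks :: "nat list \<Rightarrow> stacks" where
  "raw_stacks xs = (\<lambda>_. [])(0 := xs)"

lemma com_machine_outputs:
  assumes wf: "wf_com c" and run: "big c (raw_stacks (map bit_symbol w)) n t"
    and out: "t 1 = map bit_symbol u" and b: "2 * real n \<le> b"
  shows "outputs_within (com_machine c) w u b"
proof -
  let ?P = "code_of c 0"
  have rep: "represents (raw_stacks (map bit_symbol w)) (snd (tm_init (com_machine c) w))"
    by (auto simp: represents_def tm_init_def com_machine_def machine_of_def raw_stacks_def
        holds_stack_def holds_output_def input_tape_def nth_Cons split: nat.splits)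
  have "code_at ?P 0 ?P" by (simp add: code_at_def)
  then have "code_reach ?P (0, raw_stacks (map bit_symbol w)) n (0 + code_len c, t)"
    by (rule code_of_correct[OF run])
  then obtain n' where n': "n' \<le> n"
      "(code_step ?P ^^ n') (0, raw_stacks (map bit_symbol w)) = (code_len c, t)"
    by (auto simp: code_reach_def)
  obtain m ts' where m: "m \<le> 2 * n'"
      "(tm_step (com_machine c) ^^ m) (2 * 0, snd (tm_init (com_machine c) w)) = (2 * code_len c, ts')"
      "represents t ts'"
    using machine_of_steps[OF _ rep n'(2)] wf_code_of[OF wf, of 0 "code_len c"]
    by (auto simp: com_machine_def)
  have i: "tm_init (com_machine c) w = (2 * 0, snd (tm_init (com_machine c) w))"
    by (simp add: tm_init_def)
  have "real m \<le> b" using b m(1) n'(1) by linarith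
  moreover have "states (com_machine c) = 2 * code_len c"
    by (simp add: com_machine_def machine_of_def)
  moreover have "has_output (2 * code_len c, ts') u"
    using m(3) out by (auto simp: represents_def holds_output_def has_output_def)
  ultimately show ?thesis
    unfolding outputs_within_def using m(2) i by (intro exI[of _ m]) (auto simp: Let_def)
qed

section \<open>Loops that move and erase stacks\<close>

definition run :: "com \<Rightarrow> stacks \<Rightarrow> nat \<Rightarrow> stacks \<Rightarrow> bool" where
  "run c s n t \<longleftrightarrow> (\<exists>m\<le>n. big c s m t)"

lemma run_Push: "1 \<le> n \<Longrightarrow> t = s(r := a # s r) \<Longrightarrow> run (Push r a) s n t"
  unfolding run_def using big.Push by blast

lemma run_Pop: "1 \<le> n \<Longrightarrow> t = s(r := tl (s r)) \<Longrightarrow> run (Pop r) s n t"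
  unfolding run_def using big.Pop by blast

lemma run_Out: "1 \<le> n \<Longrightarrow> t = s(1 := s 1 @ [a]) \<Longrightarrow> run (Out a) s n t"
  unfolding run_def using big.Out by blast

lemma run_Seq: "run c s m t \<Longrightarrow> run c' t n u \<Longrightarrow> m + n \<le> l \<Longrightarrow> run (c ;; c') s l u"
  unfolding run_def by (meson add_mono big.Seq le_trans)

lemma run_IfT: "top_of (s r) \<in> A \<Longrightarrow> run c s n t \<Longrightarrow> n + 2 \<le> l \<Longrightarrow> run (If_top r A c c') s l t"
  unfolding run_def by (meson add_le_mono1 big.IfT le_trans)

lemma run_IfF: "top_of (s r) \<notin> A \<Longrightarrow> run c' s n t \<Longrightarrow> n + 2 \<le> l \<Longrightarrow> run (If_top r A c c') s l t"
  unfolding run_def by (meson add_le_mono1 big.IfF le_trans)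

lemma run_WhileF: "top_of (s r) \<notin> A \<Longrightarrow> 1 \<le> n \<Longrightarrow> run (While_top r A c) s n s"
  unfolding run_def using big.WhileF by blast

lemma run_WhileF': "top_of (s r) \<notin> A \<Longrightarrow> 1 \<le> n \<Longrightarrow> t = s \<Longrightarrow> run (While_top r A c) s n t"
  by (simp add: run_WhileF)

lemma run_WhileT:
  "top_of (s r) \<in> A \<Longrightarrow> run c s m t \<Longrightarrow> run (While_top r A c) t n u \<Longrightarrow> m + n + 2 \<le> l \<Longrightarrow>
    run (While_top r A c) s l u"
  unfolding run_def by (meson add_le_mono add_le_mono1 big.WhileT le_trans)

lemma run_mono: "run c s m t \<Longrightarrow> m \<le> n \<Longrightarrow> run c s n t"
  unfolding run_def by (meson le_trans)

text \<open>Each instruction adds at most one symbol. This later turns time bounds into size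
  bounds.\<close>

lemma run_length: "run c s n t \<Longrightarrow> length (t r) \<le> length (s r) + n"
proof -
  have "big c s m t \<Longrightarrow> length (t r) \<le> length (s r) + m" for m
    by (induction rule: big.induct) auto
  then show "run c s n t \<Longrightarrow> ?thesis" unfolding run_def by fastforce
qed

definition move_all :: "nat \<Rightarrow> nat \<Rightarrow> com" where
  "move_all r r' = While_top r {1, 2}
     (If_top r {1} (Pop r ;; Push r' 1) (Pop r ;; Push r' 2))"

definition move_all2 :: "nat \<Rightarrow> nat \<Rightarrow> nat \<Rightarrow> com" where
  "move_all2 r r' r'' = While_top r {1, 2}
     (If_top r {1} (Pop r ;; Push r' 1 ;; Push r'' 1) (Pop r ;; Push r' 2 ;; Push r'' 2))"

definition clear :: "nat \<Rightarrow> com" where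
  "clear r = While_top r {1, 2} (Pop r)"

text \<open>Per symbol: a pop, a push, and 2 each for the test of the symbol and for the round of
  the loop, which makes 6. A move reverses the order.\<close>

lemma run_move_all:
  assumes "s r = xs" "set xs \<subseteq> {1, 2}" "r \<noteq> r'" "6 * length xs + 1 \<le> n"
    "t = s(r := [], r' := rev xs @ s r')"
  shows "run (move_all r r') s n t"
  using assms
proof (induction xs arbitrary: s n)
  case Nil
  then have "t = s" by auto
  then show ?case unfolding move_all_def using Nil by (intro run_WhileF') auto
next
  case (Cons x xs)
  let ?s = "s(r := xs, r' := x # s r')"
  have "run (If_top r {1} (Pop r ;; Push r' 1) (Pop r ;; Push r' 2)) s 4 ?s"
  proof (cases "x = 1")
    case True
    then show ?thesis using Cons.prems
      by (intro run_IfT[where n = 2] run_Seq[OF run_Pop[OF order.refl refl] run_Push[OF order.refl]]) auto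
  next
    case False
    then show ?thesis using Cons.prems
      by (intro run_IfF[where n = 2] run_Seq[OF run_Pop[OF order.refl refl] run_Push[OF order.refl]]) auto
  qed
  moreover have "run (move_all r r') ?s (n - 6) t"
    using Cons.prems by (intro Cons.IH) (auto simp: fun_eq_iff)
  ultimately show ?case
    unfolding move_all_def by (rule run_WhileT[rotated 1]) (use Cons.prems in auto)
qed

lemma run_move_all2:
  assumes "s r = xs" "set xs \<subseteq> {1, 2}" "distinct [r, r', r'']" "7 * length xs + 1 \<le> n"
    "t = s(r := [], r' := rev xs @ s r', r'' := rev xs @ s r'')"
  shows "run (move_all2 r r' r'') s n t"
  using assms
proof (induction xs arbitrary: s n)
  case Nil
  then have "t = s" by auto
  then show ?case unfolding move_all2_def using Nil by (intro run_WhileF') auto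
next
  case (Cons x xs)
  let ?s = "s(r := xs, r' := x # s r', r'' := x # s r'')"
  have "run (If_top r {1} (Pop r ;; Push r' 1 ;; Push r'' 1) (Pop r ;; Push r' 2 ;; Push r'' 2)) s 5 ?s"
  proof (cases "x = 1")
    case True
    then show ?thesis using Cons.prems
      by (intro run_IfT[where n = 3] run_Seq[OF run_Pop[OF order.refl refl]
            run_Seq[OF run_Push[OF order.refl refl] run_Push[OF order.refl]]]) auto
  next
    case False
    then show ?thesis using Cons.prems
      by (intro run_IfF[where n = 3] run_Seq[OF run_Pop[OF order.refl refl]
            run_Seq[OF run_Push[OF order.refl refl] run_Push[OF order.refl]]]) auto
  qed
  moreover have "run (move_all2 r r' r'') ?s (n - 7) t"
    using Cons.prems by (intro Cons.IH) (auto simp: fun_eq_iff)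
  ultimately show ?case
    unfolding move_all2_def by (rule run_WhileT[rotated 1]) (use Cons.prems in auto)
qed

lemma run_clear:
  assumes "s r = xs" "set xs \<subseteq> {1, 2}" "3 * length xs + 1 \<le> n" "t = s(r := [])"
  shows "run (clear r) s n t"
  using assms
proof (induction xs arbitrary: s n)
  case Nil
  then have "t = s" by auto
  then show ?case unfolding clear_def using Nil by (intro run_WhileF') auto
next
  case (Cons x xs)
  have "run (Pop r) s 1 (s(r := xs))" using Cons.prems by (intro run_Pop) auto
  moreover have "run (clear r) (s(r := xs)) (n - 3) t"
    using Cons.prems by (intro Cons.IH) (auto simp: fun_eq_iff)
  ultimately show ?case
    unfolding clear_def by (rule run_WhileT[rotated 1]) (use Cons.prems in auto)
qed

section \<open>Trees as universal data\<close>

datatype tree = Leaf | Node tree tree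

text \<open>Preorder with 2 for an inner node and 1 for a leaf. The code is prefix-free, so several
  trees can lie one upon another on a stack, and it avoids 0, which signals an empty stack.\<close>

fun tcode :: "tree \<Rightarrow> nat list" where
  "tcode Leaf = [1]"
| "tcode (Node l r) = 2 # tcode l @ tcode r"

lemma set_tcode: "set (tcode t) \<subseteq> {1, 2}"
  by (induction t) auto

lemma tcode_prefix: "tcode t @ xs = tcode u @ ys \<Longrightarrow> t = u \<and> xs = ys"
proof (induction t arbitrary: u xs ys)
  case Leaf
  then show ?case by (cases u) auto
next
  case (Node l r)
  from Node.prems obtain l' r' where u: "u = Node l' r'" by (cases u) auto
  then have "tcode l @ (tcode r @ xs) = tcode l' @ (tcode r' @ ys)" using Node.prems by simp
  then have "l = l'" "tcode r @ xs = tcode r' @ ys" using Node.IH(1) by blast+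
  then show ?case using Node.IH(2) u by blast
qed

lemma tcode_inj: "tcode t = tcode u \<longleftrightarrow> t = u"
  using tcode_prefix[of t "[]" u "[]"] by auto

definition take_loop :: "nat \<Rightarrow> com" where
  "take_loop r = While_top 4 {1} (Pop 4 ;;
     If_top 0 {1} (Pop 0 ;; Push r 1) (Pop 0 ;; Push r 2 ;; Push 4 1 ;; Push 4 1))"

text \<open>Stack 4 counts in unary the trees that still have to be read.\<close>

definition take_tree :: "nat \<Rightarrow> com" where
  "take_tree r = (Push 4 1 ;; take_loop r)"

text \<open>The loop does not stop at the end of a subtree, so the remainder of its run is a
  hypothesis. This lets the runs for the two subtrees of a node be chained. A node costs 7 for the
  body and 2 for the round, whence 9 per symbol.\<close>

lemma run_take_loop:
  assumes "r \<noteq> 0" "r \<noteq> 4" "run (take_loop r) (s(0 := rest, r := rev (tcode t) @ b, 4 := k)) n u"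
    "n + 9 * length (tcode t) \<le> l"
  shows "run (take_loop r) (s(0 := tcode t @ rest, r := b, 4 := 1 # k)) l u"
  using assms
proof (induction t arbitrary: rest b k n l)
  case Leaf
  let ?s = "s(0 := tcode Leaf @ rest, r := b, 4 := 1 # k)"
  have "run (If_top 0 {1} (Pop 0 ;; Push r 1) (Pop 0 ;; Push r 2 ;; Push 4 1 ;; Push 4 1))
      (?s(4 := k)) 4 (s(0 := rest, r := 1 # b, 4 := k))"
    using Leaf.prems by (intro run_IfT[where n = 2] run_Seq[OF run_Pop[OF order.refl refl] run_Push[OF order.refl]])
      (auto simp: fun_eq_iff)
  then have "run (Pop 4 ;; If_top 0 {1} (Pop 0 ;; Push r 1) (Pop 0 ;; Push r 2 ;; Push 4 1 ;; Push 4 1))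
      ?s 5 (s(0 := rest, r := 1 # b, 4 := k))"
    using Leaf.prems(1,2) by (intro run_Seq[OF run_Pop[OF order.refl refl]]) auto
  note body = this
  have p: "run (take_loop r) (s(0 := rest, r := 1 # b, 4 := k)) n u"
    using Leaf.prems(3) by (simp only: tcode.simps rev.simps append.simps)
  show ?case
    unfolding take_loop_def
    by (rule run_WhileT[OF _ body p[unfolded take_loop_def]]) (use Leaf.prems in auto)
next
  case (Node t1 t2)
  let ?s = "s(0 := tcode (Node t1 t2) @ rest, r := b, 4 := 1 # k)"
  let ?t = "s(0 := tcode t1 @ tcode t2 @ rest, r := 2 # b, 4 := 1 # 1 # k)"
  have "run (If_top 0 {1} (Pop 0 ;; Push r 1) (Pop 0 ;; Push r 2 ;; Push 4 1 ;; Push 4 1))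
      (?s(4 := k)) 6 ?t"
    using Node.prems by (intro run_IfF[where n = 4] run_Seq[OF run_Pop[OF order.refl refl]
          run_Seq[OF run_Push[OF order.refl refl] run_Seq[OF run_Push[OF order.refl refl] run_Push[OF order.refl]
              order.refl] order.refl]])
      (auto simp: fun_eq_iff)
  then have b: "run (Pop 4 ;; If_top 0 {1} (Pop 0 ;; Push r 1) (Pop 0 ;; Push r 2 ;; Push 4 1 ;; Push 4 1))
      ?s 7 ?t"
    using Node.prems(1,2) by (intro run_Seq[OF run_Pop[OF order.refl refl]]) auto
  have "run (take_loop r) (s(0 := rest, r := rev (tcode t2) @ rev (tcode t1) @ 2 # b, 4 := k)) n u"
    using Node.prems(3)
    by (simp only: tcode.simps rev.simps rev_append append_assoc append.simps)
  note p = Node.IH(1)[OF Node.prems(1,2) Node.IH(2)[OF Node.prems(1,2) this order.refl] order.refl]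
  show ?case
    unfolding take_loop_def
    by (rule run_WhileT[OF _ b p[unfolded take_loop_def]]) (use Node.prems in auto)
qed

lemma run_take_tree:
  assumes "r \<noteq> 0" "r \<noteq> 4" "s 0 = tcode x @ rest" "s 4 = []" "9 * length (tcode x) + 2 \<le> n"
    "t = s(0 := rest, r := rev (tcode x) @ s r)"
  shows "run (take_tree r) s n t"
proof -
  have "run (take_loop r) (s(0 := rest, r := rev (tcode x) @ s r, 4 := [])) 1 t"
    using assms unfolding take_loop_def
    by (subst assms(6), subst fun_upd_triv[of s 4, symmetric], subst assms(4))
      (auto intro!: run_WhileF simp: fun_upd_twist)
  then have "run (take_loop r) (s(0 := tcode x @ rest, r := s r, 4 := [1])) (1 + 9 * length (tcode x)) t"
    using assms(1,2) by (intro run_take_loop[where n = 1]) auto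
  moreover have "s(0 := tcode x @ rest, r := s r, 4 := [1]) = s(4 := 1 # s 4)"
    using assms(3,4) by (auto simp: fun_eq_iff)
  ultimately have "run (take_loop r) (s(4 := 1 # s 4)) (1 + 9 * length (tcode x)) t"
    by simp
  then show ?thesis unfolding take_tree_def
    using assms(5) by (intro run_Seq[OF run_Push[OF order.refl refl]]) auto
qed

lemma set_rev_tcode [simp]: "set (tcode t) \<subseteq> {Suc 0, 2}"
  using set_tcode[of t] by auto

section \<open>Stack operations on whole trees\<close>

definition dup_tree :: com where
  "dup_tree = (take_tree 2 ;; move_all2 2 0 3 ;; move_all 3 2 ;; move_all 2 0)"

definition swap_trees :: com where
  "swap_trees = (take_tree 2 ;; take_tree 3 ;; move_all 2 0 ;; move_all 3 0)"

definition drop_tree :: com where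
  "drop_tree = (take_tree 2 ;; clear 2)"

lemma raw_stacks_simps [simp]:
  "raw_stacks xs 0 = xs" "0 < r \<Longrightarrow> raw_stacks xs r = []" "(raw_stacks xs)(0 := ys) = raw_stacks ys"
  by (auto simp: raw_stacks_def)

text \<open>Reading a tree leaves its code reversed on stack 2. One move restores it and makes a
  second copy, which takes two more moves to arrive unreversed on stack 0; 28 = 9 + 7 + 6 +
  6.\<close>

lemma run_dup_tree:
  assumes "28 * length (tcode x) + 5 \<le> n"
  shows "run dup_tree (raw_stacks (tcode x @ rest)) n (raw_stacks (tcode x @ tcode x @ rest))"
  unfolding dup_tree_def
  apply (rule run_Seq[OF run_take_tree[OF _ _ _ _ order.refl refl]])
       apply (auto simp: raw_stacks_def)[4]
   apply (rule run_Seq[OF run_move_all2[OF refl _ _ order.refl refl]])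
     apply (auto simp: raw_stacks_def)[2]
   apply (rule run_Seq[OF run_move_all[OF refl _ _ order.refl refl]])
     apply (auto simp: raw_stacks_def)[2]
   apply (rule run_move_all[OF refl _ _ order.refl])
     apply (auto simp: raw_stacks_def fun_eq_iff)[3]
    apply (rule order.refl)+
  using assms by (auto simp: raw_stacks_def)

lemma run_swap_trees:
  assumes "15 * length (tcode x) + 15 * length (tcode y) + 6 \<le> n"
  shows "run swap_trees (raw_stacks (tcode x @ tcode y @ rest)) n (raw_stacks (tcode y @ tcode x @ rest))"
  unfolding swap_trees_def
  apply (rule run_Seq[OF run_take_tree[OF _ _ _ _ order.refl refl]])
       apply (auto simp: raw_stacks_def)[4]
   apply (rule run_Seq[OF run_take_tree[OF _ _ _ _ order.refl refl]])
       apply (auto simp: raw_stacks_def)[4]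
   apply (rule run_Seq[OF run_move_all[OF refl _ _ order.refl refl]])
     apply (auto simp: raw_stacks_def)[2]
   apply (rule run_move_all[OF refl _ _ order.refl])
     apply (auto simp: raw_stacks_def fun_eq_iff)[3]
    apply (rule order.refl)+
  using assms by (auto simp: raw_stacks_def)

lemma run_drop_tree:
  assumes "12 * length (tcode x) + 3 \<le> n"
  shows "run drop_tree (raw_stacks (tcode x @ rest)) n (raw_stacks rest)"
  unfolding drop_tree_def
  apply (rule run_Seq[OF run_take_tree[OF _ _ _ _ order.refl refl]])
       apply (auto simp: raw_stacks_def)[4]
   apply (rule run_clear[OF refl _ order.refl])
     apply (auto simp: raw_stacks_def fun_eq_iff)[2]
  using assms by (auto simp: raw_stacks_def)

definition compare_loop :: com where
  "compare_loop = While_top 2 {1, 2} (If_top 2 {1}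
     (If_top 3 {1} (Pop 2 ;; Pop 3) (Pop 2 ;; Pop 3 ;; Push 4 1))
     (If_top 3 {2} (Pop 2 ;; Pop 3) (Pop 2 ;; Pop 3 ;; Push 4 1)))"

text \<open>Stack 4 collects a mark for every mismatch while stack 2 is emptied; an exhausted stack
  3 shows the top 0 and so counts as a mismatch. A nonempty rest of stack 3 means that the second
  code is longer. The last pushes write the code of a Boolean.\<close>

definition compare_trees :: com where
  "compare_trees = (take_tree 2 ;; take_tree 3 ;; compare_loop ;;
     If_top 4 {1} (clear 3 ;; clear 4 ;; Push 0 1)
       (If_top 3 {1, 2} (clear 3 ;; Push 0 1) (Push 0 1 ;; Push 0 1 ;; Push 0 2)))"

lemma run_compare_loop:
  assumes "s 2 = xs" "set xs \<subseteq> {1, 2}" "set (s 3) \<subseteq> {1, 2}" "set (s 4) \<subseteq> {1}" "9 * length xs + 1 \<le> n"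
  shows "\<exists>fl. run compare_loop s n (s(2 := [], 3 := drop (length xs) (s 3), 4 := fl)) \<and>
    set fl \<subseteq> {1} \<and> (fl = [] \<longleftrightarrow> s 4 = [] \<and> take (length xs) (s 3) = xs) \<and>
    length fl \<le> length (s 4) + length xs"
  using assms
proof (induction xs arbitrary: s n)
  case Nil
  then have e: "s(2 := [], 3 := drop (length []) (s 3), 4 := s 4) = s" by (auto simp: fun_eq_iff)
  have "run compare_loop s n s"
    unfolding compare_loop_def using Nil by (intro run_WhileF') auto
  have "run compare_loop s n (s(2 := [], 3 := drop (length []) (s 3), 4 := s 4))"
    by (subst e) fact
  moreover note Nil
  ultimately show ?case by (intro exI[of _ "s 4"] conjI) (assumption | simp)+
next
  case (Cons x xs)
  define eq where "eq \<longleftrightarrow> top_of (s 3) = x"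
  let ?s = "s(2 := xs, 3 := tl (s 3), 4 := (if eq then s 4 else 1 # s 4))"
  have s34: "s(2 := xs, 3 := tl (s 3)) = ?s" if eq using that by (auto simp: fun_eq_iff)
  have a: "run (Pop 2 ;; Pop 3) s 3 ?s" if eq
    unfolding s34[OF that, symmetric]
    using Cons.prems by (intro run_Seq[OF run_Pop[OF order.refl refl] run_Pop[OF order.refl]]) auto
  have b: "run (Pop 2 ;; Pop 3 ;; Push 4 1) s 3 ?s" if "\<not> eq"
    using Cons.prems that by (intro run_Seq[OF run_Pop[OF order.refl refl]
          run_Seq[OF run_Pop[OF order.refl refl] run_Push[OF order.refl] order.refl]]) auto
  have x: "x = 1 \<or> x = 2" using Cons.prems by auto
  have c: "run (If_top 3 {x} (Pop 2 ;; Pop 3) (Pop 2 ;; Pop 3 ;; Push 4 1)) s 5 ?s"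
  proof (cases eq)
    case True
    show ?thesis by (rule run_IfT[OF _ a[OF True]]) (use True in \<open>auto simp: eq_def\<close>)
  next
    case False
    show ?thesis by (rule run_IfF[OF _ b[OF False]]) (use False in \<open>auto simp: eq_def\<close>)
  qed
  have "run (If_top 2 {1}
     (If_top 3 {1} (Pop 2 ;; Pop 3) (Pop 2 ;; Pop 3 ;; Push 4 1))
     (If_top 3 {2} (Pop 2 ;; Pop 3) (Pop 2 ;; Pop 3 ;; Push 4 1))) s 7 ?s"
    using x
  proof
    assume x1: "x = 1"
    show ?thesis by (rule run_IfT[OF _ c[unfolded x1]]) (use x1 Cons.prems in auto)
  next
    assume x2: "x = 2"
    show ?thesis by (rule run_IfF[OF _ c[unfolded x2]]) (use x2 Cons.prems in auto)
  qed
  note body = this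
  have "\<exists>fl. run compare_loop ?s (n - 9) (?s(2 := [], 3 := drop (length xs) (?s 3), 4 := fl)) \<and>
    set fl \<subseteq> {1} \<and> (fl = [] \<longleftrightarrow> ?s 4 = [] \<and> take (length xs) (?s 3) = xs) \<and>
    length fl \<le> length (?s 4) + length xs"
    using Cons.prems by (intro Cons.IH; cases "s 3") auto
  then obtain fl where fl: "run compare_loop ?s (n - 9) (?s(2 := [], 3 := drop (length xs) (?s 3), 4 := fl))"
    "set fl \<subseteq> {1}" "fl = [] \<longleftrightarrow> ?s 4 = [] \<and> take (length xs) (?s 3) = xs"
    "length fl \<le> length (?s 4) + length xs" by blast
  have "run compare_loop s n (?s(2 := [], 3 := drop (length xs) (?s 3), 4 := fl))"
    unfolding compare_loop_def
    by (rule run_WhileT[OF _ body fl(1)[unfolded compare_loop_def]]) (use Cons.prems x in auto)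
  also have "?s(2 := [], 3 := drop (length xs) (?s 3), 4 := fl) =
      s(2 := [], 3 := drop (length (x # xs)) (s 3), 4 := fl)"
    by (auto simp: fun_eq_iff drop_Suc)
  finally have r: "run compare_loop s n (s(2 := [], 3 := drop (length (x # xs)) (s 3), 4 := fl))" .
  show ?case
  proof (intro exI[of _ fl] conjI)
    show "fl = [] \<longleftrightarrow> s 4 = [] \<and> take (length (x # xs)) (s 3) = x # xs"
      using fl(3) x by (cases "s 3") (auto simp: eq_def split: if_splits)
    show "length fl \<le> length (s 4) + length (x # xs)"
      using fl(4) by (auto split: if_splits)
  qed (fact r, fact fl(2))
qed

lemma run_compare_trees:
  assumes "30 * length (tcode x) + 30 * length (tcode y) + 30 \<le> n"
  shows "run compare_trees (raw_stacks (tcode x @ tcode y @ rest)) n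
    (raw_stacks ((if x = y then [2, 1, 1] else [1]) @ rest))"
proof -
  let ?nx = "length (tcode x)" and ?ny = "length (tcode y)"
  let ?s1 = "(raw_stacks (tcode y @ rest))(2 := rev (tcode x))"
  let ?s2 = "(raw_stacks rest)(2 := rev (tcode x), 3 := rev (tcode y))"
  have 1: "run (take_tree 2) (raw_stacks (tcode x @ tcode y @ rest)) (9 * ?nx + 2) ?s1"
    by (rule run_take_tree) auto
  have 2: "run (take_tree 3) ?s1 (9 * ?ny + 2) ?s2"
    by (rule run_take_tree) (auto simp: raw_stacks_def)
  have "\<exists>fl. run compare_loop ?s2 (9 * ?nx + 1)
      (?s2(2 := [], 3 := drop (length (rev (tcode x))) (?s2 3), 4 := fl)) \<and> set fl \<subseteq> {1} \<and>
      (fl = [] \<longleftrightarrow> ?s2 4 = [] \<and> take (length (rev (tcode x))) (?s2 3) = rev (tcode x)) \<and>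
      length fl \<le> length (?s2 4) + length (rev (tcode x))"
    by (rule run_compare_loop) auto
  then obtain fl where fl: "run compare_loop ?s2 (9 * ?nx + 1)
      (?s2(2 := [], 3 := drop ?nx (rev (tcode y)), 4 := fl))" "set fl \<subseteq> {1}"
      "fl = [] \<longleftrightarrow> take ?nx (rev (tcode y)) = rev (tcode x)" "length fl \<le> ?nx"
    by auto
  let ?s3 = "(raw_stacks rest)(3 := drop ?nx (rev (tcode y)), 4 := fl)"
  have s3: "?s2(2 := [], 3 := drop ?nx (rev (tcode y)), 4 := fl) = ?s3"
    by (auto simp: fun_eq_iff)
  have set3: "set (drop ?nx (rev (tcode y))) \<subseteq> {1, 2}"
    using set_tcode[of y] set_drop_subset[of ?nx "rev (tcode y)"] by (metis set_rev subset_trans)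
  have len3: "length (drop ?nx (rev (tcode y))) \<le> ?ny" by simp
  let ?t = "raw_stacks ((if x = y then [2, 1, 1] else [1]) @ rest)"
  have "run (If_top 4 {1} (clear 3 ;; clear 4 ;; Push 0 1)
       (If_top 3 {1, 2} (clear 3 ;; Push 0 1) (Push 0 1 ;; Push 0 1 ;; Push 0 2))) ?s3
       (3 * ?ny + 3 * ?nx + 15) ?t"
  proof (cases "fl = []")
    case False
    then have "x \<noteq> y" using fl(3) by auto
    moreover have "top_of fl = 1" using False fl(2) by (cases fl) auto
    moreover have "run (clear 3 ;; clear 4 ;; Push 0 1) ?s3 (3 * ?ny + 3 * ?nx + 5) (raw_stacks (1 # rest))"
      apply (rule run_Seq[OF run_clear[OF refl _ order.refl refl]])
      using set3 apply simp
       apply (rule run_Seq[OF run_clear[OF refl _ order.refl refl] run_Push[OF order.refl]])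
      using fl(2) apply auto[1]
        apply (auto simp: fun_eq_iff raw_stacks_def)[1]
       apply (rule order.refl)
      using len3 fl(4) by simp
    ultimately show ?thesis by (intro run_IfT) auto
  next
    case fl0: True
    show ?thesis
    proof (cases "drop ?nx (rev (tcode y)) = []")
      case True
      then have xy: "x = y" using fl0 fl(3) by (auto simp: tcode_inj)
      have "run (Push 0 1 ;; Push 0 1 ;; Push 0 2) ?s3 3 ?t"
        by (rule run_Seq[OF run_Push[OF order.refl refl] run_Seq[OF run_Push[OF order.refl refl]
            run_Push[OF order.refl] order.refl]])
          (use True fl0 xy in \<open>auto simp: fun_eq_iff raw_stacks_def\<close>)
      then show ?thesis using fl0 True by (intro run_IfF[OF _ run_IfF]) auto
    next
      case False
      then have "x \<noteq> y" by auto
      have "top_of (drop ?nx (rev (tcode y))) \<in> {1, 2}"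
        using False set3 by (cases "drop ?nx (rev (tcode y))") auto
      moreover have "run (clear 3 ;; Push 0 1) ?s3 (3 * ?ny + 2) ?t"
        apply (rule run_Seq[OF run_clear[OF refl _ order.refl refl] run_Push[OF order.refl]])
        using set3 apply simp
        using \<open>x \<noteq> y\<close> fl0 apply (auto simp: fun_eq_iff raw_stacks_def)[1]
        using len3 by simp
      ultimately show ?thesis using fl0 by (intro run_IfF[OF _ run_IfT]) auto
    qed
  qed
  note 4 = this
  show ?thesis unfolding compare_trees_def
    by (rule run_Seq[OF 1 run_Seq[OF 2 run_Seq[OF fl(1)[unfolded s3] 4 order.refl] order.refl]])
      (use assms in simp)
qed

lemma wf_tree_coms:
  "wf_com dup_tree" "wf_com swap_trees" "wf_com drop_tree" "wf_com compare_trees"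
  by (auto simp: dup_tree_def swap_trees_def drop_tree_def compare_trees_def take_tree_def
      take_loop_def move_all_def move_all2_def clear_def compare_loop_def)

section \<open>Polynomial-time functions on data\<close>

text \<open>As the base \<open>n + 2\<close> is at least 2, one exponent absorbs constants, sums,
  products and powers, so no polynomials have to be manipulated.\<close>

definition pbd :: "(nat \<Rightarrow> nat) \<Rightarrow> bool" where
  "pbd h \<longleftrightarrow> (\<exists>k. \<forall>n. h n \<le> (n + 2) ^ k)"

named_theorems pbd_intros

lemma pbd_power [pbd_intros]: "pbd (\<lambda>n. (n + 2) ^ k)"
  unfolding pbd_def by blast

lemma pbd_const [pbd_intros]: "pbd (\<lambda>n. c)"
proof -
  have "c \<le> (n + 2) ^ c" for n
  proof -
    have "c \<le> 2 ^ c" by (rule less_imp_le) (rule less_exp)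
    also have "\<dots> \<le> (n + 2) ^ c" by (rule power_mono) auto
    finally show ?thesis .
  qed
  then show ?thesis unfolding pbd_def by blast
qed

lemma pbd_id [pbd_intros]: "pbd (\<lambda>n. n)"
  unfolding pbd_def by (intro exI[of _ 1]) simp

lemma pbd_mult [pbd_intros]:
  assumes "pbd f" "pbd g"
  shows "pbd (\<lambda>n. f n * g n)"
proof -
  obtain k l where "\<And>n. f n \<le> (n + 2) ^ k" "\<And>n. g n \<le> (n + 2) ^ l"
    using assms unfolding pbd_def by blast
  then show ?thesis unfolding pbd_def by (intro exI[of _ "k + l"]) (simp add: power_add mult_le_mono)
qed

lemma pbd_add [pbd_intros]:
  assumes "pbd f" "pbd g"
  shows "pbd (\<lambda>n. f n + g n)"
proof -
  obtain k l where kl: "\<And>n. f n \<le> (n + 2) ^ k" "\<And>n. g n \<le> (n + 2) ^ l"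
    using assms unfolding pbd_def by blast
  have "f n + g n \<le> (n + 2) ^ Suc (max k l)" for n
  proof -
    have "(n + 2) ^ k \<le> (n + 2) ^ max k l" "(n + 2) ^ l \<le> (n + 2) ^ max k l"
      by (intro power_increasing; simp)+
    then have "f n + g n \<le> 2 * (n + 2) ^ max k l" using kl[of n] by linarith
    also have "\<dots> \<le> (n + 2) * (n + 2) ^ max k l" by simp
    finally show ?thesis by simp
  qed
  then show ?thesis unfolding pbd_def by blast
qed

lemma pbd_Suc [pbd_intros]: "pbd f \<Longrightarrow> pbd (\<lambda>n. Suc (f n))"
  using pbd_add[of f "\<lambda>_. 1"] pbd_const[of 1] by simp

lemma pbd_pow [pbd_intros]: "pbd f \<Longrightarrow> pbd (\<lambda>n. f n ^ k)"
proof (induction k)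
  case 0
  then show ?case using pbd_const[of 1] by simp
next
  case (Suc k)
  then show ?case using pbd_mult[of f "\<lambda>n. f n ^ k"] by simp
qed

lemma pbdE:
  assumes "pbd h"
  obtains k where "\<And>n m. n \<le> m \<Longrightarrow> h n \<le> (m + 2) ^ k"
proof -
  obtain k where k: "\<And>n. h n \<le> (n + 2) ^ k"
    using assms unfolding pbd_def by blast
  have "h n \<le> (m + 2) ^ k" if "n \<le> m" for n m
    using k[of n] power_mono[of "n + 2" "m + 2" k] that by linarith
  then show ?thesis by (rule that)
qed

text \<open>All data live in one universe of trees, and injectivity reduces equality of data to the
  comparison of codes in \<open>fp_eq\<close>.\<close>

class data =
  fixes tr :: "'a \<Rightarrow> tree"
  assumes tr_inj: "tr x = tr y \<Longrightarrow> x = y"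

definition dcode :: "'a::data \<Rightarrow> nat list" where
  "dcode x = tcode (tr x)"

definition sz :: "'a::data \<Rightarrow> nat" where
  "sz x = length (dcode x)"

definition tf :: "com \<Rightarrow> nat list \<Rightarrow> nat \<Rightarrow> nat list \<Rightarrow> bool" where
  "tf c xs n ys \<longleftrightarrow> run c (raw_stacks xs) n (raw_stacks ys)"

lemma tf_Seq: "tf c xs m ys \<Longrightarrow> tf c' ys n zs \<Longrightarrow> tf (c ;; c') xs (m + n) zs"
  unfolding tf_def by (rule run_Seq) auto

lemma tf_Push: "tf (Push 0 a) xs 1 (a # xs)"
  unfolding tf_def by (rule run_Push) auto

lemma tf_Pop: "tf (Pop 0) (x # xs) 1 xs"
  unfolding tf_def by (rule run_Pop) auto

lemma tf_dup: "tf dup_tree (dcode x @ rest) (28 * sz x + 5) (dcode x @ dcode x @ rest)"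
  unfolding tf_def dcode_def sz_def by (rule run_dup_tree) simp

lemma tf_swap:
  "tf swap_trees (dcode x @ dcode y @ rest) (15 * sz x + 15 * sz y + 6) (dcode y @ dcode x @ rest)"
  unfolding tf_def dcode_def sz_def by (rule run_swap_trees) simp

lemma tf_drop: "tf drop_tree (dcode x @ rest) (12 * sz x + 3) rest"
  unfolding tf_def dcode_def sz_def by (rule run_drop_tree) simp

lemma tf_mono: "tf c xs m ys \<Longrightarrow> m \<le> n \<Longrightarrow> tf c xs n ys"
  unfolding tf_def by (rule run_mono)

lemma sz_pos [simp]: "0 < sz x" "Suc 0 \<le> sz x"
  by (cases "tr x"; simp add: sz_def dcode_def)+

instantiation tree :: data
begin
definition tr_tree :: "tree \<Rightarrow> tree" where [simp]: "tr_tree t = t"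
instance by standard simp
end

text \<open>\<open>True\<close> has the code of \<open>[[]]\<close> and \<open>False\<close> that of
  \<open>[]\<close>, which reduces conditionals to case distinctions on lists.\<close>

instantiation bool :: data
begin
definition tr_bool :: "bool \<Rightarrow> tree" where "tr_bool b = (if b then Node Leaf Leaf else Leaf)"
instance by standard (auto simp: tr_bool_def split: if_splits)
end

instantiation prod :: (data, data) data
begin
definition tr_prod :: "'a \<times> 'b \<Rightarrow> tree" where "tr_prod p = Node (tr (fst p)) (tr (snd p))"
instance by standard (auto simp: tr_prod_def dest: tr_inj intro: prod_eqI)
end

text \<open>A nonempty list has the code of the pair of its head and its tail, so building it is as
  easy as pairing.\<close>

instantiation list :: (data) data
begin
fun tr_list :: "'a list \<Rightarrow> tree" where
  "tr_list [] = Leaf"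
| "tr_list (x # xs) = Node (tr x) (tr_list xs)"
instance
proof
  fix xs ys :: "'a list"
  show "tr xs = tr ys \<Longrightarrow> xs = ys"
  proof (induction xs arbitrary: ys)
    case Nil
    then show ?case by (cases ys) auto
  next
    case (Cons x xs)
    then show ?case by (cases ys) (auto dest: tr_inj)
  qed
qed
end

instantiation nat :: data
begin
definition tr_nat :: "nat \<Rightarrow> tree" where "tr_nat n = tr (bits_of_nat n)"
instance by standard (auto simp: tr_nat_def dest: tr_inj inj_bits_of_nat)
end

lemma dcode_pair: "dcode (x, y) = 2 # dcode x @ dcode y"
  by (simp add: dcode_def tr_prod_def)

lemma dcode_list [simp]: "dcode [] = [1]" "dcode (x # xs) = 2 # dcode x @ dcode xs"
  by (simp_all add: dcode_def)

lemma dcode_bool: "dcode True = [2, 1, 1]" "dcode False = [1]"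
  by (simp_all add: dcode_def tr_bool_def)

lemma sz_simps [simp]:
  "sz (x, y) = 1 + sz x + sz y" "sz ([] :: 'a::data list) = 1" "sz (z # zs) = 1 + sz z + sz zs"
  "sz True = 3" "sz False = 1"
  by (simp_all add: sz_def dcode_pair dcode_bool)

lemma sz_bool: "sz (b :: bool) \<le> 3"
  by (cases b) auto

lemma sz_fst: "sz (fst p) \<le> sz p" and sz_snd: "sz (snd p) \<le> sz p"
  by (cases p; simp)+

lemma length_le_sz: "length xs < sz xs"
  by (induction xs) auto

lemma sz_elem: "x \<in> set xs \<Longrightarrow> sz x < sz xs"
  by (induction xs) auto

lemma sz_append: "sz (xs @ ys) + 1 = sz xs + sz ys"
  by (induction xs) auto

lemma sz_list_le: "(\<And>x. x \<in> set xs \<Longrightarrow> sz x \<le> m) \<Longrightarrow> sz xs \<le> 1 + length xs * (m + 1)"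
  by (induction xs) (auto, fastforce)

text \<open>The argument lies on top of an arbitrary stack that is left alone; this allows
  compositions, pairs and loops to keep other values below it.\<close>

definition fp :: "('a::data \<Rightarrow> 'b::data) \<Rightarrow> bool" where
  "fp f \<longleftrightarrow> (\<exists>c h. wf_com c \<and> pbd h \<and>
     (\<forall>x rest. tf c (dcode x @ rest) (h (sz x)) (dcode (f x) @ rest)))"

named_theorems fp_intros

lemma fpI:
  assumes "wf_com c" "pbd h"
    "\<And>x rest. \<exists>N. tf c (dcode x @ rest) N (dcode (f x) @ rest) \<and> N \<le> h (sz x)"
  shows "fp f"
  unfolding fp_def using assms tf_mono by metis

text \<open>A program cannot write more than it has time for, so a single exponent serves for the
  time and for the size of the value. Any \<open>n\<close> above the size of the argument may be
  used, which makes the bound monotone.\<close>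

lemma fpE:
  assumes "fp f"
  obtains c k where "wf_com c"
    "\<And>x rest n. sz x \<le> n \<Longrightarrow> tf c (dcode x @ rest) ((n + 2) ^ k) (dcode (f x) @ rest)"
    "\<And>x n. sz x \<le> n \<Longrightarrow> sz (f x) < (n + 2) ^ k"
proof -
  obtain c h where c: "wf_com c" "pbd h"
    "\<And>x rest. tf c (dcode x @ rest) (h (sz x)) (dcode (f x) @ rest)"
    using assms unfolding fp_def by blast
  have "pbd (\<lambda>n. h n + n + 1)" by (intro pbd_intros c)
  then obtain k where k: "\<And>n m. n \<le> m \<Longrightarrow> h n + n + 1 \<le> (m + 2) ^ k" by (rule pbdE) blast
  have len: "sz (f x) \<le> sz x + h (sz x)" for x
    using run_length[OF c(3)[of x "[]", unfolded tf_def], of 0] by (simp add: sz_def)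
  show ?thesis
  proof (rule that[OF c(1)])
    fix x :: 'a and n assume "sz x \<le> n"
    note k' = k[OF this]
    show "tf c (dcode x @ rest) ((n + 2) ^ k) (dcode (f x) @ rest)" for rest
      using tf_mono[OF c(3)] k' by (meson add_leD1)
    show "sz (f x) < (n + 2) ^ k" using len[of x] k' by linarith
  qed
qed

lemma fp_sz:
  assumes "fp f"
  obtains k where "\<And>x n. sz x \<le> n \<Longrightarrow> sz (f x) \<le> (n + 2) ^ k"
  using fpE[OF assms] by (metis less_imp_le)

text \<open>A program sees only codes, so a change of type that preserves the code is free.\<close>

lemma fp_code_cong:
  fixes f :: "'a::data \<Rightarrow> 'b::data" and g :: "'c::data \<Rightarrow> 'd::data"
  assumes "fp g" "\<And>x. tr x = tr (i x)" "\<And>x. tr (f x) = tr (g (i x))"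
  shows "fp f"
proof -
  have "dcode x = dcode (i x)" "dcode (f x) = dcode (g (i x))" "sz x = sz (i x)" for x
    using assms(2,3) by (simp_all add: dcode_def sz_def)
  then show ?thesis using assms(1) unfolding fp_def by metis
qed

lemma fp_id [fp_intros]: "fp (\<lambda>x. x)"
proof (rule fpI)
  \<comment> \<open>There is no empty program, so a symbol is pushed and popped.\<close>
  show "wf_com (Push 0 1 ;; Pop 0)" by simp
  show "\<exists>N. tf (Push 0 1 ;; Pop 0) (dcode x @ rest) N (dcode x @ rest) \<and> N \<le> 2" for x :: 'a and rest
    by (intro exI conjI, rule tf_Seq[OF tf_Push tf_Pop]) simp
qed (rule pbd_const)

lemma fp_const [fp_intros]: "fp (\<lambda>x. c)"
proof -
  define pushes where "pushes = foldr (\<lambda>a p. p ;; Push 0 a)"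
  have wf: "wf_com p \<Longrightarrow> set xs \<subseteq> {1, 2} \<Longrightarrow> wf_com (pushes xs p)" for xs p
    unfolding pushes_def by (induction xs) auto
  have tf: "tf p ys n zs \<Longrightarrow> tf (pushes xs p) ys (n + length xs) (xs @ zs)" for p ys n zs xs
    unfolding pushes_def by (induction xs) (auto dest: tf_Seq[OF _ tf_Push])
  have set: "set (dcode c) \<subseteq> {1, 2}" unfolding dcode_def by (rule set_tcode)
  show ?thesis
  proof (rule fpI)
    show "wf_com (pushes (dcode c) drop_tree)" using wf set wf_tree_coms by blast
    show "\<exists>N. tf (pushes (dcode c) drop_tree) (dcode x @ rest) N (dcode c @ rest) \<and>
        N \<le> 12 * sz x + 3 + length (dcode c)" for x and rest
      by (intro exI conjI, rule tf[OF tf_drop]) simp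
  qed (intro pbd_intros)
qed

lemma fp_comp:
  assumes "fp g" "fp f"
  shows "fp (\<lambda>x. g (f x))"
proof -
  obtain c k where c: "wf_com c"
    "\<And>x rest n. sz x \<le> n \<Longrightarrow> tf c (dcode x @ rest) ((n + 2) ^ k) (dcode (f x) @ rest)"
    "\<And>x n. sz x \<le> n \<Longrightarrow> sz (f x) < (n + 2) ^ k"
    using fpE[OF assms(2)] by blast
  obtain d l where d: "wf_com d"
    "\<And>x rest n. sz x \<le> n \<Longrightarrow> tf d (dcode x @ rest) ((n + 2) ^ l) (dcode (g x) @ rest)"
    using fpE[OF assms(1)] by metis
  show ?thesis
  proof (rule fpI)
    show "wf_com (c ;; d)" using c d by simp
    show "\<exists>N. tf (c ;; d) (dcode x @ rest) N (dcode (g (f x)) @ rest) \<and>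
        N \<le> (sz x + 2) ^ k + ((sz x + 2) ^ k + 2) ^ l" for x rest
      by (intro exI conjI, rule tf_Seq[OF c(2)[OF order.refl] d(2)[OF less_imp_le[OF c(3)[OF order.refl]]]]) simp
  qed (intro pbd_intros)
qed

lemma fp_Pair [fp_intros]:
  assumes "fp f" "fp g"
  shows "fp (\<lambda>x. (f x, g x))"
proof -
  obtain c k where c: "wf_com c"
    "\<And>x rest n. sz x \<le> n \<Longrightarrow> tf c (dcode x @ rest) ((n + 2) ^ k) (dcode (f x) @ rest)"
    "\<And>x n. sz x \<le> n \<Longrightarrow> sz (f x) < (n + 2) ^ k"
    using fpE[OF assms(1)] by blast
  obtain d l where d: "wf_com d"
    "\<And>x rest n. sz x \<le> n \<Longrightarrow> tf d (dcode x @ rest) ((n + 2) ^ l) (dcode (g x) @ rest)"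
    "\<And>x n. sz x \<le> n \<Longrightarrow> sz (g x) < (n + 2) ^ l"
    using fpE[OF assms(2)] by blast
  show ?thesis
  proof (rule fpI)
    show "wf_com (dup_tree ;; c ;; swap_trees ;; d ;; swap_trees ;; Push 0 2)"
      using c d wf_tree_coms by simp
    show "\<exists>N. tf (dup_tree ;; c ;; swap_trees ;; d ;; swap_trees ;; Push 0 2) (dcode x @ rest) N
          (dcode (f x, g x) @ rest) \<and>
        N \<le> 28 * sz x + 5 + (sz x + 2) ^ k + (15 * (sz x + 2) ^ k + 15 * sz x + 6) + (sz x + 2) ^ l +
          (15 * (sz x + 2) ^ l + 15 * (sz x + 2) ^ k + 7)" for x rest
      unfolding dcode_pair
      apply (intro exI conjI, unfold append_Cons append_assoc)
       apply (rule tf_Seq[OF tf_dup tf_Seq[OF c(2)[OF order.refl] tf_Seq[OF tf_swap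
              tf_Seq[OF d(2)[OF order.refl] tf_Seq[OF tf_swap tf_Push]]]]])
      using c(3)[of x "sz x"] d(3)[of x "sz x"] by simp
  qed (intro pbd_intros)
qed

lemma fp_fst0: "fp (fst :: 'a::data \<times> 'b::data \<Rightarrow> 'a)"
proof (rule fpI)
  show "wf_com (Pop 0 ;; swap_trees ;; drop_tree)" using wf_tree_coms by simp
  show "\<exists>N. tf (Pop 0 ;; swap_trees ;; drop_tree) (dcode p @ rest) N (dcode (fst p) @ rest) \<and>
      N \<le> 1 + (15 * sz p + 6) + (12 * sz p + 3)" for p :: "'a \<times> 'b" and rest
    apply (cases p)
    apply (simp only: dcode_pair append_Cons append_assoc fst_conv)
    apply (intro exI conjI)
     apply (rule tf_Seq[OF tf_Pop tf_Seq[OF tf_swap tf_drop]])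
    by simp
qed (intro pbd_intros)

lemma fp_snd0: "fp (snd :: 'a::data \<times> 'b::data \<Rightarrow> 'b)"
proof (rule fpI)
  show "wf_com (Pop 0 ;; drop_tree)" using wf_tree_coms by simp
  show "\<exists>N. tf (Pop 0 ;; drop_tree) (dcode p @ rest) N (dcode (snd p) @ rest) \<and>
      N \<le> 1 + (12 * sz p + 3)" for p :: "'a \<times> 'b" and rest
    apply (cases p)
    apply (simp only: dcode_pair append_Cons append_assoc snd_conv)
    apply (intro exI conjI)
     apply (rule tf_Seq[OF tf_Pop tf_drop])
    by simp
qed (intro pbd_intros)

lemmas fp_fst [fp_intros] = fp_comp[OF fp_fst0] and fp_snd [fp_intros] = fp_comp[OF fp_snd0]

lemma fp_comp2:
  "fp (\<lambda>p. f (fst p) (snd p)) \<Longrightarrow> fp x \<Longrightarrow> fp y \<Longrightarrow> fp (\<lambda>z. f (x z) (y z))"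
  using fp_comp[of "\<lambda>p. f (fst p) (snd p)" "\<lambda>z. (x z, y z)"] fp_Pair by fastforce

lemma fp_comp3:
  "fp (\<lambda>p. f (fst p) (fst (snd p)) (snd (snd p))) \<Longrightarrow> fp x \<Longrightarrow> fp y \<Longrightarrow> fp w \<Longrightarrow>
    fp (\<lambda>z. f (x z) (y z) (w z))"
  using fp_comp2[of "\<lambda>a p. f a (fst p) (snd p)" x "\<lambda>z. (y z, w z)"] fp_Pair by fastforce

lemma fp_Cons [fp_intros]: "fp f \<Longrightarrow> fp g \<Longrightarrow> fp (\<lambda>x. f x # g x)"
  by (rule fp_code_cong[of "\<lambda>x. (f x, g x)" "\<lambda>x. x"]) (auto intro: fp_Pair simp: tr_prod_def)

lemma tf_If_top:
  assumes "xs = x # xs'" "if x \<in> A then tf c xs n ys else tf c' xs n ys"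
  shows "tf (If_top 0 A c c') xs (n + 2) ys"
  using assms unfolding tf_def by (auto intro: run_IfT run_IfF split: if_splits)

text \<open>The first symbol of the code of \<open>l x\<close> decides. In the node case this code
  is swapped below that of \<open>x\<close>; with one more 2 in front, the stack reads as the code
  of \<open>(x, y, z)\<close>, since \<open>l x\<close> has the same code as
  \<open>(y, z)\<close>.\<close>

lemma fp_case_gen:
  fixes l :: "'a::data \<Rightarrow> 'b::data" and g :: "'a \<times> 'c::data \<times> 'd::data \<Rightarrow> 'e::data"
  assumes "fp l" "fp f" "fp g"
    and cases: "\<And>x. tr (l x) = Leaf \<and> r x = f x \<or>
      (\<exists>y z. tr (l x) = Node (tr y) (tr z) \<and> r x = g (x, y, z))"
  shows "fp r"
proof -
  obtain cl k where l: "wf_com cl"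
    "\<And>x rest n. sz x \<le> n \<Longrightarrow> tf cl (dcode x @ rest) ((n + 2) ^ k) (dcode (l x) @ rest)"
    "\<And>x n. sz x \<le> n \<Longrightarrow> sz (l x) < (n + 2) ^ k"
    using fpE[OF assms(1)] by blast
  obtain cf kf where f: "wf_com cf"
    "\<And>x rest n. sz x \<le> n \<Longrightarrow> tf cf (dcode x @ rest) ((n + 2) ^ kf) (dcode (f x) @ rest)"
    using fpE[OF assms(2)] by metis
  obtain cg kg where g: "wf_com cg"
    "\<And>x rest n. sz x \<le> n \<Longrightarrow> tf cg (dcode x @ rest) ((n + 2) ^ kg) (dcode (g x) @ rest)"
    using fpE[OF assms(3)] by metis
  let ?c = "dup_tree ;; cl ;; If_top 0 {1} (Pop 0 ;; cf) (swap_trees ;; Push 0 2 ;; cg)"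
  let ?h = "\<lambda>n. (28 * n + 5) + ((n + 2) ^ k + ((1 + (n + 2) ^ kf) +
      ((15 * (n + 2) ^ k + 15 * n + 6) + (1 + (n + (n + 2) ^ k + 2) ^ kg)) + 2))"
  show ?thesis
  proof (rule fpI[where c = ?c and h = ?h])
    show "wf_com ?c" using l f g wf_tree_coms by simp
    fix x rest
    have "tf (If_top 0 {1} (Pop 0 ;; cf) (swap_trees ;; Push 0 2 ;; cg)) (dcode (l x) @ dcode x @ rest)
       ((1 + (sz x + 2) ^ kf) +
         ((15 * (sz x + 2) ^ k + 15 * sz x + 6) + (1 + (sz x + (sz x + 2) ^ k + 2) ^ kg)) + 2)
       (dcode (r x) @ rest)"
      using cases[of x]
    proof
      assume *: "tr (l x) = Leaf \<and> r x = f x"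
      then have d: "dcode (l x) = [1]" by (simp add: dcode_def)
      have "tf (Pop 0 ;; cf) (dcode (l x) @ dcode x @ rest) (1 + (sz x + 2) ^ kf) (dcode (r x) @ rest)"
        unfolding d using tf_Seq[OF tf_Pop f(2)[OF order.refl]] * by simp
      then show ?thesis unfolding d
        by (intro tf_If_top) (auto elim!: tf_mono)
    next
      assume "\<exists>y z. tr (l x) = Node (tr y) (tr z) \<and> r x = g (x, y, z)"
      then obtain y z where yz: "tr (l x) = Node (tr y) (tr z)" "r x = g (x, y, z)" by blast
      then have d: "dcode (l x) = 2 # dcode y @ dcode z" by (simp add: dcode_def)
      have s: "sz (x, y, z) \<le> sz x + (sz x + 2) ^ k" using l(3)[of x "sz x"] d by (simp add: sz_def dcode_pair)
      have "tf (swap_trees ;; Push 0 2 ;; cg) (dcode (l x) @ dcode x @ rest)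
          ((15 * sz (l x) + 15 * sz x + 6) + (1 + (sz x + (sz x + 2) ^ k + 2) ^ kg)) (dcode (r x) @ rest)"
        using tf_Seq[OF tf_swap[of "l x" x rest] tf_Seq[OF tf_Push]] g(2)[OF s, of rest] d yz(2)
        by (simp add: dcode_pair)
      then show ?thesis using d l(3)[of x "sz x"]
        by (intro tf_If_top) (auto elim!: tf_mono)
    qed
    then have "tf ?c (dcode x @ rest) (?h (sz x)) (dcode (r x) @ rest)"
      by (intro tf_Seq[OF tf_dup tf_Seq[OF l(2)[OF order.refl]]])
    then show "\<exists>N. tf ?c (dcode x @ rest) N (dcode (r x) @ rest) \<and> N \<le> ?h (sz x)" by blast
  qed (intro pbd_intros)
qed

lemma fp_case_list [fp_intros]:
  assumes "fp l" "fp f" "fp (\<lambda>p. g (fst p) (fst (snd p)) (snd (snd p)))"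
  shows "fp (\<lambda>x. case l x of [] \<Rightarrow> f x | y # ys \<Rightarrow> g x y ys)"
  by (rule fp_case_gen[OF assms]) (auto split: list.splits)

lemma fp_case_tree [fp_intros]:
  assumes "fp l" "fp f" "fp (\<lambda>p. g (fst p) (fst (snd p)) (snd (snd p)))"
  shows "fp (\<lambda>x. case l x of Leaf \<Rightarrow> f x | Node y z \<Rightarrow> g x y z)"
  by (rule fp_case_gen[OF assms]) (auto split: tree.splits)

lemma fp_If [fp_intros]:
  assumes "fp b" "fp f" "fp g"
  shows "fp (\<lambda>x. if b x then f x else g x)"
proof -
  have b: "fp (\<lambda>x. if b x then [[]] else ([] :: bool list list))"
    using assms(1) by (rule fp_code_cong) (auto simp: tr_bool_def)
  have "fp (\<lambda>x. case (if b x then [[]] else ([] :: bool list list)) of [] \<Rightarrow> g x | y # ys \<Rightarrow> f x)"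
    by (intro fp_case_list b assms fp_comp[OF assms(2)] fp_fst0)
  then show ?thesis by (rule back_subst[of fp]) (auto simp: fun_eq_iff)
qed

lemma fp_eq [fp_intros]:
  assumes "fp f" "fp g"
  shows "fp (\<lambda>x. f x = g x)"
proof -
  have "fp (\<lambda>p. fst p = (snd p :: 'b))"
  proof (rule fpI)
    show "wf_com (Pop 0 ;; compare_trees)" using wf_tree_coms by simp
    show "\<exists>N. tf (Pop 0 ;; compare_trees) (dcode p @ rest) N (dcode (fst p = snd p) @ rest) \<and>
        N \<le> 1 + (30 * sz p + 30 * sz p + 30)" for p :: "'b \<times> 'b" and rest
    proof -
      obtain x y where p: "p = (x, y)" by (cases p)
      have e: "dcode (x = y) = (if tr x = tr y then [2, 1, 1] else [1])"
        using tr_inj[of x y] dcode_bool by (cases "x = y") auto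
      have "tf compare_trees (dcode x @ dcode y @ rest) (30 * sz x + 30 * sz y + 30) (dcode (x = y) @ rest)"
        unfolding tf_def e unfolding dcode_def sz_def by (rule run_compare_trees) simp
      from tf_Seq[OF tf_Pop this, of 2] show ?thesis
        unfolding p dcode_pair append_Cons append_assoc fst_conv snd_conv
        by (intro exI conjI) (assumption, simp)
    qed
  qed (intro pbd_intros)
  from fp_comp2[OF this assms] show ?thesis .
qed

section \<open>Bounded iteration\<close>

definition while_com :: "com \<Rightarrow> com \<Rightarrow> com" where
  "while_com cb cg = (dup_tree ;; cb ;; While_top 0 {2} (drop_tree ;; cg ;; dup_tree ;; cb) ;; drop_tree)"

text \<open>The code of the condition lies on top of the state and starts with 2 iff it holds. The
  number of rounds is explicit and all states share one size bound, because the lemma also has to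
  serve the search for 3-SAT, which takes exponentially many rounds.\<close>

lemma tf_while_com:
  fixes g :: "'a::data \<Rightarrow> 'a" and b :: "'a \<Rightarrow> bool"
  assumes b: "\<And>x rest n. sz x \<le> n \<Longrightarrow> tf cb (dcode x @ rest) ((n + 2) ^ k) (dcode (b x) @ rest)"
    and g: "\<And>x rest n. sz x \<le> n \<Longrightarrow> tf cg (dcode x @ rest) ((n + 2) ^ l) (dcode (g x) @ rest)"
    and n: "\<And>i. i < n \<Longrightarrow> b ((g ^^ i) x)" "\<not> b ((g ^^ n) x)" "\<And>i. i \<le> n \<Longrightarrow> sz ((g ^^ i) x) \<le> B"
  shows "tf (while_com cb cg) (dcode x @ rest)
    ((n + 1) * ((B + 2) ^ k + (B + 2) ^ l + 28 * B + 66)) (dcode ((g ^^ n) x) @ rest)"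
proof -
  let ?c = "(B + 2) ^ k + (B + 2) ^ l + 28 * B + 46"
  let ?W = "While_top 0 {2} (drop_tree ;; cg ;; dup_tree ;; cb)"
  have "tf ?W (dcode (b x) @ dcode x @ rest) (n * ?c + 1) (dcode False @ dcode ((g ^^ n) x) @ rest)"
    using n
  proof (induction n arbitrary: x)
    case 0
    then show ?case unfolding tf_def by (auto intro!: run_WhileF' simp: dcode_bool)
  next
    case (Suc n)
    have gi: "(g ^^ i) (g x) = (g ^^ Suc i) x" for i
      by (simp add: funpow_swap1)
    have bx: "b x" using Suc.prems(1)[of 0] by simp
    have sx: "sz x \<le> B" "sz (g x) \<le> B" using Suc.prems(3)[of 0] Suc.prems(3)[of 1] by auto
    have "tf (drop_tree ;; cg ;; dup_tree ;; cb) (dcode (b x) @ dcode x @ rest)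
        (12 * sz (b x) + 3 + ((B + 2) ^ l + (28 * sz (g x) + 5 + (B + 2) ^ k)))
        (dcode (b (g x)) @ dcode (g x) @ rest)"
      by (intro tf_Seq[OF tf_drop] tf_Seq[OF g[OF sx(1)]] tf_Seq[OF tf_dup] b[OF sx(2)])
    then have body: "run (drop_tree ;; cg ;; dup_tree ;; cb) (raw_stacks (dcode (b x) @ dcode x @ rest))
       (?c - 2) (raw_stacks (dcode (b (g x)) @ dcode (g x) @ rest))"
      unfolding tf_def by (rule run_mono) (use bx sx in simp)
    have IH: "tf ?W (dcode (b (g x)) @ dcode (g x) @ rest) (n * ?c + 1)
        (dcode False @ dcode ((g ^^ n) (g x)) @ rest)"
      using Suc.prems by (intro Suc.IH) (simp_all only: gi, auto)
    show ?case unfolding tf_def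
      by (rule run_WhileT[OF _ body IH[unfolded tf_def gi]]) (use bx in \<open>auto simp: dcode_bool\<close>)
  qed
  moreover have sx: "sz x \<le> B" using n(3)[of 0] by simp
  ultimately have "tf (while_com cb cg) (dcode x @ rest)
      (28 * sz x + 5 + ((B + 2) ^ k + ((n * ?c + 1) + (12 * sz False + 3)))) (dcode ((g ^^ n) x) @ rest)"
    unfolding while_com_def by (intro tf_Seq[OF tf_dup] tf_Seq[OF b[OF sx]] tf_Seq[OF _ tf_drop])
  then show ?thesis by (rule tf_mono) (use sx in \<open>simp add: algebra_simps\<close>)
qed

lemma wf_while_com: "wf_com cb \<Longrightarrow> wf_com cg \<Longrightarrow> wf_com (while_com cb cg)"
  using wf_tree_coms by (simp add: while_com_def)

text \<open>The sizes of all intermediate states have to be bounded, since polynomially many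
  applications of a polynomial-time function can produce values of exponential size.\<close>

lemma fp_while:
  fixes g :: "'a::data \<Rightarrow> 'a"
  assumes "fp b" "fp g" "fp init" "pbd h"
    "\<And>x. \<exists>n\<le>h (sz x). F x = (g ^^ n) (init x) \<and> (\<forall>i<n. b ((g ^^ i) (init x))) \<and>
      \<not> b ((g ^^ n) (init x)) \<and> (\<forall>i\<le>n. sz ((g ^^ i) (init x)) \<le> h (sz x))"
  shows "fp F"
proof -
  obtain cb k where b: "wf_com cb"
    "\<And>x rest n. sz x \<le> n \<Longrightarrow> tf cb (dcode x @ rest) ((n + 2) ^ k) (dcode (b x) @ rest)"
    using fpE[OF assms(1)] by metis
  obtain cg l where g: "wf_com cg"
    "\<And>x rest n. sz x \<le> n \<Longrightarrow> tf cg (dcode x @ rest) ((n + 2) ^ l) (dcode (g x) @ rest)"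
    using fpE[OF assms(2)] by metis
  obtain ci m where i: "wf_com ci"
    "\<And>x rest n. sz x \<le> n \<Longrightarrow> tf ci (dcode x @ rest) ((n + 2) ^ m) (dcode (init x) @ rest)"
    using fpE[OF assms(3)] by metis
  let ?h = "\<lambda>n. (n + 2) ^ m + (h n + 1) * ((h n + 2) ^ k + (h n + 2) ^ l + 28 * h n + 66)"
  show ?thesis
  proof (rule fpI[where h = ?h])
    show "wf_com (ci ;; while_com cb cg)" using wf_while_com b g i by simp
    fix x rest
    obtain n where n: "n \<le> h (sz x)" "F x = (g ^^ n) (init x)" "\<forall>i<n. b ((g ^^ i) (init x))"
      "\<not> b ((g ^^ n) (init x))" "\<forall>i\<le>n. sz ((g ^^ i) (init x)) \<le> h (sz x)"
      using assms(5) by blast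
    have "tf (while_com cb cg) (dcode (init x) @ rest)
        ((n + 1) * ((h (sz x) + 2) ^ k + (h (sz x) + 2) ^ l + 28 * h (sz x) + 66)) (dcode (F x) @ rest)"
      unfolding n(2) using n by (intro tf_while_com[OF b(2) g(2)]) auto
    note t = tf_Seq[OF i(2)[OF order.refl] this]
    show "\<exists>N. tf (ci ;; while_com cb cg) (dcode x @ rest) N (dcode (F x) @ rest) \<and> N \<le> ?h (sz x)"
      using n(1) by (intro exI[of _ "?h (sz x)"] conjI tf_mono[OF t]) auto
  qed (intro pbd_intros assms)
qed

lemma sz_drop: "sz (drop n l) \<le> sz l" and sz_take: "sz (take n l) \<le> sz l"
proof -
  have "sz l + 1 = sz (take n l) + sz (drop n l)" using sz_append[of "take n l" "drop n l"] by simp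
  moreover have "0 < sz (take n l)" "0 < sz (drop n l)" by (rule sz_pos)+
  ultimately show "sz (drop n l) \<le> sz l" "sz (take n l) \<le> sz l" by linarith+
qed

lemma sz_append_le: "sz (xs @ ys) \<le> sz xs + sz ys"
  using sz_append[of xs ys] by linarith

lemma fp_not [fp_intros]: "fp b \<Longrightarrow> fp (\<lambda>x. \<not> b x)"
  by (rule back_subst[of fp, OF fp_If[OF _ fp_const[of False] fp_const[of True]]]) auto

lemma fp_conj [fp_intros]: "fp b \<Longrightarrow> fp c \<Longrightarrow> fp (\<lambda>x. b x \<and> c x)"
  using fp_If[OF _ _ fp_const[of False], of b c] by (rule back_subst[of fp]) auto

lemma fp_disj [fp_intros]: "fp b \<Longrightarrow> fp c \<Longrightarrow> fp (\<lambda>x. b x \<or> c x)"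
  using fp_If[OF _ fp_const[of True], of b c] by (rule back_subst[of fp]) auto

lemma fp_imp [fp_intros]: "fp b \<Longrightarrow> fp c \<Longrightarrow> fp (\<lambda>x. b x \<longrightarrow> c x)"
  using fp_If[OF _ _ fp_const[of True], of b c] by (rule back_subst[of fp]) auto

lemma fp_foldl:
  fixes g :: "'e::data \<Rightarrow> 'a::data \<Rightarrow> 'y::data \<Rightarrow> 'a"
  assumes g: "fp (\<lambda>p. g (fst p) (fst (snd p)) (snd (snd p)))"
    and eal: "fp e" "fp a" "fp l" and h: "pbd h"
    and bound: "\<And>x n. n \<le> length (l x) \<Longrightarrow> sz (foldl (g (e x)) (a x) (take n (l x))) \<le> h (sz x)"
  shows "fp (\<lambda>x. foldl (g (e x)) (a x) (l x))"
proof -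
  define step where "step = (\<lambda>p. case snd (snd p) of [] \<Rightarrow> p | y # ys \<Rightarrow> (fst p, g (fst p) (fst (snd p)) y, ys))"
  let ?F = "\<lambda>x. (e x, foldl (g (e x)) (a x) (l x), [] :: 'y list)"
  have it: "(step ^^ n) (e, a, l) = (e, foldl (g e) a (take n l), drop n l)" if "n \<le> length l" for n e a l
    using that
  proof (induction n)
    case (Suc n)
    then have "take (Suc n) l = take n l @ [l ! n]" "drop n l = l ! n # drop (Suc n) l"
      by (simp_all add: take_Suc_conv_app_nth Cons_nth_drop_Suc)
    then show ?case using Suc by (simp add: step_def)
  qed simp
  have step: "fp step"
    unfolding step_def by (intro fp_intros fp_comp3[OF g])
  obtain ke where ke: "\<And>x n. sz x \<le> n \<Longrightarrow> sz (e x) \<le> (n + 2) ^ ke" using fp_sz[OF eal(1)] by metis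
  obtain kl where kl: "\<And>x n. sz x \<le> n \<Longrightarrow> sz (l x) \<le> (n + 2) ^ kl" using fp_sz[OF eal(3)] by metis
  let ?h = "\<lambda>n. h n + (n + 2) ^ ke + (n + 2) ^ kl + 2"
  have "fp ?F"
  proof (rule fp_while[OF _ step, where b = "\<lambda>p. snd (snd p) \<noteq> []" and h = ?h and init = "\<lambda>x. (e x, a x, l x)"])
    fix x
    let ?p = "(e x, a x, l x)"
    have "sz ((step ^^ i) ?p) \<le> ?h (sz x)" if "i \<le> length (l x)" for i
      using it[OF that, of "e x" "a x"] bound[OF that] ke[of x, OF order.refl] kl[of x, OF order.refl]
        sz_drop[of i "l x"] by simp
    moreover have "length (l x) \<le> ?h (sz x)"
      using length_le_sz[of "l x"] kl[of x, OF order.refl] by linarith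
    ultimately show "\<exists>n\<le>?h (sz x). ?F x = (step ^^ n) ?p \<and>
        (\<forall>i<n. snd (snd ((step ^^ i) ?p)) \<noteq> []) \<and> \<not> snd (snd ((step ^^ n) ?p)) \<noteq> [] \<and>
        (\<forall>i\<le>n. sz ((step ^^ i) ?p) \<le> ?h (sz x))"
      using it[of _ "l x" "e x" "a x"] by (intro exI[of _ "length (l x)"] conjI allI impI) auto
  qed (intro pbd_intros fp_intros eal h)+
  then have "fp (\<lambda>x. fst (snd (?F x)))" by (intro fp_fst fp_snd)
  then show ?thesis by simp
qed

lemma sz_foldl_add:
  assumes "\<And>a y. y \<in> set l \<Longrightarrow> sz (g a y) \<le> sz a + m"
  shows "sz (foldl g a l) \<le> sz a + length l * m"
  using assms
proof (induction l arbitrary: a)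
  case (Cons y l)
  from Cons.IH[of "g a y"] Cons.prems[of y a] Cons.prems show ?case by fastforce
qed simp

text \<open>Growth by an amount that is independent of the accumulator keeps a fold
  polynomial.\<close>

lemma fp_foldl_add:
  fixes g :: "'e::data \<Rightarrow> 'a::data \<Rightarrow> 'y::data \<Rightarrow> 'a"
  assumes g: "fp (\<lambda>p. g (fst p) (fst (snd p)) (snd (snd p)))"
    and eal: "fp e" "fp a" "fp l" 
    and add: "\<And>e a y. sz (g e a y) \<le> sz a + (sz e + sz y + 2) ^ k"
  shows "fp (\<lambda>x. foldl (g (e x)) (a x) (l x))"
proof -
  obtain ke where ke: "\<And>x n. sz x \<le> n \<Longrightarrow> sz (e x) \<le> (n + 2) ^ ke" using fp_sz[OF eal(1)] by metis
  obtain ka where ka: "\<And>x n. sz x \<le> n \<Longrightarrow> sz (a x) \<le> (n + 2) ^ ka" using fp_sz[OF eal(2)] by metis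
  obtain kl where kl: "\<And>x n. sz x \<le> n \<Longrightarrow> sz (l x) \<le> (n + 2) ^ kl" using fp_sz[OF eal(3)] by metis
  let ?m = "\<lambda>n. ((n + 2) ^ ke + (n + 2) ^ kl + 2) ^ k"
  show ?thesis
  proof (rule fp_foldl[OF g eal, where h = "\<lambda>n. (n + 2) ^ ka + (n + 2) ^ kl * ?m n"])
    fix x n assume n: "n \<le> length (l x)"
    have "sz (foldl (g (e x)) (a x) (take n (l x))) \<le> sz (a x) + length (take n (l x)) * ?m (sz x)"
    proof (rule sz_foldl_add)
      fix b y assume "y \<in> set (take n (l x))"
      then have "sz y \<le> (sz x + 2) ^ kl"
        using sz_elem[of y "l x"] kl[of x "sz x"] in_set_takeD[of y n "l x"] by simp
      then have "(sz (e x) + sz y + 2) ^ k \<le> ?m (sz x)"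
        using ke[of x "sz x"] by (intro power_mono) auto
      then show "sz (g (e x) b y) \<le> sz b + ?m (sz x)"
        using add[of "e x" b y] by linarith
    qed
    also have "\<dots> \<le> (sz x + 2) ^ ka + (sz x + 2) ^ kl * ?m (sz x)"
      using n ka[of x "sz x"] kl[of x "sz x"] length_le_sz[of "l x"]
      by (intro add_mono mult_right_mono) auto
    finally show "sz (foldl (g (e x)) (a x) (take n (l x))) \<le> (sz x + 2) ^ ka + (sz x + 2) ^ kl * ?m (sz x)" .
  qed (intro pbd_intros)
qed

lemma sz_rev [simp]: "sz (rev xs) = sz xs"
proof (induction xs)
  case (Cons x xs)
  then show ?case using sz_append[of "rev xs" "[x]"] by simp
qed simp

lemma foldl_Cons_rev: "foldl (\<lambda>a y. y # a) b xs = rev xs @ b"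
  by (induction xs arbitrary: b) auto

lemma fp_rev [fp_intros]:
  assumes "fp l"
  shows "fp (\<lambda>x. rev (l x))"
proof -
  have "fp (\<lambda>x. foldl ((\<lambda>e a y. y # a) ([] :: bool list)) [] (l x))"
    by (rule fp_foldl_add[where k = 1 and e = "\<lambda>_. []" and g = "\<lambda>e a y. y # a"])
      (intro fp_intros assms | simp)+
  then show ?thesis by (simp add: foldl_Cons_rev)
qed

text \<open>Structural recursion is a left fold over the reversed list. The accumulator also
  rebuilds the suffix that the recursion equation needs, so each intermediate value is
  \<open>F\<close> of a suffix and the bound on \<open>F\<close> covers all of them.\<close>

lemma fp_listrec:
  fixes F :: "'e::data \<Rightarrow> 'y::data list \<Rightarrow> 'r::data"
  assumes F: "\<And>e. F e [] = a e" "\<And>e y ys. F e (y # ys) = g e y ys (F e ys)"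
    and a: "fp a" and g: "fp (\<lambda>p. g (fst p) (fst (snd p)) (fst (snd (snd p))) (snd (snd (snd p))))"
    and h: "pbd h" "\<And>e ys. sz (F e ys) \<le> h (sz e + sz ys)"
    and el: "fp e" "fp l"
  shows "fp (\<lambda>x. F (e x) (l x))"
proof -
  let ?step = "\<lambda>e s y. (y # fst s, g e y (fst s) (snd s))"
  have fold: "foldl (?step e) ([], a e) (rev ys) = (ys, F e ys)" for e ys
    by (induction ys) (auto simp: F)
  obtain k where k: "\<And>n m. n \<le> m \<Longrightarrow> h n \<le> (m + 2) ^ k" using pbdE[OF h(1)] by metis
  obtain ke where ke: "\<And>x n. sz x \<le> n \<Longrightarrow> sz (e x) \<le> (n + 2) ^ ke" using fp_sz[OF el(1)] by metis
  obtain kl where kl: "\<And>x n. sz x \<le> n \<Longrightarrow> sz (l x) \<le> (n + 2) ^ kl" using fp_sz[OF el(2)] by metis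
  have step: "fp (\<lambda>p. ?step (fst p) (fst (snd p)) (snd (snd p)))"
  proof -
    let ?i = "\<lambda>p :: 'e \<times> ('y list \<times> 'r) \<times> 'y. (fst p, snd (snd p), fst (fst (snd p)), snd (fst (snd p)))"
    have "fp ?i" by (intro fp_intros)
    from fp_comp[OF g this]
    have "fp (\<lambda>p. g (fst p) (snd (snd p)) (fst (fst (snd p))) (snd (fst (snd p))))"
      by (simp only: fst_conv snd_conv)
    then show ?thesis by (intro fp_intros)
  qed
  have "fp (\<lambda>x. foldl (?step (e x)) ([], a (e x)) (rev (l x)))"
  proof (rule fp_foldl[OF step el(1), where h = "\<lambda>n. 1 + (n + 2) ^ kl + ((n + 2) ^ ke + (n + 2) ^ kl + 2) ^ k"])
    fix x n
    assume "n \<le> length (rev (l x))"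
    then have "take n (rev (l x)) = rev (drop (length (l x) - n) (l x))" by (simp add: rev_drop)
    then have "sz (foldl (?step (e x)) ([], a (e x)) (take n (rev (l x)))) =
        1 + sz (drop (length (l x) - n) (l x)) + sz (F (e x) (drop (length (l x) - n) (l x)))"
      by (simp add: fold)
    moreover have "sz (drop (length (l x) - n) (l x)) \<le> (sz x + 2) ^ kl"
      using sz_drop kl[of x "sz x"] by (meson le_trans order.refl)
    moreover from this have "sz (F (e x) (drop (length (l x) - n) (l x))) \<le> ((sz x + 2) ^ ke + (sz x + 2) ^ kl + 2) ^ k"
      using ke[of x "sz x"] by (intro order.trans[OF h(2) k] add_mono) auto
    ultimately show "sz (foldl (?step (e x)) ([], a (e x)) (take n (rev (l x)))) \<le>
      1 + (sz x + 2) ^ kl + ((sz x + 2) ^ ke + (sz x + 2) ^ kl + 2) ^ k" by linarith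
  qed (intro pbd_intros fp_intros el fp_comp[OF a])+
  then have "fp (\<lambda>x. snd (foldl (?step (e x)) ([], a (e x)) (rev (l x))))" by (rule fp_snd)
  then show ?thesis by (simp add: fold)
qed

section \<open>Functions on lists\<close>

lemma fp_append [fp_intros]: "fp f \<Longrightarrow> fp g \<Longrightarrow> fp (\<lambda>x. f x @ g x)"
  by (rule fp_listrec[where F = "\<lambda>e l. l @ e" and a = "\<lambda>e. e" and g = "\<lambda>e y ys r. y # r" and h = "\<lambda>n. n"])
    (intro fp_intros pbd_intros | simp add: sz_append_le[THEN order.trans])+

lemma fp_map [fp_intros]:
  assumes "fp (\<lambda>p. g (fst p) (snd p))" "fp l"
  shows "fp (\<lambda>x. map (g x) (l x))"
proof -
  obtain k where k: "\<And>p n. sz p \<le> n \<Longrightarrow> sz (g (fst p) (snd p)) \<le> (n + 2) ^ k"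
    using fp_sz[OF assms(1)] by metis
  have "sz (map (g e) l) \<le> 1 + (sz e + sz l) * ((sz e + sz l + 2) ^ k + 1)" for e l
  proof -
    have "sz (map (g e) l) \<le> 1 + length (map (g e) l) * ((sz e + sz l + 2) ^ k + 1)"
    proof (rule sz_list_le)
      fix y assume "y \<in> set (map (g e) l)"
      then obtain z where z: "y = g e z" "z \<in> set l" by auto
      then show "sz y \<le> (sz e + sz l + 2) ^ k"
        using k[of "(e, z)" "sz e + sz l"] sz_elem[of z l] by simp
    qed
    also have "\<dots> \<le> 1 + (sz e + sz l) * ((sz e + sz l + 2) ^ k + 1)"
      using length_le_sz[of l] by (intro add_mono mult_right_mono) auto
    finally show ?thesis .
  qed
  note s = this
  show ?thesis
  proof (rule fp_listrec[where F = "\<lambda>e l. map (g e) l" and a = "\<lambda>e. []" and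
        g = "\<lambda>e y ys r. g e y # r" and h = "\<lambda>n. 1 + n * ((n + 2) ^ k + 1)", OF _ _ _ _ _ s])
  qed (intro fp_intros pbd_intros fp_comp2[OF assms(1)] assms | simp)+
qed

lemma sz_filter: "sz (filter P l) \<le> sz l"
  by (induction l) auto

lemma fp_filter [fp_intros]:
  assumes "fp (\<lambda>p. P (fst p) (snd p))" "fp l"
  shows "fp (\<lambda>x. filter (P x) (l x))"
  by (rule fp_listrec[where F = "\<lambda>e l. filter (P e) l" and a = "\<lambda>e. []" and
        g = "\<lambda>e y ys r. if P e y then y # r else r" and h = "\<lambda>n. n"])
    (intro fp_intros pbd_intros fp_comp2[OF assms(1)] assms | simp add: trans_le_add2 sz_filter)+

lemma sz_concat: "sz (concat l) \<le> sz l"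
proof (induction l)
  case (Cons x l)
  then show ?case using sz_append[of x "concat l"] by simp
qed simp

lemma fp_concat [fp_intros]:
  assumes "fp l"
  shows "fp (\<lambda>x. concat (l x))"
  by (rule fp_listrec[where F = "\<lambda>e :: bool list. concat" and a = "\<lambda>e. []" and
        g = "\<lambda>e y ys r. y @ r" and h = "\<lambda>n. n" and e = "\<lambda>_. []"])
    (intro fp_intros pbd_intros assms | simp add: trans_le_add2 sz_concat)+

lemma fp_Bex [fp_intros]:
  assumes "fp (\<lambda>p. P (fst p) (snd p))" "fp l"
  shows "fp (\<lambda>x. \<exists>y\<in>set (l x). P x y)"
proof -
  have "fp (\<lambda>x. filter (P x) (l x) \<noteq> [])" by (intro fp_intros assms)
  then show ?thesis by (simp add: filter_empty_conv)
qed

lemma fp_Ball [fp_intros]: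
  assumes "fp (\<lambda>p. P (fst p) (snd p))" "fp l"
  shows "fp (\<lambda>x. \<forall>y\<in>set (l x). P x y)"
proof -
  have "fp (\<lambda>x. filter (\<lambda>y. \<not> P x y) (l x) = [])" by (intro fp_intros assms)
  then show ?thesis by (simp add: filter_empty_conv)
qed

lemma fp_member [fp_intros]:
  assumes "fp f" "fp l"
  shows "fp (\<lambda>x. f x \<in> set (l x))"
proof -
  have "fp (\<lambda>x. \<exists>y\<in>set (l x). f x = y)"
    by (intro fp_intros assms fp_comp[OF assms(1)])
  then show ?thesis by (rule back_subst[of fp]) auto
qed

lemma fp_remdups [fp_intros]:
  assumes "fp l"
  shows "fp (\<lambda>x. remdups (l x))"
proof -
  have "sz (remdups xs) \<le> sz xs" for xs :: "'b list"
    by (induction xs) auto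
  then show ?thesis
    by (intro fp_listrec[where F = "\<lambda>e :: bool list. remdups" and a = "\<lambda>e. []" and
        g = "\<lambda>e y ys r. if y \<in> set ys then r else y # r" and h = "\<lambda>n. n" and e = "\<lambda>_. []"])
     (intro fp_intros pbd_intros assms | simp add: trans_le_add2)+
qed

section \<open>Binary numbers\<close>

fun bits_inc :: "bool list \<Rightarrow> bool list" where
  "bits_inc [] = [True]"
| "bits_inc (b # bs) = (if b then False # bits_inc bs else True # bs)"

lemma bits_of_nat_0 [simp]: "bits_of_nat 0 = []"
  by (subst bits_of_nat.simps) simp

lemma bits_of_nat_Suc: "bits_of_nat (Suc n) = bits_inc (bits_of_nat n)"
proof (induction n rule: less_induct)
  case (less n)
  show ?case
  proof (cases "n = 0")
    case True
    then show ?thesis by (simp add: bits_of_nat.simps[of "Suc 0"])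
  next
    case False
    have 1: "bits_of_nat n = odd n # bits_of_nat (n div 2)"
      using False by (subst bits_of_nat.simps) simp
    have 2: "bits_of_nat (Suc n) = even n # bits_of_nat (Suc n div 2)"
      by (subst bits_of_nat.simps) simp
    show ?thesis
    proof (cases "odd n")
      case True
      then have "Suc n div 2 = Suc (n div 2)" by simp
      then show ?thesis using 1 2 True False less[of "n div 2"] by simp
    next
      case False
      then have "Suc n div 2 = n div 2" by simp
      then show ?thesis using 1 2 False by simp
    qed
  qed
qed

lemma bits_of_nat_double: "bits_of_nat (2 * n) = (if n = 0 then [] else False # bits_of_nat n)"
  by (subst bits_of_nat.simps) simp

lemma sz_bits_inc: "sz (bits_inc bs) \<le> sz bs + 4"
  by (induction bs) auto

lemma sz_nat_def: "sz n = sz (bits_of_nat n)"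
  by (simp add: sz_def dcode_def tr_nat_def)

lemma sz_0 [simp]: "sz (0 :: nat) = 1"
  by (simp add: sz_nat_def)

lemma sz_Suc: "sz (Suc n) \<le> sz n + 4"
  by (simp add: sz_nat_def bits_of_nat_Suc sz_bits_inc)

text \<open>Crude, but enough for numbers that count the elements of a list.\<close>

lemma sz_nat_le: "sz (n :: nat) \<le> 4 * n + 1"
proof (induction n)
  case (Suc n)
  have "sz (Suc n) \<le> sz n + 4" by (rule sz_Suc)
  also have "\<dots> \<le> (4 * n + 1) + 4" using Suc by (rule add_right_mono)
  finally show ?case by simp
qed simp

lemma fp_bits_of_nat [fp_intros]: "fp f \<Longrightarrow> fp (\<lambda>x. bits_of_nat (f x))"
  by (rule fp_code_cong[where g = f and i = "\<lambda>x. x"]) (auto simp: tr_nat_def)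

lemma fp_of_bits: "fp (\<lambda>x. bits_of_nat (f x)) \<Longrightarrow> fp f"
  by (rule fp_code_cong[where g = "\<lambda>x. bits_of_nat (f x)" and i = "\<lambda>x. x"]) (auto simp: tr_nat_def)

lemma fp_Suc [fp_intros]:
  assumes "fp f"
  shows "fp (\<lambda>x. Suc (f x))"
proof (rule fp_of_bits)
  show "fp (\<lambda>x. bits_of_nat (Suc (f x)))"
    unfolding bits_of_nat_Suc
    by (rule fp_listrec[where F = "\<lambda>e :: bool list. bits_inc" and a = "\<lambda>e. [True]" and
        g = "\<lambda>e y ys r. if y then False # r else True # ys" and h = "\<lambda>n. n + 4" and e = "\<lambda>_. []"])
    (intro fp_intros pbd_intros assms | simp add: order.trans[OF sz_bits_inc])+
qed

lemma fp_double [fp_intros]: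
  assumes "fp f"
  shows "fp (\<lambda>x. 2 * (f x :: nat))"
  by (rule fp_of_bits, unfold bits_of_nat_double) (intro fp_intros assms)

lemma fp_length [fp_intros]:
  assumes "fp l"
  shows "fp (\<lambda>x. length (l x))"
proof -
  have "sz (length xs) \<le> 4 * sz xs + 1" for xs :: "'b list"
    using sz_nat_le[of "length xs"] length_le_sz[of xs] by linarith
  then have "sz (length xs) \<le> 4 * (sz (e :: bool list) + sz xs) + 1" for e and xs :: "'b list"
    by (meson add_le_mono1 le_add2 le_trans mult_le_mono2)
  then show ?thesis
    by (intro fp_listrec[where F = "\<lambda>e :: bool list. length" and a = "\<lambda>e. 0" and
        g = "\<lambda>e y ys r. Suc r" and h = "\<lambda>n. 4 * n + 1" and e = "\<lambda>_. []"])
     (intro fp_intros pbd_intros assms | simp)+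
qed

lemma enumerate_foldl: "List.enumerate 0 xs = foldl (\<lambda>a y. a @ [(length a, y)]) [] xs"
proof (induction xs rule: rev_induct)
  case (snoc x xs)
  then show ?case by (simp add: enumerate_append_eq) (metis length_enumerate)
qed simp

lemma fp_enumerate [fp_intros]:
  assumes "fp l"
  shows "fp (\<lambda>x. List.enumerate 0 (l x))"
proof -
  have "fp (\<lambda>x. foldl ((\<lambda>e a y. a @ [(length a, y)]) ([] :: bool list)) [] (l x))"
  proof -
    obtain k where k: "\<And>x n. sz x \<le> n \<Longrightarrow> sz (l x) \<le> (n + 2) ^ k" using fp_sz[OF assms] by metis
    show ?thesis
    proof (rule fp_foldl[where h = "\<lambda>n. 1 + (n + 2) ^ k * (5 * (n + 2) ^ k + 3)"])
      fix x n assume n: "n \<le> length (l x)"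
      have "sz (List.enumerate 0 (take n (l x))) \<le> 1 + length (List.enumerate 0 (take n (l x))) * ((5 * (sz x + 2) ^ k + 2) + 1)"
      proof (rule sz_list_le)
        fix y assume "y \<in> set (List.enumerate 0 (take n (l x)))"
        then have "fst y < length (take n (l x))" "snd y = take n (l x) ! fst y"
          unfolding in_set_enumerate_eq by auto
        then obtain i z where y: "y = (i, z)" "i < n" "z \<in> set (take n (l x))"
          by (cases y) (metis fst_conv length_take min_less_iff_conj nth_mem snd_conv)
        have "i \<le> (sz x + 2) ^ k" "sz z \<le> (sz x + 2) ^ k"
          using y n length_le_sz[of "l x"] k[of x "sz x"] sz_elem[of z "l x"] in_set_takeD[OF y(3)] by auto
        then show "sz y \<le> 5 * (sz x + 2) ^ k + 2"
          using y(1) sz_nat_le[of i] by simp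
      qed
      also have "\<dots> \<le> 1 + (sz x + 2) ^ k * (5 * (sz x + 2) ^ k + 3)"
      proof -
        have "length (List.enumerate 0 (take n (l x))) \<le> (sz x + 2) ^ k"
          using n length_le_sz[of "l x"] k[of x "sz x"] by simp
        then show ?thesis by (intro add_left_mono mult_mono) auto
      qed
      finally show "sz (foldl (\<lambda>a y. a @ [(length a, y)]) [] (take n (l x))) \<le> 1 + (sz x + 2) ^ k * (5 * (sz x + 2) ^ k + 3)"
        by (simp only: enumerate_foldl)
    qed (intro fp_intros pbd_intros assms)+
  qed
  then show ?thesis by (simp add: enumerate_foldl)
qed

lemma fp_upt_length [fp_intros]:
  assumes "fp l"
  shows "fp (\<lambda>x. [0..<length (l x)])"
proof -
  have "fp (\<lambda>x. map (\<lambda>p. fst p) (List.enumerate 0 (l x)))" by (intro fp_intros assms)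
  then show ?thesis by (simp add: enumerate_eq_zip)
qed

text \<open>Compares from the least significant bit on: \<open>r\<close> is the verdict of the lower
  bits, overruled wherever the bits differ. A nonempty rest of \<open>bs\<close> means a larger
  number because the most significant bit in \<open>bits_of_nat\<close> is never 0.\<close>

fun bits_le :: "bool \<Rightarrow> bool list \<Rightarrow> bool list \<Rightarrow> bool" where
  "bits_le r [] bs = (r \<or> bs \<noteq> [])"
| "bits_le r (a # as) bs = bits_le (if a = (case bs of [] \<Rightarrow> False | b # _ \<Rightarrow> b) then r else \<not> a) as (case bs of [] \<Rightarrow> [] | _ # bs' \<Rightarrow> bs')"

lemma bits_le_nat: "bits_le r (bits_of_nat m) (bits_of_nat n) \<longleftrightarrow> (if r then m \<le> n else m < n)"
proof (induction m arbitrary: n r rule: less_induct)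
  case (less m)
  have e0: "bits_of_nat n = [] \<longleftrightarrow> n = 0" by (subst bits_of_nat.simps) simp
  show ?case
  proof (cases "m = 0")
    case True
    then show ?thesis using e0 by auto
  next
    case False
    have m: "bits_of_nat m = odd m # bits_of_nat (m div 2)"
      using False by (subst bits_of_nat.simps) simp
    have n: "(case bits_of_nat n of [] \<Rightarrow> False | b # _ \<Rightarrow> b) = odd n"
      "(case bits_of_nat n of [] \<Rightarrow> [] | _ # bs' \<Rightarrow> bs') = bits_of_nat (n div 2)"
      by (cases "n = 0"; simp; subst bits_of_nat.simps; simp)+
    have "m = 2 * (m div 2) + (if odd m then 1 else 0)" "n = 2 * (n div 2) + (if odd n then 1 else 0)"
      by simp_all
    then show ?thesis
      using less[of "m div 2" "if odd m = odd n then r else even m" "n div 2"] False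
      unfolding m bits_le.simps n
      by (cases "odd m"; cases "odd n"; cases r; simp; (linarith | presburger)?)
  qed
qed

lemma bits_le_foldl:
  "bits_le r as bs = (let s = foldl (\<lambda>s a. (if a = (case snd s of [] \<Rightarrow> False | b # _ \<Rightarrow> b) then fst s else \<not> a,
     case snd s of [] \<Rightarrow> [] | _ # bs' \<Rightarrow> bs')) (r, bs) as in fst s \<or> snd s \<noteq> [])"
  by (induction r as bs rule: bits_le.induct) (auto simp: Let_def)

lemma fp_le_nat [fp_intros]:
  assumes "fp f" "fp g"
  shows "fp (\<lambda>x. f x \<le> (g x :: nat))"
proof -
  let ?step = "\<lambda>s a. (if a = (case snd s of [] \<Rightarrow> False | b # _ \<Rightarrow> b) then fst s else \<not> a,
     case snd s of [] \<Rightarrow> [] | _ # bs' \<Rightarrow> bs')"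
  have "fp (\<lambda>x. foldl ((\<lambda>e :: bool list. ?step) []) (True, bits_of_nat (g x)) (bits_of_nat (f x)))"
    by (rule fp_foldl_add[where k = 2]) ((intro fp_intros assms)+, auto simp: power2_eq_square split: list.splits
      intro!: add_mono trans_le_add1 sz_bool trans_le_add2)
  then have "fp (\<lambda>x. bits_le True (bits_of_nat (f x)) (bits_of_nat (g x)))"
    unfolding bits_le_foldl Let_def by (intro fp_intros)
  then show ?thesis by (simp add: bits_le_nat)
qed

lemma fp_less_nat [fp_intros]: "fp f \<Longrightarrow> fp g \<Longrightarrow> fp (\<lambda>x. f x < (g x :: nat))"
  unfolding Suc_le_eq[symmetric] by (intro fp_intros)

section \<open>Casts and raw words\<close>

lemma fp_spine0:
  fixes sp :: "tree \<Rightarrow> tree list"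
  assumes "\<And>t. tr (sp t) = t"
  shows "fp sp"
  by (rule fp_code_cong[where g = "\<lambda>t :: tree. t" and i = "\<lambda>t. t"]) (auto intro: fp_id simp: assms)

text \<open>Any tree is read as the list with the same code, so the conversion is free.\<close>

fun spine :: "tree \<Rightarrow> tree list" where
  "spine Leaf = []"
| "spine (Node l r) = l # spine r"

lemma tr_spine: "tr (spine t) = t"
  by (induction t) auto

lemma fp_tr [fp_intros]: "fp f \<Longrightarrow> fp (\<lambda>x. tr (f x))"
  by (rule fp_code_cong[where g = f and i = "\<lambda>x. x"]) auto

text \<open>This and the following casts are left inverses of \<open>tr\<close> that are total on
  trees: a certificate is an arbitrary tree that a verifier has to read as data. Ill-formed trees
  get some value.\<close>

definition cast_bool :: "tree \<Rightarrow> bool" where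
  "cast_bool t = (t \<noteq> Leaf)"

definition cast_prod :: "(tree \<Rightarrow> 'a) \<Rightarrow> (tree \<Rightarrow> 'b) \<Rightarrow> tree \<Rightarrow> 'a \<times> 'b" where
  "cast_prod c d t = (case t of Leaf \<Rightarrow> (c Leaf, d Leaf) | Node l r \<Rightarrow> (c l, d r))"

definition cast_list :: "(tree \<Rightarrow> 'a) \<Rightarrow> tree \<Rightarrow> 'a list" where
  "cast_list c t = map c (spine t)"

definition nat_of_bits :: "bool list \<Rightarrow> nat" where
  "nat_of_bits bs = foldr (\<lambda>b n. (if b then 1 else 0) + 2 * n) bs 0"

text \<open>Bits taken from an arbitrary tree may have zeros at the most significant end, which
  never happens in \<open>bits_of_nat\<close>; without them the list is the code of its
  number.\<close>

definition strip_bits :: "bool list \<Rightarrow> bool list" where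
  "strip_bits bs = foldr (\<lambda>b r. if b \<or> r \<noteq> [] then b # r else []) bs []"

lemma bits_of_nat_of_bits: "bits_of_nat (nat_of_bits bs) = strip_bits bs"
proof (induction bs)
  case (Cons b bs)
  have "bits_of_nat ((if b then 1 else 0) + 2 * n) =
    (if b \<or> n \<noteq> 0 then b # bits_of_nat n else [])" for n
    by (subst bits_of_nat.simps) auto
  note 1 = this[of "nat_of_bits bs"]
  have "bits_of_nat n = [] \<longleftrightarrow> n = 0" for n by (subst bits_of_nat.simps) simp
  note 2 = this[of "nat_of_bits bs"]
  have "nat_of_bits (b # bs) = (if b then 1 else 0) + 2 * nat_of_bits bs"
    "strip_bits (b # bs) = (if b \<or> strip_bits bs \<noteq> [] then b # strip_bits bs else [])"
    by (simp_all add: nat_of_bits_def strip_bits_def)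
  then show ?case using 1 2 Cons by simp
qed (simp add: nat_of_bits_def strip_bits_def)

lemma nat_of_bits_of_nat: "nat_of_bits (bits_of_nat n) = n"
proof (rule inj_bits_of_nat, unfold bits_of_nat_of_bits)
  show "strip_bits (bits_of_nat n) = bits_of_nat n"
  proof (induction n rule: less_induct)
    case (less n)
    have e: "bits_of_nat n = [] \<longleftrightarrow> n = 0" for n by (subst bits_of_nat.simps) simp
    show ?case
    proof (cases "n = 0")
      case False
      then have "bits_of_nat n = odd n # bits_of_nat (n div 2)" by (subst bits_of_nat.simps) simp
      moreover have "odd n \<or> n div 2 \<noteq> 0" using False by presburger
      ultimately show ?thesis using less[of "n div 2"] False e[of "n div 2"] by (auto simp: strip_bits_def)
    qed (simp add: strip_bits_def)
  qed
qed

definition cast_nat :: "tree \<Rightarrow> nat" where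
  "cast_nat t = nat_of_bits (cast_list cast_bool t)"

lemma cast_bool_tr: "cast_bool (tr b) = b"
  by (simp add: cast_bool_def tr_bool_def)

lemma cast_prod_tr:
  assumes "\<And>x. c (tr x) = x" "\<And>y. d (tr y) = y"
  shows "cast_prod c d (tr p) = p"
  by (cases p) (simp add: cast_prod_def tr_prod_def assms)

lemma cast_list_tr:
  assumes "\<And>x. c (tr x) = x"
  shows "cast_list c (tr xs) = xs"
  unfolding cast_list_def by (induction xs) (simp_all add: assms)

lemma cast_nat_tr: "cast_nat (tr n) = n"
  by (simp add: cast_nat_def tr_nat_def cast_list_tr cast_bool_tr nat_of_bits_of_nat)

lemma fp_cast_bool [fp_intros]: "fp cast_bool"
  unfolding cast_bool_def by (intro fp_intros)

lemma fp_cast_prod [fp_intros]: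
  assumes "fp c" "fp d"
  shows "fp (cast_prod c d)"
  unfolding cast_prod_def
  by (intro fp_intros fp_comp[OF assms(1)] fp_comp[OF assms(2)])

lemma fp_cast_list [fp_intros]:
  assumes "fp c"
  shows "fp (cast_list c)"
  unfolding cast_list_def
  by (intro fp_map fp_comp[OF assms] fp_snd fp_id fp_spine0 tr_spine)

lemma fp_nat_of_bits [fp_intros]:
  assumes "fp f"
  shows "fp (\<lambda>x. nat_of_bits (f x))"
proof (rule fp_of_bits)
  have "sz (strip_bits bs) \<le> sz bs" for bs
    by (induction bs) (auto simp: strip_bits_def)
  then have s: "sz (strip_bits bs) \<le> m + sz bs" for bs m by (meson le_add2 le_trans)
  show "fp (\<lambda>x. bits_of_nat (nat_of_bits (f x)))"
    unfolding bits_of_nat_of_bits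
    by (rule fp_listrec[where F = "\<lambda>e :: bool list. strip_bits" and a = "\<lambda>e. []" and
        g = "\<lambda>e y ys r. if y \<or> r \<noteq> [] then y # r else []" and h = "\<lambda>n. n" and e = "\<lambda>_. []"])
     (intro fp_intros pbd_intros assms s | simp add: strip_bits_def)+
qed

lemma fp_cast_nat [fp_intros]: "fp cast_nat"
  unfolding cast_nat_def by (intro fp_intros)

definition tree_bits :: "tree \<Rightarrow> bool list" where
  "tree_bits t = map (\<lambda>a. a = 2) (tcode t)"

text \<open>Preorder read from the right is postfix notation with the left subtree on top of the
  stack. An ill-formed word does no harm: it yields just some list of trees.\<close>

definition parse_step :: "tree list \<Rightarrow> bool \<Rightarrow> tree list" where
  "parse_step st b = (if b then case st of [] \<Rightarrow> [] | l # st' \<Rightarrow>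
     (case st' of [] \<Rightarrow> [] | r # st'' \<Rightarrow> Node l r # st'') else Leaf # st)"

definition parse_trees :: "bool list \<Rightarrow> tree list" where
  "parse_trees bs = foldl parse_step [] (rev bs)"

lemma parse_trees_tree_bits: "parse_trees (tree_bits t) = [t]"
proof -
  have "foldl parse_step st (rev (tree_bits t)) = t # st" for st
    by (induction t arbitrary: st) (auto simp: tree_bits_def parse_step_def rev_map[symmetric])
  then show ?thesis by (simp add: parse_trees_def)
qed

lemma sz_Node [simp]: "sz (Node l r) = 1 + sz l + sz r" "sz Leaf = 1"
  by (simp_all add: sz_def dcode_def)

lemma fp_Node [fp_intros]: "fp f \<Longrightarrow> fp g \<Longrightarrow> fp (\<lambda>x. Node (f x) (g x))"
  by (rule fp_code_cong[of "\<lambda>x. (f x, g x)" "\<lambda>x. x"]) (auto intro: fp_Pair simp: tr_prod_def)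

lemma fp_parse_trees [fp_intros]:
  assumes "fp f"
  shows "fp (\<lambda>x. parse_trees (f x))"
proof -
  have s: "fp (\<lambda>p. parse_step (fst (snd p)) (snd (snd (p :: bool list \<times> _))))"
    unfolding parse_step_def by (intro fp_intros)
  have "fp (\<lambda>x. foldl parse_step [] (rev (f x)))"
    by (rule fp_foldl_add[where k = 2 and e = "\<lambda>_. [] :: bool list" and g = "\<lambda>e. parse_step", OF s])
      (intro fp_intros assms | auto simp: parse_step_def power2_eq_square split: list.splits)+
  then show ?thesis by (simp add: parse_trees_def)
qed

section \<open>Words on the input and output tapes\<close>

definition read_word :: com where
  "read_word = (move_all 0 2 ;; Push 0 1 ;; While_top 2 {1, 2} (If_top 2 {2}
     (Pop 2 ;; Push 0 1 ;; Push 0 1 ;; Push 0 2 ;; Push 0 2) (Pop 2 ;; Push 0 1 ;; Push 0 2)))"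

definition write_word :: com where
  "write_word = While_top 0 {2} (Pop 0 ;; If_top 0 {1} (Pop 0 ;; Out 1) (Pop 0 ;; Pop 0 ;; Pop 0 ;; Out 2))"

text \<open>The code of a list is built from its end, so the word is first reversed onto stack 2.
  The initial 1 is the empty list, and each bit gets its own code and one more 2 for the list
  cell.\<close>

lemma run_read_word:
  "run read_word (raw_stacks (map bit_symbol w)) (20 * length w + 3) (raw_stacks (dcode w))"
proof -
  let ?B = "If_top 2 {2} (Pop 2 ;; Push 0 1 ;; Push 0 1 ;; Push 0 2 ;; Push 0 2) (Pop 2 ;; Push 0 1 ;; Push 0 2)"
  let ?s = "\<lambda>xs ys. (raw_stacks (dcode ys))(2 := map bit_symbol xs)"
  have loop: "run (While_top 2 {1, 2} ?B) (?s xs ys) (9 * length xs + 1) (raw_stacks (dcode (rev xs @ ys)))"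
    for xs ys
  proof (induction xs arbitrary: ys)
    case Nil
    then show ?case by (auto intro!: run_WhileF' simp: fun_eq_iff)
  next
    case (Cons x xs)
    have "run ?B (?s (x # xs) ys) 7 (?s xs (x # ys))"
    proof (cases x)
      case True
      have "run (Pop 2 ;; Push 0 1 ;; Push 0 1 ;; Push 0 2 ;; Push 0 2) (?s (x # xs) ys) 5 (?s xs (x # ys))"
        by (rule run_Seq[OF run_Pop[OF order.refl refl] run_Seq[OF run_Push[OF order.refl refl]
              run_Seq[OF run_Push[OF order.refl refl] run_Seq[OF run_Push[OF order.refl refl]
              run_Push[OF order.refl] order.refl] order.refl] order.refl]])
          (use True in \<open>auto simp: fun_eq_iff dcode_bool raw_stacks_def\<close>)
      then show ?thesis by (rule run_IfT[rotated]) (use True in \<open>auto simp: bit_symbol_def\<close>)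
    next
      case False
      have "run (Pop 2 ;; Push 0 1 ;; Push 0 2) (?s (x # xs) ys) 3 (?s xs (x # ys))"
        by (rule run_Seq[OF run_Pop[OF order.refl refl] run_Seq[OF run_Push[OF order.refl refl]
              run_Push[OF order.refl] order.refl]])
          (use False in \<open>auto simp: fun_eq_iff dcode_bool raw_stacks_def\<close>)
      then show ?thesis by (rule run_IfF[rotated]) (use False in \<open>auto simp: bit_symbol_def\<close>)
    qed
    note body = this
    have "run (While_top 2 {1, 2} ?B) (?s (x # xs) ys) (9 * length (x # xs) + 1)
        (raw_stacks (dcode (rev xs @ x # ys)))"
      by (rule run_WhileT[OF _ body Cons.IH]) (auto simp: bit_symbol_def)
    moreover have "rev xs @ x # ys = rev (x # xs) @ ys" by simp
    ultimately show ?case by (simp only:)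
  qed
  have set: "set (map bit_symbol w) \<subseteq> {1, 2}" by (auto simp: bit_symbol_def)
  have 1: "run (move_all 0 2) (raw_stacks (map bit_symbol w)) (6 * length w + 1)
      ((raw_stacks [])(2 := rev (map bit_symbol w)))"
    by (rule run_move_all[OF _ set]) (auto simp: raw_stacks_def)
  have 2: "run (Push 0 1) ((raw_stacks [])(2 := rev (map bit_symbol w))) 1 (?s (rev w) [])"
    by (rule run_Push) (auto simp: fun_eq_iff rev_map raw_stacks_def)
  show ?thesis unfolding read_word_def
    by (rule run_Seq[OF 1 run_Seq[OF 2 loop[of "[]" "rev w", unfolded rev_rev_ident append_Nil2 length_rev] order.refl]]) simp
qed

lemma run_write_word:
  "\<exists>t. run write_word ((raw_stacks (dcode u))(1 := v)) (9 * length u + 1) t \<and> t 1 = v @ map bit_symbol u"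
proof (induction u arbitrary: v)
  case Nil
  show ?case unfolding write_word_def
    by (intro exI[of _ "(raw_stacks (dcode [] ))(1 := v)"] conjI run_WhileF') auto
next
  case (Cons x u)
  let ?s = "\<lambda>u v. (raw_stacks (dcode u))(1 := v)"
  let ?s1 = "(raw_stacks (dcode x @ dcode u))(1 := v)"
  let ?C = "If_top 0 {1} (Pop 0 ;; Out 1) (Pop 0 ;; Pop 0 ;; Pop 0 ;; Out 2)"
  have "run ?C ?s1 6 (?s u (v @ [bit_symbol x]))"
  proof (cases x)
    case False
    have "run (Pop 0 ;; Out 1) ?s1 2 (?s u (v @ [bit_symbol x]))"
      by (rule run_Seq[OF run_Pop[OF order.refl refl] run_Out[OF order.refl]])
        (use False in \<open>auto simp: fun_eq_iff dcode_bool bit_symbol_def raw_stacks_def\<close>)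
    then show ?thesis by (rule run_IfT[rotated]) (use False in \<open>auto simp: dcode_bool raw_stacks_def\<close>)
  next
    case True
    have "run (Pop 0 ;; Pop 0 ;; Pop 0 ;; Out 2) ?s1 4 (?s u (v @ [bit_symbol x]))"
      by (rule run_Seq[OF run_Pop[OF order.refl refl] run_Seq[OF run_Pop[OF order.refl refl]
            run_Seq[OF run_Pop[OF order.refl refl] run_Out[OF order.refl] order.refl] order.refl]])
        (use True in \<open>auto simp: fun_eq_iff dcode_bool bit_symbol_def raw_stacks_def\<close>)
    then show ?thesis by (rule run_IfF[rotated]) (use True in \<open>auto simp: dcode_bool raw_stacks_def\<close>)
  qed
  then have body: "run (Pop 0 ;; ?C) (?s (x # u) v) 7 (?s u (v @ [bit_symbol x]))"
    by (rule run_Seq[OF run_Pop[OF order.refl], rotated]) (auto simp: fun_eq_iff raw_stacks_def)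
  obtain t where t: "run write_word (?s u (v @ [bit_symbol x])) (9 * length u + 1) t"
    "t 1 = (v @ [bit_symbol x]) @ map bit_symbol u"
    using Cons.IH by blast
  have "run write_word (?s (x # u) v) (9 * length (x # u) + 1) t"
    unfolding write_word_def
    by (rule run_WhileT[OF _ body t(1)[unfolded write_word_def]]) (auto simp: raw_stacks_def)
  moreover have "t 1 = v @ map bit_symbol (x # u)" using t(2) by simp
  ultimately show ?case by blast
qed

definition word_machine :: "com \<Rightarrow> tm" where
  "word_machine c = com_machine (read_word ;; c ;; write_word)"

lemma wf_word_machine: "wf_com c \<Longrightarrow> wf_tm (word_machine c)"
  unfolding word_machine_def
  by (intro wf_com_machine) (simp add: read_word_def write_word_def move_all_def)

lemma word_machine_outputs:
  assumes "wf_com c" "tf c (dcode w) n (dcode u)" "2 * (20 * real (length w) + real n + 9 * real (length u) + 4) \<le> b"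
  shows "outputs_within (word_machine c) w u b"
proof -
  obtain t where t: "run write_word (raw_stacks (dcode u)) (9 * length u + 1) t" "t 1 = map bit_symbol u"
    using run_write_word[of u "[]"] by (auto simp: raw_stacks_def fun_upd_twist fun_upd_idem)
  have "run (read_word ;; c ;; write_word) (raw_stacks (map bit_symbol w))
      ((20 * length w + 3) + (n + (9 * length u + 1))) t"
    by (rule run_Seq[OF run_read_word run_Seq[OF assms(2)[unfolded tf_def] t(1) order.refl] order.refl])
  then obtain m where m: "m \<le> (20 * length w + 3) + (n + (9 * length u + 1))"
      "big (read_word ;; c ;; write_word) (raw_stacks (map bit_symbol w)) m t"
    unfolding run_def by blast
  have "real m \<le> real ((20 * length w + 3) + (n + (9 * length u + 1)))" using m(1) by (rule of_nat_mono)
  then have "2 * real m \<le> b" using assms(3) by simp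
  then show ?thesis unfolding word_machine_def
    using assms(1) by (intro com_machine_outputs[OF _ m(2) t(2)])
      (simp_all add: read_word_def write_word_def move_all_def)
qed

lemma sz_bool_list: "length w \<le> sz (w :: bool list) \<and> sz w \<le> 4 * length w + 1"
proof (induction w)
  case (Cons x w)
  then show ?case by (cases x) auto
qed simp

lemma pbd_poly:
  assumes "pbd h"
  obtains p :: "nat poly" where "\<And>n. h n \<le> poly p n"
proof -
  obtain k where "\<And>n. h n \<le> (n + 2) ^ k" using assms unfolding pbd_def by blast
  then show ?thesis by (intro that[of "[:2, 1:] ^ k"]) (simp add: poly_power add.commute)
qed

lemma pbd_of_poly: "pbd (poly (p :: nat poly))"
proof (induction p)
  case 0
  then show ?case using pbd_const[of 0] by simp
next
  case (pCons a p)
  then show ?case by (simp add: pbd_intros)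
qed

text \<open>The code of a word of length \<open>n\<close> has size at most \<open>4 * n + 1\<close>,
  which turns bounds in terms of \<open>sz\<close> into bounds in the length of the input.\<close>

lemma polytime_computable_fp:
  assumes "fp f"
  shows "polytime_computable f"
proof -
  obtain c k where c: "wf_com c"
    "\<And>x rest n. sz x \<le> n \<Longrightarrow> tf c (dcode x @ rest) ((n + 2) ^ k) (dcode (f x) @ rest)"
    "\<And>x n. sz x \<le> n \<Longrightarrow> sz (f x) < (n + 2) ^ k"
    using fpE[OF assms] by blast
  have "pbd (\<lambda>n. 2 * (20 * n + (4 * n + 1 + 2) ^ k + 9 * (4 * n + 1 + 2) ^ k + 4))"
    by (intro pbd_intros)
  then obtain p :: "nat poly" where p: "\<And>n. 2 * (20 * n + (4 * n + 1 + 2) ^ k + 9 * (4 * n + 1 + 2) ^ k + 4) \<le> poly p n"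
    by (rule pbd_poly) blast
  show ?thesis unfolding polytime_computable_def
  proof (intro exI conjI allI)
    show "wf_tm (word_machine c)" by (rule wf_word_machine[OF c(1)])
    fix w :: "bool list"
    have s: "sz w \<le> 4 * length w + 1" using sz_bool_list by blast
    have l: "length (f w) \<le> (4 * length w + 1 + 2) ^ k"
      using c(3)[OF s] sz_bool_list[of "f w"] by linarith
    have "2 * (20 * length w + (4 * length w + 1 + 2) ^ k + 9 * length (f w) + 4) \<le> poly p (length w)"
      using l by (intro order.trans[OF _ p[of "length w"]]) simp
    then have "real (2 * (20 * length w + (4 * length w + 1 + 2) ^ k + 9 * length (f w) + 4)) \<le> real (poly p (length w))"
      by (rule of_nat_mono)
    then show "outputs_within (word_machine c) w (f w) (real (poly p (length w)))"
      by (intro word_machine_outputs[OF c(1) c(2)[OF s, of "[]", simplified append_Nil2]]) simp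
  qed
qed

lemma class_P_fp: "fp (\<lambda>w. w \<in> L) \<Longrightarrow> L \<in> class_P"
  unfolding class_P_def by (auto intro!: polytime_computable_fp fp_intros)

text \<open>Scanner for \<open>bit_pair\<close>: state 0 expects a mark, state 1 a bit of the first
  word, and state 2 copies the second word.\<close>

definition unpair_step :: "nat \<times> bool list \<times> bool list \<Rightarrow> bool \<Rightarrow> nat \<times> bool list \<times> bool list" where
  "unpair_step s b = (if fst s = 0 then (if b then 1 else 2, snd s)
     else if fst s = 1 then (0, fst (snd s) @ [b], snd (snd s)) else (2, fst (snd s), snd (snd s) @ [b]))"

lemma unpair_bit_pair: "foldl unpair_step (0, [], []) (bit_pair x y) = (2, x, y)"
proof -
  have 2: "foldl unpair_step (2, u, v) y = (2, u, v @ y)" for u v y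
    by (induction y arbitrary: v) (auto simp: unpair_step_def)
  have "foldl unpair_step (0, u, []) (bit_pair x y) = (2, u @ x, y)" for u
    by (induction x arbitrary: u) (auto simp: bit_pair_def unpair_step_def 2)
  then show ?thesis by simp
qed

text \<open>Certificates are trees instead of words. The verifier splits and parses its input and
  keeps the first tree that it finds, so \<open>sound\<close> has to cope with all trees.\<close>

lemma class_NP_fp:
  assumes V: "fp (\<lambda>p. V (fst p) (snd p))" and h: "pbd h"
    and sound: "\<And>x t. V x t \<Longrightarrow> x \<in> L"
    and complete: "\<And>x. x \<in> L \<Longrightarrow> \<exists>t. length (tcode t) \<le> h (length x) \<and> V x t"
  shows "L \<in> class_NP"
proof -
  define D where "D w \<longleftrightarrow> (case parse_trees (snd (snd (foldl unpair_step (0, [], []) w))) of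
    [] \<Rightarrow> False | t # _ \<Rightarrow> V (fst (snd (foldl unpair_step (0, [], []) w))) t)" for w
  have "fp (\<lambda>p. unpair_step (fst (snd p)) (snd (snd (p :: bool list \<times> _))))"
    unfolding unpair_step_def by (intro fp_intros)
  note u = this
  have "sz (unpair_step a b) \<le> sz a + (sz (e :: bool list) + sz b + 2) ^ 5" for a b e
  proof -
    have s: "sz (1 :: nat) \<le> 5" "sz (2 :: nat) \<le> 9" using sz_nat_le[of 1] sz_nat_le[of 2] by simp_all
    have "2 ^ 5 \<le> (sz e + sz b + 2) ^ 5" by (rule power_mono) auto
    then have p: "20 \<le> (sz e + sz b + 2) ^ 5" by (rule order.trans[rotated]) simp
    have "sz (unpair_step a b) \<le> sz a + 20"
      using s sz_append[of "fst (snd a)" "[b]"] sz_append[of "snd (snd a)" "[b]"] sz_bool[of b]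
      by (cases a) (auto simp: unpair_step_def)
    also have "\<dots> \<le> sz a + (sz e + sz b + 2) ^ 5" using p by (rule add_left_mono)
    finally show ?thesis .
  qed
  then have "fp (\<lambda>w. foldl unpair_step (0, [], []) w)"
    by (intro fp_foldl_add[where k = 5 and e = "\<lambda>_. [] :: bool list" and g = "\<lambda>e. unpair_step", OF u] fp_intros)
  note f = this
  have D: "fp D"
    unfolding D_def by (intro fp_intros fp_comp2[OF V] fp_comp[OF f])
  obtain p where p: "\<And>n. h n \<le> poly p n" using pbd_poly[OF h] by blast
  show ?thesis unfolding class_NP_def
  proof (intro CollectI bexI exI allI)
    show "{w. D w} \<in> class_P" using D by (intro class_P_fp) simp
    fix x
    show "x \<in> L \<longleftrightarrow> (\<exists>y. length y \<le> poly p (length x) \<and> bit_pair x y \<in> {w. D w})"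
    proof
      assume "x \<in> L"
      then obtain t where t: "length (tcode t) \<le> h (length x)" "V x t" using complete by blast
      then have "length (tree_bits t) \<le> poly p (length x)"
        using p[of "length x"] by (simp add: tree_bits_def)
      moreover have "D (bit_pair x (tree_bits t))"
        using t(2) by (simp add: D_def unpair_bit_pair parse_trees_tree_bits)
      ultimately show "\<exists>y. length y \<le> poly p (length x) \<and> bit_pair x y \<in> {w. D w}" by blast
    next
      assume "\<exists>y. length y \<le> poly p (length x) \<and> bit_pair x y \<in> {w. D w}"
      then obtain y where "D (bit_pair x y)" by blast
      then obtain t where "V x t" by (auto simp: D_def unpair_bit_pair split: list.splits)
      then show "x \<in> L" by (rule sound)
    qed
  qed
qed

section \<open>Branchings as sets of temporal edges\<close>

text \<open>\<open>E\<close> consists of the items that one more step appends to a walk: waiting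
  adds only a vertex, while an edge is recorded before its end.\<close>

definition walk_ext :: "'v tdigraph \<Rightarrow> 'v \<times> nat \<Rightarrow> 'v \<times> nat \<Rightarrow> 'v titem list \<Rightarrow> bool" where
  "walk_ext B p q E \<longleftrightarrow> p \<in> tverts B \<and> q \<in> tverts B \<and>
     ((\<exists>v t. p = (v, t) \<and> q = (v, t + 1) \<and> E = [TV q]) \<or> ((p, q) \<in> tedges B \<and> E = [TE p q, TV q]))"

lemma twalk_Suc:
  "(v, t) \<in> tverts B \<Longrightarrow> twalk B (TV (v, Suc t) # W) \<Longrightarrow> twalk B (TV (v, t) # TV (v, Suc t) # W)"
  using twalk.wait[of v t B W] by simp

lemma twalk_nonempty: "twalk B W \<Longrightarrow> W \<noteq> []"
  by (cases rule: twalk.cases) auto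

lemma twalk_last: "twalk B W \<Longrightarrow> \<exists>p\<in>tverts B. last W = TV p"
  by (induction rule: twalk.induct) auto

lemma twalk_ext: "twalk B W \<Longrightarrow> last W = TV p \<Longrightarrow> walk_ext B p q E \<Longrightarrow> twalk B (W @ E)"
proof (induction rule: twalk.induct)
  case (single p')
  then show ?case by (auto simp: walk_ext_def intro: twalk.intros twalk_Suc)
next
  case (wait v t W)
  then have "twalk B (TV (v, t + 1) # W @ E)" by simp
  then show ?case using wait.hyps twalk.wait by fastforce
next
  case (edge p' q' W)
  then have "twalk B (TV q' # W @ E)" by simp
  then show ?case using edge.hyps twalk.edge by fastforce
qed

text \<open>Walks are built from the front, but the arguments about unique walks remove the last
  step.\<close>

lemma twalk_snoc_cases:
  assumes "twalk B W"
  shows "(\<exists>p. W = [TV p]) \<or> (\<exists>W' p q E. W = W' @ E \<and> twalk B W' \<and> last W' = TV p \<and> walk_ext B p q E)"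
  using assms
proof (induction rule: twalk.induct)
  case (single p)
  then show ?case by blast
next
  case (wait v t W)
  have "(v, t + 1) \<in> tverts B" using wait.hyps(2) by (cases rule: twalk.cases) auto
  show ?case using wait.IH
  proof (elim disjE exE conjE)
    fix p assume "TV (v, t + 1) # W = [TV p]"
    then have "TV (v, t) # TV (v, t + 1) # W = [TV (v, t)] @ [TV (v, t + 1)]" by simp
    moreover have "walk_ext B (v, t) (v, t + 1) [TV (v, t + 1)]"
      using wait.hyps(1) \<open>(v, t + 1) \<in> tverts B\<close> by (simp add: walk_ext_def)
    moreover have "twalk B [TV (v, t)]" using wait.hyps(1) by (rule twalk.single)
    moreover have "last [TV (v, t)] = TV (v, t)" by simp
    ultimately show ?thesis by blast
  next
    fix W' p q E assume *: "TV (v, t + 1) # W = W' @ E" "twalk B W'" "last W' = TV p" "walk_ext B p q E"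
    then obtain W'' where W'': "W' = TV (v, t + 1) # W''" using twalk_nonempty[of B W'] by (cases W') auto
    have "twalk B (TV (v, t) # W')" using wait.hyps(1) * W'' by (auto intro: twalk_Suc)
    moreover have "last (TV (v, t) # W') = TV p" using * W'' by simp
    moreover have "TV (v, t) # TV (v, t + 1) # W = (TV (v, t) # W') @ E" using * by simp
    ultimately show ?thesis using *(4) by blast
  qed
next
  case (edge p0 q0 W)
  have "q0 \<in> tverts B" using edge.hyps(3) by (cases rule: twalk.cases) auto
  show ?case using edge.IH
  proof (elim disjE exE conjE)
    fix p assume "TV q0 # W = [TV p]"
    then have "TV p0 # TE p0 q0 # TV q0 # W = [TV p0] @ [TE p0 q0, TV q0]" by simp
    moreover have "walk_ext B p0 q0 [TE p0 q0, TV q0]"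
      using edge.hyps \<open>q0 \<in> tverts B\<close> by (simp add: walk_ext_def)
    moreover have "twalk B [TV p0]" using edge.hyps(1) by (rule twalk.single)
    moreover have "last [TV p0] = TV p0" by simp
    ultimately show ?thesis by blast
  next
    fix W' p q E assume *: "TV q0 # W = W' @ E" "twalk B W'" "last W' = TV p" "walk_ext B p q E"
    then obtain W'' where W'': "W' = TV q0 # W''" using twalk_nonempty[of B W'] by (cases W') auto
    have "twalk B (TV p0 # TE p0 q0 # W')" using edge.hyps * W'' by (auto intro: twalk.edge)
    moreover have "last (TV p0 # TE p0 q0 # W') = TV p" using * W'' by simp
    moreover have "TV p0 # TE p0 q0 # TV q0 # W = (TV p0 # TE p0 q0 # W') @ E" using * by simp
    ultimately show ?thesis using *(4) by blast
  qed
qed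

lemma walk_ext_last: "walk_ext B p q E \<Longrightarrow> E \<noteq> [] \<and> last E = TV q"
  by (auto simp: walk_ext_def)

text \<open>Both shorter walks end in a vertex, so the item before the last one tells whether the
  last step was a wait or an edge.\<close>

lemma walk_ext_unique:
  assumes "W @ E = W' @ E'" "last W = TV p" "last W' = TV p'" "W \<noteq> []" "W' \<noteq> []"
    "walk_ext B p q E" "walk_ext B p' q' E'"
  shows "W = W' \<and> E = E' \<and> p = p' \<and> q = q'"
proof -
  have l: "last (W @ E) = TV q" "last (W' @ E') = TV q'"
    using walk_ext_last[OF assms(6)] walk_ext_last[OF assms(7)] by auto
  then have q: "q = q'" using assms(1) by simp
  have "length E = length E'"
  proof (rule ccontr)
    assume "length E \<noteq> length E'"
    then consider "E = [TV q]" "E' = [TE p' q', TV q']" | "E' = [TV q']" "E = [TE p q, TV q]"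
      using assms(6,7) by (auto simp: walk_ext_def)
    then show False
    proof cases
      case 1
      then have "W = W' @ [TE p' q']" using assms(1) q by simp
      then show False using assms(2) by simp
    next
      case 2
      then have "W' = W @ [TE p q]" using assms(1) q by simp
      then show False using assms(3) by simp
    qed
  qed
  then have "W = W' \<and> E = E'" using assms(1) by simp
  then show ?thesis using q assms(2,3) by simp
qed

section \<open>Spanning branchings in terms of in-degrees\<close>

definition wait_in :: "'v tdigraph \<Rightarrow> 'v \<times> nat \<Rightarrow> bool" where
  "wait_in D p \<longleftrightarrow> (\<exists>v t. p = (v, Suc t) \<and> (v, t) \<in> tverts D)"

text \<open>A spanning branching contains every temporal vertex and thus every possible wait. A
  vertex that is entered by a wait can neither be a root nor be entered by an edge. A root is the
  end of the walk without steps and must not be entered at all. Unique predecessors alone would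
  admit cycles within a snapshot that no root reaches; \<open>rank\<close> excludes them.\<close>

definition good_edges ::
    "'v tdigraph \<Rightarrow> ('v \<times> nat) set \<Rightarrow> (('v \<times> nat) \<times> ('v \<times> nat)) set \<Rightarrow> bool" where
  "good_edges D R S \<longleftrightarrow> S \<subseteq> tedges D \<and>
     (\<forall>p\<in>tverts D. if p \<in> R then \<not> wait_in D p \<and> (\<forall>q. (q, p) \<notin> S)
       else if wait_in D p then \<forall>q. (q, p) \<notin> S else \<exists>!q. (q, p) \<in> S) \<and>
     (\<exists>rank :: 'v \<times> nat \<Rightarrow> nat. (\<forall>(q, p)\<in>S. rank q < rank p) \<and>
       (\<forall>v t. (v, t) \<in> tverts D \<longrightarrow> (v, Suc t) \<in> tverts D \<longrightarrow> rank (v, t) < rank (v, Suc t)))"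

definition edge_arcs :: "(('v \<times> nat) \<times> ('v \<times> nat)) set \<Rightarrow> ('v \<times> 'v) set" where
  "edge_arcs S = (\<lambda>(p, q). (fst p, fst q)) ` S"

lemma tedges_tverts:
  assumes "temporal_digraph D" "(p, q) \<in> tedges D"
  shows "p \<in> tverts D" "q \<in> tverts D"
proof -
  obtain u t v t' where pq: "p = (u, t)" "q = (v, t')" "(u, v) \<in> parcs (base D)" "(t, t') \<in> link D (u, v)"
    using assms(2) by (auto simp: tedges_def)
  interpret pair_fin_digraph "base D" using assms(1) by (simp add: temporal_digraph_def)
  have "u \<in> pverts (base D)" "v \<in> pverts (base D)" using pq(3) by (auto dest: in_arcsD1 in_arcsD2)
  moreover have "t \<in> act D u" "t' \<in> act D v"
    using assms(1) pq(3,4) unfolding temporal_digraph_def by blast+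
  ultimately show "p \<in> tverts D" "q \<in> tverts D" by (auto simp: tverts_def pq)
qed

lemma walk_ext_iff:
  assumes "temporal_digraph D"
  shows "walk_ext D q p E \<longleftrightarrow> p \<in> tverts D \<and> q \<in> tverts D \<and>
    ((p = (fst q, Suc (snd q)) \<and> E = [TV p]) \<or> ((q, p) \<in> tedges D \<and> E = [TE q p, TV p]))"
  by (cases p; cases q) (auto simp: walk_ext_def)

lemma wait_in_iff: "wait_in D p \<longleftrightarrow> (\<exists>q\<in>tverts D. p = (fst q, Suc (snd q)))"
  by (force simp: wait_in_def)

text \<open>Induction on the rank: a non-root admits exactly one last step, and the walk to the
  vertex before it is unique.\<close>

lemma good_edges_walks:
  assumes D: "temporal_digraph B" and R: "R \<subseteq> tverts B"
    and good: "good_edges B R (tedges B)" and p: "p \<in> tverts B"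
  shows "\<exists>!W. twalk B W \<and> (\<exists>r\<in>R. hd W = TV r) \<and> last W = TV p"
proof -
  obtain rank :: "'a \<times> nat \<Rightarrow> nat" where rank: "\<And>q p. (q, p) \<in> tedges B \<Longrightarrow> rank q < rank p"
    "\<And>v t. (v, t) \<in> tverts B \<Longrightarrow> (v, Suc t) \<in> tverts B \<Longrightarrow> rank (v, t) < rank (v, Suc t)"
    using good unfolding good_edges_def by blast
  have rk: "rank q < rank p" if "walk_ext B q p E" for q p E
    using that rank by (cases q; cases p) (auto simp: walk_ext_iff[OF D])
  have G: "if p \<in> R then \<not> wait_in B p \<and> (\<forall>q. (q, p) \<notin> tedges B)
       else if wait_in B p then \<forall>q. (q, p) \<notin> tedges B else \<exists>!q. (q, p) \<in> tedges B"
    if "p \<in> tverts B" for p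
    using good that unfolding good_edges_def by (elim conjE bspec)
  have inR: "\<not> walk_ext B q p E" if "p \<in> R" for q p E
  proof
    assume e: "walk_ext B q p E"
    then have "p \<in> tverts B" by (simp add: walk_ext_def)
    then show False using G[of p] that e unfolding walk_ext_iff[OF D] wait_in_iff by (cases q) auto
  qed
  have notR: "\<exists>q E. walk_ext B q p E \<and> (\<forall>q' E'. walk_ext B q' p E' \<longrightarrow> q' = q \<and> E' = E)"
    if pR: "p \<notin> R" and pt: "p \<in> tverts B" for p
  proof (cases "wait_in B p")
    case True
    then obtain v t where q: "(v, t) \<in> tverts B" "p = (v, Suc t)" unfolding wait_in_def by blast
    have "\<forall>q. (q, p) \<notin> tedges B" using G[OF pt] pR True by simp
    then show ?thesis using q pR pt
      by (intro exI[of _ "(v, t)"] exI[of _ "[TV p]"]) (auto simp: walk_ext_iff[OF D])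
  next
    case False
    then have "\<exists>!q. (q, p) \<in> tedges B" using G[OF pt] pR by simp
    then obtain q where q: "(q, p) \<in> tedges B" "\<And>q'. (q', p) \<in> tedges B \<Longrightarrow> q' = q"
      by (elim ex1E) blast
    show ?thesis
    proof (intro exI conjI allI impI)
      show "walk_ext B q p [TE q p, TV p]"
        using q(1) tedges_tverts[OF D q(1)] by (simp add: walk_ext_iff[OF D])
      fix q' E' assume "walk_ext B q' p E'"
      then have "(q', p) \<in> tedges B \<and> E' = [TE q' p, TV p]"
        using False unfolding walk_ext_iff[OF D] wait_in_iff by blast
      then show "q' = q" "E' = [TE q p, TV p]" using q(2) by blast+
    qed
  qed
  show ?thesis using p
  proof (induction "rank p" arbitrary: p rule: less_induct)
    case less
    show ?case
    proof (cases "p \<in> R")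
      case True
      show ?thesis
      proof (rule ex1I)
        show "twalk B [TV p] \<and> (\<exists>r\<in>R. hd [TV p] = TV r) \<and> last [TV p] = TV p"
          using True less.prems by (auto intro: twalk.single)
        fix W assume W: "twalk B W \<and> (\<exists>r\<in>R. hd W = TV r) \<and> last W = TV p"
        show "W = [TV p]"
          using twalk_snoc_cases[OF conjunct1[OF W]]
        proof (elim disjE exE conjE)
          fix V p' q E assume *: "W = V @ E" "walk_ext B p' q E"
          then have "q = p" using W walk_ext_last[OF *(2)] by simp
          then show ?thesis using inR[OF True] *(2) by blast
        qed (use W in auto)
      qed
    next
      case False
      obtain q E where q: "walk_ext B q p E" "\<And>q' E'. walk_ext B q' p E' \<Longrightarrow> q' = q \<and> E' = E"
        using notR[OF False less.prems] by blast
      have "q \<in> tverts B" using q(1) by (simp add: walk_ext_def)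
      then obtain W where W: "twalk B W" "\<exists>r\<in>R. hd W = TV r" "last W = TV q"
        "\<And>W'. twalk B W' \<Longrightarrow> (\<exists>r\<in>R. hd W' = TV r) \<Longrightarrow> last W' = TV q \<Longrightarrow> W' = W"
        using less.hyps[OF rk[OF q(1)]] by metis
      show ?thesis
      proof (rule ex1I)
        show "twalk B (W @ E) \<and> (\<exists>r\<in>R. hd (W @ E) = TV r) \<and> last (W @ E) = TV p"
          using twalk_ext[OF W(1,3) q(1)] W(2) twalk_nonempty[OF W(1)] walk_ext_last[OF q(1)] by auto
        fix V assume V: "twalk B V \<and> (\<exists>r\<in>R. hd V = TV r) \<and> last V = TV p"
        show "V = W @ E"
          using twalk_snoc_cases[OF conjunct1[OF V]]
        proof (elim disjE exE conjE)
          fix r assume "V = [TV r]"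
          then show ?thesis using V False by auto
        next
          fix V' p' q' E' assume *: "V = V' @ E'" "twalk B V'" "last V' = TV p'" "walk_ext B p' q' E'"
          have "q' = p" using V walk_ext_last[OF *(4)] *(1) by simp
          then have "p' = q" "E' = E" using q(2) *(4) by auto
          moreover have "\<exists>r\<in>R. hd V' = TV r" using V *(1) twalk_nonempty[OF *(2)] by simp
          ultimately have "V' = W" using W(4)[OF *(2)] *(3) by simp
          then show ?thesis using * \<open>E' = E\<close> by simp
        qed
      qed
    qed
  qed
qed

text \<open>The length of the unique walk serves as rank. Two ways to enter a vertex would yield two
  walks to it, and an entry into a root would compete with the walk that consists of the root
  alone.\<close>

lemma walks_good_edges:
  assumes D: "temporal_digraph B" and R: "R \<subseteq> tverts B"
    and walks: "\<And>p. p \<in> tverts B \<Longrightarrow> \<exists>!W. twalk B W \<and> (\<exists>r\<in>R. hd W = TV r) \<and> last W = TV p"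
  shows "good_edges B R (tedges B)"
proof -
  define wk where "wk p = (THE W. twalk B W \<and> (\<exists>r\<in>R. hd W = TV r) \<and> last W = TV p)" for p
  have wk: "twalk B (wk p)" "\<exists>r\<in>R. hd (wk p) = TV r" "last (wk p) = TV p" if "p \<in> tverts B" for p
    using theI'[OF walks[OF that]] by (simp_all add: wk_def)
  have un: "W = wk p" if "p \<in> tverts B" "twalk B W" "\<exists>r\<in>R. hd W = TV r" "last W = TV p" for W p
    using walks[OF that(1)] wk[OF that(1)] that by blast
  have ext: "wk p = wk q @ E" if "walk_ext B q p E" for q p E
  proof -
    have q: "q \<in> tverts B" "p \<in> tverts B" using that by (auto simp: walk_ext_def)
    show ?thesis
      using un[OF q(2), of "wk q @ E"] twalk_ext[OF wk(1,3)[OF q(1)] that] wk(2)[OF q(1)]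
        twalk_nonempty[OF wk(1)[OF q(1)]] walk_ext_last[OF that] by simp
  qed
  have root: "\<not> walk_ext B q p E" if "p \<in> R" for q p E
  proof
    assume e: "walk_ext B q p E"
    then have q: "q \<in> tverts B" by (simp add: walk_ext_def)
    have "[TV p] = wk p" using un[of p "[TV p]"] that R by (auto intro: twalk.single)
    then show False using ext[OF e] twalk_nonempty[OF wk(1)[OF q]] walk_ext_last[OF e]
      by (cases "wk q"; cases E) auto
  qed
  have unique: "q = q' \<and> E = E'" if "walk_ext B q p E" "walk_ext B q' p E'" for q q' p E E'
  proof -
    have q: "q \<in> tverts B" "q' \<in> tverts B" using that by (auto simp: walk_ext_def)
    have "wk q @ E = wk q' @ E'" using ext that by metis
    from walk_ext_unique[OF this wk(3)[OF q(1)] wk(3)[OF q(2)] _ _ that] show ?thesis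
      using twalk_nonempty wk(1) q by blast
  qed
  have ex: "\<exists>q E. walk_ext B q p E" if "p \<in> tverts B" "p \<notin> R" for p
    using twalk_snoc_cases[OF wk(1)[OF that(1)]]
  proof (elim disjE exE conjE)
    fix r assume "wk p = [TV r]"
    then show ?thesis using wk(2,3)[OF that(1)] that(2) by auto
  next
    fix W' q' p' E assume *: "wk p = W' @ E" "walk_ext B q' p' E"
    then have "p' = p" using wk(3)[OF that(1)] walk_ext_last[OF *(2)] by simp
    then show ?thesis using * by blast
  qed
  have wx: "walk_ext B q p [TV p]" if "p = (fst q, Suc (snd q))" "q \<in> tverts B" "p \<in> tverts B" for q p
    using that by (auto simp: walk_ext_iff[OF D])
  have ex2: "walk_ext B q p [TE q p, TV p]" if "(q, p) \<in> tedges B" for q p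
    using that tedges_tverts[OF D that] by (auto simp: walk_ext_iff[OF D])
  have less: "length (wk q) < length (wk p)" if "walk_ext B q p E" for q p E
    using ext[OF that] walk_ext_last[OF that] by (cases E) auto
  show ?thesis unfolding good_edges_def
  proof (intro conjI ballI)
    fix p assume p: "p \<in> tverts B"
    show "if p \<in> R then \<not> wait_in B p \<and> (\<forall>q. (q, p) \<notin> tedges B)
      else if wait_in B p then \<forall>q. (q, p) \<notin> tedges B else \<exists>!q. (q, p) \<in> tedges B"
    proof (cases "p \<in> R")
      case True
      then show ?thesis using root[OF True] wx ex2 p unfolding wait_in_iff by metis
    next
      case False
      show ?thesis
      proof (cases "wait_in B p")
        case True
        then obtain q where "q \<in> tverts B" "p = (fst q, Suc (snd q))" unfolding wait_in_iff by blast
        then have "walk_ext B q p [TV p]" using wx p by blast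
        then have "(q', p) \<notin> tedges B" for q' using unique ex2 by blast
        then show ?thesis using False True by simp
      next
        case nw: False
        obtain q E where "walk_ext B q p E" using ex[OF p False] by blast
        then have "(q, p) \<in> tedges B" using nw by (auto simp: walk_ext_iff[OF D] wait_in_iff)
        moreover from this have "q' = q" if "(q', p) \<in> tedges B" for q'
          using unique[OF ex2[OF that] ex2] by simp
        ultimately show ?thesis using False nw by auto
      qed
    qed
  next
    have "\<forall>(q, p)\<in>tedges B. length (wk q) < length (wk p)" using less ex2 by blast
    moreover have "length (wk (v, t)) < length (wk (v, Suc t))"
      if "(v, t) \<in> tverts B" "(v, Suc t) \<in> tverts B" for v t
      using less[OF wx[of "(v, Suc t)" "(v, t)"]] that by simp
    ultimately show "\<exists>rank :: 'a \<times> nat \<Rightarrow> nat. (\<forall>(q, p)\<in>tedges B. rank q < rank p) \<and>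
       (\<forall>v t. (v, t) \<in> tverts B \<longrightarrow> (v, Suc t) \<in> tverts B \<longrightarrow> rank (v, t) < rank (v, Suc t))"
      by (intro exI[of _ "\<lambda>p. length (wk p)"] conjI) blast+
  qed simp
qed

text \<open>All temporal vertices are kept, but only those arcs that carry an edge of
  \<open>S\<close>, because disjointness is about arcs and not about temporal edges.\<close>

definition edges_branching :: "'v tdigraph \<Rightarrow> (('v \<times> nat) \<times> ('v \<times> nat)) set \<Rightarrow> 'v tdigraph" where
  "edges_branching D S = \<lparr> base = \<lparr> pverts = pverts (base D), parcs = edge_arcs S \<rparr>, act = act D,
     link = (\<lambda>(u, v). {(t, t'). ((u, t), (v, t')) \<in> S}) \<rparr>"

lemma edges_branching_simps:
  "tverts (edges_branching D S) = tverts D" "tedges (edges_branching D S) = S"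
  "parcs (base (edges_branching D S)) = edge_arcs S"
  by (auto simp: edges_branching_def tverts_def tedges_def edge_arcs_def image_iff; force)+

lemma edges_branching_subdigraph:
  assumes D: "temporal_digraph D" and S: "S \<subseteq> tedges D"
  shows "temporal_subdigraph (edges_branching D S) D"
proof -
  interpret pair_fin_digraph "base D" using D by (simp add: temporal_digraph_def)
  have arcs: "edge_arcs S \<subseteq> parcs (base D)"
    using S by (fastforce simp: edge_arcs_def tedges_def)
  have fin: "pair_fin_digraph (base (edges_branching D S))"
    by unfold_locales
      (use arcs arc_fst_in_verts arc_snd_in_verts finite_subset[OF arcs] in
        \<open>auto simp: edges_branching_def dest!: subsetD[OF arcs] dest: in_arcsD1 in_arcsD2\<close>)
  then interpret B: pair_fin_digraph "base (edges_branching D S)" .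
  have l: "link (edges_branching D S) e \<subseteq> link D e" if "e \<in> edge_arcs S" for e
    using S by (cases e) (auto simp: edges_branching_def tedges_def)
  have td: "temporal_digraph (edges_branching D S)"
    unfolding temporal_digraph_def
  proof (intro conjI fin)
    show "\<forall>v\<in>pverts (base (edges_branching D S)). finite (act (edges_branching D S) v)"
      using D by (auto simp: temporal_digraph_def edges_branching_def)
    show "\<forall>(u, v)\<in>parcs (base (edges_branching D S)). \<forall>(t, t')\<in>link (edges_branching D S) (u, v).
        t \<le> t' \<and> t \<in> act (edges_branching D S) u \<and> t' \<in> act (edges_branching D S) v"
    proof (intro ballI, clarify)
      fix u v t t'
      assume "(u, v) \<in> parcs (base (edges_branching D S))" "(t, t') \<in> link (edges_branching D S) (u, v)"
      then have "(u, v) \<in> parcs (base D)" "(t, t') \<in> link D (u, v)"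
        using arcs l[of "(u, v)"] by (auto simp: edges_branching_simps)
      then have "t \<le> t' \<and> t \<in> act D u \<and> t' \<in> act D v"
        using D unfolding temporal_digraph_def by blast
      then show "t \<le> t' \<and> t \<in> act (edges_branching D S) u \<and> t' \<in> act (edges_branching D S) v"
        by (simp add: edges_branching_def)
    qed
  qed
  show ?thesis unfolding temporal_subdigraph_def subgraph_def
  proof (intro conjI td)
    show "wf_digraph (with_proj (base (edges_branching D S)))" "wf_digraph (with_proj (base D))"
      by (rule B.wf_digraph wf_digraph)+
  qed (use arcs l in \<open>auto simp: edges_branching_def\<close>)
qed

lemma good_edges_cong:
  assumes "tverts B = tverts D" "tedges B \<subseteq> tedges D"
  shows "good_edges B R (tedges B) \<longleftrightarrow> good_edges D R (tedges B)"
  using assms unfolding good_edges_def wait_in_def by simp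

lemma has_disjoint_branchings_iff:
  assumes D: "temporal_digraph D" and R: "\<And>R. R \<in> set Rs \<Longrightarrow> R \<subseteq> tverts D"
  shows "has_disjoint_branchings D Rs \<longleftrightarrow> (\<exists>Ss. length Ss = length Rs \<and>
    (\<forall>i<length Rs. good_edges D (Rs ! i) (Ss ! i)) \<and>
    (\<forall>i<length Rs. \<forall>j<length Rs. i \<noteq> j \<longrightarrow> edge_arcs (Ss ! i) \<inter> edge_arcs (Ss ! j) = {}))"
    (is "_ \<longleftrightarrow> (\<exists>Ss. ?P Ss)")
proof
  assume "has_disjoint_branchings D Rs"
  then obtain Bs where Bs: "length Bs = length Rs"
    "\<And>i. i < length Rs \<Longrightarrow> temporal_spanning_branching D (Rs ! i) (Bs ! i)"
    "\<And>i j. i < length Rs \<Longrightarrow> j < length Rs \<Longrightarrow> i \<noteq> j \<Longrightarrow> edge_disjoint (Bs ! i) (Bs ! j)"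
    unfolding has_disjoint_branchings_def by blast
  have arcs: "edge_arcs (tedges B) \<subseteq> parcs (base B)" for B :: "'a tdigraph"
    by (auto simp: edge_arcs_def tedges_def)
  have "good_edges D (Rs ! i) (tedges (Bs ! i))" if i: "i < length Rs" for i
  proof -
    let ?B = "Bs ! i"
    have sub: "temporal_subdigraph ?B D"
      and w: "\<And>p. p \<in> tverts D \<Longrightarrow> \<exists>!W. twalk ?B W \<and> (\<exists>r\<in>Rs ! i. hd W = TV r) \<and> last W = TV p"
      using Bs(2)[OF i] unfolding temporal_spanning_branching_def by blast+
    have B: "temporal_digraph ?B" using sub by (simp add: temporal_subdigraph_def)
    have pv: "pverts (base ?B) \<subseteq> pverts (base D)" "parcs (base ?B) \<subseteq> parcs (base D)"
      "\<forall>v\<in>pverts (base ?B). act ?B v \<subseteq> act D v" "\<forall>e\<in>parcs (base ?B). link ?B e \<subseteq> link D e"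
      using sub by (auto simp: temporal_subdigraph_def subgraph_def)
    \<comment> \<open>Every temporal vertex of \<open>D\<close> is the end of a walk in the
      branching, so it is active there.\<close>
    have tv: "tverts ?B = tverts D"
    proof
      show "tverts ?B \<subseteq> tverts D" using pv by (auto simp: tverts_def)
      show "tverts D \<subseteq> tverts ?B"
      proof
        fix p assume "p \<in> tverts D"
        then obtain W where "twalk ?B W" "last W = TV p" using w by blast
        then show "p \<in> tverts ?B" using twalk_last by fastforce
      qed
    qed
    have te: "tedges ?B \<subseteq> tedges D" using pv by (fastforce simp: tedges_def)
    have "Rs ! i \<subseteq> tverts ?B" using R i tv by simp
    from walks_good_edges[OF B this] w tv have "good_edges ?B (Rs ! i) (tedges ?B)" by auto
    then show ?thesis using good_edges_cong[OF tv te] by blast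
  qed
  moreover have "edge_arcs (tedges (Bs ! i)) \<inter> edge_arcs (tedges (Bs ! j)) = {}"
    if "i < length Rs" "j < length Rs" "i \<noteq> j" for i j
    using Bs(3)[OF that] arcs unfolding edge_disjoint_def by fast
  ultimately show "\<exists>Ss. ?P Ss" using Bs(1) by (intro exI[of _ "map tedges Bs"]) auto
next
  assume "\<exists>Ss. ?P Ss"
  then obtain Ss where Ss: "?P Ss" by blast
  have "temporal_spanning_branching D (Rs ! i) (edges_branching D (Ss ! i))" if i: "i < length Rs" for i
  proof -
    have g: "good_edges D (Rs ! i) (Ss ! i)" using Ss i by blast
    then have S: "Ss ! i \<subseteq> tedges D" by (simp add: good_edges_def)
    let ?B = "edges_branching D (Ss ! i)"
    have sub: "temporal_subdigraph ?B D" by (rule edges_branching_subdigraph[OF D S])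
    then have B: "temporal_digraph ?B" by (simp add: temporal_subdigraph_def)
    have "good_edges ?B (Rs ! i) (tedges ?B)"
      using good_edges_cong[of ?B D "Rs ! i"] g S by (simp add: edges_branching_simps)
    from good_edges_walks[OF B _ this] R i sub show ?thesis
      unfolding temporal_spanning_branching_def by (simp add: edges_branching_simps)
  qed
  then show "has_disjoint_branchings D Rs"
    using Ss unfolding has_disjoint_branchings_def edge_disjoint_def
    by (intro exI[of _ "map (edges_branching D) Ss"]) (simp add: edges_branching_simps)
qed

section \<open>Reducing satisfiability to disjoint branchings in a star\<close>

definition cnf_sat :: "(bool \<times> 'v) list list \<Rightarrow> bool" where
  "cnf_sat \<phi> \<longleftrightarrow> (\<exists>\<sigma>. \<forall>C\<in>set \<phi>. \<exists>(b, x)\<in>set C. \<sigma> x = b)"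

definition fvars :: "(bool \<times> 'v) list list \<Rightarrow> 'v list" where
  "fvars \<phi> = remdups (map snd (concat \<phi>))"

definition flits :: "(bool \<times> 'v) list list \<Rightarrow> (bool \<times> 'v) list" where
  "flits \<phi> = map (Pair True) (fvars \<phi>) @ map (Pair False) (fvars \<phi>)"

text \<open>One numbering for all times: item \<open>i\<close> belongs to time \<open>2 * i\<close>.
  The empty items reserve the times of the leaves, which thus precede those of the centre and differ
  from them.\<close>

definition items :: "(bool \<times> 'v) list list \<Rightarrow> (bool \<times> 'v) list list" where
  "items \<phi> = map (\<lambda>_. []) (flits \<phi>) @ \<phi> @ map (\<lambda>x. [(True, x), (False, x)]) (fvars \<phi>)"

abbreviation eitems :: "(bool \<times> 'v) list list \<Rightarrow> (nat \<times> (bool \<times> 'v) list) list" where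
  "eitems \<phi> \<equiv> List.enumerate 0 (items \<phi>)"

abbreviation leaves :: "(bool \<times> 'v) list list \<Rightarrow> (nat \<times> bool \<times> 'v) list" where
  "leaves \<phi> \<equiv> List.enumerate 0 (flits \<phi>)"

text \<open>
  The centre of the star is 0 and the literal number \<open>j\<close> is the leaf \<open>j + 1\<close>, active at time \<open>2j\<close>
  only. The centre is active at one time per clause. The first branching has to enter the centre at
  the times of the clauses of the formula, the second one at the times of the clauses
  \<open>x \<or> \<not> x\<close>; as an arc belongs to only one of them, the arcs used by the first are consistent.
\<close>

definition red_verts :: "(bool \<times> 'v) list list \<Rightarrow> (nat \<times> nat list) list" where
  "red_verts \<phi> =
     (0, map (\<lambda>p. 2 * fst p) (filter (\<lambda>p. length (flits \<phi>) \<le> fst p) (eitems \<phi>))) #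
     map (\<lambda>p. (Suc (fst p), [2 * fst p])) (leaves \<phi>)"

definition red_arcs :: "(bool \<times> 'v) list list \<Rightarrow> ((nat \<times> nat) \<times> (nat \<times> nat) list) list" where
  "red_arcs \<phi> = map (\<lambda>p. ((Suc (fst p), 0), map (\<lambda>q. (2 * fst p, 2 * fst q))
     (filter (\<lambda>q. snd p \<in> set (snd q)) (eitems \<phi>)))) (leaves \<phi>)"

definition leaf_roots :: "(bool \<times> 'v) list list \<Rightarrow> (nat \<times> nat) list" where
  "leaf_roots \<phi> = map (\<lambda>p. (Suc (fst p), 2 * fst p)) (leaves \<phi>)"

text \<open>The sum of two lengths is written as the length of a list so that
  \<open>fp_length\<close> applies; the elements of that list are merely counted.\<close>

definition pos_roots :: "(bool \<times> 'v) list list \<Rightarrow> (nat \<times> nat) list" where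
  "pos_roots \<phi> = map (\<lambda>p. (0, 2 * fst p)) (filter (\<lambda>p. length (flits \<phi>) \<le> fst p \<and>
     fst p < length (flits \<phi> @ map (\<lambda>_. (True, undefined)) \<phi>)) (eitems \<phi>))"

definition neg_roots :: "(bool \<times> 'v) list list \<Rightarrow> (nat \<times> nat) list" where
  "neg_roots \<phi> = map (\<lambda>p. (0, 2 * fst p)) (filter (\<lambda>p.
     length (flits \<phi> @ map (\<lambda>_. (True, undefined)) \<phi>) \<le> fst p) (eitems \<phi>))"

text \<open>Each of the first two branchings has as roots, besides the leaves, the times of the
  centre that the other one must enter. For the remaining \<open>k - 2\<close> branchings everything
  is a root, so they need no edges.\<close>

definition red_roots :: "nat \<Rightarrow> (bool \<times> 'v) list list \<Rightarrow> (nat \<times> nat) list list" where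
  "red_roots k \<phi> = [leaf_roots \<phi> @ neg_roots \<phi>, leaf_roots \<phi> @ pos_roots \<phi>] @
     map (\<lambda>_. leaf_roots \<phi> @ pos_roots \<phi> @ neg_roots \<phi>) (replicate (k - 2) False)"

definition reduction :: "nat \<Rightarrow> (bool \<times> 'v) list list \<Rightarrow> edtsb_instance" where
  "reduction k \<phi> = (red_verts \<phi>, red_arcs \<phi>, red_roots k \<phi>)"

lemma fp_reduction:
  "fp (reduction k :: (bool \<times> 'v::data) list list \<Rightarrow> _)"
proof -
  have v: "fp (fvars :: (bool \<times> 'v) list list \<Rightarrow> _)"
    unfolding fvars_def by (intro fp_intros)
  have l: "fp (flits :: (bool \<times> 'v) list list \<Rightarrow> _)"
    unfolding flits_def by (intro fp_intros fp_comp[OF v])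
  have i: "fp (items :: (bool \<times> 'v) list list \<Rightarrow> _)"
    unfolding items_def by (intro fp_intros fp_comp[OF v] fp_comp[OF l])
  note i' = fp_comp[OF i] and l' = fp_comp[OF l] and v' = fp_comp[OF v]
  have 1: "fp (red_verts :: (bool \<times> 'v) list list \<Rightarrow> _)"
    unfolding red_verts_def by (intro fp_intros i' l')
  have 2: "fp (red_arcs :: (bool \<times> 'v) list list \<Rightarrow> _)"
    unfolding red_arcs_def by (intro fp_intros i' l')
  have 3: "fp (leaf_roots :: (bool \<times> 'v) list list \<Rightarrow> _)"
    unfolding leaf_roots_def by (intro fp_intros l')
  have 4: "fp (pos_roots :: (bool \<times> 'v) list list \<Rightarrow> _)"
    unfolding pos_roots_def by (intro fp_intros i' l')
  have 5: "fp (neg_roots :: (bool \<times> 'v) list list \<Rightarrow> _)"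
    unfolding neg_roots_def by (intro fp_intros i' l')
  have 6: "fp (red_roots k :: (bool \<times> 'v) list list \<Rightarrow> _)"
    unfolding red_roots_def by (intro fp_intros fp_comp[OF 3] fp_comp[OF 4] fp_comp[OF 5])
  show ?thesis
    unfolding reduction_def by (intro fp_intros fp_comp[OF 1] fp_comp[OF 2] fp_comp[OF 6])
qed

text \<open>The number of branchings affects only the roots, so \<open>D\<close> may be taken from
  \<open>reduction 0 \<phi>\<close>. The items below \<open>N\<close> are the empty ones, those from
  \<open>N\<close> on are the clauses of \<phi>, and those from \<open>P\<close> on are the clauses
  of a variable and its negation.\<close>

context
  fixes \<phi> :: "(bool \<times> 'v) list list" and N P M :: nat and D :: "nat tdigraph"
  defines "N \<equiv> length (flits \<phi>)" and "P \<equiv> length (flits \<phi>) + length \<phi>" and "M \<equiv> length (items \<phi>)"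
    and "D \<equiv> inst_digraph (reduction 0 \<phi>)"
begin

lemma red_sizes: "N = 2 * length (fvars \<phi>)" "M = P + length (fvars \<phi>)" "N \<le> P" "P \<le> M"
  by (simp_all add: N_def P_def M_def flits_def items_def)

lemma item_leaf: "i < N \<Longrightarrow> items \<phi> ! i = []"
  by (simp add: items_def N_def nth_append)

lemma item_pos: "i < length \<phi> \<Longrightarrow> items \<phi> ! (N + i) = \<phi> ! i"
  by (simp add: items_def N_def nth_append)

lemma item_neg: "i < length (fvars \<phi>) \<Longrightarrow>
    items \<phi> ! (P + i) = [(True, fvars \<phi> ! i), (False, fvars \<phi> ! i)]"
  by (simp add: items_def P_def nth_append)

lemma set_eitems: "set (eitems \<phi>) = {(i, items \<phi> ! i) | i. i < M}"
  by (auto simp: in_set_enumerate_eq M_def)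

lemma set_leaves: "set (leaves \<phi>) = {(j, flits \<phi> ! j) | j. j < N}"
  by (auto simp: in_set_enumerate_eq N_def)

lemma red_pverts: "pverts (base D) = {..N}"
proof -
  have "pverts (base D) = insert 0 (Suc ` {..<N})"
    by (auto simp: D_def reduction_def red_verts_def set_leaves image_iff Bex_def)
  then show ?thesis by (simp add: lessThan_Suc_eq_insert_0[symmetric] lessThan_Suc_atMost)
qed

lemma red_parcs: "parcs (base D) = {(Suc j, 0) | j. j < N}"
  by (auto simp: D_def reduction_def red_arcs_def set_leaves image_iff Bex_def)

lemma red_act: "t \<in> act D v \<longleftrightarrow> (v = 0 \<and> (\<exists>i. N \<le> i \<and> i < M \<and> t = 2 * i)) \<or> (\<exists>j<N. v = Suc j \<and> t = 2 * j)"
proof -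
  have "t \<in> act D v \<longleftrightarrow> (\<exists>p\<in>set (red_verts \<phi>). fst p = v \<and> t \<in> set (snd p))"
    by (force simp: D_def reduction_def)
  then show ?thesis
    unfolding red_verts_def by (auto simp: set_leaves set_eitems N_def image_iff)
qed

lemma red_link: "(t, t') \<in> link D (Suc j, 0) \<longleftrightarrow>
    (j < N \<and> t = 2 * j \<and> (\<exists>i. i < M \<and> t' = 2 * i \<and> flits \<phi> ! j \<in> set (items \<phi> ! i)))"
proof -
  have "(t, t') \<in> link D (Suc j, 0) \<longleftrightarrow> (\<exists>p\<in>set (red_arcs \<phi>). fst p = (Suc j, 0) \<and> (t, t') \<in> set (snd p))"
    by (force simp: D_def reduction_def)
  then show ?thesis
    unfolding red_arcs_def by (auto simp: set_leaves set_eitems image_iff)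
qed

lemma red_tverts: "tverts D = {(0, 2 * i) | i. N \<le> i \<and> i < M} \<union> {(Suc j, 2 * j) | j. j < N}"
  by (auto simp: tverts_def red_pverts red_act)

lemma red_tedges: "tedges D = {((Suc j, 2 * j), (0, 2 * i)) | i j. j < N \<and> N \<le> i \<and> i < M \<and>
    flits \<phi> ! j \<in> set (items \<phi> ! i)}"
proof -
  have "\<not> flits \<phi> ! j \<in> set (items \<phi> ! i)" if "i < N" for i j using item_leaf[OF that] by simp
  then show ?thesis
    unfolding tedges_def by (auto simp: red_parcs red_link) (metis not_less)+
qed

lemma red_temporal: "temporal_digraph D"
proof -
  have "pair_fin_digraph (base D)"
  proof
    show "finite (parcs (base D))" by (simp add: red_parcs)
  qed (auto simp: red_pverts red_parcs)
  moreover have "finite (act D v)" for v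
  proof (rule finite_subset)
    show "act D v \<subseteq> {..2 * (M + N)}" by (auto simp: red_act)
  qed simp
  moreover have "t \<le> t' \<and> t \<in> act D u \<and> t' \<in> act D v"
    if "(u, v) \<in> parcs (base D)" "(t, t') \<in> link D (u, v)" for u v t t'
  proof -
    have "((u, t), (v, t')) \<in> tedges D" using that by (auto simp: tedges_def)
    then show ?thesis unfolding red_tedges by (auto simp: red_act)
  qed
  ultimately show ?thesis unfolding temporal_digraph_def by blast
qed

text \<open>All times are even.\<close>

lemma red_no_wait: "\<not> wait_in D p" if "p \<in> tverts D"
  using that by (auto simp: wait_in_def red_tverts) presburger+

text \<open>The time is a rank, since the leaves precede all active times of the centre.\<close>

lemma red_good_iff:
  "good_edges D R S \<longleftrightarrow> S \<subseteq> tedges D \<and>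
    (\<forall>p\<in>tverts D. if p \<in> R then \<forall>q. (q, p) \<notin> S else \<exists>!q. (q, p) \<in> S)"
proof -
  have "snd q < snd p" if "S \<subseteq> tedges D" "(q, p) \<in> S" for p q
    using subsetD[OF that] unfolding red_tedges by auto
  moreover have False if "(v, t) \<in> tverts D" "(v, Suc t) \<in> tverts D" for v t
    using that red_no_wait[OF that(2)] by (auto simp: wait_in_def)
  ultimately have "\<exists>rank :: nat \<times> nat \<Rightarrow> nat. (\<forall>(q, p)\<in>S. rank q < rank p) \<and>
       (\<forall>v t. (v, t) \<in> tverts D \<longrightarrow> (v, Suc t) \<in> tverts D \<longrightarrow> rank (v, t) < rank (v, Suc t))"
    if "S \<subseteq> tedges D"
    using that by (intro exI[of _ snd]) blast
  then show ?thesis unfolding good_edges_def using red_no_wait by auto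
qed

lemma set_leaf_roots: "set (leaf_roots \<phi>) = {(Suc j, 2 * j) | j. j < N}"
  by (auto simp: leaf_roots_def set_leaves image_iff)

lemma set_pos_roots: "set (pos_roots \<phi>) = {(0, 2 * i) | i. N \<le> i \<and> i < P}"
  using red_sizes by (auto simp: pos_roots_def set_eitems image_iff P_def N_def)

lemma set_neg_roots: "set (neg_roots \<phi>) = {(0, 2 * i) | i. P \<le> i \<and> i < M}"
  by (auto simp: neg_roots_def set_eitems image_iff P_def)

lemma red_enter:
  assumes "good_edges D R S" "N \<le> i" "i < M" "(0, 2 * i) \<notin> R"
  obtains j where "j < N" "flits \<phi> ! j \<in> set (items \<phi> ! i)" "((Suc j, 2 * j), (0, 2 * i)) \<in> S"
proof -
  have "(0, 2 * i) \<in> tverts D" using assms(2,3) by (auto simp: red_tverts)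
  then obtain q where q: "(q, (0, 2 * i)) \<in> S" "S \<subseteq> tedges D"
    using assms unfolding red_good_iff by (metis (mono_tags, lifting))
  then show ?thesis using that unfolding red_tedges by force
qed

lemma red_good_image:
  assumes f: "\<And>i. i \<in> I \<Longrightarrow> f i < N \<and> flits \<phi> ! f i \<in> set (items \<phi> ! i)" and I: "I \<subseteq> {N..<M}"
    and R: "R = set (leaf_roots \<phi>) \<union> {(0, 2 * i) | i. i \<in> {N..<M} - I}"
  shows "good_edges D R ((\<lambda>i. ((Suc (f i), 2 * f i), (0, 2 * i))) ` I)"
  unfolding red_good_iff
proof (intro conjI ballI)
  show "(\<lambda>i. ((Suc (f i), 2 * f i), (0, 2 * i))) ` I \<subseteq> tedges D"
    using f I unfolding red_tedges by fastforce
  fix p assume "p \<in> tverts D"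
  then show "if p \<in> R then \<forall>q. (q, p) \<notin> (\<lambda>i. ((Suc (f i), 2 * f i), (0, 2 * i))) ` I
      else \<exists>!q. (q, p) \<in> (\<lambda>i. ((Suc (f i), 2 * f i), (0, 2 * i))) ` I"
    unfolding red_tverts R set_leaf_roots by auto
qed

lemma edge_arcs_image: "edge_arcs ((\<lambda>i. ((Suc (f i), 2 * f i), (0, 2 * i))) ` I) = (\<lambda>i. (Suc (f i), 0)) ` I"
  by (auto simp: edge_arcs_def image_iff Bex_def)

lemma inst_digraph_reduction: "inst_digraph (reduction k \<phi>) = D"
  by (simp add: D_def reduction_def)

lemma length_red_roots: "2 \<le> k \<Longrightarrow> length (red_roots k \<phi>) = k"
  by (simp add: red_roots_def)

lemma red_roots_tverts: "R \<in> set (map set (red_roots k \<phi>)) \<Longrightarrow> R \<subseteq> tverts D"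
  using red_sizes
  by (auto simp: red_roots_def red_tverts set_leaf_roots set_pos_roots set_neg_roots)

lemma red_root_nth:
  assumes "2 \<le> k"
  shows "map set (red_roots k \<phi>) ! 0 = set (leaf_roots \<phi>) \<union> {(0, 2 * i) | i. i \<in> {N..<M} - {N..<P}}"
    "map set (red_roots k \<phi>) ! 1 = set (leaf_roots \<phi>) \<union> {(0, 2 * i) | i. i \<in> {N..<M} - {P..<M}}"
    "2 \<le> i \<Longrightarrow> i < k \<Longrightarrow>
      map set (red_roots k \<phi>) ! i = set (leaf_roots \<phi>) \<union> {(0, 2 * i) | i. i \<in> {N..<M} - {}}"
  using red_sizes assms
  by (auto simp: red_roots_def set_pos_roots set_neg_roots nth_append nth_Cons split: nat.splits)

lemma in_flits: "(b, x) \<in> set (flits \<phi>) \<longleftrightarrow> x \<in> set (fvars \<phi>)"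
  by (cases b) (auto simp: flits_def)

lemma reduction_yes_iff:
  assumes k: "2 \<le> k"
  shows "edtsb_yes (reduction k \<phi>) \<longleftrightarrow> cnf_sat \<phi>"
proof -
  let ?Rs = "map set (red_roots k \<phi>)"
  have yes: "edtsb_yes (reduction k \<phi>) \<longleftrightarrow> (\<exists>Ss. length Ss = k \<and>
    (\<forall>i<k. good_edges D (?Rs ! i) (Ss ! i)) \<and>
    (\<forall>i<k. \<forall>j<k. i \<noteq> j \<longrightarrow> edge_arcs (Ss ! i) \<inter> edge_arcs (Ss ! j) = {}))"
    unfolding edtsb_yes_def inst_digraph_reduction
    using has_disjoint_branchings_iff[OF red_temporal, of ?Rs] red_roots_tverts length_red_roots[OF k]
    by (simp add: reduction_def)
  have inj: "j = j'" if "j < N" "j' < N" "flits \<phi> ! j = flits \<phi> ! j'" for j j'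
  proof -
    have "distinct (flits \<phi>)" by (auto simp: flits_def fvars_def distinct_map inj_on_def)
    then show ?thesis using that by (simp add: N_def nth_eq_iff_index_eq)
  qed
  show ?thesis
  proof
    assume "edtsb_yes (reduction k \<phi>)"
    then obtain Ss where Ss: "\<And>i. i < k \<Longrightarrow> good_edges D (?Rs ! i) (Ss ! i)"
      "\<And>i j. i < k \<Longrightarrow> j < k \<Longrightarrow> i \<noteq> j \<Longrightarrow> edge_arcs (Ss ! i) \<inter> edge_arcs (Ss ! j) = {}"
      using yes by blast
    have g1: "good_edges D (?Rs ! 0) (Ss ! 0)" and g2: "good_edges D (?Rs ! 1) (Ss ! 1)"
      using Ss(1)[of 0] Ss(1)[of 1] k by auto
    have dis: "edge_arcs (Ss ! 0) \<inter> edge_arcs (Ss ! 1) = {}" using Ss(2)[of 0 1] k by auto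
    \<comment> \<open>The first branching fixes the assignment: a variable is true iff that
      branching uses the arc of the positive literal.\<close>
    define \<sigma> where "\<sigma> x \<longleftrightarrow> (\<exists>j<N. flits \<phi> ! j = (True, x) \<and> (Suc j, 0) \<in> edge_arcs (Ss ! 0))" for x
    have arc: "(Suc j, 0) \<in> edge_arcs S" if "((Suc j, 2 * j), (0, 2 * i)) \<in> S" for i j and S :: "((nat \<times> nat) \<times> nat \<times> nat) set"
      using that by (force simp: edge_arcs_def)
    have "\<exists>(b, x)\<in>set C. \<sigma> x = b" if C: "C \<in> set \<phi>" for C
    proof -
      obtain i where i: "i < length \<phi>" "\<phi> ! i = C" using C by (auto simp: in_set_conv_nth)
      have "(0, 2 * (N + i)) \<notin> ?Rs ! 0" using i unfolding red_root_nth(1)[OF k] by (auto simp: set_leaf_roots P_def N_def)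
      moreover have "N \<le> N + i" "N + i < M" using i red_sizes by (auto simp: P_def N_def)
      ultimately obtain j where j: "j < N" "flits \<phi> ! j \<in> set C" "((Suc j, 2 * j), (0, 2 * (N + i))) \<in> Ss ! 0"
        using red_enter[OF g1] item_pos[OF i(1)] i(2) by metis
      obtain b x where bx: "flits \<phi> ! j = (b, x)" by (cases "flits \<phi> ! j")
      have "\<sigma> x = b"
      proof (cases b)
        case True
        then show ?thesis using bx j arc[OF j(3)] by (auto simp: \<sigma>_def)
      next
        \<comment> \<open>The arc of the negative literal belongs to the first branching, so the
          second one has to enter the time of \<open>x\<close> and its negation through the arc of
          \<open>x\<close>; hence the first branching does not use that arc.\<close>
        case False
        have "x \<in> set (fvars \<phi>)" using bx j(1) in_flits by (metis N_def nth_mem)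
        then obtain l where l: "l < length (fvars \<phi>)" "fvars \<phi> ! l = x" by (auto simp: in_set_conv_nth)
        have "(0, 2 * (P + l)) \<notin> ?Rs ! 1" using l red_sizes unfolding red_root_nth(2)[OF k] by (auto simp: set_leaf_roots)
        moreover have "N \<le> P + l" "P + l < M" using l red_sizes by auto
        ultimately obtain j' where j': "j' < N" "flits \<phi> ! j' \<in> {(True, x), (False, x)}" "((Suc j', 2 * j'), (0, 2 * (P + l))) \<in> Ss ! 1"
          using red_enter[OF g2] item_neg[OF l(1)] l(2) by (metis list.set(1) list.set(2))
        have "flits \<phi> ! j' \<noteq> (False, x)"
        proof
          assume "flits \<phi> ! j' = (False, x)"
          then have "j' = j" using inj[OF j'(1) j(1)] bx False by simp
          then show False using dis arc[OF j(3)] arc[OF j'(3)] by blast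
        qed
        then have "flits \<phi> ! j' = (True, x)" using j'(2) by blast
        then have "\<not> \<sigma> x" using inj[OF j'(1)] arc[OF j'(3)] dis by (auto simp: \<sigma>_def)
        then show ?thesis using False by simp
      qed
      then show ?thesis using j(2) bx by auto
    qed
    then show "cnf_sat \<phi>" unfolding cnf_sat_def by blast
  next
    assume "cnf_sat \<phi>"
    then obtain \<sigma> where \<sigma>: "\<And>C. C \<in> set \<phi> \<Longrightarrow> \<exists>(b, x)\<in>set C. \<sigma> x = b" unfolding cnf_sat_def by blast
    have idx: "\<exists>j<N. flits \<phi> ! j = (b, x)" if "x \<in> set (fvars \<phi>)" for b x
      using that in_flits[of b x] by (auto simp: in_set_conv_nth N_def)
    have "\<exists>j<N. flits \<phi> ! j \<in> set (items \<phi> ! i) \<and> \<sigma> (snd (flits \<phi> ! j)) = fst (flits \<phi> ! j)" if "i \<in> {N..<P}" for i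
    proof -
      have i: "i - N < length \<phi>" "N + (i - N) = i" using that by (auto simp: P_def N_def)
      obtain b x where bx: "(b, x) \<in> set (\<phi> ! (i - N))" "\<sigma> x = b" using \<sigma>[of "\<phi> ! (i - N)"] i(1) by force
      then have "x \<in> set (fvars \<phi>)" using i(1) nth_mem[OF i(1)] by (force simp: fvars_def)
      then obtain j where "j < N" "flits \<phi> ! j = (b, x)" using idx by blast
      then show ?thesis using bx item_pos[OF i(1)] i(2) by auto
    qed
    then obtain f where f: "\<And>i. i \<in> {N..<P} \<Longrightarrow> f i < N \<and> flits \<phi> ! f i \<in> set (items \<phi> ! i) \<and>
        \<sigma> (snd (flits \<phi> ! f i)) = fst (flits \<phi> ! f i)" by metis
    have "\<exists>j<N. flits \<phi> ! j \<in> set (items \<phi> ! i) \<and> \<sigma> (snd (flits \<phi> ! j)) \<noteq> fst (flits \<phi> ! j)" if "i \<in> {P..<M}" for i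
    proof -
      have i: "i - P < length (fvars \<phi>)" "P + (i - P) = i" using that red_sizes by auto
      let ?x = "fvars \<phi> ! (i - P)"
      obtain j where "j < N" "flits \<phi> ! j = (\<not> \<sigma> ?x, ?x)" using idx[of ?x "\<not> \<sigma> ?x"] i(1) by auto
      then show ?thesis using item_neg[OF i(1)] i(2) by (cases "\<sigma> ?x") (auto intro!: exI[of _ j])
    qed
    then obtain g where g: "\<And>i. i \<in> {P..<M} \<Longrightarrow> g i < N \<and> flits \<phi> ! g i \<in> set (items \<phi> ! i) \<and>
        \<sigma> (snd (flits \<phi> ! g i)) \<noteq> fst (flits \<phi> ! g i)" by metis
    \<comment> \<open>The choice \<open>f\<close> for the first branching takes only literals that
      are true under \<sigma>, the choice \<open>g\<close> for the second only false ones, so no arc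
      is used by both.\<close>
    define E where "E = (\<lambda>(f :: nat \<Rightarrow> nat) I. (\<lambda>i. ((Suc (f i), 2 * f i), (0 :: nat, 2 * i))) ` I)"
    define Ss where "Ss = [E f {N..<P}, E g {P..<M}] @ replicate (k - 2) {}"
    have "good_edges D (?Rs ! i) (Ss ! i)" if "i < k" for i
    proof -
      have 0: "good_edges D (?Rs ! 0) (E f {N..<P})" unfolding E_def
        using f red_sizes by (intro red_good_image red_root_nth(1)[OF k]) auto
      have 1: "good_edges D (?Rs ! 1) (E g {P..<M})" unfolding E_def
        using g red_sizes by (intro red_good_image red_root_nth(2)[OF k]) auto
      have 2: "good_edges D (?Rs ! i) {}" if "2 \<le> i" "i < k"
        using red_good_image[of "{}" _ "?Rs ! i"] red_root_nth(3)[OF k that] by simp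
      have "Ss ! i = {}" if "2 \<le> i" using that \<open>i < k\<close> by (simp add: Ss_def nth_append)
      then show ?thesis using 0 1 2 that by (cases "i = 0"; cases "i = 1") (auto simp: Ss_def)
    qed
    moreover have "edge_arcs (Ss ! i) \<inter> edge_arcs (Ss ! j) = {}" if "i < k" "j < k" "i \<noteq> j" for i j
    proof -
      have "edge_arcs (E f {N..<P}) \<inter> edge_arcs (E g {P..<M}) = {}"
        using f g unfolding E_def edge_arcs_image by fastforce
      then have d: "edge_arcs (Ss ! 0) \<inter> edge_arcs (Ss ! 1) = {}" by (simp add: Ss_def)
      have "Ss ! i = {}" if "2 \<le> i" "i < k" for i using that by (simp add: Ss_def nth_append)
      then have e: "edge_arcs (Ss ! i) = {}" if "2 \<le> i" "i < k" for i
        using that by (simp add: edge_arcs_def)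
      consider "2 \<le> i" | "2 \<le> j" | "i = 0" "j = 1" | "i = 1" "j = 0" using \<open>i \<noteq> j\<close> by linarith
      then show ?thesis
      proof cases
        case 1
        then show ?thesis using e[OF 1] that by simp
      next
        case 2
        then show ?thesis using e[OF 2] that by simp
      next
        case 3
        then show ?thesis using d by simp
      next
        case 4
        then show ?thesis using d by (simp add: Int_commute)
      qed
    qed
    moreover have "length Ss = k" using k by (simp add: Ss_def)
    ultimately show "edtsb_yes (reduction k \<phi>)" using yes by blast
  qed
qed

text \<open>No two temporal vertices share a time, so a snapshot is at most one vertex without
  edges; this is why the constant can be 1.\<close>

lemma reduction_restricted:
  assumes k: "2 \<le> k"
  shows "reduction k \<phi> \<in> restricted_instances k 1"
proof -
  have r: "inst_roots (reduction k \<phi>) = map set (red_roots k \<phi>)" by (simp add: reduction_def)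
  have "reduction k \<phi> \<in> edtsb_instances k"
    unfolding edtsb_instances_def mem_Collect_eq inst_digraph_reduction r
    using red_temporal length_red_roots[OF k] red_roots_tverts by simp
  moreover have "acyclic (parcs (base D))"
  proof (rule acyclic_subset)
    show "acyclic (less_than\<inverse>)" using wf_less_than by (simp add: wf_acyclic)
    show "parcs (base D) \<subseteq> less_than\<inverse>" by (auto simp: red_parcs)
  qed
  moreover have "digraph_size (snapshot D t) \<le> 1" for t
  proof -
    have "{v \<in> pverts (base D). t \<in> act D v} \<subseteq> {if t < 2 * N then Suc (t div 2) else 0}"
      by (auto simp: red_act)
    then have "card {v \<in> pverts (base D). t \<in> act D v} \<le> 1"
      by (metis card.empty card_insert_disjoint card_mono empty_iff finite.emptyI finite.insertI One_nat_def)
    moreover have "{e \<in> parcs (base D). (t, t) \<in> link D e} = {}"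
    proof -
      have "(t, t) \<notin> link D (u, v)" if "(u, v) \<in> parcs (base D)" for u v
      proof
        assume "(t, t) \<in> link D (u, v)"
        then have "((u, t), (v, t)) \<in> tedges D" using that by (auto simp: tedges_def)
        then show False unfolding red_tedges by auto
      qed
      then show ?thesis by auto
    qed
    ultimately show ?thesis
      unfolding digraph_size_def snapshot_def
      by (simp only: pair_pre_digraph.select_convs card.empty add_0_right)
  qed
  moreover have "underlying_star (base D)"
    unfolding underlying_star_def
  proof (intro bexI[of _ 0])
    show "{{u, v} | u v. (u, v) \<in> parcs (base D)} = {{0, v} | v. v \<in> pverts (base D) - {0}}"
      unfolding red_parcs red_pverts
      by (auto simp: insert_commute) (metis Suc_le_eq Suc_pred insert_commute not_gr_zero)+
  qed (simp add: red_pverts)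
  ultimately show ?thesis
    unfolding restricted_instances_def mem_Collect_eq inst_digraph_reduction by blast
qed

text \<open>All times are below \<open>2 * M\<close>, and \<open>M\<close> counts three items per
  variable (two literals and one clause) and one item per clause of \<phi>.\<close>

lemma lifetime_reduction: "lifetime (inst_digraph (reduction k \<phi>)) \<le> 6 * length (fvars \<phi>) + 2 * length \<phi>"
proof -
  have "t \<le> 2 * M" if "t \<in> act D v" for t v
    using that red_sizes by (auto simp: red_act)
  then have sub: "insert 0 (\<Union>v\<in>pverts (base D). act D v) \<subseteq> {..2 * M}" by blast
  then have "finite (insert 0 (\<Union>v\<in>pverts (base D). act D v))"
    by (rule finite_subset) simp
  then have "lifetime D \<le> 2 * M"
    unfolding lifetime_def using sub by (intro Max.boundedI) blast+
  then show ?thesis unfolding inst_digraph_reduction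
    by (simp add: red_sizes P_def flits_def)
qed

end

section \<open>Membership in NP\<close>

lemma fp_enc_list [fp_intros]:
  assumes "fp f" "fp g"
  shows "fp (\<lambda>x. enc_list f (g x))"
  unfolding enc_list_def by (intro fp_intros fp_comp[OF assms(1)] assms(2))

lemma fp_enc_nat [fp_intros]: "fp f \<Longrightarrow> fp (\<lambda>x. enc_nat (f x))"
  unfolding enc_nat_def enc_bool_def by (intro fp_intros)

lemma fp_enc_prod [fp_intros]:
  assumes "fp f" "fp g" "fp h"
  shows "fp (\<lambda>x. enc_prod f g (h x))"
  unfolding enc_prod_def
  by (intro fp_intros fp_comp[OF assms(1)] fp_comp[OF assms(2)] assms(3))

lemma fp_eta: "fp (\<lambda>x. f x) \<Longrightarrow> fp f"
  by simp

lemma fp_enc_instance: "fp enc_instance"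
proof -
  have n: "fp enc_nat" by (rule fp_eta) (intro fp_intros)
  have ln: "fp (enc_list enc_nat)" by (rule fp_eta) (intro fp_intros n)
  have pn: "fp (enc_prod enc_nat enc_nat)" by (rule fp_eta) (intro fp_enc_prod fp_id n)
  have lpn: "fp (enc_list (enc_prod enc_nat enc_nat))" by (rule fp_eta) (intro fp_enc_list fp_id pn)
  have v: "fp (enc_prod enc_nat (enc_list enc_nat))" by (rule fp_eta) (intro fp_enc_prod fp_id n ln)
  have e: "fp (enc_prod (enc_prod enc_nat enc_nat) (enc_list (enc_prod enc_nat enc_nat)))"
    by (rule fp_eta) (intro fp_enc_prod fp_id pn lpn)
  have lv: "fp (enc_list (enc_prod enc_nat (enc_list enc_nat)))"
    by (rule fp_eta) (intro fp_enc_list fp_id v)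
  have le: "fp (enc_list (enc_prod (enc_prod enc_nat enc_nat) (enc_list (enc_prod enc_nat enc_nat))))"
    by (rule fp_eta) (intro fp_enc_list fp_id e)
  have lr: "fp (enc_list (enc_list (enc_prod enc_nat enc_nat)))"
    by (rule fp_eta) (intro fp_enc_list fp_id lpn)
  have ler: "fp (enc_prod (enc_list (enc_prod (enc_prod enc_nat enc_nat) (enc_list (enc_prod enc_nat enc_nat))))
      (enc_list (enc_list (enc_prod enc_nat enc_nat))))"
    by (rule fp_eta) (intro fp_enc_prod fp_id le lr)
  show ?thesis unfolding enc_instance_def
    by (rule fp_eta) (intro fp_enc_prod fp_id lv ler)
qed

text \<open>Links \<open>sz\<close>, in which all bounds are computed, with the length of the
  encoding. The added 1 pays for the constructor of a pair; the factor 4 is attained by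
  \<open>True\<close>, with size 3 and a single bit.\<close>

definition short_data :: "('a::data \<Rightarrow> bool list) \<Rightarrow> bool" where
  "short_data f \<longleftrightarrow> (\<forall>x. sz x + 1 \<le> 4 * length (f x))"

lemma short_data_bool: "short_data enc_bool"
  using sz_bool by (auto simp: short_data_def enc_bool_def)

lemma short_data_list:
  assumes "short_data f"
  shows "short_data (enc_list f)"
  unfolding short_data_def
proof
  fix xs
  show "sz xs + 1 \<le> 4 * length (enc_list f xs)"
  proof (induction xs)
    case (Cons x xs)
    have "sz x + 1 \<le> 4 * length (f x)" using assms by (simp add: short_data_def)
    then show ?case using Cons by (simp add: enc_list_def)
  qed (simp add: enc_list_def)
qed

lemma short_data_prod: "short_data f \<Longrightarrow> short_data g \<Longrightarrow> short_data (enc_prod f g)"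
  unfolding short_data_def
proof
  fix p
  assume "\<forall>x. sz x + 1 \<le> 4 * length (f x)" "\<forall>x. sz x + 1 \<le> 4 * length (g x)"
  then have "sz (fst p) + 1 \<le> 4 * length (f (fst p))" "sz (snd p) + 1 \<le> 4 * length (g (snd p))"
    by blast+
  then show "sz p + 1 \<le> 4 * length (enc_prod f g p)"
    by (cases p) (simp add: enc_prod_def)
qed

lemma short_data_nat: "short_data enc_nat"
  using short_data_list[OF short_data_bool] by (simp add: short_data_def enc_nat_def sz_nat_def)

lemma short_data_instance: "short_data enc_instance"
  unfolding enc_instance_def
  by (intro short_data_prod short_data_list short_data_nat)

section \<open>Deciding the conditions on instances\<close>

definition inst_tverts :: "edtsb_instance \<Rightarrow> (nat \<times> nat) list" where
  "inst_tverts I = concat (map (\<lambda>p. map (\<lambda>t. (fst p, t)) (snd p)) (fst I))"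

definition inst_tedges :: "edtsb_instance \<Rightarrow> ((nat \<times> nat) \<times> (nat \<times> nat)) list" where
  "inst_tedges I = concat (map (\<lambda>e. map (\<lambda>q. ((fst (fst e), fst q), (snd (fst e), snd q))) (snd e)) (fst (snd I)))"

lemma set_inst_tverts: "set (inst_tverts I) = tverts (inst_digraph I)"
  by (cases I) (force simp: inst_tverts_def tverts_def)

lemma set_inst_tedges: "set (inst_tedges I) = tedges (inst_digraph I)"
  by (cases I) (force simp: inst_tedges_def tedges_def)

definition inst_ok :: "nat \<Rightarrow> edtsb_instance \<Rightarrow> bool" where
  "inst_ok k I \<longleftrightarrow> (\<forall>e\<in>set (fst (snd I)). (\<exists>p\<in>set (fst I). fst p = fst (fst e)) \<and> (\<exists>p\<in>set (fst I). fst p = snd (fst e))) \<and>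
     (\<forall>e\<in>set (inst_tedges I). snd (fst e) \<le> snd (snd e) \<and> fst e \<in> set (inst_tverts I) \<and> snd e \<in> set (inst_tverts I)) \<and>
     length (snd (snd I)) = k \<and> (\<forall>R\<in>set (snd (snd I)). \<forall>p\<in>set R. p \<in> set (inst_tverts I))"

lemma fp_inst_tverts: "fp inst_tverts"
  unfolding inst_tverts_def by (intro fp_intros)

lemma fp_inst_tedges: "fp inst_tedges"
  unfolding inst_tedges_def by (intro fp_intros)

lemma fp_inst_ok: "fp (inst_ok k)"
  unfolding inst_ok_def by (intro fp_intros fp_comp[OF fp_inst_tverts] fp_comp[OF fp_inst_tedges])

lemma temporal_inst_iff:
  "temporal_digraph (inst_digraph I) \<longleftrightarrow>
     (\<forall>e\<in>set (fst (snd I)). (\<exists>p\<in>set (fst I). fst p = fst (fst e)) \<and> (\<exists>p\<in>set (fst I). fst p = snd (fst e))) \<and>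
     (\<forall>e\<in>set (inst_tedges I). snd (fst e) \<le> snd (snd e) \<and> fst e \<in> set (inst_tverts I) \<and> snd e \<in> set (inst_tverts I))"
  (is "?L \<longleftrightarrow> ?A \<and> ?B")
proof
  assume L: ?L
  interpret pair_fin_digraph "base (inst_digraph I)" using L by (simp add: temporal_digraph_def)
  have ?A
  proof
    fix e assume "e \<in> set (fst (snd I))"
    then have "fst e \<in> parcs (base (inst_digraph I))" by (cases I) auto
    then have "fst (fst e) \<in> pverts (base (inst_digraph I))" "snd (fst e) \<in> pverts (base (inst_digraph I))"
      using arc_fst_in_verts arc_snd_in_verts by blast+
    moreover have v: "pverts (base (inst_digraph I)) = fst ` set (fst I)" by (cases I) simp
    ultimately have "fst (fst e) \<in> fst ` set (fst I)" "snd (fst e) \<in> fst ` set (fst I)"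
      unfolding v by blast+
    then obtain p q where "p \<in> set (fst I)" "fst (fst e) = fst p" "q \<in> set (fst I)" "snd (fst e) = fst q"
      by (elim imageE)
    then show "(\<exists>p\<in>set (fst I). fst p = fst (fst e)) \<and> (\<exists>p\<in>set (fst I). fst p = snd (fst e))"
      by (intro conjI bexI[of _ p] bexI[of _ q]) simp_all
  qed
  moreover have ?B
  proof
    fix e assume "e \<in> set (inst_tedges I)"
    then have e: "(fst e, snd e) \<in> tedges (inst_digraph I)" by (simp add: set_inst_tedges)
    then have "snd (fst e) \<le> snd (snd e)"
      using L unfolding temporal_digraph_def tedges_def by fastforce
    then show "snd (fst e) \<le> snd (snd e) \<and> fst e \<in> set (inst_tverts I) \<and> snd e \<in> set (inst_tverts I)"
      using tedges_tverts[OF L e] by (simp add: set_inst_tverts)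
  qed
  ultimately show "?A \<and> ?B" by blast
next
  assume AB: "?A \<and> ?B"
  have "pair_fin_digraph (base (inst_digraph I))"
  proof
    fix e assume "e \<in> parcs (base (inst_digraph I))"
    then obtain x where x: "x \<in> set (fst (snd I))" "fst x = e" by (cases I) auto
    then have "\<exists>p\<in>set (fst I). fst p = fst e" "\<exists>p\<in>set (fst I). fst p = snd e" using AB by blast+
    then show "fst e \<in> pverts (base (inst_digraph I))" "snd e \<in> pverts (base (inst_digraph I))"
      by (cases I; force)+
  next
    show "finite (pverts (base (inst_digraph I)))" "finite (parcs (base (inst_digraph I)))"
      by (cases I; simp)+
  qed
  moreover have "finite (act (inst_digraph I) v)" for v
  proof -
    have "act (inst_digraph I) v \<subseteq> snd ` set (inst_tverts I)"
      by (cases I) (force simp: inst_tverts_def)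
    then show ?thesis by (rule finite_subset) simp
  qed
  moreover have "t \<le> t' \<and> t \<in> act (inst_digraph I) u \<and> t' \<in> act (inst_digraph I) v"
    if "(u, v) \<in> parcs (base (inst_digraph I))" "(t, t') \<in> link (inst_digraph I) (u, v)" for u v t t'
  proof -
    have "((u, t), (v, t')) \<in> set (inst_tedges I)" using that by (auto simp: set_inst_tedges tedges_def)
    then have "t \<le> t' \<and> (u, t) \<in> set (inst_tverts I) \<and> (v, t') \<in> set (inst_tverts I)" using AB by fastforce
    then show ?thesis by (simp add: set_inst_tverts tverts_def)
  qed
  ultimately show ?L unfolding temporal_digraph_def by blast
qed

lemma edtsb_instances_iff: "I \<in> edtsb_instances k \<longleftrightarrow> inst_ok k I"
proof -
  have r: "inst_roots I = map set (snd (snd I))" by (cases I) simp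
  show ?thesis
    unfolding edtsb_instances_def mem_Collect_eq temporal_inst_iff inst_ok_def r
    by (auto simp: set_inst_tverts)
qed

text \<open>The first two conditions say that snapshots have size at most 1. A star is acyclic iff
  it has no two opposite arcs; the case \<open>e = f\<close> excludes loops.\<close>

definition star_ok :: "edtsb_instance \<Rightarrow> bool" where
  "star_ok I \<longleftrightarrow> (\<forall>p\<in>set (inst_tverts I). \<forall>q\<in>set (inst_tverts I). snd p = snd q \<longrightarrow> p = q) \<and>
     (\<forall>e\<in>set (inst_tedges I). snd (fst e) \<noteq> snd (snd e)) \<and>
     (\<forall>e\<in>set (fst (snd I)). \<forall>f\<in>set (fst (snd I)). \<not> (fst (fst e) = snd (fst f) \<and> snd (fst e) = fst (fst f))) \<and>
     (\<exists>c\<in>set (fst I). (\<forall>e\<in>set (fst (snd I)). fst (fst e) = fst c \<or> snd (fst e) = fst c) \<and>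
       (\<forall>v\<in>set (fst I). fst v = fst c \<or> (\<exists>e\<in>set (fst (snd I)).
         (fst (fst e) = fst c \<and> snd (fst e) = fst v) \<or> (snd (fst e) = fst c \<and> fst (fst e) = fst v))))"

lemma fp_star_ok: "fp star_ok"
  unfolding star_ok_def
  by (intro fp_intros fp_comp[OF fp_inst_tverts] fp_comp[OF fp_inst_tedges])

lemma star_acyclic_iff:
  assumes wf: "\<And>u v. (u, v) \<in> parcs G \<Longrightarrow> u \<in> pverts G \<and> v \<in> pverts G"
  shows "acyclic (parcs G) \<and> underlying_star G \<longleftrightarrow>
    (\<forall>u v. (u, v) \<in> parcs G \<longrightarrow> (v, u) \<notin> parcs G) \<and>
    (\<exists>c\<in>pverts G. (\<forall>(u, v)\<in>parcs G. u = c \<or> v = c) \<and>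
      (\<forall>v\<in>pverts G. v = c \<or> (c, v) \<in> parcs G \<or> (v, c) \<in> parcs G))" (is "?L \<longleftrightarrow> ?A \<and> ?S")
proof
  assume L: ?L
  have ?A
  proof (intro allI impI notI)
    fix u v assume "(u, v) \<in> parcs G" "(v, u) \<in> parcs G"
    then have "(u, u) \<in> (parcs G)\<^sup>+" by (meson trancl.simps)
    then show False using L by (auto simp: acyclic_def)
  qed
  moreover have ?S
  proof -
    obtain c where c: "c \<in> pverts G" "{{u, v} | u v. (u, v) \<in> parcs G} = {{c, v} | v. v \<in> pverts G - {c}}"
      using L unfolding underlying_star_def by blast
    show ?thesis
    proof (intro bexI[OF _ c(1)] conjI ballI, clarify)
      fix u v assume "(u, v) \<in> parcs G" "v \<noteq> c"
      then have "{u, v} \<in> {{c, v} | v. v \<in> pverts G - {c}}" using c(2) by blast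
      then show "u = c" using \<open>v \<noteq> c\<close> by (auto simp: doubleton_eq_iff)
    next
      fix v assume v: "v \<in> pverts G"
      show "v = c \<or> (c, v) \<in> parcs G \<or> (v, c) \<in> parcs G"
      proof (cases "v = c")
        case False
        then have "{c, v} \<in> {{u, v} | u v. (u, v) \<in> parcs G}" using c(2) v by blast
        then show ?thesis by (auto simp: doubleton_eq_iff)
      qed simp
    qed
  qed
  ultimately show "?A \<and> ?S" by blast
next
  assume AS: "?A \<and> ?S"
  then obtain c where c: "c \<in> pverts G" "\<And>u v. (u, v) \<in> parcs G \<Longrightarrow> u = c \<or> v = c"
      "\<And>v. v \<in> pverts G \<Longrightarrow> v = c \<or> (c, v) \<in> parcs G \<or> (v, c) \<in> parcs G" by blast
  have noloop: "(u, u) \<notin> parcs G" for u using AS by blast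
  \<comment> \<open>A topological order: arcs into the centre start at level 0, arcs out of it end
    at level 2.\<close>
  define f where "f v = (if v = c then 1 else if (c, v) \<in> parcs G then 2 else 0 :: nat)" for v
  have "f u < f v" if "(u, v) \<in> parcs G" for u v
    using c(2)[OF that] that noloop AS by (auto simp: f_def)
  then have "parcs G \<subseteq> inv_image less_than f" by auto
  then have "acyclic (parcs G)"
    by (metis acyclic_subset wf_acyclic wf_inv_image wf_less_than)
  moreover have "{{u, v} | u v. (u, v) \<in> parcs G} = {{c, v} | v. v \<in> pverts G - {c}}"
  proof (intro equalityI subsetI)
    fix x assume "x \<in> {{u, v} | u v. (u, v) \<in> parcs G}"
    then obtain u v where x: "x = {u, v}" "(u, v) \<in> parcs G" by blast
    moreover have "u \<noteq> v" using noloop x by blast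
    ultimately show "x \<in> {{c, v} | v. v \<in> pverts G - {c}}" using c(2)[OF x(2)] wf[OF x(2)] by blast
  next
    fix x assume "x \<in> {{c, v} | v. v \<in> pverts G - {c}}"
    then obtain v where "x = {c, v}" "v \<in> pverts G" "v \<noteq> c" by blast
    then show "x \<in> {{u, v} | u v. (u, v) \<in> parcs G}" using c(3)[of v] by blast
  qed
  ultimately show ?L using c(1) unfolding underlying_star_def by blast
qed

text \<open>An edge in a snapshot brings a vertex with it, so such a snapshot has size at least
  2.\<close>

lemma snapshot_size_iff:
  assumes D: "temporal_digraph D"
  shows "(\<forall>t. digraph_size (snapshot D t) \<le> 1) \<longleftrightarrow>
    (\<forall>p\<in>tverts D. \<forall>q\<in>tverts D. snd p = snd q \<longrightarrow> p = q) \<and> (\<forall>e\<in>tedges D. snd (fst e) \<noteq> snd (snd e))"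
proof -
  interpret pair_fin_digraph "base D" using D by (simp add: temporal_digraph_def)
  let ?V = "\<lambda>t. {v \<in> pverts (base D). t \<in> act D v}" and ?E = "\<lambda>t. {e \<in> parcs (base D). (t, t) \<in> link D e}"
  have fin: "finite (?V t)" "finite (?E t)" for t
    using finite_verts finite_arcs by auto
  have s: "digraph_size (snapshot D t) = card (?V t) + card (?E t)" for t
    by (simp add: digraph_size_def snapshot_def)
  have E: "?E t = {} \<longleftrightarrow> (\<forall>e\<in>tedges D. \<not> (snd (fst e) = t \<and> snd (snd e) = t))" for t
    by (force simp: tedges_def)
  have V: "?V t \<noteq> {}" if ne: "?E t \<noteq> {}" for t
  proof -
    obtain e where e: "e \<in> tedges D" "snd (fst e) = t" using ne E[of t] by blast
    then have "fst e \<in> tverts D" using tedges_tverts(1)[OF D, of "fst e" "snd e"] by simp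
    then show ?thesis using e(2) by (auto simp: tverts_def)
  qed
  have V1: "card (?V t) \<le> 1 \<longleftrightarrow> (\<forall>p\<in>tverts D. \<forall>q\<in>tverts D. snd p = t \<and> snd q = t \<longrightarrow> p = q)" for t
    using card_le_Suc0_iff_eq[OF fin(1)[of t]] by (fastforce simp: tverts_def)
  have "digraph_size (snapshot D t) \<le> 1 \<longleftrightarrow> card (?V t) \<le> 1 \<and> ?E t = {}" for t
  proof (cases "?E t = {}")
    case False
    then have "card (?V t) \<noteq> 0" "card (?E t) \<noteq> 0" using V[OF False] fin[of t] by (simp_all only: card_0_eq) auto
    then show ?thesis using s[of t] False by linarith
  qed (simp only: s card.empty add_0_right simp_thms)
  note l = this[unfolded V1 E]
  have "(\<forall>t. \<forall>p\<in>tverts D. \<forall>q\<in>tverts D. snd p = t \<and> snd q = t \<longrightarrow> p = q) \<longleftrightarrow>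
    (\<forall>p\<in>tverts D. \<forall>q\<in>tverts D. snd p = snd q \<longrightarrow> p = q)" by metis
  moreover have "(\<forall>t. \<forall>e\<in>tedges D. \<not> (snd (fst e) = t \<and> snd (snd e) = t)) \<longleftrightarrow>
    (\<forall>e\<in>tedges D. snd (fst e) \<noteq> snd (snd e))" by metis
  ultimately show ?thesis unfolding l all_conj_distrib by (rule arg_cong2[of _ _ _ _ "(\<and>)"])
qed

lemma restricted_instances_iff: "I \<in> restricted_instances k 1 \<longleftrightarrow> inst_ok k I \<and> star_ok I"
proof (cases "inst_ok k I")
  case True
  then have I: "I \<in> edtsb_instances k" by (simp add: edtsb_instances_iff)
  then have D: "temporal_digraph (inst_digraph I)" by (simp add: edtsb_instances_def)
  interpret pair_fin_digraph "base (inst_digraph I)" using D by (simp add: temporal_digraph_def)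
  let ?G = "base (inst_digraph I)"
  have arcs: "parcs ?G = fst ` set (fst (snd I))" and verts: "pverts ?G = fst ` set (fst I)"
    by (cases I; simp)+
  have mem: "(u, v) \<in> parcs ?G \<longleftrightarrow> (\<exists>e\<in>set (fst (snd I)). fst (fst e) = u \<and> snd (fst e) = v)" for u v
    unfolding arcs by force
  have wf: "\<And>u v. (u, v) \<in> parcs ?G \<Longrightarrow> u \<in> pverts ?G \<and> v \<in> pverts ?G"
    by (auto dest: in_arcsD1 in_arcsD2)
  have A: "(\<forall>u v. (u, v) \<in> parcs ?G \<longrightarrow> (v, u) \<notin> parcs ?G) \<longleftrightarrow>
      (\<forall>e\<in>set (fst (snd I)). \<forall>f\<in>set (fst (snd I)). \<not> (fst (fst e) = snd (fst f) \<and> snd (fst e) = fst (fst f)))"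
    unfolding mem by metis
  have B: "(\<forall>(u, v)\<in>parcs ?G. u = c \<or> v = c) \<longleftrightarrow> (\<forall>e\<in>set (fst (snd I)). fst (fst e) = c \<or> snd (fst e) = c)" for c
    unfolding arcs by (simp add: case_prod_beta)
  have C: "(c, v) \<in> parcs ?G \<or> (v, c) \<in> parcs ?G \<longleftrightarrow> (\<exists>e\<in>set (fst (snd I)).
         (fst (fst e) = c \<and> snd (fst e) = v) \<or> (snd (fst e) = c \<and> fst (fst e) = v))" for c v
    unfolding mem by blast
  have "acyclic (parcs ?G) \<and> underlying_star ?G \<longleftrightarrow>
    (\<forall>u v. (u, v) \<in> parcs ?G \<longrightarrow> (v, u) \<notin> parcs ?G) \<and>
    (\<exists>c\<in>pverts ?G. (\<forall>(u, v)\<in>parcs ?G. u = c \<or> v = c) \<and>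
      (\<forall>v\<in>pverts ?G. v = c \<or> (c, v) \<in> parcs ?G \<or> (v, c) \<in> parcs ?G))"
    by (rule star_acyclic_iff) (rule wf)
  note s = this[unfolded A B C verts ball_simps bex_simps]
  have "I \<in> restricted_instances k 1 \<longleftrightarrow> (acyclic (parcs ?G) \<and> underlying_star ?G) \<and>
      (\<forall>t. digraph_size (snapshot (inst_digraph I) t) \<le> 1)"
    using I unfolding restricted_instances_def by blast
  also have "\<dots> \<longleftrightarrow> star_ok I"
    unfolding snapshot_size_iff[OF D] s star_ok_def set_inst_tverts set_inst_tedges
    by (rule iffI; elim conjE; intro conjI; assumption)
  finally show ?thesis using True by blast
qed (auto simp: restricted_instances_def edtsb_instances_iff)

section \<open>Certificates for branchings\<close>

type_synonym branching_cert = "((nat \<times> nat) \<times> (nat \<times> nat)) list \<times> ((nat \<times> nat) \<times> nat) list"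

text \<open>The second component of the certificate is the graph of the rank in
  \<open>good_edges\<close>, so that the absence of cycles can be checked edge by edge.\<close>

definition cert_ok :: "edtsb_instance \<Rightarrow> (nat \<times> nat) list \<Rightarrow> branching_cert \<Rightarrow> bool" where
  "cert_ok I R c \<longleftrightarrow> (\<forall>e\<in>set (fst c). e \<in> set (inst_tedges I)) \<and>
     (\<forall>p\<in>set (inst_tverts I).
       if p \<in> set R then \<not> (\<exists>q\<in>set (inst_tverts I). fst p = fst q \<and> snd p = Suc (snd q)) \<and> (\<forall>e\<in>set (fst c). snd e \<noteq> p)
       else if \<exists>q\<in>set (inst_tverts I). fst p = fst q \<and> snd p = Suc (snd q) then \<forall>e\<in>set (fst c). snd e \<noteq> p
       else (\<exists>e\<in>set (fst c). snd e = p) \<and> (\<forall>e\<in>set (fst c). \<forall>f\<in>set (fst c). snd e = p \<and> snd f = p \<longrightarrow> e = f)) \<and>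
     (\<forall>a\<in>set (snd c). \<forall>b\<in>set (snd c). fst a = fst b \<longrightarrow> a = b) \<and>
     (\<forall>e\<in>set (fst c). \<exists>a\<in>set (snd c). \<exists>b\<in>set (snd c). fst a = fst e \<and> fst b = snd e \<and> snd a < snd b) \<and>
     (\<forall>q\<in>set (inst_tverts I). \<forall>p\<in>set (inst_tverts I). fst p = fst q \<and> snd p = Suc (snd q) \<longrightarrow>
       (\<exists>a\<in>set (snd c). \<exists>b\<in>set (snd c). fst a = q \<and> fst b = p \<and> snd a < snd b))"

lemma fp_cert_ok: "fp (\<lambda>p. cert_ok (fst p) (fst (snd p)) (snd (snd p)))"
  unfolding cert_ok_def
  by (intro fp_intros fp_comp[OF fp_inst_tverts] fp_comp[OF fp_inst_tedges])

lemma ex1_pair_iff: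
  "(\<exists>!q. (q, p) \<in> S) \<longleftrightarrow> (\<exists>e\<in>S. snd e = p) \<and> (\<forall>e\<in>S. \<forall>f\<in>S. snd e = p \<and> snd f = p \<longrightarrow> e = f)"
proof
  assume "\<exists>!q. (q, p) \<in> S"
  then obtain q where q: "(q, p) \<in> S" "\<And>q'. (q', p) \<in> S \<Longrightarrow> q' = q" by (elim ex1E) blast
  have e: "e = (q, p)" if "e \<in> S" "snd e = p" for e using that q(2)[of "fst e"] by (cases e) simp
  show "(\<exists>e\<in>S. snd e = p) \<and> (\<forall>e\<in>S. \<forall>f\<in>S. snd e = p \<and> snd f = p \<longrightarrow> e = f)"
  proof (intro conjI ballI impI)
    show "\<exists>e\<in>S. snd e = p" by (rule bexI[OF _ q(1)]) simp
    fix e f assume "e \<in> S" "f \<in> S" "snd e = p \<and> snd f = p"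
    then show "e = f" using e[of e] e[of f] by simp
  qed
next
  assume *: "(\<exists>e\<in>S. snd e = p) \<and> (\<forall>e\<in>S. \<forall>f\<in>S. snd e = p \<and> snd f = p \<longrightarrow> e = f)"
  then obtain e where e: "e \<in> S" "snd e = p" by (elim conjE bexE)
  show "\<exists>!q. (q, p) \<in> S"
  proof (rule ex1I[of _ "fst e"])
    show "(fst e, p) \<in> S" using e by (cases e) simp
    fix q assume q: "(q, p) \<in> S"
    have "(q, p) = e" using bspec[OF bspec[OF conjunct2[OF *] q] e(1)] e(2) by simp
    then show "q = fst e" by auto
  qed
qed

lemma cert_ok_good:
  assumes "cert_ok I R c"
  shows "good_edges (inst_digraph I) (set R) (set (fst c))"
proof -
  let ?D = "inst_digraph I"
  note c = assms[unfolded cert_ok_def set_inst_tverts set_inst_tedges]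
  have w: "wait_in ?D p \<longleftrightarrow> (\<exists>q\<in>tverts ?D. fst p = fst q \<and> snd p = Suc (snd q))" for p
    unfolding wait_in_iff by (metis fst_conv prod.collapse snd_conv)
  define rank where "rank p = (THE n. (p, n) \<in> set (snd c))" for p
  have rank: "rank (fst a) = snd a" if a: "a \<in> set (snd c)" for a
    unfolding rank_def
  proof (rule the_equality)
    fix n assume "(fst a, n) \<in> set (snd c)"
    then show "n = snd a" using c a by (metis fst_conv snd_conv)
  qed (use a in simp)
  have r1: "rank (fst e) < rank (snd e)" if "e \<in> set (fst c)" for e
    using c that rank by metis
  have r2: "rank q < rank p" if "q \<in> tverts ?D" "p \<in> tverts ?D" "fst p = fst q" "snd p = Suc (snd q)" for p q
    using c that rank by metis
  show ?thesis unfolding good_edges_def w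
  proof (intro conjI ballI)
    show "set (fst c) \<subseteq> tedges ?D" using c by blast
    have "\<forall>(q, p)\<in>set (fst c). rank q < rank p" using r1 by auto
    moreover have "\<forall>v t. (v, t) \<in> tverts ?D \<longrightarrow> (v, Suc t) \<in> tverts ?D \<longrightarrow> rank (v, t) < rank (v, Suc t)"
      using r2 by auto
    ultimately show "\<exists>rank :: nat \<times> nat \<Rightarrow> nat. (\<forall>(q, p)\<in>set (fst c). rank q < rank p) \<and>
        (\<forall>v t. (v, t) \<in> tverts ?D \<longrightarrow> (v, Suc t) \<in> tverts ?D \<longrightarrow> rank (v, t) < rank (v, Suc t))" by blast
    fix p assume p: "p \<in> tverts ?D"
    have e1: "(\<forall>q. (q, p) \<notin> set (fst c)) \<longleftrightarrow> (\<forall>e\<in>set (fst c). snd e \<noteq> p)" by force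
    have e2: "(\<exists>!q. (q, p) \<in> set (fst c)) \<longleftrightarrow> (\<exists>e\<in>set (fst c). snd e = p) \<and>
        (\<forall>e\<in>set (fst c). \<forall>f\<in>set (fst c). snd e = p \<and> snd f = p \<longrightarrow> e = f)"
      by (rule ex1_pair_iff)
    show "if p \<in> set R then \<not> (\<exists>q\<in>tverts ?D. fst p = fst q \<and> snd p = Suc (snd q)) \<and> (\<forall>q. (q, p) \<notin> set (fst c))
      else if \<exists>q\<in>tverts ?D. fst p = fst q \<and> snd p = Suc (snd q) then \<forall>q. (q, p) \<notin> set (fst c)
      else \<exists>!q. (q, p) \<in> set (fst c)"
      unfolding e1 e2 using c p by blast
  qed
qed

lemma good_cert_ok:
  assumes D: "temporal_digraph (inst_digraph I)" and g: "good_edges (inst_digraph I) (set R) S"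
  obtains c where "cert_ok I R c" "set (fst c) = S" "sz (fst c) \<le> sz (inst_tedges I)"
    "sz (snd c) \<le> 1 + sz (inst_tverts I) * (5 * sz (inst_tverts I) + 3)"
proof -
  let ?D = "inst_digraph I" and ?T = "inst_tverts I"
  obtain rank :: "nat \<times> nat \<Rightarrow> nat" where rank: "\<And>q p. (q, p) \<in> S \<Longrightarrow> rank q < rank p"
    "\<And>v t. (v, t) \<in> tverts ?D \<Longrightarrow> (v, Suc t) \<in> tverts ?D \<Longrightarrow> rank (v, t) < rank (v, Suc t)"
    using g unfolding good_edges_def by blast
  \<comment> \<open>The values of \<open>rank\<close> may be arbitrarily large. Counting the
    temporal vertices of smaller rank keeps strict inequalities and bounds the values by the size of
    the instance.\<close>
  define rk where "rk p = card {q \<in> set ?T. rank q < rank p}" for p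
  have rk: "rk q < rk p" if "q \<in> set ?T" "rank q < rank p" for p q
    unfolding rk_def using that by (intro psubset_card_mono) auto
  have rk_le: "rk p \<le> sz ?T" for p
  proof -
    have "rk p \<le> card (set ?T)" unfolding rk_def by (intro card_mono) auto
    then show ?thesis using card_length[of ?T] length_le_sz[of ?T] by linarith
  qed
  define c where "c = (filter (\<lambda>e. e \<in> S) (inst_tedges I), map (\<lambda>p. (p, rk p)) ?T)"
  have S: "S \<subseteq> set (inst_tedges I)" using g by (simp add: good_edges_def set_inst_tedges)
  then have set: "set (fst c) = S" by (auto simp: c_def)
  have w: "wait_in ?D p \<longleftrightarrow> (\<exists>q\<in>tverts ?D. fst p = fst q \<and> snd p = Suc (snd q))" for p
    unfolding wait_in_iff by (metis fst_conv prod.collapse snd_conv)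
  have rks: "\<exists>a\<in>set (snd c). \<exists>b\<in>set (snd c). fst a = q \<and> fst b = p \<and> snd a < snd b"
    if "q \<in> set ?T" "p \<in> set ?T" "rank q < rank p" for p q
    using that rk[OF that(1,3)] by (auto simp: c_def)
  have "cert_ok I R c" unfolding cert_ok_def set
  proof (intro conjI ballI impI)
    fix p assume p: "p \<in> set ?T"
    have e1: "(\<forall>q. (q, p) \<notin> S) \<longleftrightarrow> (\<forall>e\<in>S. snd e \<noteq> p)" by force
    have e2: "(\<exists>!q. (q, p) \<in> S) \<longleftrightarrow> (\<exists>e\<in>S. snd e = p) \<and>
        (\<forall>e\<in>S. \<forall>f\<in>S. snd e = p \<and> snd f = p \<longrightarrow> e = f)"
      by (rule ex1_pair_iff)
    show "if p \<in> set R then \<not> (\<exists>q\<in>set ?T. fst p = fst q \<and> snd p = Suc (snd q)) \<and> (\<forall>e\<in>S. snd e \<noteq> p)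
       else if \<exists>q\<in>set ?T. fst p = fst q \<and> snd p = Suc (snd q) then \<forall>e\<in>S. snd e \<noteq> p
       else (\<exists>e\<in>S. snd e = p) \<and> (\<forall>e\<in>S. \<forall>f\<in>S. snd e = p \<and> snd f = p \<longrightarrow> e = f)"
      using g p unfolding good_edges_def w set_inst_tverts e1[symmetric] e2[symmetric] by (elim conjE bspec)
  next
    fix e assume e: "e \<in> S"
    then have "(fst e, snd e) \<in> tedges ?D" using S by (auto simp: set_inst_tedges)
    from tedges_tverts[OF D this]
    show "\<exists>a\<in>set (snd c). \<exists>b\<in>set (snd c). fst a = fst e \<and> fst b = snd e \<and> snd a < snd b"
      using rank(1)[of "fst e" "snd e"] e by (intro rks) (simp_all add: set_inst_tverts)
  next
    fix q p assume "q \<in> set ?T" "p \<in> set ?T" "fst p = fst q \<and> snd p = Suc (snd q)"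
    moreover from this have "p = (fst q, Suc (snd q))" by (simp add: prod_eq_iff)
    ultimately show "\<exists>a\<in>set (snd c). \<exists>b\<in>set (snd c). fst a = q \<and> fst b = p \<and> snd a < snd b"
      using rank(2)[of "fst q" "snd q"] by (intro rks) (simp_all add: set_inst_tverts)
  qed (use S in \<open>auto simp: c_def\<close>)
  moreover have "sz (snd c) \<le> 1 + sz ?T * (5 * sz ?T + 3)"
  proof -
    have "sz (snd c) \<le> 1 + length (snd c) * ((5 * sz ?T + 2) + 1)"
    proof (rule sz_list_le)
      fix x assume "x \<in> set (snd c)"
      then obtain p where "x = (p, rk p)" "p \<in> set ?T" by (auto simp: c_def)
      then show "sz x \<le> 5 * sz ?T + 2"
        using sz_elem[of p ?T] rk_le[of p] sz_nat_le[of "rk p"] by simp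
    qed
    also have "length (snd c) * ((5 * sz ?T + 2) + 1) \<le> sz ?T * (5 * sz ?T + 3)"
      using length_le_sz[of ?T] by (intro mult_mono) (simp_all add: c_def)
    finally show ?thesis by simp
  qed
  moreover have "sz (fst c) \<le> sz (inst_tedges I)"
    using sz_filter[of "\<lambda>e. e \<in> S" "inst_tedges I"] by (simp add: c_def)
  ultimately show ?thesis using set by (intro that[of c])
qed

definition certs_ok :: "nat \<Rightarrow> edtsb_instance \<Rightarrow> branching_cert list \<Rightarrow> bool" where
  "certs_ok k I cs \<longleftrightarrow> length cs = k \<and>
     (\<forall>a\<in>set (List.enumerate 0 cs). \<forall>r\<in>set (List.enumerate 0 (snd (snd I))). fst a = fst r \<longrightarrow> cert_ok I (snd r) (snd a)) \<and>
     (\<forall>a\<in>set (List.enumerate 0 cs). \<forall>b\<in>set (List.enumerate 0 cs). fst a \<noteq> fst b \<longrightarrow>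
       (\<forall>e\<in>set (fst (snd a)). \<forall>f\<in>set (fst (snd b)). (fst (fst e), fst (snd e)) \<noteq> (fst (fst f), fst (snd f))))"

lemma fp_certs_ok: "fp (\<lambda>p. certs_ok k (fst p) (snd p))"
  unfolding certs_ok_def by (intro fp_intros fp_comp3[OF fp_cert_ok])

lemma certs_ok_iff:
  assumes "length (snd (snd I)) = k"
  shows "certs_ok k I cs \<longleftrightarrow> length cs = k \<and> (\<forall>i<k. cert_ok I (snd (snd I) ! i) (cs ! i)) \<and>
    (\<forall>i<k. \<forall>j<k. i \<noteq> j \<longrightarrow> edge_arcs (set (fst (cs ! i))) \<inter> edge_arcs (set (fst (cs ! j))) = {})"
proof (cases "length cs = k")
  case True
  have B: "(\<forall>a\<in>set (List.enumerate 0 xs). P a) \<longleftrightarrow> (\<forall>i<length xs. P (i, xs ! i))" for P and xs :: "'x list"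
    by (auto simp: in_set_enumerate_eq)
  have "edge_arcs S \<inter> edge_arcs S' = {} \<longleftrightarrow>
    (\<forall>e\<in>S. \<forall>f\<in>S'. (fst (fst e), fst (snd e)) \<noteq> (fst (fst f), fst (snd f)))" for S S' :: "((nat \<times> nat) \<times> nat \<times> nat) set"
    by (auto simp: edge_arcs_def case_prod_beta)
  then show ?thesis unfolding certs_ok_def B using True assms by auto
qed (simp add: certs_ok_def)

lemma edtsb_in_NP:
  assumes ok: "fp ok" and II: "\<And>I. I \<in> \<I> \<longleftrightarrow> inst_ok k I \<and> ok I"
  shows "edtsb_language \<I> \<in> class_NP"
proof -
  define cI where "cI = (cast_prod (cast_list (cast_prod cast_nat (cast_list cast_nat)))
    (cast_prod (cast_list (cast_prod (cast_prod cast_nat cast_nat) (cast_list (cast_prod cast_nat cast_nat))))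
      (cast_list (cast_list (cast_prod cast_nat cast_nat)))) :: tree \<Rightarrow> edtsb_instance)"
  define cC where "cC = (cast_list (cast_prod
    (cast_list (cast_prod (cast_prod cast_nat cast_nat) (cast_prod cast_nat cast_nat)))
    (cast_list (cast_prod (cast_prod cast_nat cast_nat) cast_nat))) :: tree \<Rightarrow> branching_cert list)"
  have cI: "cI (tr I) = I" "fp cI" for I
    unfolding cI_def by (intro cast_prod_tr cast_list_tr cast_nat_tr) (intro fp_intros)
  have cC: "cC (tr cs) = cs" "fp cC" for cs
    unfolding cC_def by (intro cast_prod_tr cast_list_tr cast_nat_tr) (intro fp_intros)
  \<comment> \<open>The instance is guessed along with the branchings and compared with the input
    through its encoding, so inputs never have to be decoded.\<close>
  define V where "V x t \<longleftrightarrow> (case t of Leaf \<Rightarrow> False | Node l r \<Rightarrow>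
    x = enc_instance (cI l) \<and> inst_ok k (cI l) \<and> ok (cI l) \<and> certs_ok k (cI l) (cC r))" for x t
  have roots: "map set (snd (snd I)) = inst_roots I" for I by (cases I) simp
  have yes: "edtsb_yes I \<longleftrightarrow> (\<exists>Ss. length Ss = k \<and>
      (\<forall>i<k. good_edges (inst_digraph I) (set (snd (snd I) ! i)) (Ss ! i)) \<and>
      (\<forall>i<k. \<forall>j<k. i \<noteq> j \<longrightarrow> edge_arcs (Ss ! i) \<inter> edge_arcs (Ss ! j) = {}))"
    if "inst_ok k I" for I
  proof -
    have I: "I \<in> edtsb_instances k" using that by (simp add: edtsb_instances_iff)
    have l: "length (snd (snd I)) = k" using that by (simp add: inst_ok_def)
    have "temporal_digraph (inst_digraph I)" "\<And>R. R \<in> set (map set (snd (snd I))) \<Longrightarrow> R \<subseteq> tverts (inst_digraph I)"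
      using I unfolding edtsb_instances_def roots[symmetric] by blast+
    from has_disjoint_branchings_iff[of "inst_digraph I" "map set (snd (snd I))", OF this]
    show ?thesis unfolding edtsb_yes_def roots[symmetric]
      using l by simp
  qed
  obtain a where a: "\<And>x n. sz x \<le> n \<Longrightarrow> sz (inst_tverts x) \<le> (n + 2) ^ a" using fp_sz[OF fp_inst_tverts] by metis
  obtain b where b: "\<And>x n. sz x \<le> n \<Longrightarrow> sz (inst_tedges x) \<le> (n + 2) ^ b" using fp_sz[OF fp_inst_tedges] by metis
  let ?B = "\<lambda>l. (4 * l + 2) ^ b + (1 + (4 * l + 2) ^ a * (5 * (4 * l + 2) ^ a + 3)) + 1"
  let ?h = "\<lambda>l. 1 + 4 * l + (1 + k * (?B l + 1))"
  show ?thesis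
  proof (rule class_NP_fp)
    have "fp (\<lambda>p. V (fst p) (snd p))"
      unfolding V_def
      by (intro fp_intros fp_comp[OF cI(2)] fp_comp[OF cC(2)] fp_comp[OF ok] fp_comp[OF fp_inst_ok]
          fp_comp2[OF fp_certs_ok] fp_comp[OF fp_enc_instance])
    then show "fp (\<lambda>p. V (fst p) (snd p))" .
    show "pbd ?h" by (intro pbd_intros)
    fix x t
    assume "V x t"
    then obtain l r where t: "x = enc_instance (cI l)" "inst_ok k (cI l)" "ok (cI l)" "certs_ok k (cI l) (cC r)"
      by (auto simp: V_def split: tree.splits)
    have l: "length (snd (snd (cI l))) = k" using t(2) by (simp add: inst_ok_def)
    have "edtsb_yes (cI l)" unfolding yes[OF t(2)]
      using t(4) unfolding certs_ok_iff[OF l]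
      by (intro exI[of _ "map (\<lambda>c. set (fst c)) (cC r)"]) (auto intro: cert_ok_good)
    then show "x \<in> edtsb_language \<I>" unfolding edtsb_language_def using t II by blast
  next
    fix x assume "x \<in> edtsb_language \<I>"
    then obtain I where I: "x = enc_instance I" "inst_ok k I" "ok I" "edtsb_yes I"
      unfolding edtsb_language_def using II by blast
    have l: "length (snd (snd I)) = k" using I(2) by (simp add: inst_ok_def)
    have D: "temporal_digraph (inst_digraph I)"
      using I(2) unfolding edtsb_instances_iff[symmetric] edtsb_instances_def by blast
    obtain Ss where Ss: "length Ss = k" "\<And>i. i < k \<Longrightarrow> good_edges (inst_digraph I) (set (snd (snd I) ! i)) (Ss ! i)"
      "\<And>i j. i < k \<Longrightarrow> j < k \<Longrightarrow> i \<noteq> j \<Longrightarrow> edge_arcs (Ss ! i) \<inter> edge_arcs (Ss ! j) = {}"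
      using I(4) unfolding yes[OF I(2)] by blast
    have "\<exists>c. cert_ok I (snd (snd I) ! i) c \<and> set (fst c) = Ss ! i \<and> sz (fst c) \<le> sz (inst_tedges I) \<and>
        sz (snd c) \<le> 1 + sz (inst_tverts I) * (5 * sz (inst_tverts I) + 3)" if "i < k" for i
      using good_cert_ok[OF D Ss(2)[OF that]] by metis
    then obtain c where c: "\<And>i. i < k \<Longrightarrow> cert_ok I (snd (snd I) ! i) (c i) \<and> set (fst (c i)) = Ss ! i \<and>
        sz (fst (c i)) \<le> sz (inst_tedges I) \<and>
        sz (snd (c i)) \<le> 1 + sz (inst_tverts I) * (5 * sz (inst_tverts I) + 3)" by metis
    define cs where "cs = map c [0..<k]"
    have "certs_ok k I cs" unfolding certs_ok_iff[OF l] cs_def using c Ss by simp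
    then have V: "V x (Node (tr I) (tr cs))" using I by (simp add: V_def cI cC)
    have sI: "sz I \<le> 4 * length x" using short_data_instance I(1) unfolding short_data_def
      by (metis add_leD1)
    have "sz cs \<le> 1 + length cs * (?B (length x) + 1)"
    proof (rule sz_list_le)
      fix y assume "y \<in> set cs"
      then obtain i where i: "i < k" "y = c i" by (auto simp: cs_def)
      have "sz (inst_tverts I) * (5 * sz (inst_tverts I) + 3) \<le>
          (4 * length x + 2) ^ a * (5 * (4 * length x + 2) ^ a + 3)"
        using a[OF sI] by (intro mult_mono) auto
      moreover have "sz (c i) = 1 + sz (fst (c i)) + sz (snd (c i))" by (cases "c i") simp
      ultimately show "sz y \<le> ?B (length x)"
        using c[OF i(1)] b[OF sI] unfolding i(2) by linarith
    qed
    then have "length (tcode (Node (tr I) (tr cs))) \<le> ?h (length x)"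
      using sI by (simp add: sz_def dcode_def cs_def)
    then show "\<exists>t. length (tcode t) \<le> ?h (length x) \<and> V x t" using V by blast
  qed
qed

section \<open>The Cook-Levin theorem\<close>

lemma set_concat_map: "set (concat (map f xs)) = (\<Union>x\<in>set xs. set (f x))"
  by auto

definition horn :: "'v list \<Rightarrow> 'v \<Rightarrow> (bool \<times> 'v) list" where
  "horn ps c = map (Pair False) ps @ [(True, c)]"

lemma horn_sat: "(\<exists>(b, x)\<in>set (horn ps c). \<sigma> x = b) \<longleftrightarrow> ((\<forall>p\<in>set ps. \<sigma> p) \<longrightarrow> \<sigma> c)"
  by (auto simp: horn_def)

lemma fp_horn [fp_intros]: "fp f \<Longrightarrow> fp g \<Longrightarrow> fp (\<lambda>x. horn (f x) (g x))"
  unfolding horn_def by (intro fp_intros) (auto intro: fp_intros)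

text \<open>Shifted by 1, so that natural numbers suffice: the new position of a head is the old one
  plus the code minus 1.\<close>

definition move_code :: "move \<Rightarrow> nat" where
  "move_code m = (case m of ToLeft \<Rightarrow> 0 | Stay \<Rightarrow> 1 | ToRight \<Rightarrow> 2)"

text \<open>A halting configuration repeats itself, so a tableau of fixed length also describes
  computations that end earlier.\<close>

definition total_delta :: "tm \<Rightarrow> nat \<Rightarrow> nat list \<Rightarrow> nat \<times> (nat \<times> move) list" where
  "total_delta M q ss = (if q < states M then delta M q ss else (states M, map (\<lambda>s. (s, Stay)) ss))"

text \<open>The transition function is an arbitrary function, but its relevant part is finite and
  thus a constant, both of the reduction and of the later simulation.\<close>

definition delta_table :: "tm \<Rightarrow> (nat \<times> nat list \<times> nat \<times> (nat \<times> nat) list) list" where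
  "delta_table M = concat (map (\<lambda>q. map (\<lambda>ss. (q, ss, fst (total_delta M q ss),
     map (\<lambda>a. (fst a, move_code (snd a))) (snd (total_delta M q ss))))
     (List.n_lists (tapes M) [0..<symbols M])) [0..<Suc (states M)])"

lemma delta_table_iff: "e \<in> set (delta_table M) \<longleftrightarrow> (\<exists>q ss. q \<le> states M \<and> length ss = tapes M \<and>
    set ss \<subseteq> {..<symbols M} \<and> e = (q, ss, fst (total_delta M q ss),
     map (\<lambda>a. (fst a, move_code (snd a))) (snd (total_delta M q ss))))"
  unfolding delta_table_def set_concat_map set_map set_n_lists set_upt atLeast0LessThan
  by (auto simp: less_Suc_eq_le)

text \<open>
  The variables \<open>[0, t, j, i, s]\<close>, \<open>[1, t, j, i]\<close>, \<open>[2, t, q]\<close>, \<open>[3, t, j, s]\<close> and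
  \<open>[4, t, j, s, m]\<close> say that at time \<open>t\<close> cell \<open>i\<close> of tape \<open>j\<close> holds \<open>s\<close>, that head \<open>j\<close> is at
  cell \<open>i\<close>, that the state is \<open>q\<close>, that head \<open>j\<close> reads \<open>s\<close>, and that it writes \<open>s\<close> and makes the
  move \<open>m\<close>. Apart from the choice of the certificate and one negative clause, all clauses are
  definite, so an assignment only has to contain the facts of the computation.
\<close>

definition start_cells :: "nat \<Rightarrow> bool list \<Rightarrow> nat \<Rightarrow> nat list list" where
  "start_cells W pre P = replicate W [0] @ map (\<lambda>b. [bit_symbol b]) pre @ replicate P [0, 1, 2] @ replicate W [0]"

lemma start_cells_cases:
  assumes "i < length (start_cells W pre P)"
  obtains "i < W" "start_cells W pre P ! i = [0]"
  | u where "u < length pre" "i = W + u" "start_cells W pre P ! i = [bit_symbol (pre ! u)]"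
  | u where "u < P" "i = W + length pre + u" "start_cells W pre P ! i = [0, 1, 2]"
  | u where "i = W + length pre + P + u" "start_cells W pre P ! i = [0]"
proof -
  consider "i < W" | "W \<le> i" "i < W + length pre" | "W + length pre \<le> i" "i < W + length pre + P"
    | "W + length pre + P \<le> i" by linarith
  then show thesis
  proof cases
    case 1
    then show thesis using that(1) by (simp add: start_cells_def nth_append)
  next
    case 2
    then have "i - W < length pre" by linarith
    then show thesis using that(2)[of "i - W"] 2 by (simp add: start_cells_def nth_append)
  next
    case 3
    then have "\<not> i - W < length pre" "i - W - length pre < P" by linarith+
    then show thesis using that(3)[of "i - W - length pre"] 3 by (simp add: start_cells_def nth_append)
  next
    case 4
    then have "\<not> i - W < length pre" "\<not> i - W - length pre < P" "i - W - length pre - P < W"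
      using assms by (auto simp: start_cells_def)
    then show thesis using that(4)[of "i - W - length pre - P"] 4
      by (simp add: start_cells_def nth_append)
  qed
qed

text \<open>The cells with three admissible symbols are those of the certificate. A blank there
  forces a blank in the next cell, so that the certificate is a word, possibly shorter than the
  space reserved for it.\<close>

definition start_clauses :: "tm \<Rightarrow> nat \<Rightarrow> nat list list \<Rightarrow> (bool \<times> nat list) list list" where
  "start_clauses M W ini = [(True, [2, 0, 0])] # map (\<lambda>j. [(True, [1, 0, j, W])]) [0..<tapes M] @
     map (\<lambda>p. map (\<lambda>s. (True, [0, 0, 0, fst p, s])) (snd p)) (List.enumerate 0 ini) @
     concat (map (\<lambda>p. if length (snd p) = 3 then [horn [[0, 0, 0, fst p, 0]] [0, 0, 0, Suc (fst p), 0]] else [])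
       (List.enumerate 0 ini)) @
     concat (map (\<lambda>j. map (\<lambda>i. [(True, [0, 0, j, i, 0])]) [0..<length ini]) [1..<tapes M])"

definition read_clauses :: "tm \<Rightarrow> nat list \<Rightarrow> nat list \<Rightarrow> (bool \<times> nat list) list list" where
  "read_clauses M ts is = concat (map (\<lambda>t. concat (map (\<lambda>j. concat (map (\<lambda>i.
     map (\<lambda>s. horn [[1, t, j, i], [0, t, j, i, s]] [3, t, j, s]) [0..<symbols M]) is)) [0..<tapes M])) ts)"

definition delta_clauses :: "tm \<Rightarrow> nat list \<Rightarrow> (bool \<times> nat list) list list" where
  "delta_clauses M ts = concat (map (\<lambda>t. concat (map (\<lambda>e.
     horn ([2, t, fst e] # map (\<lambda>p. [3, t, fst p, snd p]) (List.enumerate 0 (fst (snd e)))) [2, Suc t, fst (snd (snd e))] #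
     map (\<lambda>a. horn ([2, t, fst e] # map (\<lambda>p. [3, t, fst p, snd p]) (List.enumerate 0 (fst (snd e))))
       [4, t, fst a, fst (snd a), snd (snd a)]) (List.enumerate 0 (snd (snd (snd e))))) (delta_table M))) ts)"

text \<open>The cell of the head is written as \<open>Suc i\<close>, which avoids subtraction for a
  move to the left; each \<open>g\<close> pairs the code of a move with the new cell. The margin of
  \<open>Suc T\<close> cells keeps the head away from index 0 during \<open>T\<close> steps.\<close>

definition move_clauses :: "tm \<Rightarrow> nat list \<Rightarrow> nat list \<Rightarrow> (bool \<times> nat list) list list" where
  "move_clauses M ts is = concat (map (\<lambda>t. concat (map (\<lambda>j. concat (map (\<lambda>i. concat (map (\<lambda>s. concat (map (\<lambda>g.
     [horn [[4, t, j, s, fst g], [1, t, j, Suc i]] [1, Suc t, j, snd g],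
      horn [[4, t, j, s, fst g], [1, t, j, Suc i]] [0, Suc t, j, Suc i, s]])
     [(0, i), (1, Suc i), (2, Suc (Suc i))])) [0..<symbols M])) is)) [0..<tapes M])) ts)"

definition keep_clauses :: "tm \<Rightarrow> nat list \<Rightarrow> nat list \<Rightarrow> (bool \<times> nat list) list list" where
  "keep_clauses M ts is = concat (map (\<lambda>t. concat (map (\<lambda>j. concat (map (\<lambda>i. concat (map (\<lambda>i'.
     if i = i' then [] else map (\<lambda>s. horn [[1, t, j, i], [0, t, j, i', s]] [0, Suc t, j, i', s]) [0..<symbols M])
     is)) is)) [0..<tapes M])) ts)"

text \<open>The last clause forbids the answer \<open>False\<close>, whose symbol is 1, in cell 0 of
  the output tape, which has the index \<open>Suc T\<close>.\<close>

definition tableau :: "tm \<Rightarrow> nat \<Rightarrow> bool list \<Rightarrow> nat \<Rightarrow> (bool \<times> nat list) list list" where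
  "tableau M T pre P = start_clauses M (Suc T) (start_cells (Suc T) pre P) @
     read_clauses M [0..<T] [0..<length (start_cells (Suc T) pre P)] @ delta_clauses M [0..<T] @
     move_clauses M [0..<T] [0..<length (start_cells (Suc T) pre P)] @
     keep_clauses M [0..<T] [0..<length (start_cells (Suc T) pre P)] @ [[(False, [0, T, 1, Suc T, 1])]]"

section \<open>The clauses describe the computation\<close>

context
  fixes M :: tm and w :: "bool list"
  assumes M: "wf_tm M"
begin

abbreviation "cfg t \<equiv> (tm_step M ^^ t) (tm_init M w)"
abbreviation "tp t j \<equiv> snd (cfg t) ! j"
abbreviation "reads t \<equiv> map tape_read (snd (cfg t))"
abbreviation "acts t \<equiv> snd (total_delta M (fst (cfg t)) (reads t))"

lemma total_delta_wf:
  assumes "q \<le> states M" "length ss = tapes M" "set ss \<subseteq> {..<symbols M}"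
  shows "fst (total_delta M q ss) \<le> states M \<and> length (snd (total_delta M q ss)) = tapes M \<and>
    fst ` set (snd (total_delta M q ss)) \<subseteq> {..<symbols M}"
proof (cases "q < states M")
  case True
  then show ?thesis using M assms unfolding wf_tm_def total_delta_def by (fastforce split: prod.splits)
qed (use assms in \<open>auto simp: total_delta_def\<close>)

lemma tm_step_total:
  assumes "q \<le> states M"
  shows "tm_step M (q, ts) = (fst (total_delta M q (map tape_read ts)),
    map2 tape_act (snd (total_delta M q (map tape_read ts))) ts)"
proof (cases "q < states M")
  case False
  have "map2 tape_act (map (\<lambda>s. (s, Stay)) (map tape_read ts)) ts = ts"
    by (rule map2_tape_act_stay)
  then show ?thesis using False assms by (simp add: total_delta_def)
qed (simp add: total_delta_def split: prod.splits)

lemma cfg_wf: "fst (cfg t) \<le> states M \<and> length (snd (cfg t)) = tapes M \<and>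
    (\<forall>j<tapes M. \<forall>i. fst (tp t j) i < symbols M)"
proof (induction t)
  case 0
  have "tapes M \<ge> 2" "symbols M \<ge> 3" using M by (simp_all add: wf_tm_def)
  then show ?case
    by (auto simp: tm_init_def nth_Cons input_tape_def bit_symbol_def split: nat.splits)
next
  case (Suc t)
  have r: "set (reads t) \<subseteq> {..<symbols M}"
  proof
    fix s assume "s \<in> set (reads t)"
    then obtain j where "j < tapes M" "s = tape_read (tp t j)" using Suc by (auto simp: in_set_conv_nth)
    then show "s \<in> {..<symbols M}" using Suc by (cases "tp t j") (metis fst_conv lessThan_iff tape_read.simps)
  qed
  have c: "cfg (Suc t) = (fst (total_delta M (fst (cfg t)) (reads t)), map2 tape_act (acts t) (snd (cfg t)))"
    using tm_step_total[of "fst (cfg t)" "snd (cfg t)"] Suc by simp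
  note d = total_delta_wf[OF conjunct1[OF Suc] _ r]
  have "fst (tape_act a tp') i < symbols M" if "fst a < symbols M" "\<forall>i. fst tp' i < symbols M" for a tp' i
    using that by (cases a; cases tp') auto
  moreover have "fst (acts t ! j) < symbols M" if "j < tapes M" for j
    using d Suc that nth_mem[of j "acts t"] by fastforce
  ultimately show ?case unfolding c using Suc d by simp
qed

lemma reads_wf: "set (reads t) \<subseteq> {..<symbols M}"
proof
  fix s assume "s \<in> set (reads t)"
  then obtain j where "j < tapes M" "s = tape_read (tp t j)" using cfg_wf[of t] by (auto simp: in_set_conv_nth)
  then show "s \<in> {..<symbols M}" using cfg_wf[of t] by (cases "tp t j") (metis fst_conv lessThan_iff tape_read.simps)
qed

lemma cfg_Suc: "fst (cfg (Suc t)) = fst (total_delta M (fst (cfg t)) (reads t))"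
  "j < tapes M \<Longrightarrow> tp (Suc t) j = tape_act (acts t ! j) (tp t j)"
  using tm_step_total[of "fst (cfg t)" "snd (cfg t)"] cfg_wf[of t]
    total_delta_wf[of "fst (cfg t)" "reads t", OF _ _ reads_wf] by simp_all

lemma acts_wf: "length (acts t) = tapes M" "j < tapes M \<Longrightarrow> fst (acts t ! j) < symbols M"
  using cfg_wf[of t] total_delta_wf[of "fst (cfg t)" "reads t", OF _ _ reads_wf]
    nth_mem[of j "acts t"] by fastforce+

lemma tape_act_at: "fst (tape_act a tp') (snd tp') = fst a"
  "i \<noteq> snd tp' \<Longrightarrow> fst (tape_act a tp') i = fst tp' i"
  "snd (tape_act a tp') = snd tp' + int (move_code (snd a)) - 1"
  by (cases a; cases tp'; cases "snd a"; auto simp: move_code_def)+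

text \<open>The variables are interpreted by the facts of the actual computation on
  \<open>w\<close>; the reserved cells behind \<open>y\<close> count as blanks.\<close>

lemma tableau_satisfiable:
  assumes w: "w = pre @ y" "length y \<le> P" and out: "fst (tp T 1) 0 \<noteq> 1"
  shows "cnf_sat (tableau M T pre P)"
proof -
  let ?W = "Suc T" and ?ini = "start_cells (Suc T) pre P"
  define \<sigma> where "\<sigma> v \<longleftrightarrow>
    (\<exists>t j i s. v = [0, t, j, i, s] \<and> fst (tp t j) (int i - int ?W) = s) \<or>
    (\<exists>t j i. v = [1, t, j, i] \<and> snd (tp t j) = int i - int ?W) \<or>
    (\<exists>t q. v = [2, t, q] \<and> fst (cfg t) = q) \<or>
    (\<exists>t j s. v = [3, t, j, s] \<and> tape_read (tp t j) = s) \<or>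
    (\<exists>t j s m. v = [4, t, j, s, m] \<and> fst (acts t ! j) = s \<and> move_code (snd (acts t ! j)) = m)" for v :: "nat list"
  have s: "\<sigma> [0, t, j, i, s] \<longleftrightarrow> fst (tp t j) (int i - int ?W) = s"
    "\<sigma> [1, t, j, i] \<longleftrightarrow> snd (tp t j) = int i - int ?W"
    "\<sigma> [2, t, q] \<longleftrightarrow> fst (cfg t) = q"
    "\<sigma> [3, t, j, s] \<longleftrightarrow> tape_read (tp t j) = s"
    "\<sigma> [4, t, j, s, m] \<longleftrightarrow> fst (acts t ! j) = s \<and> move_code (snd (acts t ! j)) = m" for t j i s q m
    unfolding \<sigma>_def by simp_all
  have tapes: "tapes M \<ge> 2" using M by (simp add: wf_tm_def)
  have tr: "tape_read (tp t j) = fst (tp t j) (snd (tp t j))" for t j by (cases "tp t j") simp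
  have init: "tp 0 0 = input_tape w" "fst (cfg 0) = 0" by (simp_all add: tm_init_def)
  have init': "tp 0 j = (\<lambda>_. 0, 0)" if "0 < j" "j < tapes M" for j
    using that by (simp add: tm_init_def nth_Cons')
  let ?sat = "\<lambda>C. \<exists>(b, x)\<in>set C. \<sigma> x = b"
  have cell0: "fst (tp 0 0) (int i - int ?W) \<in> set (?ini ! i)" if "i < length ?ini" for i
  proof -
    show ?thesis using that
    proof (cases rule: start_cells_cases)
      case 1
      then show ?thesis unfolding init by (simp add: input_tape_def)
    next
      case (2 u)
      then have "int i - int ?W = int u" by simp
      then show ?thesis unfolding init using 2 w by (simp add: input_tape_def nth_append)
    next
      case (3 u)
      then have "int i - int ?W = int (length pre + u)" by simp
      then show ?thesis unfolding init using 3 w by (auto simp: input_tape_def bit_symbol_def)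
    next
      case (4 u)
      then have "int i - int ?W = int (length pre + P + u)" by simp
      then show ?thesis unfolding init using 4 w by (auto simp: input_tape_def)
    qed
  qed
  have c1: "?sat C" if "C \<in> set (start_clauses M ?W ?ini)" for C
    using that unfolding start_clauses_def
  proof (simp only: set_append set_concat_map set_map list.set Un_iff insert_iff UN_iff, elim disjE)
    assume "C = [(True, [2, 0, 0])]"
    then show ?thesis using s(3) init by simp
  next
    assume "C \<in> (\<lambda>j. [(True, [1, 0, j, ?W])]) ` set [0..<tapes M]"
    then obtain j where j: "j < tapes M" "C = [(True, [1, 0, j, ?W])]" by auto
    then show ?thesis using s(2)[of 0 j ?W] init(1) init'[of j] by (cases "j = 0") (auto simp: input_tape_def)
  next
    assume "C \<in> (\<lambda>p. map (\<lambda>s. (True, [0, 0, 0, fst p, s])) (snd p)) ` set (List.enumerate 0 ?ini)"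
    then obtain i where i: "i < length ?ini" "C = map (\<lambda>s. (True, [0, 0, 0, i, s])) (?ini ! i)"
      by (auto simp: in_set_enumerate_eq)
    then show ?thesis using cell0[OF i(1)] s(1)[of 0 0 i] by auto
  next
    assume "\<exists>x\<in>set (List.enumerate 0 ?ini). C \<in> set (if length (snd x) = 3
      then [horn [[0, 0, 0, fst x, 0]] [0, 0, 0, Suc (fst x), 0]] else [])"
    then obtain i where i: "i < length ?ini" "length (?ini ! i) = 3" "C = horn [[0, 0, 0, i, 0]] [0, 0, 0, Suc i, 0]"
      by (auto simp: in_set_enumerate_eq split: if_splits)
    have "?W + length pre \<le> i" using i(1) by (cases rule: start_cells_cases) (use i(2) in auto)
    then have "fst (tp 0 0) (int i - int ?W) = 0 \<longrightarrow> fst (tp 0 0) (int (Suc i) - int ?W) = 0"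
      unfolding init by (auto simp: input_tape_def bit_symbol_def)
    then show ?thesis unfolding i(3) horn_sat using s(1) by simp
  next
    assume "\<exists>x\<in>set [1..<tapes M]. C \<in> (\<lambda>i. [(True, [0, 0, x, i, 0])]) ` set [0..<length ?ini]"
    then obtain j i where "0 < j" "j < tapes M" "C = [(True, [0, 0, j, i, 0])]" by auto
    then show ?thesis using s(1)[of 0 j i 0] init'[of j] by simp
  qed
  have c2: "?sat C" if "C \<in> set (read_clauses M ts is)" for C ts "is"
  proof -
    obtain t j i s' where C: "C = horn [[1, t, j, i], [0, t, j, i, s']] [3, t, j, s']"
      using \<open>C \<in> set (read_clauses M ts is)\<close> unfolding read_clauses_def set_concat_map by auto
    show ?thesis
      unfolding C horn_sat using s(1)[of t j i s'] s(2)[of t j i] s(4)[of t j s'] tr[of t j] by simp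
  qed
  have c3: "?sat C" if "C \<in> set (delta_clauses M ts)" for C ts
  proof -
    obtain t e where te: "e \<in> set (delta_table M)"
      "C \<in> set (horn ([2, t, fst e] # map (\<lambda>p. [3, t, fst p, snd p]) (List.enumerate 0 (fst (snd e)))) [2, Suc t, fst (snd (snd e))] #
       map (\<lambda>a. horn ([2, t, fst e] # map (\<lambda>p. [3, t, fst p, snd p]) (List.enumerate 0 (fst (snd e))))
         [4, t, fst a, fst (snd a), snd (snd a)]) (List.enumerate 0 (snd (snd (snd e)))))"
      using \<open>C \<in> set (delta_clauses M ts)\<close> unfolding delta_clauses_def set_concat_map by blast
    obtain q ss where q: "length ss = tapes M" "e = (q, ss, fst (total_delta M q ss),
       map (\<lambda>a. (fst a, move_code (snd a))) (snd (total_delta M q ss)))"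
      using te(1) unfolding delta_table_iff by blast
    have "C = horn ([2, t, q] # map (\<lambda>p. [3, t, fst p, snd p]) (List.enumerate 0 ss)) [2, Suc t, fst (total_delta M q ss)] \<or>
       (\<exists>j<length (snd (total_delta M q ss)). C = horn ([2, t, q] # map (\<lambda>p. [3, t, fst p, snd p]) (List.enumerate 0 ss))
         [4, t, j, fst (snd (total_delta M q ss) ! j), move_code (snd (snd (total_delta M q ss) ! j))])"
    proof -
      consider "C = horn ([2, t, q] # map (\<lambda>p. [3, t, fst p, snd p]) (List.enumerate 0 ss)) [2, Suc t, fst (total_delta M q ss)]"
        | a where "a \<in> set (List.enumerate 0 (snd (snd (snd e))))" "C = horn ([2, t, q] # map (\<lambda>p. [3, t, fst p, snd p]) (List.enumerate 0 ss))
         [4, t, fst a, fst (snd a), snd (snd a)]"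
        using te(2) unfolding q(2) by auto
      then show ?thesis
      proof cases
        case (2 a)
        then show ?thesis unfolding q(2)
          by (intro disjI2 exI[of _ "fst a"]) (cases a; auto simp: in_set_enumerate_eq)
      qed blast
    qed
    note C = q(1) this
    have prem: "q = fst (cfg t) \<and> ss = reads t"
      if p: "\<forall>p\<in>set ([2, t, q] # map (\<lambda>p. [3, t, fst p, snd p]) (List.enumerate 0 ss)). \<sigma> p"
    proof -
      have "tape_read (tp t i) = ss ! i" if "i < tapes M" for i
      proof -
        have "(i, ss ! i) \<in> set (List.enumerate 0 ss)" using that C(1) by (simp add: in_set_enumerate_eq)
        then have "\<sigma> [3, t, i, ss ! i]" using p by force
        then show ?thesis using s(4)[of t i "ss ! i"] by simp
      qed
      then have "ss = reads t" using C(1) cfg_wf[of t] by (intro nth_equalityI) auto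
      moreover have "q = fst (cfg t)" using p s(3)[of t q] by simp
      ultimately show ?thesis by blast
    qed
    show ?thesis using C(2)
    proof (elim disjE exE conjE)
      assume "C = horn ([2, t, q] # map (\<lambda>p. [3, t, fst p, snd p]) (List.enumerate 0 ss)) [2, Suc t, fst (total_delta M q ss)]"
      then show ?thesis using prem cfg_Suc(1)[of t] s(3)[of "Suc t"] by (simp only: horn_sat) blast
    next
      fix j assume "j < length (snd (total_delta M q ss))" "C = horn ([2, t, q] # map (\<lambda>p. [3, t, fst p, snd p]) (List.enumerate 0 ss))
         [4, t, j, fst (snd (total_delta M q ss) ! j), move_code (snd (snd (total_delta M q ss) ! j))]"
      then show ?thesis using prem s(5)[of t j] by (simp only: horn_sat) blast
    qed
  qed
  have c4: "?sat C" if "C \<in> set (move_clauses M ts is)" for C ts "is"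
  proof -
    obtain t j i s' g where g: "j \<in> {0..<tapes M}" "g \<in> set [(0, i), (1, Suc i), (2, Suc (Suc i))]"
      "C \<in> set [horn [[4, t, j, s', fst g], [1, t, j, Suc i]] [1, Suc t, j, snd g],
        horn [[4, t, j, s', fst g], [1, t, j, Suc i]] [0, Suc t, j, Suc i, s']]"
      using \<open>C \<in> set (move_clauses M ts is)\<close>
      unfolding move_clauses_def set_concat_map UN_iff set_upt by blast
    define m where "m = fst g"
    have "snd g = i + m" using g(2) by (auto simp: m_def)
    then have "C = horn [[4, t, j, s', m], [1, t, j, Suc i]] [1, Suc t, j, i + m] \<or>
       C = horn [[4, t, j, s', m], [1, t, j, Suc i]] [0, Suc t, j, Suc i, s']"
      using g(3) by (simp add: m_def)
    moreover have "j < tapes M" using g(1) by simp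
    ultimately have C: "j < tapes M" "True" "C = horn [[4, t, j, s', m], [1, t, j, Suc i]] [1, Suc t, j, i + m] \<or>
       C = horn [[4, t, j, s', m], [1, t, j, Suc i]] [0, Suc t, j, Suc i, s']" by simp_all
    have "snd (tp t j) = int (Suc i) - int ?W \<and> fst (acts t ! j) = s' \<and> move_code (snd (acts t ! j)) = m \<Longrightarrow>
      snd (tp (Suc t) j) = int (i + m) - int ?W \<and> fst (tp (Suc t) j) (int (Suc i) - int ?W) = s'"
      using cfg_Suc(2)[OF C(1), of t] tape_act_at(1,3)[of "acts t ! j" "tp t j"] by auto
    then have "\<sigma> [4, t, j, s', m] \<Longrightarrow> \<sigma> [1, t, j, Suc i] \<Longrightarrow> \<sigma> [1, Suc t, j, i + m] \<and> \<sigma> [0, Suc t, j, Suc i, s']"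
      unfolding s by blast
    then show ?thesis using C(3)
      by (elim disjE) (simp only: horn_sat, metis list.set_intros(1) list.set_intros(2))+
  qed
  have c5: "?sat C" if "C \<in> set (keep_clauses M ts is)" for C ts "is"
  proof -
    obtain t j i i' s' where C: "j < tapes M" "i \<noteq> i'" "C = horn [[1, t, j, i], [0, t, j, i', s']] [0, Suc t, j, i', s']"
      using \<open>C \<in> set (keep_clauses M ts is)\<close> unfolding keep_clauses_def by (auto simp: set_concat_map split: if_splits)
    have "\<sigma> [0, Suc t, j, i', s']" if h: "\<sigma> [1, t, j, i]" "\<sigma> [0, t, j, i', s']"
    proof -
      have ne: "int i' - int ?W \<noteq> snd (tp t j)" using C(2) h(1) unfolding s(2) by simp
      have "fst (tp (Suc t) j) (int i' - int ?W) = fst (tp t j) (int i' - int ?W)"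
        unfolding cfg_Suc(2)[OF C(1)] by (rule tape_act_at(2)[OF ne])
      then show ?thesis using h(2) unfolding s(1) by (rule trans)
    qed
    then show ?thesis unfolding C(3) horn_sat by (intro impI) (simp only: list.set_intros)
  qed
  have c6: "?sat [(False, [0, T, 1, Suc T, 1])]" using s(1)[of T 1 "Suc T" 1] out by simp
  have "?sat C" if "C \<in> set (tableau M T pre P)" for C
  proof -
    have "C \<in> set (start_clauses M ?W ?ini) \<or> C \<in> set (read_clauses M [0..<T] [0..<length ?ini]) \<or>
      C \<in> set (delta_clauses M [0..<T]) \<or> C \<in> set (move_clauses M [0..<T] [0..<length ?ini]) \<or>
      C \<in> set (keep_clauses M [0..<T] [0..<length ?ini]) \<or> C = [(False, [0, T, 1, Suc T, 1])]"
      using that by (simp only: tableau_def set_append list.set Un_iff insert_iff empty_iff simp_thms)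
    then show ?thesis
    proof (elim disjE)
      assume "C \<in> set (start_clauses M ?W ?ini)"
      then show ?thesis by (rule c1)
    next
      assume "C \<in> set (read_clauses M [0..<T] [0..<length ?ini])"
      then show ?thesis by (rule c2)
    next
      assume "C \<in> set (delta_clauses M [0..<T])"
      then show ?thesis by (rule c3)
    next
      assume "C \<in> set (move_clauses M [0..<T] [0..<length ?ini])"
      then show ?thesis by (rule c4)
    next
      assume "C \<in> set (keep_clauses M [0..<T] [0..<length ?ini])"
      then show ?thesis by (rule c5)
    next
      assume "C = [(False, [0, T, 1, Suc T, 1])]"
      then show ?thesis by (simp only: c6)
    qed
  qed
  then show ?thesis unfolding cnf_sat_def by blast
qed

text \<open>The assignment may contain more than the facts of the computation on \<open>w\<close>,
  but by induction on the time the definite clauses force it to contain all of these. So the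
  variable that the last clause forbids is not a fact.\<close>

lemma tableau_sound:
  fixes \<sigma> :: "nat list \<Rightarrow> bool"
  assumes sat: "\<And>C. C \<in> set (tableau M T pre P) \<Longrightarrow> \<exists>(b, x)\<in>set C. \<sigma> x = b"
    and start: "\<And>i. i < length (start_cells (Suc T) pre P) \<Longrightarrow> \<sigma> [0, 0, 0, i, fst (input_tape w) (int i - int (Suc T))]"
  shows "fst (tp T 1) 0 \<noteq> 1"
proof -
  let ?W = "Suc T" and ?X = "length (start_cells (Suc T) pre P)"
  have X: "2 * ?W \<le> ?X" by (simp add: start_cells_def)
  have tapes: "tapes M \<ge> 2" using M by (simp add: wf_tm_def)
  have st: "\<exists>(b, x)\<in>set C. \<sigma> x = b" if "C \<in> set (start_clauses M ?W (start_cells (Suc T) pre P))" for C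
    using sat that by (simp add: tableau_def)
  have horn: "\<sigma> c" if "horn ps c \<in> set (tableau M T pre P)" "\<And>p. p \<in> set ps \<Longrightarrow> \<sigma> p" for ps c
    using sat[OF that(1)] that(2) unfolding horn_sat by blast
  have tr: "tape_read (tp t j) = fst (tp t j) (snd (tp t j))" for t j by (cases "tp t j") simp
  \<comment> \<open>The bound on the head positions keeps the heads among the cells of the
    tableau.\<close>
  have "\<sigma> [2, t, fst (cfg t)] \<and> (\<forall>j<tapes M. \<bar>snd (tp t j)\<bar> \<le> int t \<and> \<sigma> [1, t, j, nat (snd (tp t j) + int ?W)] \<and>
      (\<forall>i<?X. \<sigma> [0, t, j, i, fst (tp t j) (int i - int ?W)]))" if "t \<le> T" for t
    using that
  proof (induction t)
    case 0
    have "\<sigma> [2, 0, 0]" using st[of "[(True, [2, 0, 0])]"] by (simp add: start_clauses_def)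
    moreover have "\<sigma> [1, 0, j, ?W]" if "j < tapes M" for j
      using st[of "[(True, [1, 0, j, ?W])]"] that by (auto simp: start_clauses_def)
    moreover have "\<sigma> [0, 0, j, i, 0]" if "0 < j" "j < tapes M" "i < ?X" for i j
    proof -
      have c: "[(True, [0, 0, j, i, 0])] \<in> set (concat (map (\<lambda>j. map (\<lambda>i. [(True, [0, 0, j, i, 0])])
          [0..<?X]) [1..<tapes M]))" (is "_ \<in> set ?c")
        using that by (auto simp: image_iff)
      have "[(True, [0, 0, j, i, 0])] \<in> set (start_clauses M ?W (start_cells ?W pre P))"
        unfolding start_clauses_def list.set set_append using c by blast
      from st[OF this] show ?thesis by simp
    qed
    moreover have "tp 0 j = (if j = 0 then input_tape w else (\<lambda>_. 0, 0))" if "j < tapes M" for j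
      using that by (simp add: tm_init_def nth_Cons')
    moreover have "snd (input_tape w) = 0" by (simp add: input_tape_def)
    moreover have "nat (1 + int T) = Suc T" by simp
    ultimately show ?case using start by (auto simp: tm_init_def)
  next
    case (Suc t)
    then have t: "t < T" and IH: "\<sigma> [2, t, fst (cfg t)]"
      "\<And>j. j < tapes M \<Longrightarrow> \<bar>snd (tp t j)\<bar> \<le> int t" "\<And>j. j < tapes M \<Longrightarrow> \<sigma> [1, t, j, nat (snd (tp t j) + int ?W)]"
      "\<And>j i. j < tapes M \<Longrightarrow> i < ?X \<Longrightarrow> \<sigma> [0, t, j, i, fst (tp t j) (int i - int ?W)]" by auto
    define h where "h j = nat (snd (tp t j) + int ?W)" for j
    have h: "snd (tp t j) = int (h j) - int ?W" "Suc 0 \<le> h j" "h j < ?X" if "j < tapes M" for j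
      using IH(2)[OF that] t X by (auto simp: h_def)
    have sy: "fst (tp t j) i < symbols M" if "j < tapes M" for j i using cfg_wf[of t] that by blast
    have rd: "\<sigma> [3, t, j, tape_read (tp t j)]" if j: "j < tapes M" for j
    proof (rule horn)
      show "horn [[1, t, j, h j], [0, t, j, h j, tape_read (tp t j)]] [3, t, j, tape_read (tp t j)] \<in> set (tableau M T pre P)"
      proof -
        have "t \<in> set [0..<T]" "j \<in> set [0..<tapes M]" "h j \<in> set [0..<?X]" "tape_read (tp t j) \<in> set [0..<symbols M]"
          using t j h(3)[OF j] sy[OF j] by (simp_all add: tr)
        then have "horn [[1, t, j, h j], [0, t, j, h j, tape_read (tp t j)]] [3, t, j, tape_read (tp t j)]
            \<in> set (read_clauses M [0..<T] [0..<?X])"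
          unfolding read_clauses_def set_concat_map UN_iff
          by (intro bexI[of _ t] bexI[of _ j] bexI[of _ "h j"]) auto
        then show ?thesis unfolding tableau_def by simp
      qed
      show "\<sigma> p" if "p \<in> set [[1, t, j, h j], [0, t, j, h j, tape_read (tp t j)]]" for p
        using that IH(3)[OF j] IH(4)[OF j h(3)[OF j]] h(1)[OF j] by (auto simp: h_def[symmetric] tr)
    qed
    define e where "e = (fst (cfg t), reads t, fst (total_delta M (fst (cfg t)) (reads t)),
      map (\<lambda>a. (fst a, move_code (snd a))) (acts t))"
    have e: "e \<in> set (delta_table M)"
      unfolding delta_table_iff e_def using cfg_wf[of t] reads_wf[of t] by (intro exI[of _ "fst (cfg t)"] exI[of _ "reads t"]) simp
    have dc: "set (horn ([2, t, fst e] # map (\<lambda>p. [3, t, fst p, snd p]) (List.enumerate 0 (fst (snd e)))) [2, Suc t, fst (snd (snd e))] #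
       map (\<lambda>a. horn ([2, t, fst e] # map (\<lambda>p. [3, t, fst p, snd p]) (List.enumerate 0 (fst (snd e))))
         [4, t, fst a, fst (snd a), snd (snd a)]) (List.enumerate 0 (snd (snd (snd e))))) \<subseteq> set (tableau M T pre P)"
    proof -
      have "t \<in> set [0..<T]" using t by simp
      then have "set (horn ([2, t, fst e] # map (\<lambda>p. [3, t, fst p, snd p]) (List.enumerate 0 (fst (snd e)))) [2, Suc t, fst (snd (snd e))] #
       map (\<lambda>a. horn ([2, t, fst e] # map (\<lambda>p. [3, t, fst p, snd p]) (List.enumerate 0 (fst (snd e))))
         [4, t, fst a, fst (snd a), snd (snd a)]) (List.enumerate 0 (snd (snd (snd e))))) \<subseteq> set (delta_clauses M [0..<T])"
        unfolding delta_clauses_def set_concat_map using e by blast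
      then show ?thesis unfolding tableau_def set_append by blast
    qed
    have prem: "\<sigma> p" if "p \<in> set ([2, t, fst e] # map (\<lambda>p. [3, t, fst p, snd p]) (List.enumerate 0 (fst (snd e))))" for p
      using that IH(1) rd cfg_wf[of t] by (auto simp: e_def in_set_enumerate_eq)
    have "\<sigma> [2, Suc t, fst (snd (snd e))]"
    proof (rule horn)
      show "horn ([2, t, fst e] # map (\<lambda>p. [3, t, fst p, snd p]) (List.enumerate 0 (fst (snd e))))
          [2, Suc t, fst (snd (snd e))] \<in> set (tableau M T pre P)"
        by (rule subsetD[OF dc]) simp
    qed (rule prem)
    then have 1: "\<sigma> [2, Suc t, fst (cfg (Suc t))]" unfolding cfg_Suc by (simp add: e_def)
    have act: "\<sigma> [4, t, j, fst (acts t ! j), move_code (snd (acts t ! j))]" if j: "j < tapes M" for j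
    proof -
      have "(j, fst (acts t ! j), move_code (snd (acts t ! j))) \<in> set (List.enumerate 0 (snd (snd (snd e))))"
        using j acts_wf(1)[of t] by (simp add: e_def in_set_enumerate_eq)
      then have "horn ([2, t, fst e] # map (\<lambda>p. [3, t, fst p, snd p]) (List.enumerate 0 (fst (snd e))))
         [4, t, j, fst (acts t ! j), move_code (snd (acts t ! j))] \<in> set (tableau M T pre P)"
        by (intro subsetD[OF dc]) force
      from horn[OF this prem] show ?thesis by simp
    qed
    have "\<bar>snd (tp (Suc t) j)\<bar> \<le> int (Suc t) \<and> \<sigma> [1, Suc t, j, nat (snd (tp (Suc t) j) + int ?W)] \<and>
      (\<forall>i<?X. \<sigma> [0, Suc t, j, i, fst (tp (Suc t) j) (int i - int ?W)])" if j: "j < tapes M" for j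
    proof -
      let ?a = "acts t ! j" and ?i = "h j - 1"
      have m: "move_code (snd ?a) \<le> 2" by (simp add: move_code_def split: move.splits)
      have i: "Suc ?i = h j" "?i < ?X" using h[OF j] by auto
      have s: "fst ?a < symbols M" by (rule acts_wf(2)[OF j])
      have mc: "C \<in> set (tableau M T pre P)"
        if "C \<in> {horn [[4, t, j, fst ?a, move_code (snd ?a)], [1, t, j, Suc ?i]] [1, Suc t, j, ?i + move_code (snd ?a)],
          horn [[4, t, j, fst ?a, move_code (snd ?a)], [1, t, j, Suc ?i]] [0, Suc t, j, Suc ?i, fst ?a]}" for C
      proof -
        have g: "(move_code (snd ?a), ?i + move_code (snd ?a)) \<in> set [(0, ?i), (1, Suc ?i), (2, Suc (Suc ?i))]"
          by (simp add: move_code_def split: move.splits)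
        have "t \<in> set [0..<T]" "j \<in> set [0..<tapes M]" "?i \<in> set [0..<?X]" "fst ?a \<in> set [0..<symbols M]"
          using t j i s by simp_all
        then have "C \<in> set (move_clauses M [0..<T] [0..<?X])"
          unfolding move_clauses_def set_concat_map UN_iff using g that
          by (intro bexI[of _ t] bexI[of _ j] bexI[of _ ?i] bexI[of _ "fst ?a"]
              bexI[of _ "(move_code (snd ?a), ?i + move_code (snd ?a))"])
            (assumption | simp only: list.set fst_conv snd_conv)+
        then show ?thesis unfolding tableau_def by simp
      qed
      have pr: "\<sigma> p" if "p \<in> set [[4, t, j, fst ?a, move_code (snd ?a)], [1, t, j, Suc ?i]]" for p
        using that act[OF j] IH(3)[OF j] i(1) by (auto simp: h_def)
      have tp: "snd (tp (Suc t) j) = snd (tp t j) + int (move_code (snd ?a)) - 1"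
        "fst (tp (Suc t) j) (snd (tp t j)) = fst ?a"
        "\<And>i. i \<noteq> snd (tp t j) \<Longrightarrow> fst (tp (Suc t) j) i = fst (tp t j) i"
        unfolding cfg_Suc(2)[OF j] by (rule tape_act_at(3) tape_act_at(1) tape_act_at(2); assumption?)+
      have "\<sigma> [1, Suc t, j, ?i + move_code (snd ?a)]"
        by (rule horn[OF mc[OF insertI1]]) (rule pr)
      moreover have "nat (snd (tp (Suc t) j) + int ?W) = ?i + move_code (snd ?a)"
        unfolding tp(1) using h[OF j] by simp
      moreover have "\<bar>snd (tp (Suc t) j)\<bar> \<le> int (Suc t)" unfolding tp(1) using IH(2)[OF j] m by auto
      moreover have "\<sigma> [0, Suc t, j, i, fst (tp (Suc t) j) (int i - int ?W)]" if i': "i < ?X" for i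
      proof (cases "i = h j")
        case True
        have "\<sigma> [0, Suc t, j, Suc ?i, fst ?a]"
          by (rule horn[OF mc[OF insertI2[OF insertI1]]]) (rule pr)
        then show ?thesis using True i(1) h(1)[OF j] tp(2) by simp
      next
        case False
        let ?s = "fst (tp t j) (int i - int ?W)"
        have "t \<in> set [0..<T]" "j \<in> set [0..<tapes M]" "h j \<in> set [0..<?X]" "i \<in> set [0..<?X]"
          using t j i' h(3)[OF j] by simp_all
        then have "horn [[1, t, j, h j], [0, t, j, i, ?s]] [0, Suc t, j, i, ?s] \<in> set (keep_clauses M [0..<T] [0..<?X])"
          unfolding keep_clauses_def set_concat_map UN_iff using False sy[OF j]
          by (intro bexI[of _ t] bexI[of _ j] bexI[of _ "h j"] bexI[of _ i]) auto
        then have "horn [[1, t, j, h j], [0, t, j, i, ?s]] [0, Suc t, j, i, ?s] \<in> set (tableau M T pre P)"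
          unfolding tableau_def by simp
        then have "\<sigma> [0, Suc t, j, i, ?s]"
          by (rule horn) (use IH(3)[OF j] IH(4)[OF j i'] in \<open>auto simp: h_def\<close>)
        moreover have "int i - int ?W \<noteq> snd (tp t j)" using h(1)[OF j] False by simp
        ultimately show ?thesis using tp(3) by simp
      qed
      ultimately show ?thesis by simp
    qed
    then show ?case using 1 by blast
  qed
  from this[of T] have c: "\<sigma> [0, T, 1, i, fst (tp T 1) (int i - int ?W)]" if "i < ?X" for i
    using that tapes by simp
  have "\<sigma> [0, T, 1, ?W, fst (tp T 1) 0]" using c[of ?W] X by simp
  moreover have "\<not> \<sigma> [0, T, 1, ?W, 1]" using sat[of "[(False, [0, T, 1, ?W, 1])]"] by (simp add: tableau_def)
  ultimately show ?thesis by metis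
qed

end

section \<open>The tableau is computable in polynomial time\<close>

lemma fp_replicate_length [fp_intros]:
  assumes "fp l" "fp f"
  shows "fp (\<lambda>x. replicate (length (l x)) (f x))"
proof -
  have "fp (\<lambda>x. map (\<lambda>_. f x) (l x))" by (intro fp_intros assms fp_comp[OF assms(2)])
  then show ?thesis by (simp add: map_replicate_const)
qed

text \<open>Time bounds are computed in unary, as lengths of lists; the tableau enumerates all times
  and cells anyway.\<close>

lemma fp_poly_list: "\<exists>f :: bool list \<Rightarrow> bool list. fp f \<and> (\<forall>w. length (f w) = poly p (length w))"
  proof (induction p)
    case 0
    show ?case by (intro exI[of _ "\<lambda>_. []"]) (auto intro: fp_intros)
  next
    case (pCons a p)
    then obtain f :: "bool list \<Rightarrow> bool list" where f: "fp f" "\<And>w. length (f w) = poly p (length w)" by blast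
    have "fp (\<lambda>w. replicate a False @ concat (map (\<lambda>_. f w) w))"
      by (intro fp_intros fp_comp[OF f(1)])
    then show ?case
      by (intro exI[of _ "\<lambda>w. replicate a False @ concat (map (\<lambda>_. f w) w)"])
        (simp add: f(2) length_concat sum_list_replicate map_replicate_const)
  qed

lemma fp_tableau:
  assumes "fp a" "fp b" "fp c"
  shows "fp (\<lambda>x. tableau M (length (a x)) (b x) (length (c x)))"
proof -
  have ini: "fp (\<lambda>x. start_cells (Suc (length (a x))) (b x) (length (c x)))"
    unfolding start_cells_def replicate_Suc bit_symbol_def by (intro fp_intros assms)
  have W: "fp (\<lambda>x. Suc (length (a x)))" by (intro fp_intros assms)
  have ts: "fp (\<lambda>x. [0..<length (a x)])" by (intro fp_intros assms)
  have iss: "fp (\<lambda>x. [0..<length (start_cells (Suc (length (a x))) (b x) (length (c x)))])"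
    by (intro fp_upt_length ini)
  have 1: "fp (\<lambda>x. start_clauses M (Suc (length (a x))) (start_cells (Suc (length (a x))) (b x) (length (c x))))"
    unfolding start_clauses_def by (intro fp_intros ini fp_comp[OF W] fp_comp[OF iss] iss)
  have 2: "fp (\<lambda>x. read_clauses M [0..<length (a x)] [0..<length (start_cells (Suc (length (a x))) (b x) (length (c x)))])"
    unfolding read_clauses_def by (intro fp_map fp_concat fp_horn fp_Cons fp_fst fp_snd fp_id fp_const fp_comp[OF iss] ts)
  have 3: "fp (\<lambda>x. delta_clauses M [0..<length (a x)])"
    unfolding delta_clauses_def by (intro fp_intros ts)
  have 4: "fp (\<lambda>x. move_clauses M [0..<length (a x)] [0..<length (start_cells (Suc (length (a x))) (b x) (length (c x)))])"
    unfolding move_clauses_def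
    by (intro fp_map fp_concat fp_horn fp_Cons fp_Pair fp_Suc fp_fst fp_snd fp_id fp_const fp_comp[OF iss] ts)
  have 5: "fp (\<lambda>x. keep_clauses M [0..<length (a x)] [0..<length (start_cells (Suc (length (a x))) (b x) (length (c x)))])"
    unfolding keep_clauses_def
    by (intro fp_map fp_concat fp_If fp_eq fp_horn fp_Cons fp_Suc fp_fst fp_snd fp_id fp_const fp_comp[OF iss] ts)
  show ?thesis unfolding tableau_def
    by (intro fp_append 1 2 3 4 5) (intro fp_intros assms)
qed

lemma nat_poly_mono: "m \<le> n \<Longrightarrow> poly p m \<le> poly p (n :: nat)"
  by (induction p) (auto intro: add_mono mult_le_mono)

text \<open>A halting configuration is a fixed point of \<open>tm_step\<close>, so the output is
  still there at any later time.\<close>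

lemma outputs_within_cfg:
  assumes "outputs_within M w u (real b)" "b \<le> T"
  shows "has_output ((tm_step M ^^ T) (tm_init M w)) u"
proof -
  obtain n where n: "n \<le> b" "fst ((tm_step M ^^ n) (tm_init M w)) = states M"
      "has_output ((tm_step M ^^ n) (tm_init M w)) u"
    using assms(1) unfolding outputs_within_def Let_def by auto
  have "tm_step M c = c" if "fst c = states M" for c using that by (cases c) simp
  then have "(tm_step M ^^ i) c = c" if "fst c = states M" for i c using that by (induction i) auto
  then have "(tm_step M ^^ (T - n + n)) (tm_init M w) = (tm_step M ^^ n) (tm_init M w)"
    using n(2) by (simp only: funpow_add comp_apply)
  then show ?thesis using n assms(2) by simp
qed

text \<open>The class of instances enters only through \<open>II\<close>, so one reduction serves
  for all instances and for the restricted ones.\<close>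

theorem NP_hard_edtsb:
  assumes II: "\<And>\<phi> :: (bool \<times> nat list) list list. reduction k \<phi> \<in> \<I>" and k: "2 \<le> k"
  shows "NP_hard (edtsb_language \<I>)"
  unfolding NP_hard_def
proof
  fix L assume "L \<in> class_NP"
  then obtain V p where V: "V \<in> class_P"
    and L: "\<And>x. x \<in> L \<longleftrightarrow> (\<exists>y. length y \<le> poly p (length x) \<and> bit_pair x y \<in> V)"
    unfolding class_NP_def by blast
  obtain M q where M: "wf_tm M" and MV: "\<And>w. outputs_within M w [w \<in> V] (real (poly q (length w)))"
    using V unfolding class_P_def polytime_computable_def by blast
  define pre where "pre x = concat (map (\<lambda>b. [True, b]) x) @ [False]" for x
  obtain pl :: "bool list \<Rightarrow> bool list" where pl: "fp pl" "\<And>w. length (pl w) = poly p (length w)"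
    using fp_poly_list[of p] by blast
  obtain ql :: "bool list \<Rightarrow> bool list" where ql: "fp ql" "\<And>w. length (ql w) = poly q (length w)"
    using fp_poly_list[of q] by blast
  define g where "g x = tableau M (length (ql (pre x @ pl x))) (pre x) (length (pl x))" for x
  have pre: "fp pre" unfolding pre_def by (intro fp_intros)
  have "fp g" unfolding g_def
    by (intro fp_tableau fp_comp[OF ql(1)] fp_append pre pl(1))
  then have "polytime_computable (\<lambda>x. enc_instance (reduction k (g x)))"
    by (intro polytime_computable_fp fp_comp[OF fp_enc_instance] fp_comp[OF fp_reduction])
  moreover have "x \<in> L \<longleftrightarrow> cnf_sat (g x)" for x
  proof -
    let ?P = "poly p (length x)" and ?T = "length (ql (pre x @ pl x))" and ?W = "Suc (length (ql (pre x @ pl x)))"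
    have bp: "bit_pair x y = pre x @ y" for y by (simp add: bit_pair_def pre_def)
    have out: "fst (snd ((tm_step M ^^ ?T) (tm_init M w)) ! 1) 0 = bit_symbol (w \<in> V)"
      if "w = bit_pair x y" "length y \<le> ?P" for w y
    proof -
      have "poly q (length w) \<le> ?T" unfolding ql(2) using that by (intro nat_poly_mono) (simp add: bp pl(2))
      from outputs_within_cfg[OF MV this] show ?thesis by (auto simp: has_output_def Let_def)
    qed
    show ?thesis
    proof
      assume "x \<in> L"
      then obtain y where y: "length y \<le> ?P" "bit_pair x y \<in> V" using L by blast
      then show "cnf_sat (g x)" unfolding g_def
        using out[OF refl y(1)] pl(2)[of x]
        by (intro tableau_satisfiable[OF M bp]) (auto simp: bit_symbol_def)
    next
      assume "cnf_sat (g x)"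
      then obtain \<sigma> where \<sigma>: "\<And>C. C \<in> set (g x) \<Longrightarrow> \<exists>(b, x)\<in>set C. \<sigma> x = b"
        unfolding cnf_sat_def by blast
      let ?ini = "start_cells ?W (pre x) (length (pl x))" and ?n = "length (pre x)"
      have st: "\<exists>s\<in>set (?ini ! i). \<sigma> [0, 0, 0, i, s]" if "i < length ?ini" for i
      proof -
        have "(i, ?ini ! i) \<in> set (List.enumerate 0 ?ini)" using that by (simp add: in_set_enumerate_eq)
        then have "map (\<lambda>s. (True, [0, 0, 0, i, s])) (?ini ! i) \<in>
            (\<lambda>p. map (\<lambda>s. (True, [0, 0, 0, fst p, s])) (snd p)) ` set (List.enumerate 0 ?ini)"
          by (rule image_eqI[rotated]) simp
        then have "map (\<lambda>s. (True, [0, 0, 0, i, s])) (?ini ! i) \<in> set (start_clauses M ?W ?ini)"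
          unfolding start_clauses_def set_append list.set set_map by blast
        then have "map (\<lambda>s. (True, [0, 0, 0, i, s])) (?ini ! i) \<in> set (g x)" by (simp add: g_def tableau_def)
        from \<sigma>[OF this] show ?thesis by auto
      qed
      have mono: "\<sigma> [0, 0, 0, Suc i, 0]" if "i < length ?ini" "?ini ! i = [0, 1, 2]" "\<sigma> [0, 0, 0, i, 0]" for i
      proof -
        have "(i, [0, 1, 2]) \<in> set (List.enumerate 0 ?ini)" using that by (simp add: in_set_enumerate_eq)
        then have "horn [[0, 0, 0, i, 0]] [0, 0, 0, Suc i, 0] \<in> (\<Union>p\<in>set (List.enumerate 0 ?ini).
            set (if length (snd p) = 3 then [horn [[0, 0, 0, fst p, 0]] [0, 0, 0, Suc (fst p), 0]] else []))"
          by (rule UN_I) simp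
        then have "horn [[0, 0, 0, i, 0]] [0, 0, 0, Suc i, 0] \<in> set (start_clauses M ?W ?ini)"
          unfolding start_clauses_def set_append list.set set_map set_concat_map by blast
        then have "horn [[0, 0, 0, i, 0]] [0, 0, 0, Suc i, 0] \<in> set (g x)" by (simp add: g_def tableau_def)
        from \<sigma>[OF this] show ?thesis using that(3) unfolding horn_sat by simp
      qed
      \<comment> \<open>A cell of the certificate is regarded as blank as soon as \<sigma> admits
        the blank there, whatever else it admits; the certificate ends before the first such cell,
        \<open>l\<close>.\<close>
      define B where "B u \<longleftrightarrow> \<sigma> [0, 0, 0, ?W + ?n + u, 0]" for u
      define l where "l = (LEAST u. u = ?P \<or> B u)"
      have l: "l = ?P \<or> B l" unfolding l_def by (rule LeastI[of _ ?P]) simp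
      have lP: "l \<le> ?P" unfolding l_def by (rule Least_le) simp
      have nB: "\<not> B u" if "u < l" for u using not_less_Least[of u "\<lambda>u. u = ?P \<or> B u"] that by (auto simp: l_def)
      have guess: "?W + ?n + u < length ?ini \<and> ?ini ! (?W + ?n + u) = [0, 1, 2]" if "u < ?P" for u
        using that by (simp add: start_cells_def nth_append pl(2) del: replicate_Suc)
      have Bmono: "B u" if "l \<le> u" "u < ?P" for u
        using that
      proof (induction u rule: dec_induct)
        case base
        then show ?case using l by simp
      next
        case (step u)
        then show ?case using mono[of "?W + ?n + u"] guess[of u] by (simp add: B_def)
      qed
      \<comment> \<open>Where \<sigma> admits both bits, \<open>True\<close> is taken.\<close>
      define y where "y = map (\<lambda>u. \<sigma> [0, 0, 0, ?W + ?n + u, 2]) [0..<l]"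
      have y: "length y \<le> ?P" using lP by (simp add: y_def)
      have "\<sigma> [0, 0, 0, i, fst (input_tape (bit_pair x y)) (int i - int ?W)]" if "i < length ?ini" for i
        using that
      proof (cases rule: start_cells_cases)
        case 1
        then show ?thesis using st[OF that] by (simp add: input_tape_def)
      next
        case (2 u)
        then have "int i - int ?W = int u" by simp
        then show ?thesis using st[OF that] 2 by (simp add: input_tape_def bp nth_append)
      next
        case (3 u)
        then have i: "int i - int ?W = int (?n + u)" "i = ?W + ?n + u" by simp_all
        have u: "u < ?P" using 3 pl(2) by simp
        show ?thesis
        proof (cases "u < l")
          case True
          then have "\<not> \<sigma> [0, 0, 0, i, 0]" using nB i(2) by (simp add: B_def)
          then have "\<sigma> [0, 0, 0, i, 1] \<or> \<sigma> [0, 0, 0, i, 2]" using st[OF that] 3(3) by auto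
          moreover have "fst (input_tape (bit_pair x y)) (int i - int ?W) = bit_symbol (\<sigma> [0, 0, 0, i, 2])"
            unfolding i(1) bp using True i(2) by (simp add: input_tape_def y_def nth_append nat_int_add)
          ultimately show ?thesis by (auto simp: bit_symbol_def)
        next
          case False
          then have "\<sigma> [0, 0, 0, i, 0]" using Bmono[of u] u i(2) by (simp add: B_def)
          then show ?thesis unfolding i(1) bp using False by (simp add: input_tape_def y_def)
        qed
      next
        case (4 u)
        then have i: "int i - int ?W = int (?n + (?P + u))" using pl(2)[of x] by simp
        have "\<sigma> [0, 0, 0, i, 0]" using st[OF that] 4 by simp
        then show ?thesis unfolding i bp using y by (simp add: input_tape_def)
      qed
      from tableau_sound[where \<sigma> = \<sigma> and w = "bit_pair x y" and T = ?T and pre = "pre x" and P = "length (pl x)",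
          OF M \<sigma>[unfolded g_def] this]
      have "fst (snd ((tm_step M ^^ ?T) (tm_init M (bit_pair x y))) ! 1) 0 \<noteq> 1"
        by simp
      then have "bit_pair x y \<in> V" using out[OF refl y] by (auto simp: bit_symbol_def split: if_splits)
      then show "x \<in> L" using L y by blast
    qed
  qed
  moreover have "cnf_sat (g x) \<longleftrightarrow> enc_instance (reduction k (g x)) \<in> edtsb_language \<I>" for x
  proof -
    have "I = J" if "enc_instance I = enc_instance J" for I J
      using self_delimiting_instance that unfolding self_delimiting_def by metis
    then show ?thesis unfolding edtsb_language_def using II reduction_yes_iff[OF k] by blast
  qed
  ultimately show "polytime_reducible L (edtsb_language \<I>)"
    unfolding polytime_reducible_def by (intro exI[of _ "\<lambda>x. enc_instance (reduction k (g x))"]) simp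
qed

section \<open>Sparsification\<close>

definition mins :: "'l set set \<Rightarrow> 'l set set" where
  "mins F = {C \<in> F. \<not> (\<exists>D\<in>F. D \<subset> C)}"

text \<open>Clauses are sets to be hit by the set of true literals. A literal and its negation are
  unrelated elements of \<open>U\<close> here; sparsification does not look inside literals.\<close>

definition clause_sys :: "'l set \<Rightarrow> 'l set set \<Rightarrow> bool" where
  "clause_sys U F \<longleftrightarrow> finite U \<and> (\<forall>C\<in>F. C \<subseteq> U \<and> card C \<le> 3) \<and> (\<forall>C\<in>F. \<forall>D\<in>F. C \<subseteq> D \<longrightarrow> C = D)"

definition of_size :: "'l set set \<Rightarrow> nat \<Rightarrow> 'l set set" where
  "of_size F c = {C \<in> F. card C = c}"

text \<open>The inclusion is strict so that no petal is empty.\<close>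

definition flower :: "'l set set \<Rightarrow> 'l set \<Rightarrow> nat \<Rightarrow> 'l set set" where
  "flower F H c = {C \<in> F. card C = c \<and> H \<subset> C}"

definition petals :: "'l set set \<Rightarrow> 'l set \<Rightarrow> nat \<Rightarrow> 'l set set" where
  "petals F H c = (\<lambda>C. C - H) ` flower F H c"

text \<open>
  Adding a unit removes at most \<open>w\<close> clauses of size 2 once every literal is in at most \<open>w\<close> of them,
  so each branch decreases this potential.
\<close>

definition few_pairs :: "nat \<Rightarrow> 'l set set \<Rightarrow> bool" where
  "few_pairs w F \<longleftrightarrow> (\<forall>l. card (flower F {l} 2) \<le> w)"

definition potential :: "nat \<Rightarrow> 'l set \<Rightarrow> 'l set set \<Rightarrow> int" where
  "potential w U F = 2 * int w * (int (card U) - int (card (of_size F 1))) -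
     (if few_pairs w F then int (card (of_size F 2)) else 0)"

lemma mins_below:
  assumes "finite C" "C \<in> F"
  shows "\<exists>D\<in>mins F. D \<subseteq> C"
  using assms
proof (induction C rule: finite_psubset_induct)
  case (psubset C)
  show ?case
  proof (cases "\<exists>D\<in>F. D \<subset> C")
    case True
    then obtain D where "D \<in> F" "D \<subset> C" by blast
    then show ?thesis using psubset.IH[of D] by blast
  next
    case False
    then show ?thesis using psubset.prems by (auto simp: mins_def)
  qed
qed

lemma mins_hit:
  assumes "\<And>C. C \<in> F \<Longrightarrow> finite C"
  shows "(\<forall>C\<in>mins F. C \<inter> T \<noteq> {}) \<longleftrightarrow> (\<forall>C\<in>F. C \<inter> T \<noteq> {})"
proof
  assume h: "\<forall>C\<in>mins F. C \<inter> T \<noteq> {}"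
  show "\<forall>C\<in>F. C \<inter> T \<noteq> {}"
  proof
    fix C assume "C \<in> F"
    then obtain D where "D \<in> mins F" "D \<subseteq> C" using mins_below[OF assms] by (meson bexE)
    then show "C \<inter> T \<noteq> {}" using h by blast
  qed
qed (simp add: mins_def)

lemma clause_sys_mins:
  assumes "finite U" "\<And>C. C \<in> F \<Longrightarrow> C \<subseteq> U \<and> card C \<le> 3"
  shows "clause_sys U (mins F)"
  unfolding clause_sys_def
proof (intro conjI ballI impI)
  fix C assume "C \<in> mins F"
  then show "C \<subseteq> U" "card C \<le> 3" using assms(2)[of C] by (simp_all add: mins_def)
  fix D assume "D \<in> mins F" "C \<subseteq> D"
  then show "C = D" using \<open>C \<in> mins F\<close> by (auto simp: mins_def)
qed (rule assms(1))

lemma clause_sys_finite: "clause_sys U F \<Longrightarrow> finite F \<and> (\<forall>C\<in>F. finite C)"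
  unfolding clause_sys_def by (meson PowI finite_Pow_iff finite_subset subsetI)

text \<open>If \<open>T\<close> misses the heart, it hits every clause of the flower within its
  petal. Conversely, both extended systems contain \<open>F\<close>.\<close>

lemma petals_hit:
  "(\<forall>C\<in>F. C \<inter> T \<noteq> {}) \<longleftrightarrow>
    (\<forall>C\<in>insert H F. C \<inter> T \<noteq> {}) \<or> (\<forall>C\<in>petals F H c \<union> F. C \<inter> T \<noteq> {})"
  unfolding petals_def flower_def by blast

section \<open>The effect of new clauses on the potential\<close>

context
  fixes U :: "'l set" and F X :: "'l set set" and s :: nat
  assumes F: "clause_sys U F" and X: "\<And>x. x \<in> X \<Longrightarrow> card x = s \<and> (\<exists>C\<in>F. x \<subset> C)" and s: "0 < s"
begin

lemma new_not_above: "x \<in> X \<Longrightarrow> D \<in> F \<Longrightarrow> \<not> D \<subseteq> x"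
  using X[of x] F unfolding clause_sys_def by (metis psubset_imp_subset subset_psubset_trans order_less_irrefl)

lemma new_finite: "x \<in> X \<Longrightarrow> finite x"
  using X s by (metis card.infinite less_numeral_extra(3))

text \<open>New clauses of equal size cannot contain each other strictly, and since each lies
  strictly below an old clause, the antichain \<open>F\<close> has no member below it. So all new
  clauses survive, and the old ones above them disappear.\<close>

lemma mins_new: "mins (X \<union> F) = X \<union> {C \<in> F. \<not> (\<exists>x\<in>X. x \<subset> C)}"
proof -
  have "\<not> D \<subset> x" if "x \<in> X" "D \<in> X" for x D
    using X[OF that(1)] X[OF that(2)] psubset_card_mono[OF new_finite[OF that(1)], of D] by auto
  moreover have "\<not> D \<subset> x" if "x \<in> X" "D \<in> F" for x D using new_not_above[OF that] by blast
  moreover have "\<not> D \<subset> C" if "C \<in> F" "D \<in> F" for C D using that F unfolding clause_sys_def by blast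
  ultimately have "C \<in> mins (X \<union> F) \<longleftrightarrow> C \<in> X \<union> {C \<in> F. \<not> (\<exists>x\<in>X. x \<subset> C)}" for C
    unfolding mins_def mem_Collect_eq bex_Un Un_iff by metis
  then show ?thesis by blast
qed

lemma new_sys: "clause_sys U (mins (X \<union> F))"
proof (rule clause_sys_mins)
  show "finite U" using F by (simp add: clause_sys_def)
  fix C assume "C \<in> X \<union> F"
  then show "C \<subseteq> U \<and> card C \<le> 3"
  proof
    assume "C \<in> X"
    then obtain D where D: "D \<in> F" "C \<subset> D" using X by blast
    then have "finite D" "D \<subseteq> U" "card D \<le> 3" using F clause_sys_finite[OF F] by (auto simp: clause_sys_def)
    then show ?thesis using D card_mono[of D C] by auto
  qed (use F in \<open>auto simp: clause_sys_def\<close>)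
qed

lemma new_disjoint: "X \<inter> F = {}"
  using new_not_above by blast

lemma finF: "finite F" "C \<in> F \<Longrightarrow> finite C" "finite X"
proof -
  show "finite F" "C \<in> F \<Longrightarrow> finite C" using clause_sys_finite[OF F] by auto
  have "X \<subseteq> Pow U"
  proof
    fix x assume "x \<in> X"
    then obtain C where "C \<in> F" "x \<subset> C" using X by (meson bexE)
    moreover from this have "C \<subseteq> U" using F by (simp add: clause_sys_def)
    ultimately show "x \<in> Pow U" by blast
  qed
  then show "finite X" using F unfolding clause_sys_def by (meson finite_Pow_iff finite_subset)
qed

text \<open>A unit is worth \<open>2 * w\<close>. While \<open>few_pairs\<close> holds, it removes
  at most \<open>w\<close> pairs, so \<open>w\<close> remains as gain. If \<open>few_pairs\<close>
  becomes true only now, the pairs that begin to count lower the potential further.\<close>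

lemma potential_units:
  assumes s1: "s = 1"
  shows "potential w U (mins (X \<union> F)) \<le> potential w U F - int w * int (card X)"
proof -
  let ?F = "mins (X \<union> F)"
  have u: "of_size ?F 1 = X \<union> of_size F 1"
  proof -
    have "\<not> x \<subset> C" if "x \<in> X" "C \<in> F" "card C = 1" for x C
      using X[OF that(1)] s1 that(3) finF(2)[OF that(2)] psubset_card_mono[of C x] by auto
    moreover have "card x = 1" if "x \<in> X" for x using X[OF that] s1 by simp
    ultimately have "C \<in> of_size ?F 1 \<longleftrightarrow> C \<in> X \<union> of_size F 1" for C
      unfolding mins_new of_size_def mem_Collect_eq Un_iff by metis
    then show ?thesis by blast
  qed
  have cu: "card (of_size ?F 1) = card X + card (of_size F 1)"
    unfolding u using finF new_disjoint by (intro card_Un_disjoint) (auto simp: of_size_def)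
  have x1: "card x \<noteq> 2" if "x \<in> X" for x using X[OF that] s1 by simp
  have two: "of_size ?F 2 \<subseteq> of_size F 2"
    unfolding mins_new of_size_def using x1 by blast
  have good: "few_pairs w ?F" if "few_pairs w F"
    unfolding few_pairs_def
  proof
    fix l
    have "flower ?F {l} 2 \<subseteq> flower F {l} 2" unfolding mins_new flower_def using x1 by blast
    then have "card (flower ?F {l} 2) \<le> card (flower F {l} 2)"
      using finF by (intro card_mono) (auto simp: flower_def)
    then show "card (flower ?F {l} 2) \<le> w" using that unfolding few_pairs_def by (meson le_trans)
  qed
  have t: "card (of_size F 2) \<le> card (of_size ?F 2) + w * card X" if g: "few_pairs w F"
  proof -
    have "of_size F 2 \<subseteq> of_size ?F 2 \<union> (\<Union>x\<in>X. {C \<in> F. card C = 2 \<and> x \<subset> C})"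
      unfolding mins_new of_size_def by blast
    then have "card (of_size F 2) \<le> card (of_size ?F 2 \<union> (\<Union>x\<in>X. {C \<in> F. card C = 2 \<and> x \<subset> C}))"
      using finF two by (intro card_mono) (auto simp: of_size_def mins_new)
    also have "\<dots> \<le> card (of_size ?F 2) + card (\<Union>x\<in>X. {C \<in> F. card C = 2 \<and> x \<subset> C})" by (rule card_Un_le)
    also have "card (\<Union>x\<in>X. {C \<in> F. card C = 2 \<and> x \<subset> C}) \<le> (\<Sum>x\<in>X. card {C \<in> F. card C = 2 \<and> x \<subset> C})"
      using finF by (intro card_UN_le) auto
    also have "\<dots> \<le> (\<Sum>x\<in>X. w)"
    proof (rule sum_mono)
      fix x assume "x \<in> X"
      then obtain l where "x = {l}" using X s1 by (metis card_1_singletonE)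
      then show "card {C \<in> F. card C = 2 \<and> x \<subset> C} \<le> w" using g unfolding few_pairs_def flower_def by simp
    qed
    finally show ?thesis by (simp add: mult.commute)
  qed
  show ?thesis
  proof (cases "few_pairs w F")
    case True
    have "int (card (of_size F 2)) \<le> int (card (of_size ?F 2)) + int w * int (card X)"
      using t[OF True] by (metis of_nat_add of_nat_le_iff of_nat_mult)
    then show ?thesis using True good[OF True] unfolding potential_def cu by (simp add: algebra_simps)
  next
    case False
    have "0 \<le> int w * int (card X)" by simp
    then show ?thesis using False unfolding potential_def cu by (simp add: algebra_simps)
  qed
qed

text \<open>A clause of size at most 2 is never strictly above a new pair, so no unit and no pair is
  lost; as the degrees stay within \<open>w\<close>, the pairs count both before and after.\<close>

lemma potential_pairs:
  assumes s2: "s = 2" and g: "\<And>l. card (flower F {l} 2) + card {x \<in> X. l \<in> x} \<le> w"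
  shows "potential w U (mins (X \<union> F)) = potential w U F - int (card X)"
proof -
  let ?F = "mins (X \<union> F)"
  have small: "\<not> x \<subset> C" if "x \<in> X" "C \<in> F" "card C \<le> 2" for x C
    using X[OF that(1)] s2 that(3) finF(2)[OF that(2)] psubset_card_mono[of C x] by auto
  have x2: "card x = 2" "card x \<noteq> 1" if "x \<in> X" for x using X[OF that] s2 by simp_all
  have sm: "\<not> x \<subset> C" if "x \<in> X" "C \<in> F" "card C = 1 \<or> card C = 2" for x C
    using small[OF that(1,2)] that(3) by linarith
  have u: "of_size ?F 1 = of_size F 1"
    unfolding mins_new of_size_def using x2 sm by blast
  have t: "of_size ?F 2 = X \<union> of_size F 2"
    unfolding mins_new of_size_def using x2 sm by blast
  have ct: "card (of_size ?F 2) = card X + card (of_size F 2)"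
    unfolding t using finF new_disjoint by (intro card_Un_disjoint) (auto simp: of_size_def)
  have "few_pairs w F" unfolding few_pairs_def using g by (meson add_leD1)
  moreover have "few_pairs w ?F"
    unfolding few_pairs_def
  proof
    fix l
    have "flower ?F {l} 2 \<subseteq> flower F {l} 2 \<union> {x \<in> X. l \<in> x}"
      unfolding mins_new flower_def by auto
    then have "card (flower ?F {l} 2) \<le> card (flower F {l} 2 \<union> {x \<in> X. l \<in> x})"
      using finF by (intro card_mono) (auto simp: flower_def)
    also have "\<dots> \<le> w" using card_Un_le[of "flower F {l} 2" "{x \<in> X. l \<in> x}"] g[of l] by linarith
    finally show "card (flower ?F {l} 2) \<le> w" .
  qed
  ultimately show ?thesis unfolding potential_def u ct by simp
qed

end

text \<open>Clauses with at least two literals avoid the literals of the units, since no clause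
  contains another one. So the flowers of the remaining literals cover them.\<close>

lemma pairs_bound:
  assumes F: "clause_sys U F" and w: "\<And>l. card (flower F {l} c) \<le> w" and c: "2 \<le> c"
  shows "card (of_size F c) \<le> w * (card U - card (of_size F 1))"
proof -
  have U: "finite U" using F by (simp add: clause_sys_def)
  note fin = clause_sys_finite[OF F]
  let ?S = "\<Union>(of_size F 1)"
  have S: "?S \<subseteq> U" using F by (auto simp: clause_sys_def of_size_def)
  have cS: "card ?S = card (of_size F 1)"
  proof -
    have "of_size F 1 = (\<lambda>l. {l}) ` ?S"
      by (auto simp: of_size_def card_1_singleton_iff)
    then show ?thesis by (metis card_image inj_singleton)
  qed
  have "of_size F c \<subseteq> (\<Union>l\<in>U - ?S. flower F {l} c)"
  proof
    fix C assume "C \<in> of_size F c"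
    then have C: "C \<in> F" "card C = c" by (auto simp: of_size_def)
    then obtain l where l: "l \<in> C" using c by fastforce
    have ne: "{l} \<noteq> C" using C(2) c by auto
    have "l \<notin> ?S"
    proof
      assume "l \<in> ?S"
      then obtain D where "D \<in> F" "card D = 1" "l \<in> D" by (auto simp: of_size_def)
      then have "D = {l}" "D \<in> F" by (auto simp: card_1_singleton_iff)
      then show False using F C(1) l ne unfolding clause_sys_def by blast
    qed
    moreover have "l \<in> U" using F C(1) l by (auto simp: clause_sys_def)
    ultimately show "C \<in> (\<Union>l\<in>U - ?S. flower F {l} c)" using C l ne by (auto simp: flower_def)
  qed
  then have "card (of_size F c) \<le> card (\<Union>l\<in>U - ?S. flower F {l} c)"
    using U fin by (intro card_mono) (auto simp: flower_def)
  also have "\<dots> \<le> (\<Sum>l\<in>U - ?S. card (flower F {l} c))" using U by (intro card_UN_le) auto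
  also have "\<dots> \<le> (\<Sum>l\<in>U - ?S. w)" using w by (intro sum_mono) auto
  finally show ?thesis using U S cS by (simp add: card_Diff_subset finite_subset mult.commute)
qed

text \<open>By \<open>pairs_bound\<close>, the pairs weigh at most half of what the literals without
  a unit contribute.\<close>

lemma potential_nonneg:
  assumes F: "clause_sys U F"
  shows "0 \<le> potential w U F"
proof -
  have U: "finite U" using F by (simp add: clause_sys_def)
  have "of_size F 1 \<subseteq> (\<lambda>l. {l}) ` U"
    using F by (auto simp: of_size_def clause_sys_def card_1_singleton_iff)
  then have u: "card (of_size F 1) \<le> card U"
    using U by (metis card_image card_mono finite_imageI inj_singleton)
  show ?thesis
  proof (cases "few_pairs w F")
    case True
    then have "card (of_size F 2) \<le> w * (card U - card (of_size F 1))"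
      using pairs_bound[OF F, of 2 w] by (simp add: few_pairs_def)
    then have "int (card (of_size F 2)) \<le> int w * (int (card U) - int (card (of_size F 1)))"
      using u by (metis of_nat_diff of_nat_le_iff of_nat_mult)
    moreover have "0 \<le> int w * (int (card U) - int (card (of_size F 1)))" using u by simp
    ultimately show ?thesis using True unfolding potential_def by (simp add: mult.assoc)
  next
    case False
    then show ?thesis using u unfolding potential_def by simp
  qed
qed

lemma potential_le: "potential w U F \<le> 2 * int w * int (card U)"
  unfolding potential_def by (simp add: algebra_simps)

lemma card_petals: "card (petals F H c) = card (flower F H c)"
  unfolding petals_def by (rule card_image) (auto simp: inj_on_def flower_def)

lemma card_petal:
  assumes "clause_sys U F" "x \<in> petals F H c"
  shows "card x = c - card H \<and> (H \<noteq> {} \<longrightarrow> (\<exists>C\<in>F. x \<subset> C))"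
proof -
  obtain C where C: "C \<in> F" "card C = c" "H \<subset> C" "x = C - H" using assms(2) by (auto simp: petals_def flower_def)
  then have "finite C" using clause_sys_finite[OF assms(1)] by blast
  then show ?thesis using C by (auto simp: card_Diff_subset finite_subset)
qed

text \<open>The priority of the rules keeps degrees small. When pairs become petals, any literal
  lies in fewer than \<open>d ^ 2\<close> old pairs by the failure of the first rule, and in fewer
  than \<open>d ^ 2\<close> petals, because together with the heart it forms a pair to which the
  second rule does not apply. So \<open>few_pairs\<close> persists for
  \<open>w = 2 * d ^ 2\<close>.\<close>

definition rule_applies :: "nat \<Rightarrow> 'l set set \<Rightarrow> 'l set \<Rightarrow> nat \<Rightarrow> bool" where
  "rule_applies d F H c \<longleftrightarrow>
     (card H = 1 \<and> c = 2 \<and> d ^ 2 \<le> card (flower F H 2)) \<or>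
     ((\<forall>l. card (flower F {l} 2) < d ^ 2) \<and>
       ((card H = 2 \<and> c = 3 \<and> d ^ 2 \<le> card (flower F H 3)) \<or>
        ((\<forall>H. card H = 2 \<longrightarrow> card (flower F H 3) < d ^ 2) \<and>
          card H = 1 \<and> c = 3 \<and> d ^ 4 \<le> card (flower F H 3))))"

text \<open>The heart gains at least 1. Petals that are units number at least \<open>d ^ 2\<close>
  and gain \<open>2 * d ^ 2\<close> each; petals that are pairs number at least \<open>d ^ 4\<close>
  and gain 1 each. So the petals gain \<open>d ^ 4\<close> in either case.\<close>

lemma rule_potential:
  assumes F: "clause_sys U F" and r: "rule_applies d F H c" and d: "1 \<le> d"
  shows "clause_sys U (mins (insert H F))" "clause_sys U (mins (petals F H c \<union> F))"
    "potential (2 * d ^ 2) U (mins (insert H F)) \<le> potential (2 * d ^ 2) U F - 1"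
    "potential (2 * d ^ 2) U (mins (petals F H c \<union> F)) \<le> potential (2 * d ^ 2) U F - int (d ^ 4)"
proof -
  let ?w = "2 * d ^ 2" and ?P = "petals F H c"
  have d2: "1 \<le> d ^ 2" "1 \<le> d ^ 4" using d by simp_all
  have hc: "card H < c" "0 < card H" "card H \<le> 2" "1 \<le> card (flower F H c)" "H \<noteq> {}"
    using r d2 unfolding rule_applies_def by auto
  then have "flower F H c \<noteq> {}" by auto
  then have H: "\<And>x. x \<in> {H} \<Longrightarrow> card x = card H \<and> (\<exists>C\<in>F. x \<subset> C)" by (auto simp: flower_def)
  have P: "\<And>x. x \<in> ?P \<Longrightarrow> card x = c - card H \<and> (\<exists>C\<in>F. x \<subset> C)" using card_petal[OF F] hc(5) by blast
  show "clause_sys U (mins (insert H F))" using new_sys[where X = "{H}", OF F H hc(2)] by simp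
  show "clause_sys U (mins (?P \<union> F))" using new_sys[OF F P] hc(1) by simp
  have hu: "potential ?w U (mins (insert H F)) \<le> potential ?w U F - 1" if "card H = 1"
  proof -
    have "potential ?w U (mins ({H} \<union> F)) \<le> potential ?w U F - int ?w * int (card {H})"
      using potential_units[OF F H hc(2) that] .
    moreover have "1 \<le> int ?w" using d2(1) by linarith
    ultimately show ?thesis by simp
  qed
  have pu: "potential ?w U (mins (?P \<union> F)) \<le> potential ?w U F - int (d ^ 4)"
    if "c - card H = 1" "d ^ 2 \<le> card (flower F H c)"
  proof -
    have "potential ?w U (mins (?P \<union> F)) \<le> potential ?w U F - int ?w * int (card ?P)"
      using that(1) by (intro potential_units[where X = ?P, OF F P]) simp_all
    moreover have "d ^ 4 \<le> ?w * card ?P"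
    proof -
      have "d ^ 4 = d ^ 2 * d ^ 2" by (simp add: power_add[symmetric])
      also have "\<dots> \<le> ?w * card ?P" unfolding card_petals using that(2) by (intro mult_mono) auto
      finally show ?thesis .
    qed
    then have "int (d ^ 4) \<le> int ?w * int (card ?P)" by (metis of_nat_le_iff of_nat_mult)
    ultimately show ?thesis by linarith
  qed
  consider (a) "card H = 1" "c = 2" "d ^ 2 \<le> card (flower F H 2)"
    | (b) "\<And>l. card (flower F {l} 2) < d ^ 2" "card H = 2" "c = 3" "d ^ 2 \<le> card (flower F H 3)"
    | (c) "\<And>l. card (flower F {l} 2) < d ^ 2" "\<And>H. card H = 2 \<Longrightarrow> card (flower F H 3) < d ^ 2"
        "card H = 1" "c = 3" "d ^ 4 \<le> card (flower F H 3)"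
    using r unfolding rule_applies_def by blast
  then have "potential ?w U (mins (insert H F)) \<le> potential ?w U F - 1 \<and>
    potential ?w U (mins (?P \<union> F)) \<le> potential ?w U F - int (d ^ 4)"
  proof cases
    case a
    then show ?thesis using hu pu by simp
  next
    case b
    have "potential ?w U (mins ({H} \<union> F)) = potential ?w U F - int (card {H})"
    proof (rule potential_pairs[OF F H hc(2) b(2)])
      fix l
      have "card {x \<in> {H}. l \<in> x} \<le> card {H}" by (intro card_mono) auto
      then show "card (flower F {l} 2) + card {x \<in> {H}. l \<in> x} \<le> ?w" using b(1)[of l] by simp
    qed
    then show ?thesis using pu b by simp
  next
    case c
    have "potential ?w U (mins (?P \<union> F)) = potential ?w U F - int (card ?P)"
    proof (rule potential_pairs[OF F P])
      fix l
      have "card {x \<in> ?P. l \<in> x} < d ^ 2"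
      proof (cases "l \<in> H")
        case True
        then have "{x \<in> ?P. l \<in> x} = {}" by (auto simp: petals_def)
        then have "card {x \<in> ?P. l \<in> x} = 0" by (simp only: card.empty)
        then show ?thesis using d2 by linarith
      next
        case False
        have finH: "finite H" using c(3) by (metis card.infinite zero_neq_one)
        have c2: "card (insert l H) = 2" using False c(3) finH by simp
        have "{x \<in> ?P. l \<in> x} \<subseteq> (\<lambda>C. C - H) ` flower F (insert l H) 3"
        proof
          fix x assume "x \<in> {x \<in> ?P. l \<in> x}"
          then obtain C where C: "C \<in> F" "card C = 3" "H \<subset> C" "x = C - H" "l \<in> C"
            using c(4) by (auto simp: petals_def flower_def)
          have "insert l H \<noteq> C" using c2 C(2) by auto
          then show "x \<in> (\<lambda>C. C - H) ` flower F (insert l H) 3" using C by (auto simp: flower_def)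
        qed
        then have "card {x \<in> ?P. l \<in> x} \<le> card (flower F (insert l H) 3)"
          using clause_sys_finite[OF F] by (intro surj_card_le) (auto simp: flower_def)
        then show ?thesis using c(2)[OF c2] by linarith
      qed
      then show "card (flower F {l} 2) + card {x \<in> ?P. l \<in> x} \<le> ?w" using c(1)[of l] by linarith
    qed (use c in auto)
    then show ?thesis using hu c card_petals[of F H c] by simp
  qed
  then show "potential ?w U (mins (insert H F)) \<le> potential ?w U F - 1"
    "potential ?w U (mins (?P \<union> F)) \<le> potential ?w U F - int (d ^ 4)" by blast+
qed

text \<open>The leading 1 is for the empty clause; the three terms in the last factor are for the
  clauses of size 1, 2 and 3 per literal.\<close>

lemma sparse_card:
  assumes F: "clause_sys U F" and no: "\<And>H c. \<not> rule_applies d F H c"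
  shows "card F \<le> 1 + card U * (1 + d ^ 2 + d ^ 4)"
proof -
  note fin = clause_sys_finite[OF F]
  have U: "finite U" using F by (simp add: clause_sys_def)
  have 2: "card (flower F {l} 2) < d ^ 2" for l
    using no[of "{l}" 2] unfolding rule_applies_def by auto
  have 3: "card (flower F H 3) < d ^ 2" if "card H = 2" for H
    using no[of H 3] 2 that unfolding rule_applies_def by auto
  have 4: "card (flower F {l} 3) < d ^ 4" for l
    using no[of "{l}" 3] 2 3 unfolding rule_applies_def by auto
  have "F = of_size F 0 \<union> of_size F 1 \<union> of_size F 2 \<union> of_size F 3"
  proof -
    have "card C = 0 \<or> card C = 1 \<or> card C = 2 \<or> card C = 3" if "C \<in> F" for C
    proof -
      have "card C \<le> 3" using F that by (simp add: clause_sys_def)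
      then show ?thesis by linarith
    qed
    then show ?thesis by (auto simp: of_size_def)
  qed
  then have "card F = card (of_size F 0 \<union> of_size F 1 \<union> of_size F 2 \<union> of_size F 3)"
    by (rule arg_cong[where f = card])
  also have "\<dots> \<le> card (of_size F 0) + card (of_size F 1) + card (of_size F 2) + card (of_size F 3)"
    using card_Un_le[of "of_size F 0 \<union> of_size F 1 \<union> of_size F 2" "of_size F 3"]
      card_Un_le[of "of_size F 0 \<union> of_size F 1" "of_size F 2"] card_Un_le[of "of_size F 0" "of_size F 1"]
    by linarith
  finally have "card F \<le> card (of_size F 0) + card (of_size F 1) + card (of_size F 2) + card (of_size F 3)" .
  moreover have "of_size F 0 \<subseteq> {{}}" using fin by (auto simp: of_size_def)
  then have "card (of_size F 0) \<le> 1" by (metis card.empty card.insert card_mono empty_iff finite.emptyI finite.insertI One_nat_def)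
  moreover have "of_size F 1 \<subseteq> (\<lambda>l. {l}) ` U"
    using F by (auto simp: of_size_def clause_sys_def card_1_singleton_iff)
  then have "card (of_size F 1) \<le> card U"
    using U by (metis card_image card_mono finite_imageI inj_singleton)
  moreover have "card (of_size F 2) \<le> d ^ 2 * card U"
  proof -
    have "card (of_size F 2) \<le> d ^ 2 * (card U - card (of_size F 1))"
      using 2 by (intro pairs_bound[OF F]) (auto intro: less_imp_le)
    also have "\<dots> \<le> d ^ 2 * card U" by (intro mult_le_mono2) simp
    finally show ?thesis .
  qed
  moreover have "card (of_size F 3) \<le> d ^ 4 * card U"
  proof -
    have "card (of_size F 3) \<le> d ^ 4 * (card U - card (of_size F 1))"
      using 4 by (intro pairs_bound[OF F]) (auto intro: less_imp_le)
    also have "\<dots> \<le> d ^ 4 * card U" by (intro mult_le_mono2) simp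
    finally show ?thesis .
  qed
  ultimately show ?thesis by (simp add: algebra_simps)
qed

text \<open>This is the characteristic inequality of a recurrence with drops 1 and
  \<open>d ^ 4\<close>, for the rate \<open>x = 1 + 1 / d ^ 3\<close>. Here
  \<open>1 - 1 / x = 1 / (d ^ 3 + 1)\<close>, and Bernoulli's inequality gives
  \<open>x ^ (d ^ 3) \<ge> 2\<close>, so the power with exponent \<open>d ^ 4\<close> is at least
  \<open>2 ^ d\<close>.\<close>

lemma growth_rate:
  assumes "10 \<le> d"
  shows "inverse (1 + 1 / real d ^ 3) + inverse ((1 + 1 / real d ^ 3) ^ (d ^ 4)) \<le> 1"
proof -
  let ?x = "1 + 1 / real d ^ 3"
  have d3: "real d ^ 3 > 0" using assms by simp
  have x: "?x > 0" using d3 by (simp add: add_pos_pos)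
  \<comment> \<open>The number 10 comes from here: 1001 \<le> 1024, whereas 9 would give 730 >
    512.\<close>
  have "d ^ 3 + 1 \<le> 2 ^ d" using assms
  proof (induction d rule: nat_induct_at_least)
    case base
    show ?case by simp
  next
    case (Suc n)
    have "Suc n ^ 3 + 1 \<le> 2 * (n ^ 3 + 1)"
    proof -
      have "3 * n ^ 2 + 3 * n \<le> 10 * n ^ 2" using Suc.hyps by (simp add: power2_eq_square)
      also have "\<dots> \<le> n * n ^ 2" using Suc.hyps by (intro mult_le_mono1)
      finally have "3 * n ^ 2 + 3 * n \<le> n ^ 3" by (simp add: power3_eq_cube power2_eq_square)
      moreover have "Suc n ^ 3 = n ^ 3 + 3 * n ^ 2 + 3 * n + 1"
        by (simp add: power3_eq_cube power2_eq_square algebra_simps)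
      ultimately have "Suc n ^ 3 + 1 \<le> (n ^ 3 + n ^ 3) + 2" by (simp only: add_le_mono)
      then show ?thesis by simp
    qed
    then show ?case using Suc.IH by simp
  qed
  then have "real (d ^ 3 + 1) \<le> real (2 ^ d)" by (rule of_nat_mono)
  then have a: "real d ^ 3 + 1 \<le> 2 ^ d" by simp
  have "1 + real (d ^ 3) * (1 / real d ^ 3) \<le> ?x ^ (d ^ 3)"
    by (rule Bernoulli_inequality) (rule order.trans[of _ 0], simp_all)
  then have "2 \<le> ?x ^ (d ^ 3)" using d3 by simp
  then have "2 ^ d \<le> (?x ^ (d ^ 3)) ^ d" by (intro power_mono) auto
  also have "\<dots> = ?x ^ (d ^ 4)" by (simp add: power_mult[symmetric] power_add[symmetric] eval_nat_numeral mult_ac)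
  finally have "real d ^ 3 + 1 \<le> ?x ^ (d ^ 4)" using a by linarith
  moreover have "0 < real d ^ 3 + 1" using d3 by (intro add_pos_pos zero_less_power) auto
  ultimately have "inverse (?x ^ (d ^ 4)) \<le> inverse (real d ^ 3 + 1)" by (rule le_imp_inverse_le)
  moreover have "inverse ?x = 1 - inverse (real d ^ 3 + 1)"
  proof -
    have "0 < real d ^ 3" "0 < real d ^ 3 + 1" using d3 by (simp, intro add_pos_pos zero_less_power, auto)
    then show ?thesis by (simp add: divide_simps)
  qed
  ultimately show ?thesis by linarith
qed

section \<open>Solving 3-SAT by branching\<close>

text \<open>A normal form relative to the list \<open>U\<close>: equal sets of literals become equal
  lists, so that lengths of lists are cardinalities.\<close>

definition canon :: "'l list \<Rightarrow> 'l list \<Rightarrow> 'l list" where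
  "canon U C = filter (\<lambda>l. l \<in> set C) U"

definition minimal_clauses :: "'l list list \<Rightarrow> 'l list list" where
  "minimal_clauses \<psi> = remdups (filter (\<lambda>C. \<not> (\<exists>D\<in>set \<psi>. (\<forall>l\<in>set D. l \<in> set C) \<and> \<not> (\<forall>l\<in>set C. l \<in> set D))) \<psi>)"

definition clause_sets :: "'l list list \<Rightarrow> 'l set set" where
  "clause_sets \<psi> = set ` set \<psi>"

definition flower_list :: "'l list list \<Rightarrow> 'l list \<Rightarrow> nat \<Rightarrow> 'l list list" where
  "flower_list \<psi> H c = filter (\<lambda>C. length C = c \<and> (\<forall>l\<in>set H. l \<in> set C)) \<psi>"

definition pair_lists :: "'l list \<Rightarrow> 'l list list" where
  "pair_lists U = concat (map (\<lambda>l. map (\<lambda>m. [l, m]) (filter (\<lambda>m. m \<noteq> l) U)) U)"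

text \<open>Only the first element is used. The three parts follow the priority of the rules: if a
  later part supplies it, the earlier ones are empty.\<close>

definition pick_heart :: "nat \<Rightarrow> 'l list \<Rightarrow> 'l list list \<Rightarrow> ('l list \<times> nat) list" where
  "pick_heart d U \<psi> = map (\<lambda>H. (H, 2)) (filter (\<lambda>H. d ^ 2 \<le> length (flower_list \<psi> H 2)) (map (\<lambda>l. [l]) U)) @
     map (\<lambda>H. (H, 3)) (filter (\<lambda>H. d ^ 2 \<le> length (flower_list \<psi> H 3)) (pair_lists U)) @
     map (\<lambda>H. (H, 3)) (filter (\<lambda>H. d ^ 4 \<le> length (flower_list \<psi> H 3)) (map (\<lambda>l. [l]) U))"

definition heart_branch :: "'l list \<Rightarrow> 'l list list \<Rightarrow> 'l list \<Rightarrow> 'l list list" where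
  "heart_branch U \<psi> H = minimal_clauses (canon U H # \<psi>)"

definition petal_branch :: "'l list list \<Rightarrow> 'l list \<Rightarrow> nat \<Rightarrow> 'l list list" where
  "petal_branch \<psi> H c = minimal_clauses (map (\<lambda>C. filter (\<lambda>l. l \<notin> set H) C) (flower_list \<psi> H c) @ \<psi>)"

definition canon_sys :: "'l list \<Rightarrow> 'l list list \<Rightarrow> bool" where
  "canon_sys U \<psi> \<longleftrightarrow> distinct U \<and> clause_sys (set U) (clause_sets \<psi>) \<and> (\<forall>C\<in>set \<psi>. canon U C = C) \<and> distinct \<psi>"

lemma clause_sets_minimal: "clause_sets (minimal_clauses \<psi>) = mins (clause_sets \<psi>)"
proof -
  have "(\<forall>l\<in>set D. l \<in> set C) \<and> \<not> (\<forall>l\<in>set C. l \<in> set D) \<longleftrightarrow> set D \<subset> set C" for C D :: "'a list"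
    by blast
  then have "set (minimal_clauses \<psi>) = {C \<in> set \<psi>. \<not> (\<exists>D\<in>set \<psi>. set D \<subset> set C)}"
    unfolding minimal_clauses_def by simp
  then show ?thesis unfolding clause_sets_def mins_def by auto
qed

lemma set_canon: "set (canon U C) = set C \<inter> set U"
  by (auto simp: canon_def)

lemma canon_set_eq: "set C = set D \<Longrightarrow> canon U C = canon U D"
  by (simp add: canon_def)

lemma distinct_minimal: "distinct (minimal_clauses \<psi>)"
  by (simp add: minimal_clauses_def)

lemma set_minimal: "set (minimal_clauses \<psi>) \<subseteq> set \<psi>"
  by (auto simp: minimal_clauses_def)

lemma canon_sys_inj: "canon_sys U \<psi> \<Longrightarrow> inj_on set (set \<psi>)"
  unfolding canon_sys_def inj_on_def by (metis canon_set_eq)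

lemma canon_sys_card:
  assumes "canon_sys U \<psi>" "C \<in> set \<psi>"
  shows "card (set C) = length C"
proof -
  have "C = filter (\<lambda>l. l \<in> set C) U" "distinct U" using assms by (auto simp: canon_sys_def canon_def)
  then have "distinct C" by (metis distinct_filter)
  then show ?thesis by (rule distinct_card)
qed

lemma flower_list:
  assumes "canon_sys U \<psi>" "distinct H" "length H < c"
  shows "clause_sets (flower_list \<psi> H c) = flower (clause_sets \<psi>) (set H) c"
    "length (flower_list \<psi> H c) = card (flower (clause_sets \<psi>) (set H) c)"
proof -
  have *: "length C = c \<and> (\<forall>l\<in>set H. l \<in> set C) \<longleftrightarrow> card (set C) = c \<and> set H \<subset> set C" if "C \<in> set \<psi>" for C
    using canon_sys_card[OF assms(1) that] distinct_card[OF assms(2)] assms(3) by auto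
  have "set (flower_list \<psi> H c) = {C \<in> set \<psi>. card (set C) = c \<and> set H \<subset> set C}"
    unfolding flower_list_def set_filter using * by blast
  then show 1: "clause_sets (flower_list \<psi> H c) = flower (clause_sets \<psi>) (set H) c"
    unfolding clause_sets_def flower_def by auto
  have "distinct (flower_list \<psi> H c)" using assms(1) by (simp add: flower_list_def canon_sys_def)
  moreover have "inj_on set (set (flower_list \<psi> H c))"
    using canon_sys_inj[OF assms(1)] by (rule inj_on_subset) (auto simp: flower_list_def)
  ultimately have "length (flower_list \<psi> H c) = card (clause_sets (flower_list \<psi> H c))"
    by (simp add: clause_sets_def card_image distinct_card)
  then show "length (flower_list \<psi> H c) = card (flower (clause_sets \<psi>) (set H) c)" by (simp only: 1)
qed

lemma set_pair_lists: "H \<in> set (pair_lists U) \<longleftrightarrow> (\<exists>l m. H = [l, m] \<and> l \<in> set U \<and> m \<in> set U \<and> m \<noteq> l)"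
  by (auto simp: pair_lists_def)

lemma pick_heart_none:
  assumes S: "canon_sys U \<psi>" and n: "pick_heart d U \<psi> = []" and d: "1 \<le> d"
  shows "\<not> rule_applies d (clause_sets \<psi>) H c"
proof -
  have d2: "1 \<le> d ^ 2" "1 \<le> d ^ 4" using d by simp_all
  have U: "H \<subseteq> set U" if "1 \<le> card (flower (clause_sets \<psi>) H c)" for H c
  proof -
    have "flower (clause_sets \<psi>) H c \<noteq> {}" using that by auto
    then show ?thesis using S by (auto simp: flower_def canon_sys_def clause_sys_def)
  qed
  have 1: "length (flower_list \<psi> [l] 2) < d ^ 2" "length (flower_list \<psi> [l] 3) < d ^ 4" if "l \<in> set U" for l
    using n that unfolding pick_heart_def by (auto simp: filter_empty_conv not_le)
  have 2: "length (flower_list \<psi> [l, m] 3) < d ^ 2" if "l \<in> set U" "m \<in> set U" "m \<noteq> l" for l m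
    using n that unfolding pick_heart_def by (auto simp: filter_empty_conv not_le set_pair_lists)
  show ?thesis
  proof
    assume "rule_applies d (clause_sets \<psi>) H c"
    then consider "card H = 1" "d ^ 2 \<le> card (flower (clause_sets \<psi>) H 2)"
      | "card H = 2" "d ^ 2 \<le> card (flower (clause_sets \<psi>) H 3)"
      | "card H = 1" "d ^ 4 \<le> card (flower (clause_sets \<psi>) H 3)"
      unfolding rule_applies_def by blast
    then show False
    proof cases
      case 1
      then obtain l where l: "H = {l}" by (metis card_1_singletonE)
      have "l \<in> set U" using U[of H 2] 1 d2 l by simp
      then show False using 1(2) \<open>l \<in> set U \<Longrightarrow> length (flower_list \<psi> [l] 2) < d ^ 2\<close> flower_list(2)[OF S, of "[l]" 2] l by simp
    next
      case 2
      then obtain l m where lm: "H = {l, m}" "l \<noteq> m" by (metis card_2_iff)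
      have "l \<in> set U" "m \<in> set U" using U[of H 3] 2 d2 lm by simp_all
      then show False using 2(2) \<open>\<And>m l. l \<in> set U \<Longrightarrow> m \<in> set U \<Longrightarrow> m \<noteq> l \<Longrightarrow> length (flower_list \<psi> [l, m] 3) < d ^ 2\<close>[of l m]
          flower_list(2)[OF S, of "[l, m]" 3] lm by auto
    next
      case 3
      then obtain l where l: "H = {l}" by (metis card_1_singletonE)
      have "l \<in> set U" using U[of H 3] 3 d2 l by simp
      then show False using 3(2) \<open>l \<in> set U \<Longrightarrow> length (flower_list \<psi> [l] 3) < d ^ 4\<close> flower_list(2)[OF S, of "[l]" 3] l by simp
    qed
  qed
qed

lemma pick_heart_some:
  assumes S: "canon_sys U \<psi>" and p: "pick_heart d U \<psi> = (H, c) # r" and d: "1 \<le> d"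
  shows "rule_applies d (clause_sets \<psi>) (set H) c" "distinct H" "length H < c" "set H \<subseteq> set U"
proof -
  have d2: "1 \<le> d ^ 2" using d by simp
  let ?A = "filter (\<lambda>H. d ^ 2 \<le> length (flower_list \<psi> H 2)) (map (\<lambda>l. [l]) U)"
  let ?B = "filter (\<lambda>H. d ^ 2 \<le> length (flower_list \<psi> H 3)) (pair_lists U)"
  let ?C = "filter (\<lambda>H. d ^ 4 \<le> length (flower_list \<psi> H 3)) (map (\<lambda>l. [l]) U)"
  have A: "card (flower (clause_sets \<psi>) {l} 2) < d ^ 2" if "?A = []" for l
  proof (cases "l \<in> set U")
    case True
    then show ?thesis using that flower_list(2)[OF S, of "[l]" 2] by (auto simp: filter_empty_conv not_le)
  next
    case False
    moreover have "\<forall>C\<in>clause_sets \<psi>. C \<subseteq> set U" using S by (simp add: canon_sys_def clause_sys_def)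
    ultimately have "flower (clause_sets \<psi>) {l} 2 = {}" unfolding flower_def psubset_eq by blast
    then have "card (flower (clause_sets \<psi>) {l} 2) = 0" by (simp only: card.empty)
    then show ?thesis using d2 by linarith
  qed
  have B: "card (flower (clause_sets \<psi>) G 3) < d ^ 2" if b: "?B = []" "card G = 2" for G
  proof -
    obtain l m where lm: "G = {l, m}" "l \<noteq> m" using b(2) by (metis card_2_iff)
    show ?thesis
    proof (cases "l \<in> set U \<and> m \<in> set U")
      case True
      then have "[l, m] \<in> set (pair_lists U)" using lm by (auto simp: set_pair_lists)
      then show ?thesis using b flower_list(2)[OF S, of "[l, m]" 3] lm by (auto simp: filter_empty_conv not_le)
    next
      case False
      moreover have "\<forall>C\<in>clause_sets \<psi>. C \<subseteq> set U" using S by (simp add: canon_sys_def clause_sys_def)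
      ultimately have "flower (clause_sets \<psi>) G 3 = {}" unfolding flower_def psubset_eq lm(1) by blast
      then have "card (flower (clause_sets \<psi>) G 3) = 0" by (simp only: card.empty)
      then show ?thesis using d2 by linarith
    qed
  qed
  consider "(H, c) \<in> set (map (\<lambda>H. (H, 2)) ?A)" | "?A = []" "(H, c) \<in> set (map (\<lambda>H. (H, 3)) ?B)"
    | "?A = []" "?B = []" "(H, c) \<in> set (map (\<lambda>H. (H, 3)) ?C)"
  proof (cases "?A = []")
    case False
    then have "(H, c) = hd (map (\<lambda>H. (H, 2)) ?A)" using p unfolding pick_heart_def by (cases ?A) auto
    then show thesis using False that(1) by (metis hd_in_set map_is_Nil_conv)
  next
    case A: True
    show thesis
    proof (cases "?B = []")
      case False
      then have "(H, c) = hd (map (\<lambda>H. (H, 3)) ?B)" using p A unfolding pick_heart_def by (cases ?B) auto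
      then show thesis using False A that(2) by (metis hd_in_set map_is_Nil_conv)
    next
      case True
      then have "map (\<lambda>H. (H, 3)) ?C = (H, c) # r" using p A unfolding pick_heart_def by (simp only: map_is_Nil_conv list.map append_Nil)
      then show thesis using True A that(3) by (metis list.set_intros(1))
    qed
  qed
  then have "rule_applies d (clause_sets \<psi>) (set H) c \<and> distinct H \<and> length H < c \<and> set H \<subseteq> set U"
  proof cases
    case 1
    then obtain l where l: "H = [l]" "c = 2" "l \<in> set U" "d ^ 2 \<le> length (flower_list \<psi> [l] 2)" by auto
    then show ?thesis using flower_list(2)[OF S, of "[l]" 2] by (simp add: rule_applies_def)
  next
    case 2
    then obtain l m where l: "H = [l, m]" "c = 3" "l \<in> set U" "m \<in> set U" "m \<noteq> l" "d ^ 2 \<le> length (flower_list \<psi> [l, m] 3)"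
      by (auto simp: set_pair_lists)
    then show ?thesis using flower_list(2)[OF S, of "[l, m]" 3] A[OF 2(1)] by (auto simp: rule_applies_def)
  next
    case 3
    then obtain l where l: "H = [l]" "c = 3" "l \<in> set U" "d ^ 4 \<le> length (flower_list \<psi> [l] 3)" by auto
    then show ?thesis using flower_list(2)[OF S, of "[l]" 3] A[OF 3(1)] B[OF 3(2)] by (auto simp: rule_applies_def)
  qed
  then show "rule_applies d (clause_sets \<psi>) (set H) c" "distinct H" "length H < c" "set H \<subseteq> set U" by blast+
qed

lemma branch_sets:
  assumes S: "canon_sys U \<psi>" and H: "distinct H" "length H < c" "set H \<subseteq> set U"
  shows "clause_sets (heart_branch U \<psi> H) = mins (insert (set H) (clause_sets \<psi>))"
    "clause_sets (petal_branch \<psi> H c) = mins (petals (clause_sets \<psi>) (set H) c \<union> clause_sets \<psi>)"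
proof -
  have "set (canon U H) = set H" using H(3) by (auto simp: set_canon)
  then show "clause_sets (heart_branch U \<psi> H) = mins (insert (set H) (clause_sets \<psi>))"
    unfolding heart_branch_def clause_sets_minimal by (simp add: clause_sets_def)
  have "set (filter (\<lambda>l. l \<notin> set H) C) = set C - set H" for C by auto
  then have "clause_sets (map (\<lambda>C. filter (\<lambda>l. l \<notin> set H) C) (flower_list \<psi> H c) @ \<psi>) =
      (\<lambda>C. C - set H) ` clause_sets (flower_list \<psi> H c) \<union> clause_sets \<psi>"
    unfolding clause_sets_def by (simp only: set_append set_map image_Un image_image)
  then show "clause_sets (petal_branch \<psi> H c) = mins (petals (clause_sets \<psi>) (set H) c \<union> clause_sets \<psi>)"
    unfolding petal_branch_def clause_sets_minimal petals_def flower_list(1)[OF S H(1,2)] by simp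
qed

lemma branch_sys:
  assumes S: "canon_sys U \<psi>" and p: "pick_heart d U \<psi> = (H, c) # r" and d: "1 \<le> d"
  shows "canon_sys U (heart_branch U \<psi> H)" "canon_sys U (petal_branch \<psi> H c)"
proof -
  note h = pick_heart_some[OF assms]
  have c: "\<And>C. C \<in> set \<psi> \<Longrightarrow> canon U C = C" and U: "distinct U" and F: "clause_sys (set U) (clause_sets \<psi>)"
    using S by (auto simp: canon_sys_def)
  have "canon U (canon U H) = canon U H" unfolding canon_def by (rule filter_cong) auto
  then have "\<forall>C\<in>set (heart_branch U \<psi> H). canon U C = C"
    using set_minimal[of "canon U H # \<psi>"] c unfolding heart_branch_def by auto
  then show "canon_sys U (heart_branch U \<psi> H)"
    using rule_potential(1)[OF F h(1) d] U unfolding canon_sys_def branch_sets(1)[OF S h(2-4)]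
    by (simp add: heart_branch_def distinct_minimal)
  have "canon U (filter (\<lambda>l. l \<notin> set H) C) = filter (\<lambda>l. l \<notin> set H) C" if "C \<in> set \<psi>" for C
  proof -
    have "filter (\<lambda>l. l \<notin> set H) C = filter (\<lambda>l. l \<notin> set H) (filter (\<lambda>l. l \<in> set C) U)"
      using c[OF that] by (simp add: canon_def)
    also have "\<dots> = canon U (filter (\<lambda>l. l \<notin> set H) C)" unfolding canon_def filter_filter by (rule filter_cong) auto
    finally show ?thesis by simp
  qed
  then have "\<forall>C\<in>set (petal_branch \<psi> H c). canon U C = C"
    using set_minimal[of "map (\<lambda>C. filter (\<lambda>l. l \<notin> set H) C) (flower_list \<psi> H c) @ \<psi>"] c
    unfolding petal_branch_def flower_list_def by auto
  then show "canon_sys U (petal_branch \<psi> H c)"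
    using rule_potential(2)[OF F h(1) d] U unfolding canon_sys_def branch_sets(2)[OF S h(2-4)]
    by (simp add: petal_branch_def distinct_minimal)
qed

lemma cnf_sat_hit:
  "cnf_sat \<psi> \<longleftrightarrow> (\<exists>\<sigma>. \<forall>C\<in>clause_sets \<psi>. C \<inter> {l. \<sigma> (snd l) = fst l} \<noteq> {})"
proof -
  have *: "(\<exists>(b, x)\<in>set C. \<sigma> x = b) \<longleftrightarrow> set C \<inter> {l. \<sigma> (snd l) = fst l} \<noteq> {}" for C :: "(bool \<times> 'a) list" and \<sigma>
    unfolding case_prod_unfold by blast
  show ?thesis unfolding cnf_sat_def clause_sets_def ball_simps(9) * ..
qed

lemma branch_sat:
  assumes S: "canon_sys U \<psi>" and p: "pick_heart d U \<psi> = (H, c) # r" and d: "1 \<le> d"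
  shows "cnf_sat \<psi> \<longleftrightarrow> cnf_sat (heart_branch U \<psi> H) \<or> cnf_sat (petal_branch \<psi> H c)"
proof -
  note h = pick_heart_some[OF assms]
  have fin: "finite C" if "C \<in> clause_sets \<psi>" for C using that by (auto simp: clause_sets_def)
  have 1: "(\<forall>C\<in>mins (insert (set H) (clause_sets \<psi>)). C \<inter> T \<noteq> {}) \<longleftrightarrow> (\<forall>C\<in>insert (set H) (clause_sets \<psi>). C \<inter> T \<noteq> {})" for T
    by (rule mins_hit) (use fin in auto)
  have 2: "(\<forall>C\<in>mins (petals (clause_sets \<psi>) (set H) c \<union> clause_sets \<psi>). C \<inter> T \<noteq> {}) \<longleftrightarrow>
      (\<forall>C\<in>petals (clause_sets \<psi>) (set H) c \<union> clause_sets \<psi>. C \<inter> T \<noteq> {})" for T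
    by (rule mins_hit) (use fin in \<open>auto simp: petals_def flower_def\<close>)
  show ?thesis
    unfolding cnf_sat_hit branch_sets[OF S h(2-4)] 1 2 ex_disj_distrib[symmetric]
    by (rule arg_cong[of _ _ Ex], rule ext, rule petals_hit)
qed

lemma canon_sys_length:
  assumes S: "canon_sys U \<psi>"
  shows "length \<psi> = card (clause_sets \<psi>)"
  using S canon_sys_inj[OF S] by (simp add: clause_sets_def card_image canon_sys_def distinct_card)

text \<open>There are at most \<open>(1 + length U) ^ 3\<close> sets of at most three literals. The
  bound is independent of the branchings that have led to \<psi>, so it holds for all formulas of
  the search.\<close>

lemma canon_sys_sz:
  fixes U :: "'l::data list"
  assumes S: "canon_sys U \<psi>"
  shows "sz \<psi> \<le> 1 + (1 + length U) ^ 3 * (sz U + 1)"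
proof -
  have c: "\<And>C. C \<in> set \<psi> \<Longrightarrow> canon U C = C" and F: "clause_sys (set U) (clause_sets \<psi>)"
    using S by (auto simp: canon_sys_def)
  \<comment> \<open>\<open>None\<close> fills the places of a clause with fewer than three
    literals.\<close>
  define A where "A = insert None (Some ` set U)"
  define g where "g = (\<lambda>(a, b, c). set_option a \<union> set_option b \<union> set_option c :: 'l set)"
  have "clause_sets \<psi> \<subseteq> g ` (A \<times> A \<times> A)"
  proof
    fix C assume C: "C \<in> clause_sets \<psi>"
    then have CU: "C \<subseteq> set U" "card C \<le> 3" "finite C" using F clause_sys_finite[OF F] by (auto simp: clause_sys_def)
    have "card C = 0 \<or> card C = 1 \<or> card C = 2 \<or> card C = 3" using CU(2) by linarith
    then consider "C = {}" | x where "C = {x}" | x y where "C = {x, y}" | x y z where "C = {x, y, z}"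
      using CU(3) card_0_eq card_1_singletonE card_2_iff card_3_iff by metis
    then show "C \<in> g ` (A \<times> A \<times> A)"
    proof cases
      case 1
      then show ?thesis by (intro image_eqI[of _ _ "(None, None, None)"]) (simp_all add: g_def A_def)
    next
      case (2 x)
      then show ?thesis using CU(1) by (intro image_eqI[of _ _ "(Some x, None, None)"]) (simp_all add: g_def A_def)
    next
      case (3 x y)
      then show ?thesis using CU(1) by (intro image_eqI[of _ _ "(Some x, Some y, None)"]) (simp_all add: g_def A_def insert_commute)
    next
      case (4 x y z)
      then show ?thesis using CU(1) by (intro image_eqI[of _ _ "(Some x, Some y, Some z)"]) (auto simp: g_def A_def)
    qed
  qed
  then have "card (clause_sets \<psi>) \<le> card (A \<times> A \<times> A)"
    by (rule surj_card_le[rotated]) (simp add: A_def)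
  also have "\<dots> = card A ^ 3" by (simp add: card_cartesian_product power3_eq_cube)
  also have "\<dots> \<le> (1 + length U) ^ 3"
  proof (rule power_mono)
    have "card A \<le> Suc (card (Some ` set U))" by (simp add: A_def card_insert_if)
    also have "\<dots> \<le> 1 + length U" using card_image_le[of "set U" Some] card_length[of U] by simp
    finally show "card A \<le> 1 + length U" .
  qed simp
  finally have "length \<psi> \<le> (1 + length U) ^ 3" unfolding canon_sys_length[OF S] .
  moreover have "sz \<psi> \<le> 1 + length \<psi> * (sz U + 1)"
  proof (rule sz_list_le)
    fix C assume "C \<in> set \<psi>"
    then show "sz C \<le> sz U" using c[of C] sz_filter[of "\<lambda>l. l \<in> set C" U] by (simp add: canon_def)
  qed
  ultimately show ?thesis by (meson add_left_mono le_trans mult_le_mono1)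
qed

lemma canon_sys_start:
  assumes "\<And>C. C \<in> set \<phi> \<Longrightarrow> set C \<subseteq> set U \<and> length C \<le> 3" "distinct U"
  shows "canon_sys U (minimal_clauses (map (canon U) \<phi>))"
    "clause_sets (minimal_clauses (map (canon U) \<phi>)) = mins (clause_sets \<phi>)"
proof -
  have "set (canon U C) = set C" if "C \<in> set \<phi>" for C using assms(1)[OF that] by (auto simp: set_canon)
  then have e: "clause_sets (map (canon U) \<phi>) = clause_sets \<phi>"
    unfolding clause_sets_def set_map image_image by (rule image_cong[OF refl])
  show 1: "clause_sets (minimal_clauses (map (canon U) \<phi>)) = mins (clause_sets \<phi>)"
    unfolding clause_sets_minimal e ..
  have "canon U (canon U C) = canon U C" for C unfolding canon_def by (rule filter_cong) auto
  then have "\<forall>C\<in>set (minimal_clauses (map (canon U) \<phi>)). canon U C = C"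
    using set_minimal[of "map (canon U) \<phi>"] by auto
  moreover have "clause_sys (set U) (mins (clause_sets \<phi>))"
  proof (rule clause_sys_mins)
    fix C assume "C \<in> clause_sets \<phi>"
    then show "C \<subseteq> set U \<and> card C \<le> 3" using assms(1) card_length le_trans unfolding clause_sets_def by blast
  qed simp
  ultimately show "canon_sys U (minimal_clauses (map (canon U) \<phi>))"
    unfolding canon_sys_def 1 using assms(2) by (simp add: distinct_minimal)
qed

section \<open>Simulating a machine on data\<close>

text \<open>Cells that are not stored are blank, so an exhausted side of the tape supplies
  0.\<close>

definition head0 :: "nat list \<Rightarrow> nat" where
  "head0 xs = (case xs of [] \<Rightarrow> 0 | x # _ \<Rightarrow> x)"

definition tail0 :: "'x list \<Rightarrow> 'x list" where
  "tail0 xs = (case xs of [] \<Rightarrow> [] | _ # ys \<Rightarrow> ys)"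

definition zip_act :: "nat \<times> nat \<Rightarrow> nat list \<times> nat list \<Rightarrow> nat list \<times> nat list" where
  "zip_act a z = (if snd a = 0 then (tail0 (fst z), head0 (fst z) # fst a # tail0 (snd z))
     else if snd a = 1 then (fst z, fst a # tail0 (snd z)) else (fst a # fst z, tail0 (snd z)))"

text \<open>
  A tape is stored as the cells to the left of the head and those from the head on. As the output
  cell is not marked, its content is kept separately, together with the unary numbers of moves
  of the output head to the right and to the left.
\<close>

type_synonym sim = "nat \<times> (nat list \<times> nat list) list \<times> bool list \<times> bool list \<times> nat"

text \<open>The transition is looked up in \<open>delta_table\<close>, and its entry behind the
  first one belongs to the output tape. The stored output cell changes only if head 1 stands on it,
  that is, if it has made equally many moves to the right and to the left.\<close>

definition sim_step :: "tm \<Rightarrow> sim \<Rightarrow> sim" where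
  "sim_step M c = (case filter (\<lambda>e. fst e = fst c \<and> fst (snd e) = map (\<lambda>z. head0 (snd z)) (fst (snd c))) (delta_table M) of
     [] \<Rightarrow> c
   | e # _ \<Rightarrow> (fst (snd (snd e)), map (\<lambda>p. zip_act (fst p) (snd p)) (zip (snd (snd (snd e))) (fst (snd c))),
       (case tail0 (snd (snd (snd e))) of [] \<Rightarrow> snd (snd c) | a # _ \<Rightarrow>
         (if snd a = 2 then True # fst (snd (snd c)) else fst (snd (snd c)),
          if snd a = 0 then True # fst (snd (snd (snd c))) else fst (snd (snd (snd c))),
          if length (fst (snd (snd c))) = length (fst (snd (snd (snd c)))) then fst a else snd (snd (snd (snd c)))))))"

definition sim_init :: "tm \<Rightarrow> bool list \<Rightarrow> sim" where
  "sim_init M w = (0, ([], map bit_symbol w) # replicate (tapes M - 1) ([], []), [], [], 0)"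

definition tape_rel :: "nat list \<times> nat list \<Rightarrow> tape \<Rightarrow> bool" where
  "tape_rel z ta \<longleftrightarrow> (\<forall>i. fst ta (snd ta + int i) = (if i < length (snd z) then snd z ! i else 0)) \<and>
     (\<forall>i. fst ta (snd ta - 1 - int i) = (if i < length (fst z) then fst z ! i else 0))"

definition sim_rel :: "tm \<Rightarrow> sim \<Rightarrow> config \<Rightarrow> bool" where
  "sim_rel M c f \<longleftrightarrow> fst c = fst f \<and> length (fst (snd c)) = tapes M \<and>
     (\<forall>j<tapes M. tape_rel (fst (snd c) ! j) (snd f ! j)) \<and>
     snd (snd f ! 1) = int (length (fst (snd (snd c)))) - int (length (fst (snd (snd (snd c))))) \<and>
     fst (snd f ! 1) 0 = snd (snd (snd (snd c)))"

lemma tape_rel_read: "tape_rel z ta \<Longrightarrow> tape_read ta = head0 (snd z)"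
  by (cases ta; cases "snd z") (auto simp: tape_rel_def head0_def dest: spec[of _ 0])

lemma tape_rel_act:
  assumes r: "tape_rel z ta"
  shows "tape_rel (zip_act (s, move_code m) z) (tape_act (s, m) ta)"
proof -
  obtain f p where ta: "ta = (f, p)" by (cases ta)
  obtain l r where z: "z = (l, r)" by (cases z)
  have R: "f (p + int i) = (if i < length r then r ! i else 0)" for i using r by (simp add: tape_rel_def ta z)
  have L: "f (p - 1 - int i) = (if i < length l then l ! i else 0)" for i using r by (simp add: tape_rel_def ta z)
  have R1: "f (p + 1 + int i) = (if i < length (tail0 r) then tail0 r ! i else 0)" for i
    using R[of "Suc i"] by (cases r) (auto simp: tail0_def add_ac)
  have L1: "f (p - 2 - int i) = (if i < length (tail0 l) then tail0 l ! i else 0)" for i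
    using L[of "Suc i"] by (cases l) (auto simp: tail0_def algebra_simps)
  have L0: "f (p - 1) = head0 l" using L[of 0] by (cases l) (auto simp: head0_def)
  let ?f = "f(p := s)"
  have R': "?f (p + int i) = (if i < length (s # tail0 r) then (s # tail0 r) ! i else 0)" for i
    using R1[of "i - 1"] by (cases i) (auto simp: add_ac)
  have L': "?f (p - 1 - int i) = (if i < length l then l ! i else 0)" for i using L[of i] by simp
  show ?thesis
  proof (cases m)
    case ToLeft
    have "?f (p - 1 + int i) = (if i < length (head0 l # s # tail0 r) then (head0 l # s # tail0 r) ! i else 0)" for i
      using R'[of "i - 1"] L0 by (cases i) (auto simp: add_ac)
    moreover have "?f (p - 1 - 1 - int i) = (if i < length (tail0 l) then tail0 l ! i else 0)" for i
      using L1[of i] by (simp add: algebra_simps)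
    ultimately show ?thesis unfolding tape_rel_def ta z using ToLeft by (simp add: zip_act_def move_code_def)
  next
    case Stay
    then show ?thesis unfolding tape_rel_def ta z using R' L' by (simp add: zip_act_def move_code_def)
  next
    case ToRight
    have "?f (p + 1 + int i) = (if i < length (tail0 r) then tail0 r ! i else 0)" for i using R1[of i] by simp
    moreover have "?f (p + 1 - 1 - int i) = (if i < length (s # l) then (s # l) ! i else 0)" for i
      using L'[of "i - 1"] by (cases i) (auto simp: algebra_simps)
    ultimately show ?thesis unfolding tape_rel_def ta z using ToRight by (simp add: zip_act_def move_code_def)
  qed
qed

lemma sim_init_rel: "wf_tm M \<Longrightarrow> sim_rel M (sim_init M w) (tm_init M w)"
  unfolding wf_tm_def
  by (auto simp: sim_rel_def sim_init_def tm_init_def tape_rel_def nth_Cons input_tape_def split: nat.splits)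

lemma sim_step_rel:
  assumes M: "wf_tm M" and r: "sim_rel M c ((tm_step M ^^ t) (tm_init M w))"
  shows "sim_rel M (sim_step M c) ((tm_step M ^^ Suc t) (tm_init M w))"
proof -
  let ?f = "(tm_step M ^^ t) (tm_init M w)" and ?g = "(tm_step M ^^ Suc t) (tm_init M w)"
  let ?rd = "map tape_read (snd ?f)"
  let ?as = "snd (total_delta M (fst ?f) ?rd)"
  have wf: "fst ?f \<le> states M" "length (snd ?f) = tapes M" using cfg_wf[OF M, of t w] by auto
  have rd: "map (\<lambda>z. head0 (snd z)) (fst (snd c)) = ?rd"
  proof (rule nth_equalityI)
    show "length (map (\<lambda>z. head0 (snd z)) (fst (snd c))) = length ?rd" using r wf by (simp add: sim_rel_def)
    fix i assume "i < length (map (\<lambda>z. head0 (snd z)) (fst (snd c)))"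
    then have i: "i < tapes M" "i < length (fst (snd c))" using r by (simp_all add: sim_rel_def)
    then have "tape_rel (fst (snd c) ! i) (snd ?f ! i)" using r by (simp add: sim_rel_def)
    then show "map (\<lambda>z. head0 (snd z)) (fst (snd c)) ! i = ?rd ! i" using tape_rel_read[of "fst (snd c) ! i" "snd ?f ! i"] i wf by simp
  qed
  have q: "fst c = fst ?f" using r by (simp add: sim_rel_def)
  define e where "e = (fst ?f, ?rd, fst (total_delta M (fst ?f) ?rd), map (\<lambda>a. (fst a, move_code (snd a))) ?as)"
  have mem: "e \<in> set (delta_table M)"
    unfolding delta_table_iff e_def using wf reads_wf[OF M, of t w] by (intro exI[of _ "fst ?f"] exI[of _ ?rd]) simp
  let ?fl = "filter (\<lambda>e. fst e = fst c \<and> fst (snd e) = map (\<lambda>z. head0 (snd z)) (fst (snd c))) (delta_table M)"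
  have all: "x = e" if "x \<in> set ?fl" for x
    using that unfolding q rd by (auto simp: delta_table_iff e_def)
  have "e \<in> set ?fl" using mem unfolding q rd by (simp add: e_def)
  then obtain rest where fl: "?fl = e # rest" using all by (cases ?fl) auto
  have K: "2 \<le> tapes M" using M by (simp add: wf_tm_def)
  have len: "length ?as = tapes M" using acts_wf(1)[OF M, of t w] .
  have a1: "tail0 (snd (snd (snd e))) = (fst (?as ! 1), move_code (snd (?as ! 1))) # tl (tl (snd (snd (snd e))))"
    using K len by (cases ?as; cases "tl ?as") (auto simp: e_def tail0_def)
  have ta: "snd ?g ! j = tape_act (?as ! j) (snd ?f ! j)" if "j < tapes M" for j by (rule cfg_Suc(2)[OF M that])
  have "tape_rel (map (\<lambda>p. zip_act (fst p) (snd p)) (zip (snd (snd (snd e))) (fst (snd c))) ! j) (snd ?g ! j)" if j: "j < tapes M" for j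
    using tape_rel_act[of "fst (snd c) ! j" "snd ?f ! j" "fst (?as ! j)" "snd (?as ! j)"] r j len
    unfolding ta[OF j] by (simp add: sim_rel_def e_def)
  moreover have "length (map (\<lambda>p. zip_act (fst p) (snd p)) (zip (snd (snd (snd e))) (fst (snd c)))) = tapes M"
    using r len by (simp add: sim_rel_def e_def)
  moreover have "fst (snd (snd e)) = fst ?g" unfolding cfg_Suc(1)[OF M] by (simp add: e_def)
  moreover have "snd (snd ?g ! 1) = snd (snd ?f ! 1) + int (move_code (snd (?as ! 1))) - 1"
    using K ta[of 1] by (simp only: tape_act_at(3)[OF M])
  moreover have "fst (snd ?g ! 1) 0 = (if snd (snd ?f ! 1) = 0 then fst (?as ! 1) else fst (snd ?f ! 1) 0)"
    using K ta[of 1] tape_act_at(1)[OF M, of "?as ! 1" "snd ?f ! 1"] tape_act_at(2)[OF M, of 0 "snd ?f ! 1" "?as ! 1"] by auto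
  moreover have "move_code (snd (?as ! 1)) \<in> {0, 1, 2}" by (auto simp: move_code_def split: move.splits)
  moreover have "sim_step M c = (fst (snd (snd e)), map (\<lambda>p. zip_act (fst p) (snd p)) (zip (snd (snd (snd e))) (fst (snd c))),
      if move_code (snd (?as ! 1)) = 2 then True # fst (snd (snd c)) else fst (snd (snd c)),
      if move_code (snd (?as ! 1)) = 0 then True # fst (snd (snd (snd c))) else fst (snd (snd (snd c))),
      if length (fst (snd (snd c))) = length (fst (snd (snd (snd c)))) then fst (?as ! 1) else snd (snd (snd (snd c))))"
    unfolding sim_step_def fl list.case a1 by simp
  ultimately show ?thesis using r unfolding sim_rel_def by (auto simp del: funpow.simps)
qed

lemma foldl_zip:
  "foldl (\<lambda>s y. case fst s of [] \<Rightarrow> s | z # zs \<Rightarrow> (zs, (y, z) # snd s)) (ys, acc) xs =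
    (drop (length xs) ys, rev (zip xs ys) @ acc)"
proof (induction xs arbitrary: ys acc)
  case (Cons x xs)
  then show ?case by (cases ys) simp_all
qed simp

lemma fp_zip:
  assumes "fp f" "fp g"
  shows "fp (\<lambda>x. zip (f x) (g x))"
proof -
  let ?step = "\<lambda>s y. case fst s of [] \<Rightarrow> s | z # zs \<Rightarrow> (zs, (y, z) # snd s)"
  have s: "fp (\<lambda>p. ?step (fst (snd p)) (snd (snd (p :: bool list \<times> _))))" by (intro fp_intros)
  have "fp (\<lambda>x. foldl ?step (g x, []) (f x))"
  proof (rule fp_foldl_add[where k = 1 and e = "\<lambda>_. [] :: bool list" and g = "\<lambda>e. ?step", OF s])
    show "sz (?step a y) \<le> sz a + (sz e + sz y + 2) ^ 1" for e :: "bool list" and a y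
      by (cases a; cases "fst a") auto
  qed (intro fp_intros assms)+
  then have "fp (\<lambda>x. rev (snd (foldl ?step (g x, []) (f x))))" by (intro fp_intros)
  then show ?thesis unfolding foldl_zip by simp
qed

lemma fp_canon: "fp (\<lambda>p. canon (fst p) (snd p))"
  unfolding canon_def by (intro fp_intros)

lemma fp_minimal_clauses: "fp minimal_clauses"
  unfolding minimal_clauses_def by (intro fp_intros)

lemma fp_pick_heart: "fp (\<lambda>p. pick_heart d (fst p) (snd p))"
  unfolding pick_heart_def flower_list_def pair_lists_def by (intro fp_intros)

lemma fp_heart_branch: "fp (\<lambda>p. heart_branch (fst p) (fst (snd p)) (snd (snd p)))"
  unfolding heart_branch_def by (intro fp_comp[OF fp_minimal_clauses] fp_comp2[OF fp_canon] fp_intros)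

lemma fp_petal_branch: "fp (\<lambda>p. petal_branch (fst p) (fst (snd p)) (snd (snd p)))"
  unfolding petal_branch_def flower_list_def by (intro fp_comp[OF fp_minimal_clauses] fp_intros)

lemma fp_flits: "fp (flits :: (bool \<times> 'v::data) list list \<Rightarrow> _)"
  unfolding flits_def fvars_def by (intro fp_intros)

lemma fp_head0: "fp f \<Longrightarrow> fp (\<lambda>x. head0 (f x))"
  unfolding head0_def by (intro fp_intros)

lemma fp_tail0: "fp f \<Longrightarrow> fp (\<lambda>x. tail0 (f x))"
  unfolding tail0_def by (intro fp_intros)

lemma fp_zip_act: "fp (\<lambda>p. zip_act (fst p) (snd p))"
  unfolding zip_act_def by (intro fp_intros fp_head0 fp_tail0)

lemma fp_sim_step: "fp (sim_step M)"
  unfolding sim_step_def by (intro fp_intros fp_zip fp_comp2[OF fp_zip_act] fp_head0 fp_tail0)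

lemma fp_sim_init: "fp (sim_init M)"
  unfolding sim_init_def bit_symbol_def by (intro fp_intros)

lemma sz_zip_act: "sz (zip_act a z) \<le> sz z + sz (fst a) + 4"
proof -
  obtain l r where z: "z = (l, r)" by (cases z)
  show ?thesis unfolding z zip_act_def by (cases l; cases r) (simp_all add: head0_def tail0_def)
qed

lemma sz_map_zip_act: "sz (map (\<lambda>p. zip_act (fst p) (snd p)) (zip as zs)) \<le> sz zs + 4 * sz as"
proof (induction as arbitrary: zs)
  case (Cons a as)
  show ?case
  proof (cases zs)
    case (Cons z zs')
    have "sz (fst a) \<le> sz a" by (rule sz_fst)
    then show ?thesis using Cons.IH[of zs'] sz_zip_act[of a z] Cons by simp
  qed simp
qed simp

text \<open>The growth is by a constant that does not depend on the configuration, so a simulation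
  of \<open>S\<close> steps stays linear in \<open>S\<close>. A constant factor per step would
  already ruin the final bound.\<close>

lemma sz_sim_step: "sz (sim_step M c) \<le> sz c + (6 * sz (delta_table M) + 8)"
proof (cases "filter (\<lambda>e. fst e = fst c \<and> fst (snd e) = map (\<lambda>z. head0 (snd z)) (fst (snd c))) (delta_table M)")
  case Nil
  then show ?thesis by (simp add: sim_step_def)
next
  case (Cons e es)
  let ?D = "sz (delta_table M)"
  have "set (e # es) \<subseteq> set (delta_table M)" unfolding Cons[symmetric] by auto
  then have "e \<in> set (delta_table M)" by simp
  then have "sz e < ?D" by (rule sz_elem)
  obtain q0 ss q as where e: "e = (q0, ss, q, as)" by (cases e)
  then have q: "sz q \<le> ?D" and as: "sz as \<le> ?D" using \<open>sz e < ?D\<close> by simp_all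
  obtain p ts A B v where c: "c = (p, ts, A, B, v)" by (cases c)
  have t: "sz (map (\<lambda>p. zip_act (fst p) (snd p)) (zip as ts)) \<le> sz ts + 4 * ?D"
    using sz_map_zip_act[of as ts] as by linarith
  have step: "sim_step M c = (q, map (\<lambda>p. zip_act (fst p) (snd p)) (zip as ts),
      (case tail0 as of [] \<Rightarrow> (A, B, v) | a # _ \<Rightarrow> (if snd a = 2 then True # A else A, if snd a = 0 then True # B else B,
        if length A = length B then fst a else v)))"
    unfolding sim_step_def Cons by (simp add: e c split: list.split)
  have "sz (case tail0 as of [] \<Rightarrow> (A, B, v) | a # _ \<Rightarrow> (if snd a = 2 then True # A else A, if snd a = 0 then True # B else B,
        if length A = length B then fst a else v)) \<le> sz (A, B, v) + ?D + 8"
  proof (cases "tail0 as")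
    case Nil
    then show ?thesis by simp
  next
    case (Cons a as')
    then have "a \<in> set as" by (cases as) (auto simp: tail0_def)
    then have "sz (fst a) \<le> ?D" using sz_elem[of a as] sz_fst[of a] as by linarith
    then show ?thesis using Cons by simp
  qed
  then show ?thesis unfolding step using q t by (simp add: c)
qed

text \<open>Scanner for \<open>enc_cnf\<close>. State 0 expects a mark before a clause, 1 a mark
  before a literal, 2 a sign, 3 a mark before a bit, 4 a bit, and 5 is the end. Lists are collected
  in reverse order.\<close>

definition dec_step ::
    "nat \<times> (bool \<times> bool list) list list \<times> (bool \<times> bool list) list \<times> bool \<times> bool list \<Rightarrow> bool \<Rightarrow>
     nat \<times> (bool \<times> bool list) list list \<times> (bool \<times> bool list) list \<times> bool \<times> bool list" where
  "dec_step s y = (if fst s = 0 then (if y then 1 else 5, snd s)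
     else if fst s = 1 then (if y then (2, snd s) else (0, fst (snd (snd s)) # fst (snd s), [], snd (snd (snd s))))
     else if fst s = 2 then (3, fst (snd s), fst (snd (snd s)), y, [])
     else if fst s = 3 then (if y then (4, snd s) else (1, fst (snd s), snd (snd (snd s)) # fst (snd (snd s)), False, []))
     else if fst s = 4 then (3, fst (snd s), fst (snd (snd s)), fst (snd (snd (snd s))), y # snd (snd (snd (snd s))))
     else s)"

definition decode_cnf :: "bool list \<Rightarrow> cnf" where
  "decode_cnf w = map (\<lambda>C. rev (map (\<lambda>l. (fst l, nat_of_bits (rev (snd l)))) C))
     (rev (fst (snd (foldl dec_step (0, [], [], False, []) w))))"

lemma dec_nat: "foldl dec_step (3, cs, ls, b, bs) (enc_list enc_bool ys @ w) =
    foldl dec_step (1, cs, (b, rev ys @ bs) # ls, False, []) w"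
  by (induction ys arbitrary: bs) (simp_all add: enc_list_def enc_bool_def dec_step_def)

lemma dec_lit: "foldl dec_step (2, cs, ls, b, bs) (enc_prod enc_bool enc_nat l @ w) =
    foldl dec_step (1, cs, (fst l, rev (bits_of_nat (snd l))) # ls, False, []) w"
  using dec_nat[of cs ls "fst l" "[]" "bits_of_nat (snd l)" w]
  by (simp add: enc_prod_def enc_bool_def enc_nat_def dec_step_def)

lemma dec_clause: "foldl dec_step (1, cs, ls, False, []) (enc_list (enc_prod enc_bool enc_nat) C @ w) =
    foldl dec_step (0, (rev (map (\<lambda>l. (fst l, rev (bits_of_nat (snd l)))) C) @ ls) # cs, [], False, []) w"
proof (induction C arbitrary: ls)
  case Nil
  show ?case by (simp add: enc_list_def dec_step_def)
next
  case (Cons l C)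
  have "enc_list (enc_prod enc_bool enc_nat) (l # C) @ w =
      True # enc_prod enc_bool enc_nat l @ enc_list (enc_prod enc_bool enc_nat) C @ w" by (simp add: enc_list_def)
  moreover have "dec_step (1, cs, ls, False, []) True = (2, cs, ls, False, [])" by (simp add: dec_step_def)
  ultimately show ?case by (simp only: foldl_Cons dec_lit Cons.IH) simp
qed

lemma dec_formula: "foldl dec_step (0, cs, [], False, []) (enc_cnf \<phi>) =
    (5, rev (map (\<lambda>C. rev (map (\<lambda>l. (fst l, rev (bits_of_nat (snd l)))) C)) \<phi>) @ cs, [], False, [])"
proof (induction \<phi> arbitrary: cs)
  case Nil
  show ?case by (simp add: enc_cnf_def enc_list_def dec_step_def)
next
  case (Cons C \<phi>)
  have "enc_cnf (C # \<phi>) = True # enc_list (enc_prod enc_bool enc_nat) C @ enc_cnf \<phi>"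
    by (simp add: enc_cnf_def enc_list_def)
  moreover have "dec_step (0, cs, [], False, []) True = (1, cs, [], False, [])" by (simp add: dec_step_def)
  ultimately show ?case by (simp only: foldl_Cons dec_clause Cons.IH) simp
qed

lemma decode_cnf: "decode_cnf (enc_cnf \<phi>) = \<phi>"
  unfolding decode_cnf_def dec_formula by (simp add: rev_map nat_of_bits_of_nat comp_def)

lemma fp_decode_cnf: "fp decode_cnf"
proof -
  have s: "fp (\<lambda>p. dec_step (fst (snd p)) (snd (snd (p :: bool list \<times> _))))"
    unfolding dec_step_def by (intro fp_intros)
  have f: "fp (\<lambda>w. foldl dec_step (0, [], [], False, []) w)"
  proof (rule fp_foldl_add[where k = 3 and e = "\<lambda>_. [] :: bool list" and g = "\<lambda>e. dec_step", OF s])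
    fix e :: "bool list" and y
      and a :: "nat \<times> (bool \<times> bool list) list list \<times> (bool \<times> bool list) list \<times> bool \<times> bool list"
    obtain m cs ls b bs where a: "a = (m, cs, ls, b, bs)" by (cases a)
    have "sz (dec_step a y) \<le> sz a + 40"
      unfolding dec_step_def a using sz_nat_le[of 1] sz_nat_le[of 2] sz_nat_le[of 3] sz_nat_le[of 4] sz_nat_le[of 5] sz_bool[of y] by simp
    also have "\<dots> \<le> sz a + (2 + 2) ^ 3" by simp
    also have "\<dots> \<le> sz a + (sz e + sz y + 2) ^ 3"
    proof -
      have "0 < sz e" "0 < sz y" by (rule sz_pos)+
      then show ?thesis by (intro add_left_mono power_mono) linarith+
    qed
    finally show "sz (dec_step a y) \<le> sz a + (sz e + sz y + 2) ^ 3" .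
  qed (intro fp_intros)+
  show ?thesis unfolding decode_cnf_def by (intro f fp_intros)
qed

section \<open>Runs of the search\<close>

inductive loops :: "('a::data \<Rightarrow> 'a) \<Rightarrow> ('a \<Rightarrow> bool) \<Rightarrow> nat \<Rightarrow> nat \<Rightarrow> 'a \<Rightarrow> 'a \<Rightarrow> bool" for g b B where
  loops_refl: "sz x \<le> B \<Longrightarrow> loops g b B 0 x x"
| loops_step: "b x \<Longrightarrow> sz x \<le> B \<Longrightarrow> loops g b B n (g x) y \<Longrightarrow> loops g b B (Suc n) x y"

lemma loops_trans: "loops g b B m x y \<Longrightarrow> loops g b B n y z \<Longrightarrow> loops g b B (m + n) x z"
proof (induction m x y rule: loops.induct)
  case (loops_step x n' y)
  show ?case unfolding add_Suc by (rule loops.loops_step[OF loops_step(1,2) loops_step.IH[OF loops_step.prems]])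
qed simp

lemma loops_funpow:
  "loops g b B n x y \<Longrightarrow> (g ^^ n) x = y \<and> (\<forall>i<n. b ((g ^^ i) x)) \<and> (\<forall>i\<le>n. sz ((g ^^ i) x) \<le> B)"
proof (induction n x y rule: loops.induct)
  case (loops_step x n y)
  have "b ((g ^^ i) x)" if "i < Suc n" for i
    using that loops_step by (cases i) (simp_all add: funpow_swap1)
  moreover have "sz ((g ^^ i) x) \<le> B" if "i \<le> Suc n" for i
    using that loops_step by (cases i) (simp_all add: funpow_swap1)
  ultimately show ?case using loops_step by (simp add: funpow_swap1)
qed simp

type_synonym search_state = "(bool \<times> nat) list \<times> cnf list \<times> sim list \<times> bool"

text \<open>
  The stack holds the formulas that remain to be tried. A formula to which no rule applies is
  handed to the simulated machine.
\<close>

definition search_step :: "nat \<Rightarrow> nat \<Rightarrow> tm \<Rightarrow> search_state \<Rightarrow> search_state" where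
  "search_step k d M s = (case fst (snd (snd s)) of
     c # _ \<Rightarrow> (if fst c = states M then (fst s, fst (snd s), [], snd (snd (snd (snd c))) = 2)
       else (fst s, fst (snd s), [sim_step M c], False))
   | [] \<Rightarrow> (case fst (snd s) of [] \<Rightarrow> s | \<psi> # r \<Rightarrow>
       (case pick_heart d (fst s) \<psi> of
         [] \<Rightarrow> (fst s, r, [sim_init M (enc_instance (reduction k \<psi>))], False)
       | h # _ \<Rightarrow> (fst s, heart_branch (fst s) \<psi> (fst h) # petal_branch \<psi> (fst h) (snd h) # r, [], False))))"

definition searching :: "search_state \<Rightarrow> bool" where
  "searching s \<longleftrightarrow> \<not> snd (snd (snd s)) \<and> (fst (snd (snd s)) \<noteq> [] \<or> fst (snd s) \<noteq> [])"

lemma fp_searching: "fp searching"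
  unfolding searching_def by (intro fp_intros)

lemma fp_search_step: "fp (search_step k d M)"
  unfolding search_step_def
  by (intro fp_intros fp_comp[OF fp_sim_step] fp_comp[OF fp_sim_init] fp_comp[OF fp_enc_instance]
      fp_comp[OF fp_reduction] fp_comp2[OF fp_pick_heart] fp_comp3[OF fp_heart_branch] fp_comp3[OF fp_petal_branch])

lemma tm_halted:
  assumes "fst ((tm_step M ^^ t) c) = states M"
  shows "(tm_step M ^^ (t + j)) c = (tm_step M ^^ t) c"
proof (induction j)
  case (Suc j)
  then show ?case using assms by (cases "(tm_step M ^^ t) c") simp
qed simp

lemma sim_loops:
  assumes M: "wf_tm M" and K: "\<And>c. sz (sim_step M c) \<le> sz c + K"
    and h: "fst ((tm_step M ^^ t0) (tm_init M w)) = states M"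
      "\<And>t. t < t0 \<Longrightarrow> fst ((tm_step M ^^ t) (tm_init M w)) \<noteq> states M"
      "has_output ((tm_step M ^^ t0) (tm_init M w)) [a]"
  shows "t + j = t0 \<Longrightarrow> sim_rel M c ((tm_step M ^^ t) (tm_init M w)) \<Longrightarrow> sz U + sz r + sz c + K * j + 10 \<le> B \<Longrightarrow>
    loops (search_step k d M) searching B (Suc j) (U, r, [c], False) (U, r, [], a)"
proof (induction j arbitrary: t c)
  case 0
  have q: "fst c = states M" using 0 h(1) by (simp add: sim_rel_def)
  have "snd (snd (snd (snd c))) = bit_symbol a"
    using 0 h(3) by (simp add: sim_rel_def has_output_def Let_def)
  then have v: "(snd (snd (snd (snd c))) = 2) = a" by (simp add: bit_symbol_def)
  have st: "search_step k d M (U, r, [c], False) = (U, r, [], a)"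
    unfolding search_step_def using q v by simp
  show ?case
  proof (rule loops_step)
    show "loops (search_step k d M) searching B 0 (search_step k d M (U, r, [c], False)) (U, r, [], a)"
      unfolding st using 0(3) sz_bool[of a] by (intro loops_refl) simp
  qed (use 0(3) in \<open>simp_all add: searching_def\<close>)
next
  case (Suc j)
  have q: "fst c \<noteq> states M" using Suc.prems h(2)[of t] by (simp add: sim_rel_def)
  have st: "search_step k d M (U, r, [c], False) = (U, r, [sim_step M c], False)"
    unfolding search_step_def using q by simp
  show ?case
  proof (rule loops_step)
    show "loops (search_step k d M) searching B (Suc j) (search_step k d M (U, r, [c], False)) (U, r, [], a)"
      unfolding st
    proof (rule Suc.IH)
      show "Suc t + j = t0" using Suc.prems by simp
      show "sim_rel M (sim_step M c) ((tm_step M ^^ Suc t) (tm_init M w))" by (rule sim_step_rel[OF M Suc.prems(2)])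
      show "sz U + sz r + sz (sim_step M c) + K * j + 10 \<le> B" using Suc.prems(3) K[of c] by simp
    qed
  qed (use Suc.prems(3) in \<open>simp_all add: searching_def\<close>)
qed

lemma leaf_loops:
  assumes M: "wf_tm M" and K: "\<And>c. sz (sim_step M c) \<le> sz c + K" and o: "outputs_within M w [a] (real S)"
    and B: "sz U + sz r + sz (sim_init M w) + K * S + 10 \<le> B"
  shows "\<exists>n\<le>S + 1. loops (search_step k d M) searching B n (U, r, [sim_init M w], False) (U, r, [], a)"
proof -
  obtain n where n: "n \<le> S" "fst ((tm_step M ^^ n) (tm_init M w)) = states M" "has_output ((tm_step M ^^ n) (tm_init M w)) [a]"
    using o unfolding outputs_within_def Let_def by auto
  \<comment> \<open>The simulation stops at the first halting configuration, while
    \<open>outputs_within\<close> may name a later time.\<close>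
  define t0 where "t0 = (LEAST t. fst ((tm_step M ^^ t) (tm_init M w)) = states M)"
  have h: "fst ((tm_step M ^^ t0) (tm_init M w)) = states M" unfolding t0_def
    by (rule LeastI[of "\<lambda>t. fst ((tm_step M ^^ t) (tm_init M w)) = states M", OF n(2)])
  have le: "t0 \<le> n" unfolding t0_def
    by (rule Least_le[of "\<lambda>t. fst ((tm_step M ^^ t) (tm_init M w)) = states M", OF n(2)])
  have lt: "fst ((tm_step M ^^ t) (tm_init M w)) \<noteq> states M" if "t < t0" for t
    using not_less_Least[of t "\<lambda>t. fst ((tm_step M ^^ t) (tm_init M w)) = states M"] that unfolding t0_def by blast
  have "(tm_step M ^^ n) (tm_init M w) = (tm_step M ^^ t0) (tm_init M w)"
    using tm_halted[OF h, of "n - t0"] le by simp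
  then have out: "has_output ((tm_step M ^^ t0) (tm_init M w)) [a]" using n(3) by simp
  have "K * t0 \<le> K * S" using le n(1) by simp
  then have "sz U + sz r + sz (sim_init M w) + K * t0 + 10 \<le> B" using B by linarith
  then have "loops (search_step k d M) searching B (Suc t0) (U, r, [sim_init M w], False) (U, r, [], a)"
    using sim_init_rel[OF M, of w] by (intro sim_loops[OF M K h lt out, of 0]) simp_all
  then show ?thesis using le n(1) by (intro exI[of _ "Suc t0"]) simp
qed

text \<open>The tree of branchings has at most \<open>x ^ m\<close> leaves for
  \<open>x = 1 + 1 / d ^ 3\<close>, hence at most \<open>2 * x ^ m - 1\<close> nodes, each of which
  costs at most \<open>S + 3\<close>. On the way down a heart branch leaves one formula waiting and
  lowers \<open>m\<close> by at least 1, so \<open>m + 1\<close> formulas of size \<open>Z\<close>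
  bound the stack. An unsatisfiable formula leaves the rest \<open>r\<close> of the stack to be
  tried next.\<close>

lemma search_loops:
  fixes U :: "(bool \<times> nat) list"
  assumes M: "wf_tm M" and K: "\<And>c. sz (sim_step M c) \<le> sz c + K" and d: "10 \<le> d"
    and leaf: "\<And>\<psi>. canon_sys U \<psi> \<Longrightarrow> pick_heart d U \<psi> = [] \<Longrightarrow>
      outputs_within M (enc_instance (reduction k \<psi>)) [cnf_sat \<psi>] (real S) \<and>
      sz (sim_init M (enc_instance (reduction k \<psi>))) \<le> Z0"
    and Z: "\<And>\<psi>. canon_sys U \<psi> \<Longrightarrow> sz \<psi> \<le> Z"
  shows "canon_sys U \<psi> \<Longrightarrow> potential (2 * d ^ 2) (set U) (clause_sets \<psi>) \<le> int m \<Longrightarrow>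
    sz U + sz r + (m + 1) * (Z + 1) + (Z0 + K * S + 10) \<le> B \<Longrightarrow>
    \<exists>n r'. loops (search_step k d M) searching B n (U, \<psi> # r, [], False) (U, r', [], cnf_sat \<psi>) \<and>
      (\<not> cnf_sat \<psi> \<longrightarrow> r' = r) \<and> real n \<le> (real S + 3) * (2 * (1 + 1 / real d ^ 3) ^ m - 1)"
proof (induction m arbitrary: \<psi> r rule: less_induct)
  case (less m)
  define x where "x = 1 + 1 / real d ^ 3"
  have x1: "1 \<le> x" using d by (simp add: x_def)
  then have xm: "1 \<le> x ^ j" for j by (rule one_le_power)
  have d1: "1 \<le> d" using d by simp
  have S: "canon_sys U \<psi>" and pm: "potential (2 * d ^ 2) (set U) (clause_sets \<psi>) \<le> int m" by (rule less.prems)+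
  have sz0: "sz (U, \<psi> # r, [] :: sim list, False) \<le> B"
    using less.prems(3) Z[OF S] by simp
  have b0: "searching (U, \<psi> # r, [], False)" by (simp add: searching_def)
  show ?case
  proof (cases "pick_heart d U \<psi>")
    case Nil
    let ?w = "enc_instance (reduction k \<psi>)"
    have st: "search_step k d M (U, \<psi> # r, [], False) = (U, r, [sim_init M ?w], False)"
      unfolding search_step_def using Nil by simp
    have l: "outputs_within M ?w [cnf_sat \<psi>] (real S)" "sz (sim_init M ?w) \<le> Z0" using leaf[OF S Nil] by blast+
    have "sz U + sz r + sz (sim_init M ?w) + K * S + 10 \<le> B" using l(2) less.prems(3) by linarith
    then obtain n where n: "n \<le> S + 1"
      "loops (search_step k d M) searching B n (U, r, [sim_init M ?w], False) (U, r, [], cnf_sat \<psi>)"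
      using leaf_loops[OF M K l(1)] by blast
    have "loops (search_step k d M) searching B (Suc n) (U, \<psi> # r, [], False) (U, r, [], cnf_sat \<psi>)"
      using n(2) unfolding st[symmetric] by (rule loops_step[where b = searching, OF b0 sz0])
    moreover have "real (Suc n) \<le> (real S + 3) * (2 * x ^ m - 1)"
    proof -
      have "real (Suc n) \<le> (real S + 3) * 1" using n(1) by simp
      also have "\<dots> \<le> (real S + 3) * (2 * x ^ m - 1)" using xm[of m] by (intro mult_left_mono) linarith+
      finally show ?thesis .
    qed
    ultimately show ?thesis unfolding x_def by blast
  next
    case (Cons h hs)
    obtain H c where h: "h = (H, c)" by (cases h)
    have p: "pick_heart d U \<psi> = (H, c) # hs" using Cons h by simp
    let ?h = "heart_branch U \<psi> H" and ?p = "petal_branch \<psi> H c"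
    note ph = pick_heart_some[OF S p d1]
    have F: "clause_sys (set U) (clause_sets \<psi>)" using S by (simp add: canon_sys_def)
    have hS: "canon_sys U ?h" and pS: "canon_sys U ?p" by (rule branch_sys[OF S p d1])+
    have hp: "potential (2 * d ^ 2) (set U) (clause_sets ?h) \<le> int m - 1"
      using rule_potential(3)[OF F ph(1) d1] pm unfolding branch_sets(1)[OF S ph(2-4)] by linarith
    have pp: "potential (2 * d ^ 2) (set U) (clause_sets ?p) \<le> int m - int (d ^ 4)"
      using rule_potential(4)[OF F ph(1) d1] pm unfolding branch_sets(2)[OF S ph(2-4)] by linarith
    have "0 \<le> potential (2 * d ^ 2) (set U) (clause_sets ?h)" "0 \<le> potential (2 * d ^ 2) (set U) (clause_sets ?p)"
      using hS pS by (auto intro!: potential_nonneg simp: canon_sys_def)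
    \<comment> \<open>The potentials of the branches are nonnegative, so neither drop exceeds
      \<open>m\<close> and the differences below are not truncated.\<close>
    then have m: "1 \<le> m" "d ^ 4 \<le> m" using hp pp by linarith+
    have d4: "1 \<le> d ^ 4" using d1 by simp
    define m' where "m' = m - d ^ 4"
    have m': "m' < m" "int m' = int m - int (d ^ 4)" "m' + d ^ 4 = m" using m d4 by (simp_all add: m'_def)
    have rate: "x ^ (m - 1) + x ^ m' \<le> x ^ m"
    proof -
      have "x ^ m * (inverse x + inverse (x ^ (d ^ 4))) \<le> x ^ m * 1"
        using growth_rate[OF d] xm[of m] unfolding x_def by (intro mult_left_mono) linarith+
      moreover have "x ^ m * inverse x = x ^ (m - 1)" using m(1) x1 by (cases m) simp_all
      moreover have "x ^ m * inverse (x ^ (d ^ 4)) = x ^ m'" using x1 unfolding m'(3)[symmetric] power_add by simp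
      ultimately show ?thesis by (simp add: distrib_left)
    qed
    have st: "search_step k d M (U, \<psi> # r, [], False) = (U, ?h # ?p # r, [], False)"
      unfolding search_step_def using p by simp
    have szp: "sz ?p \<le> Z" by (rule Z[OF pS])
    have "\<exists>n r'. loops (search_step k d M) searching B n (U, ?h # ?p # r, [], False) (U, r', [], cnf_sat ?h) \<and>
      (\<not> cnf_sat ?h \<longrightarrow> r' = ?p # r) \<and> real n \<le> (real S + 3) * (2 * (1 + 1 / real d ^ 3) ^ (m - 1) - 1)"
    proof (rule less.IH[OF _ hS])
      show "m - 1 < m" using m(1) by simp
      show "potential (2 * d ^ 2) (set U) (clause_sets ?h) \<le> int (m - 1)" using hp m(1) by simp
      have "(m + 1) * (Z + 1) = (m - 1 + 1) * (Z + 1) + (Z + 1)" using m(1) by (cases m) simp_all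
      then show "sz U + sz (?p # r) + (m - 1 + 1) * (Z + 1) + (Z0 + K * S + 10) \<le> B"
        using less.prems(3) szp unfolding sz_simps by linarith
    qed
    then obtain n1 r1 where 1: "loops (search_step k d M) searching B n1 (U, ?h # ?p # r, [], False) (U, r1, [], cnf_sat ?h)"
      "\<not> cnf_sat ?h \<Longrightarrow> r1 = ?p # r" "real n1 \<le> (real S + 3) * (2 * x ^ (m - 1) - 1)"
      unfolding x_def by blast
    have 2: "loops (search_step k d M) searching B (Suc n1) (U, \<psi> # r, [], False) (U, r1, [], cnf_sat ?h)"
      using 1(1) unfolding st[symmetric] by (rule loops_step[where b = searching, OF b0 sz0])
    show ?thesis
    proof (cases "cnf_sat ?h")
      case True
      then have sat: "cnf_sat \<psi> = True" using branch_sat[OF S p d1] by simp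
      have "real (Suc n1) \<le> (real S + 3) * (2 * x ^ (m - 1) - 1) + (real S + 3) * 1" using 1(3) by simp
      also have "\<dots> = (real S + 3) * (2 * x ^ (m - 1))" by (simp add: algebra_simps)
      also have "\<dots> \<le> (real S + 3) * (2 * x ^ m - 1)"
      proof (rule mult_left_mono)
        show "2 * x ^ (m - 1) \<le> 2 * x ^ m - 1" using rate xm[of m'] by argo
      qed simp
      finally have "real (Suc n1) \<le> (real S + 3) * (2 * x ^ m - 1)" .
      then show ?thesis using 2 True unfolding sat x_def by auto
    next
      case False
      then have r1: "r1 = ?p # r" and sat: "cnf_sat \<psi> = cnf_sat ?p" using 1(2) branch_sat[OF S p d1] by simp_all
      have "\<exists>n r'. loops (search_step k d M) searching B n (U, ?p # r, [], False) (U, r', [], cnf_sat ?p) \<and>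
        (\<not> cnf_sat ?p \<longrightarrow> r' = r) \<and> real n \<le> (real S + 3) * (2 * (1 + 1 / real d ^ 3) ^ m' - 1)"
      proof (rule less.IH[OF m'(1) pS])
        show "potential (2 * d ^ 2) (set U) (clause_sets ?p) \<le> int m'" using pp m'(2) by simp
        have "(m' + 1) * (Z + 1) \<le> (m + 1) * (Z + 1)" using m'(1) by (intro mult_le_mono1) simp
        then show "sz U + sz r + (m' + 1) * (Z + 1) + (Z0 + K * S + 10) \<le> B" using less.prems(3) by linarith
      qed
      then obtain n2 r2 where 3: "loops (search_step k d M) searching B n2 (U, ?p # r, [], False) (U, r2, [], cnf_sat ?p)"
        "\<not> cnf_sat ?p \<longrightarrow> r2 = r" "real n2 \<le> (real S + 3) * (2 * x ^ m' - 1)"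
        unfolding x_def by blast
      have f: "cnf_sat ?h = False" using False by simp
      have "loops (search_step k d M) searching B (Suc n1 + n2) (U, \<psi> # r, [], False) (U, r2, [], cnf_sat ?p)"
        using loops_trans[OF 2[unfolded r1 f] 3(1)] .
      moreover have "real (Suc n1 + n2) \<le> (real S + 3) * (2 * x ^ m - 1)"
      proof -
        have "real (Suc n1 + n2) \<le> (real S + 3) * (2 * x ^ (m - 1) - 1) + (real S + 3) * (2 * x ^ m' - 1) + (real S + 3) * 1"
          using 1(3) 3(3) by simp
        also have "\<dots> = (real S + 3) * (2 * (x ^ (m - 1) + x ^ m') - 1)" by (simp add: algebra_simps)
        also have "\<dots> \<le> (real S + 3) * (2 * x ^ m - 1)"
        proof (rule mult_left_mono)
          show "2 * (x ^ (m - 1) + x ^ m') - 1 \<le> 2 * x ^ m - 1" using rate by argo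
        qed simp
        finally show ?thesis .
      qed
      ultimately show ?thesis using 3(2) unfolding sat x_def by blast
    qed
  qed
qed

section \<open>The Exponential Time Hypothesis\<close>

text \<open>Polynomial factors are hidden and only the exponent \<open>e\<close> is tracked: it adds
  up under products, is multiplied under powers, and is 0 for polynomial quantities.\<close>

definition exp_bound :: "real \<Rightarrow> (cnf \<Rightarrow> real) \<Rightarrow> bool" where
  "exp_bound e g \<longleftrightarrow> (\<exists>a. \<forall>\<phi>. 0 \<le> g \<phi> \<and>
     g \<phi> \<le> (real (length (enc_cnf \<phi>)) + 2) ^ a * 2 powr (e * real (length (fvars \<phi>))))"

lemma exp_bound_le: "exp_bound e g \<Longrightarrow> (\<And>\<phi>. 0 \<le> h \<phi> \<and> h \<phi> \<le> g \<phi>) \<Longrightarrow> exp_bound e h"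
  unfolding exp_bound_def by (meson order.trans)

lemma exp_bound_mono:
  assumes "exp_bound e g" "e \<le> e'"
  shows "exp_bound e' g"
proof -
  obtain a where a: "\<And>\<phi>. 0 \<le> g \<phi> \<and> g \<phi> \<le> (real (length (enc_cnf \<phi>)) + 2) ^ a * 2 powr (e * real (length (fvars \<phi>)))"
    using assms(1) unfolding exp_bound_def by blast
  have "(real (length (enc_cnf \<phi>)) + 2) ^ a * 2 powr (e * real (length (fvars \<phi>))) \<le>
      (real (length (enc_cnf \<phi>)) + 2) ^ a * 2 powr (e' * real (length (fvars \<phi>)))" for \<phi>
    using assms(2) by (intro mult_left_mono powr_mono mult_right_mono) auto
  then show ?thesis unfolding exp_bound_def using a order.trans by blast
qed

lemma exp_bound_const:
  assumes "0 \<le> c"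
  shows "exp_bound 0 (\<lambda>_. c)"
proof -
  obtain a where a: "c < 2 ^ a" using real_arch_pow[of 2 c] by auto
  have "2 ^ a \<le> (real (length (enc_cnf \<phi>)) + 2) ^ a" for \<phi> by (intro power_mono) auto
  then have "c \<le> (real (length (enc_cnf \<phi>)) + 2) ^ a" for \<phi> using a order.trans less_imp_le by metis
  then show ?thesis unfolding exp_bound_def using assms by (intro exI[of _ a]) simp
qed

lemma exp_bound_mult:
  assumes "exp_bound e g" "exp_bound e' h"
  shows "exp_bound (e + e') (\<lambda>\<phi>. g \<phi> * h \<phi>)"
proof -
  let ?b = "\<lambda>\<phi>. real (length (enc_cnf \<phi>)) + 2" and ?n = "\<lambda>\<phi>. real (length (fvars \<phi>))"
  obtain a where a: "\<And>\<phi>. 0 \<le> g \<phi> \<and> g \<phi> \<le> ?b \<phi> ^ a * 2 powr (e * ?n \<phi>)"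
    using assms(1) unfolding exp_bound_def by blast
  obtain a' where a': "\<And>\<phi>. 0 \<le> h \<phi> \<and> h \<phi> \<le> ?b \<phi> ^ a' * 2 powr (e' * ?n \<phi>)"
    using assms(2) unfolding exp_bound_def by blast
  have "0 \<le> g \<phi> * h \<phi> \<and> g \<phi> * h \<phi> \<le> ?b \<phi> ^ (a + a') * 2 powr ((e + e') * ?n \<phi>)" for \<phi>
  proof -
    have "g \<phi> * h \<phi> \<le> (?b \<phi> ^ a * 2 powr (e * ?n \<phi>)) * (?b \<phi> ^ a' * 2 powr (e' * ?n \<phi>))"
      using a[of \<phi>] a'[of \<phi>] by (intro mult_mono) auto
    also have "\<dots> = ?b \<phi> ^ (a + a') * 2 powr ((e + e') * ?n \<phi>)" by (simp add: power_add powr_add distrib_right)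
    finally show ?thesis using a[of \<phi>] a'[of \<phi>] by simp
  qed
  then show ?thesis unfolding exp_bound_def by blast
qed

lemma exp_bound_mult0: "exp_bound 0 g \<Longrightarrow> exp_bound 0 h \<Longrightarrow> exp_bound 0 (\<lambda>\<phi>. g \<phi> * h \<phi>)"
  using exp_bound_mult[of 0 g 0 h] by simp

lemma exp_bound_add:
  assumes "exp_bound e g" "exp_bound e h"
  shows "exp_bound e (\<lambda>\<phi>. g \<phi> + h \<phi>)"
proof -
  let ?b = "\<lambda>\<phi>. real (length (enc_cnf \<phi>)) + 2" and ?n = "\<lambda>\<phi>. real (length (fvars \<phi>))"
  obtain a where a: "\<And>\<phi>. 0 \<le> g \<phi> \<and> g \<phi> \<le> ?b \<phi> ^ a * 2 powr (e * ?n \<phi>)"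
    using assms(1) unfolding exp_bound_def by blast
  obtain a' where a': "\<And>\<phi>. 0 \<le> h \<phi> \<and> h \<phi> \<le> ?b \<phi> ^ a' * 2 powr (e * ?n \<phi>)"
    using assms(2) unfolding exp_bound_def by blast
  have "0 \<le> g \<phi> + h \<phi> \<and> g \<phi> + h \<phi> \<le> ?b \<phi> ^ (a + a' + 1) * 2 powr (e * ?n \<phi>)" for \<phi>
  proof -
    have b: "?b \<phi> ^ a \<le> ?b \<phi> ^ (a + a')" "?b \<phi> ^ a' \<le> ?b \<phi> ^ (a + a')" by (intro power_increasing; simp)+
    have "?b \<phi> ^ a + ?b \<phi> ^ a' \<le> 2 * ?b \<phi> ^ (a + a')" using b by linarith
    also have "\<dots> \<le> ?b \<phi> * ?b \<phi> ^ (a + a')" by (intro mult_right_mono) auto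
    finally have "?b \<phi> ^ a + ?b \<phi> ^ a' \<le> ?b \<phi> ^ (a + a' + 1)" by simp
    then have "(?b \<phi> ^ a + ?b \<phi> ^ a') * 2 powr (e * ?n \<phi>) \<le> ?b \<phi> ^ (a + a' + 1) * 2 powr (e * ?n \<phi>)"
      by (rule mult_right_mono) simp
    then show ?thesis using a[of \<phi>] a'[of \<phi>] unfolding distrib_right by linarith
  qed
  then show ?thesis unfolding exp_bound_def by blast
qed

lemma exp_bound_power: "exp_bound e g \<Longrightarrow> exp_bound (real k * e) (\<lambda>\<phi>. g \<phi> ^ k)"
proof (induction k)
  case 0
  then show ?case using exp_bound_const[of 1] by simp
next
  case (Suc k)
  then show ?case using exp_bound_mult[of e g "real k * e" "\<lambda>\<phi>. g \<phi> ^ k"] by (simp add: algebra_simps)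
qed

lemma exp_bound_power0: "exp_bound 0 g \<Longrightarrow> exp_bound 0 (\<lambda>\<phi>. g \<phi> ^ k)"
  using exp_bound_power[of 0 g k] by simp

lemma exp_bound_length: "exp_bound 0 (\<lambda>\<phi>. real (length (enc_cnf \<phi>)))"
  unfolding exp_bound_def by (intro exI[of _ 1]) simp

lemma exp_bound_powr: "exp_bound e (\<lambda>\<phi>. 2 powr (e * real (length (fvars \<phi>))))"
  unfolding exp_bound_def by (intro exI[of _ 0]) simp

lemmas exp_bound_intros =
  exp_bound_const exp_bound_add exp_bound_mult0 exp_bound_power0 exp_bound_length

lemma exp_bound_fp:
  assumes "fp F"
  shows "exp_bound 0 (\<lambda>\<phi>. real (sz (F (enc_cnf \<phi>))))"
proof -
  obtain j where j: "\<And>w n. sz w \<le> n \<Longrightarrow> sz (F w) \<le> (n + 2) ^ j" using fp_sz[OF assms] by metis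
  show ?thesis
  proof (rule exp_bound_le)
    show "exp_bound 0 (\<lambda>\<phi>. (4 * real (length (enc_cnf \<phi>)) + 3) ^ j)" by (intro exp_bound_intros) simp_all
    fix \<phi>
    have "sz (F (enc_cnf \<phi>)) \<le> (4 * length (enc_cnf \<phi>) + 1 + 2) ^ j"
      by (rule j) (use sz_bool_list in blast)
    then have "real (sz (F (enc_cnf \<phi>))) \<le> real ((4 * length (enc_cnf \<phi>) + 1 + 2) ^ j)" by (rule of_nat_mono)
    then show "0 \<le> real (sz (F (enc_cnf \<phi>))) \<and> real (sz (F (enc_cnf \<phi>))) \<le> (4 * real (length (enc_cnf \<phi>)) + 3) ^ j"
      by (simp add: add.commute)
  qed
qed

lemma outputs_within_mono: "outputs_within M w u b \<Longrightarrow> b \<le> b' \<Longrightarrow> outputs_within M w u b'"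
  unfolding outputs_within_def by (meson order.trans)

lemma length_flits: "length (flits \<phi>) = 2 * length (fvars \<phi>)"
  by (simp add: flits_def)

lemma distinct_flits: "distinct (flits \<phi>)"
  by (auto simp: flits_def fvars_def distinct_map inj_on_def)

lemma leaf_size:
  fixes \<phi> \<psi> :: cnf
  assumes S: "canon_sys (flits \<phi>) \<psi>" and p: "pick_heart d (flits \<phi>) \<psi> = []" and d: "1 \<le> d"
  shows "length (fvars \<psi>) \<le> length (fvars \<phi>)" "length \<psi> \<le> 1 + 2 * length (fvars \<phi>) * (1 + d ^ 2 + d ^ 4)"
proof -
  have F: "clause_sys (set (flits \<phi>)) (clause_sets \<psi>)" using S by (simp add: canon_sys_def)
  have "\<forall>C\<in>set \<psi>. set C \<subseteq> set (flits \<phi>)" using F by (simp add: clause_sys_def clause_sets_def)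
  moreover have "snd l \<in> set (fvars \<phi>)" if "l \<in> set (flits \<phi>)" for l
    using that in_flits[of "fst l" "snd l" \<phi>] by simp
  ultimately have sub: "set (fvars \<psi>) \<subseteq> set (fvars \<phi>)" unfolding fvars_def by fastforce
  have "card (set (fvars \<psi>)) \<le> card (set (fvars \<phi>))" by (rule card_mono[OF _ sub]) simp
  then show "length (fvars \<psi>) \<le> length (fvars \<phi>)" by (simp add: fvars_def distinct_card[symmetric])
  have "card (clause_sets \<psi>) \<le> 1 + card (set (flits \<phi>)) * (1 + d ^ 2 + d ^ 4)"
    by (rule sparse_card[OF F]) (rule pick_heart_none[OF S p d])
  then show "length \<psi> \<le> 1 + 2 * length (fvars \<phi>) * (1 + d ^ 2 + d ^ 4)"
    unfolding canon_sys_length[OF S] distinct_card[OF distinct_flits] length_flits .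
qed

text \<open>The factor 8 is that of \<open>potential_le\<close>: at most \<open>2 * w\<close> per
  literal, with \<open>w = 2 * d ^ 2\<close> and two literals per variable.\<close>

lemma search_start:
  fixes \<phi> :: cnf
  assumes "three_cnf \<phi>"
  defines "\<psi> \<equiv> minimal_clauses (map (canon (flits \<phi>)) \<phi>)"
  shows "canon_sys (flits \<phi>) \<psi>" "cnf_sat \<psi> = satisfiable \<phi>"
    "potential (2 * d ^ 2) (set (flits \<phi>)) (clause_sets \<psi>) \<le> int (8 * d ^ 2 * length (fvars \<phi>))"
proof -
  have a: "set C \<subseteq> set (flits \<phi>) \<and> length C \<le> 3" if C: "C \<in> set \<phi>" for C
  proof
    show "length C \<le> 3" using assms(1) C by (simp add: three_cnf_def)
    show "set C \<subseteq> set (flits \<phi>)"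
    proof
      fix l assume "l \<in> set C"
      then have "snd l \<in> set (fvars \<phi>)" using C unfolding fvars_def by force
      then show "l \<in> set (flits \<phi>)" using in_flits[of "fst l" "snd l" \<phi>] by simp
    qed
  qed
  show "canon_sys (flits \<phi>) \<psi>"
    unfolding \<psi>_def by (rule canon_sys_start(1)[OF _ distinct_flits]) (use a in blast)
  have e: "clause_sets \<psi> = mins (clause_sets \<phi>)"
    unfolding \<psi>_def by (rule canon_sys_start(2)[OF _ distinct_flits]) (use a in blast)
  have fin: "finite C" if "C \<in> clause_sets \<phi>" for C using that by (auto simp: clause_sets_def)
  have mh: "(\<forall>C\<in>mins (clause_sets \<phi>). C \<inter> T \<noteq> {}) \<longleftrightarrow> (\<forall>C\<in>clause_sets \<phi>. C \<inter> T \<noteq> {})" for T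
    by (rule mins_hit) (use fin in blast)
  have "cnf_sat \<psi> = cnf_sat \<phi>" unfolding cnf_sat_hit e mh ..
  then show "cnf_sat \<psi> = satisfiable \<phi>" by (simp add: cnf_sat_def satisfiable_def)
  show "potential (2 * d ^ 2) (set (flits \<phi>)) (clause_sets \<psi>) \<le> int (8 * d ^ 2 * length (fvars \<phi>))"
    using potential_le[of "2 * d ^ 2" "set (flits \<phi>)" "clause_sets \<psi>"]
    unfolding distinct_card[OF distinct_flits] length_flits by (simp add: algebra_simps)
qed

text \<open>The finitely many arguments at which the asymptotic estimate may fail are absorbed by
  the constant.\<close>

lemma small_o_linear:
  fixes f :: "nat \<Rightarrow> real"
  assumes "f \<in> o(\<lambda>T. real T)" "0 < \<eta>"
  obtains c where "0 \<le> c" "\<And>T. f T \<le> \<eta> * real T + c"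
proof -
  have "eventually (\<lambda>T. norm (f T) \<le> \<eta> * norm (real T)) at_top" by (rule landau_o.smallD[OF assms])
  then obtain m where m: "\<And>T. m \<le> T \<Longrightarrow> norm (f T) \<le> \<eta> * norm (real T)"
    unfolding eventually_at_top_linorder by blast
  show thesis
  proof (rule that[of "\<Sum>t<m. \<bar>f t\<bar>"])
    fix T
    show "f T \<le> \<eta> * real T + (\<Sum>t<m. \<bar>f t\<bar>)"
    proof (cases "m \<le> T")
      case True
      have "0 \<le> (\<Sum>t<m. \<bar>f t\<bar>)" by (rule sum_nonneg) simp
      moreover have "f T \<le> \<eta> * real T" using m[OF True] by simp
      ultimately show ?thesis by linarith
    next
      case False
      have "\<bar>f T\<bar> \<le> (\<Sum>t<m. \<bar>f t\<bar>)" by (rule member_le_sum) (use False in auto)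
      moreover have "0 \<le> \<eta> * real T" using assms(2) by simp
      ultimately show ?thesis by linarith
    qed
  qed (rule sum_nonneg, simp)
qed

text \<open>By \<open>1 + y \<le> exp y\<close>, the power is at most
  \<open>exp (8 * n / d)\<close>. Since \<open>ln 2 \<ge> 1 / 2\<close>, twice that exponent
  suffices for base 2.\<close>

lemma branching_powr:
  assumes "1 \<le> d"
  shows "(1 + 1 / real d ^ 3) ^ (8 * d ^ 2 * n) \<le> 2 powr (16 / real d * real n)"
proof -
  have "(1 + 1 / real d ^ 3) ^ (8 * d ^ 2 * n) \<le> exp (1 / real d ^ 3) ^ (8 * d ^ 2 * n)"
    by (intro power_mono exp_ge_add_one_self) simp
  also have "\<dots> = exp (real (8 * d ^ 2 * n) * (1 / real d ^ 3))" by (rule exp_of_nat_mult[symmetric])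
  also have "real (8 * d ^ 2 * n) * (1 / real d ^ 3) = 8 * real n / real d"
    using assms by (simp add: field_simps power3_eq_cube power2_eq_square)
  also have "exp (8 * real n / real d) \<le> exp (16 / real d * real n * ln 2)"
  proof -
    have "1 / 2 \<le> ln (2 :: real)" using exp_half_le2 by (subst ln_ge_iff) auto
    then have "16 / real d * real n * (1 / 2) \<le> 16 / real d * real n * ln 2" by (intro mult_left_mono) auto
    then show ?thesis by simp
  qed
  also have "\<dots> = 2 powr (16 / real d * real n)" by (simp add: powr_def)
  finally show ?thesis .
qed

lemma three_sat_solvable_if:
  assumes k: "2 \<le> k" and sol: "solvable_subexp_lifetime (restricted_instances k 1)" and \<delta>: "0 < \<delta>"
  shows "three_sat_solvable \<delta>"
proof -
  obtain M p f where M: "wf_tm M" and f: "f \<in> o(\<lambda>T. real T)"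
    and run: "\<And>I. I \<in> restricted_instances k 1 \<Longrightarrow> outputs_within M (enc_instance I) [edtsb_yes I]
      (real (poly p (length (enc_instance I))) * 2 powr f (lifetime (inst_digraph I)))"
    using sol unfolding solvable_subexp_lifetime_def by blast
  \<comment> \<open>Half of \<delta> is spent on the branching:
    \<open>16 / d \<le> \<delta> / 2\<close>. The 10 is the one of
    \<open>growth_rate\<close>.\<close>
  define d where "d = max 10 (nat \<lceil>32 / \<delta>\<rceil>)"
  have d: "10 \<le> d" "1 \<le> d" by (simp_all add: d_def)
  have "32 / \<delta> \<le> real (nat \<lceil>32 / \<delta>\<rceil>)" by (rule real_nat_ceiling_ge)
  also have "\<dots> \<le> real d" by (simp add: d_def)
  finally have "32 \<le> real d * \<delta>" using \<delta> by (simp add: field_simps)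
  then have d\<delta>: "16 / real d \<le> \<delta> / 2" using d by (simp add: field_simps)

  define start where "start = (\<lambda>\<phi> :: cnf. (flits \<phi>, [minimal_clauses (map (canon (flits \<phi>)) \<phi>)], [] :: sim list, False))"
  have fl: "fp (\<lambda>w. flits (decode_cnf w))" by (rule fp_comp[OF fp_flits fp_decode_cnf])
  have fs: "fp (\<lambda>w. start (decode_cnf w))"
    unfolding start_def
    by (intro fp_comp[OF fp_minimal_clauses] fp_comp2[OF fp_canon] fp_comp[OF fl] fp_comp[OF fp_decode_cnf]
        fp_Pair fp_Cons fp_map fp_const fp_fst fp_snd fp_id)
  have fe: "fp (\<lambda>s :: search_state. [snd (snd (snd s))])" by (intro fp_intros)
  obtain cs ks where cs: "wf_com cs"
    "\<And>x rest n. sz x \<le> n \<Longrightarrow> tf cs (dcode x @ rest) ((n + 2) ^ ks) (dcode (start (decode_cnf x)) @ rest)"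
    by (rule fpE[OF fs]) (rule that, assumption+)
  obtain cb kb where cb: "wf_com cb"
    "\<And>x rest n. sz x \<le> n \<Longrightarrow> tf cb (dcode x @ rest) ((n + 2) ^ kb) (dcode (searching x) @ rest)"
    by (rule fpE[OF fp_searching]) (rule that, assumption+)
  obtain cg kg where cg: "wf_com cg"
    "\<And>x rest n. sz x \<le> n \<Longrightarrow> tf cg (dcode x @ rest) ((n + 2) ^ kg) (dcode (search_step k d M x) @ rest)"
    by (rule fpE[OF fp_search_step[of k d M]]) (rule that, assumption+)
  obtain ce ke where ce: "wf_com ce"
    "\<And>(x :: search_state) rest n. sz x \<le> n \<Longrightarrow> tf ce (dcode x @ rest) ((n + 2) ^ ke) (dcode [snd (snd (snd x))] @ rest)"
    by (rule fpE[OF fe]) (rule that, assumption+)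
  have fw: "fp (\<lambda>\<psi> :: cnf. enc_instance (reduction k \<psi>))" by (rule fp_comp[OF fp_enc_instance fp_reduction])
  obtain kw where kw: "\<And>(\<psi> :: cnf) n. sz \<psi> \<le> n \<Longrightarrow> sz (enc_instance (reduction k \<psi>)) \<le> (n + 2) ^ kw"
    using fp_sz[OF fw] by metis
  obtain kz where kz: "\<And>(\<psi> :: cnf) n. sz \<psi> \<le> n \<Longrightarrow> sz (sim_init M (enc_instance (reduction k \<psi>))) \<le> (n + 2) ^ kz"
    using fp_sz[OF fp_comp[OF fp_sim_init fw]] by metis
  obtain kp where kp: "\<And>n. poly p n \<le> (n + 2) ^ kp" using pbd_of_poly[of p] unfolding pbd_def by blast

  \<comment> \<open>The states of the search have size \<open>2 ^ (\<epsilon> n)\<close> up to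
    polynomial factors; one round is polynomial in this size with degrees \<open>kb\<close> and
    \<open>kg\<close>, the final output with degree \<open>ke\<close>. As these degrees are fixed by
    now, \<epsilon> can be chosen so that all this fits into the other half of \<delta>. The 2
    accounts for the time at the leaves and for the linear term in \<open>H\<close>.\<close>
  define \<epsilon> where "\<epsilon> = \<delta> / (2 * (real kb + real kg + real ke + 2))"
  have \<epsilon>: "0 < \<epsilon>" unfolding \<epsilon>_def using \<delta> by (intro divide_pos_pos) auto
  have \<epsilon>k: "(real kb + real kg + real ke + 2) * \<epsilon> = \<delta> / 2" unfolding \<epsilon>_def by (simp add: divide_simps)
  \<comment> \<open>A sparse formula has at most \<open>1 + 2 * n * (1 + d ^ 2 + d ^ 4)\<close>
    clauses, and the lifetime is at most 6 per variable plus 2 per clause, altogether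
    \<open>C * n + 2\<close>. With \<eta> as below, \<eta> times the lifetime is thus
    \<open>\<epsilon> * n\<close> up to a constant.\<close>
  define C where "C = real (6 + 4 * (1 + d ^ 2 + d ^ 4))"
  have C: "0 < C" unfolding C_def by (rule of_nat_0_less_iff[THEN iffD2]) simp
  define \<eta> where "\<eta> = \<epsilon> / C"
  have \<eta>: "0 < \<eta>" using \<epsilon> C by (simp add: \<eta>_def)
  have \<eta>C: "\<eta> * C = \<epsilon>" using C by (simp add: \<eta>_def)
  obtain c0 where c0: "0 \<le> c0" "\<And>T. f T \<le> \<eta> * real T + c0" using small_o_linear[OF f \<eta>] by blast

  define K where "K = 6 * sz (delta_table M) + 8"
  define n where "n = (\<lambda>\<phi> :: cnf. length (fvars \<phi>))"
  define u where "u = (\<lambda>\<phi> :: cnf. sz (flits \<phi>))"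
  define Z where "Z = (\<lambda>\<phi>. 1 + (1 + u \<phi>) ^ 3 * (u \<phi> + 1))"
  define Z0 where "Z0 = (\<lambda>\<phi>. (Z \<phi> + 2) ^ kz)"
  \<comment> \<open>The time of the machine at a leaf. In the exponent, \<open>2 * \<eta>\<close>
    stems from the summand 2 of the lifetime and \<open>c0\<close> from
    \<open>small_o_linear\<close>.\<close>
  define R where "R = (\<lambda>\<phi>. real (poly p ((Z \<phi> + 2) ^ kw)) * 2 powr (\<epsilon> * real (n \<phi>) + (2 * \<eta> + c0)))"
  define S where "S = (\<lambda>\<phi>. nat \<lceil>R \<phi>\<rceil>)"
  define m where "m = (\<lambda>\<phi>. 8 * d ^ 2 * n \<phi>)"
  \<comment> \<open>The size of a state: the literals, the waiting formulas, and a configuration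
    that starts with size at most \<open>Z0\<close> and grows by at most \<open>K\<close> in each of
    \<open>S\<close> steps.\<close>
  define B where "B = (\<lambda>\<phi>. u \<phi> + 1 + (m \<phi> + 1) * (Z \<phi> + 1) + (Z0 \<phi> + K * S \<phi> + 10))"
  define G where "G = (\<lambda>\<phi>. (real (S \<phi>) + 3) * (2 * (1 + 1 / real d ^ 3) ^ m \<phi>))"
  define H where "H = (\<lambda>\<phi>. (real (B \<phi>) + 2) ^ kb + (real (B \<phi>) + 2) ^ kg + 28 * real (B \<phi>) + 66)"
  define W where "W = (\<lambda>\<phi>. 2 * (20 * real (length (enc_cnf \<phi>)) +
    ((4 * real (length (enc_cnf \<phi>)) + 3) ^ ks + (G \<phi> + 1) * H \<phi> + (real (B \<phi>) + 2) ^ ke) + 13))"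

  have n_le: "n \<phi> \<le> u \<phi>" for \<phi>
    using length_le_sz[of "flits \<phi>"] by (simp add: n_def u_def length_flits)
  have bu: "exp_bound 0 (\<lambda>\<phi>. real (u \<phi>))"
    using exp_bound_fp[OF fl] by (simp add: u_def decode_cnf)
  have bn: "exp_bound 0 (\<lambda>\<phi>. real (n \<phi>))" by (rule exp_bound_le[OF bu]) (simp add: n_le)
  have bm: "exp_bound 0 (\<lambda>\<phi>. real (m \<phi>))"
    unfolding m_def of_nat_mult by (intro exp_bound_intros bn) simp_all
  have bZ: "exp_bound 0 (\<lambda>\<phi>. real (Z \<phi>))"
    unfolding Z_def of_nat_add of_nat_mult of_nat_power of_nat_1 by (intro exp_bound_intros bu) simp_all
  have bZ0: "exp_bound 0 (\<lambda>\<phi>. real (Z0 \<phi>))"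
    unfolding Z0_def of_nat_add of_nat_power of_nat_numeral by (intro exp_bound_intros bZ) simp_all
  have bp: "exp_bound 0 (\<lambda>\<phi>. real (poly p ((Z \<phi> + 2) ^ kw)))"
  proof (rule exp_bound_le)
    show "exp_bound 0 (\<lambda>\<phi>. ((real (Z \<phi>) + 2) ^ kw + 2) ^ kp)" by (intro exp_bound_intros bZ) simp_all
    fix \<phi>
    have "real (poly p ((Z \<phi> + 2) ^ kw)) \<le> real (((Z \<phi> + 2) ^ kw + 2) ^ kp)" by (rule of_nat_mono[OF kp])
    then show "0 \<le> real (poly p ((Z \<phi> + 2) ^ kw)) \<and> real (poly p ((Z \<phi> + 2) ^ kw)) \<le> ((real (Z \<phi>) + 2) ^ kw + 2) ^ kp"
      by (simp add: add.commute)
  qed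
  have R0: "0 \<le> R \<phi>" for \<phi> by (simp add: R_def)
  have bR: "exp_bound \<epsilon> R"
  proof -
    have "exp_bound (0 + (\<epsilon> + 0)) (\<lambda>\<phi>. real (poly p ((Z \<phi> + 2) ^ kw)) *
        (2 powr (\<epsilon> * real (length (fvars \<phi>))) * 2 powr (2 * \<eta> + c0)))"
      by (intro exp_bound_mult bp exp_bound_powr exp_bound_const) simp
    then show ?thesis unfolding R_def n_def powr_add by simp
  qed
  have one: "exp_bound \<epsilon> (\<lambda>_. c)" if "0 \<le> c" for c
    using exp_bound_mono[OF exp_bound_const[OF that]] \<epsilon> by simp
  have bS: "exp_bound \<epsilon> (\<lambda>\<phi>. real (S \<phi>))"
  proof (rule exp_bound_le[OF exp_bound_add[OF bR one[of 1]]])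
    show "0 \<le> real (S \<phi>) \<and> real (S \<phi>) \<le> R \<phi> + 1" for \<phi> using R0[of \<phi>] unfolding S_def by linarith
  qed simp
  have bB: "exp_bound \<epsilon> (\<lambda>\<phi>. real (B \<phi>))"
  proof (rule exp_bound_le)
    have 0: "exp_bound 0 (\<lambda>\<phi>. real (u \<phi>) + 1 + (real (m \<phi>) + 1) * (real (Z \<phi>) + 1) + real (Z0 \<phi>) + 10)"
      by (intro exp_bound_intros bu bm bZ bZ0) simp_all
    have 1: "exp_bound (0 + \<epsilon>) (\<lambda>\<phi>. real K * real (S \<phi>))" by (intro exp_bound_mult exp_bound_const bS) simp
    show "exp_bound \<epsilon> (\<lambda>\<phi>. real (u \<phi>) + 1 + (real (m \<phi>) + 1) * (real (Z \<phi>) + 1) + real (Z0 \<phi>) + 10 + real K * real (S \<phi>))"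
      using exp_bound_add[OF exp_bound_mono[OF 0] 1[unfolded add_0]] \<epsilon> by simp
  qed (simp add: B_def algebra_simps)
  have b2: "exp_bound \<epsilon> (\<lambda>\<phi>. real (B \<phi>) + 2)" by (intro exp_bound_add bB one) simp
  have bG: "exp_bound (\<epsilon> + \<delta> / 2) (\<lambda>\<phi>. G \<phi> + 1)"
  proof (rule exp_bound_add)
    have x: "exp_bound (\<delta> / 2) (\<lambda>\<phi>. (1 + 1 / real d ^ 3) ^ m \<phi>)"
    proof (rule exp_bound_le[OF exp_bound_powr])
      fix \<phi>
      have "(1 + 1 / real d ^ 3) ^ m \<phi> \<le> 2 powr (16 / real d * real (length (fvars \<phi>)))"
        unfolding m_def n_def by (rule branching_powr[OF d(2)])
      also have "\<dots> \<le> 2 powr (\<delta> / 2 * real (length (fvars \<phi>)))" using d\<delta> by (intro powr_mono mult_right_mono) auto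
      finally show "0 \<le> (1 + 1 / real d ^ 3) ^ m \<phi> \<and> (1 + 1 / real d ^ 3) ^ m \<phi> \<le> 2 powr (\<delta> / 2 * real (length (fvars \<phi>)))"
        by simp
    qed
    have "exp_bound (\<epsilon> + (0 + \<delta> / 2)) G"
      unfolding G_def by (intro exp_bound_mult exp_bound_add bS one exp_bound_const x) simp_all
    then show "exp_bound (\<epsilon> + \<delta> / 2) G" by simp
    show "exp_bound (\<epsilon> + \<delta> / 2) (\<lambda>_. 1)" using exp_bound_mono[OF exp_bound_const[of 1]] \<epsilon> \<delta> by simp
  qed
  let ?e = "(real kb + real kg + 1) * \<epsilon>"
  have e: "0 \<le> ?e" "\<epsilon> \<le> ?e" "real kb * \<epsilon> \<le> ?e" "real kg * \<epsilon> \<le> ?e" using \<epsilon> by (simp_all add: algebra_simps)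
  have bH: "exp_bound ?e H"
    unfolding H_def
  proof (intro exp_bound_add)
    show "exp_bound ?e (\<lambda>\<phi>. (real (B \<phi>) + 2) ^ kb)" by (rule exp_bound_mono[OF exp_bound_power[OF b2] e(3)])
    show "exp_bound ?e (\<lambda>\<phi>. (real (B \<phi>) + 2) ^ kg)" by (rule exp_bound_mono[OF exp_bound_power[OF b2] e(4)])
    have "exp_bound (0 + \<epsilon>) (\<lambda>\<phi>. 28 * real (B \<phi>))" by (intro exp_bound_mult exp_bound_const bB) simp
    then show "exp_bound ?e (\<lambda>\<phi>. 28 * real (B \<phi>))" using exp_bound_mono e(2) by simp
    show "exp_bound ?e (\<lambda>_. 66)" by (rule exp_bound_mono[OF exp_bound_const e(1)]) simp
  qed
  have up: "exp_bound \<delta> g" if "exp_bound 0 g" for g using exp_bound_mono[OF that] \<delta> by simp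
  have bW: "exp_bound \<delta> W"
  proof -
    have "\<epsilon> + \<delta> / 2 + ?e \<le> \<delta>"
    proof -
      have "\<epsilon> + ?e + real ke * \<epsilon> = \<delta> / 2" using \<epsilon>k by (simp add: algebra_simps)
      moreover have "0 \<le> real ke * \<epsilon>" using \<epsilon> by simp
      ultimately show ?thesis by linarith
    qed
    then have 1: "exp_bound \<delta> (\<lambda>\<phi>. (G \<phi> + 1) * H \<phi>)" by (rule exp_bound_mono[OF exp_bound_mult[OF bG bH]])
    have "real ke * \<epsilon> \<le> \<delta>"
    proof -
      have "real ke * \<epsilon> + (real kb + real kg + 2) * \<epsilon> = \<delta> / 2" using \<epsilon>k by (simp add: algebra_simps)
      moreover have "0 \<le> (real kb + real kg + 2) * \<epsilon>" using \<epsilon> by simp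
      ultimately show ?thesis using \<delta> by linarith
    qed
    then have 2: "exp_bound \<delta> (\<lambda>\<phi>. (real (B \<phi>) + 2) ^ ke)" by (rule exp_bound_mono[OF exp_bound_power[OF b2]])
    have 3: "exp_bound 0 (\<lambda>\<phi>. 20 * real (length (enc_cnf \<phi>)))" "exp_bound 0 (\<lambda>\<phi>. (4 * real (length (enc_cnf \<phi>)) + 3) ^ ks)"
      "exp_bound 0 (\<lambda>\<phi>. 13)" by (intro exp_bound_intros; simp)+
    have "exp_bound (0 + \<delta>) (\<lambda>\<phi>. 2 * (20 * real (length (enc_cnf \<phi>)) +
        ((4 * real (length (enc_cnf \<phi>)) + 3) ^ ks + (G \<phi> + 1) * H \<phi> + (real (B \<phi>) + 2) ^ ke) + 13))"
      by (rule exp_bound_mult[OF exp_bound_const]) (simp, intro exp_bound_add 1 2 up[OF 3(1)] up[OF 3(2)] up[OF 3(3)])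
    then show ?thesis unfolding W_def by simp
  qed

  define prog where "prog = (cs ;; while_com cb cg ;; ce)"
  have wf: "wf_com prog" unfolding prog_def using cs(1) wf_while_com[OF cb(1) cg(1)] ce(1) by simp
  have main: "outputs_within (word_machine prog) (enc_cnf \<phi>) [satisfiable \<phi>] (W \<phi>)" if \<phi>: "three_cnf \<phi>" for \<phi>
  proof -
    let ?U = "flits \<phi>" and ?w = "enc_cnf \<phi>"
    let ?\<psi> = "minimal_clauses (map (canon ?U) \<phi>)"
    note st = search_start[OF \<phi>]
    have sK: "sz (sim_step M c) \<le> sz c + K" for c unfolding K_def by (rule sz_sim_step)
    have Zb: "sz \<psi> \<le> Z \<phi>" if "canon_sys ?U \<psi>" for \<psi>
    proof -
      have "length ?U \<le> u \<phi>" using length_le_sz[of ?U] by (simp add: u_def)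
      then have "(1 + length ?U) ^ 3 * (sz ?U + 1) \<le> (1 + u \<phi>) ^ 3 * (u \<phi> + 1)"
        unfolding u_def by (intro mult_le_mono power_mono) simp_all
      then show ?thesis using canon_sys_sz[OF that] unfolding Z_def by linarith
    qed
    have leaf: "outputs_within M (enc_instance (reduction k \<psi>)) [cnf_sat \<psi>] (real (S \<phi>)) \<and>
        sz (sim_init M (enc_instance (reduction k \<psi>))) \<le> Z0 \<phi>"
      if \<psi>: "canon_sys ?U \<psi>" "pick_heart d ?U \<psi> = []" for \<psi>
    proof
      let ?I = "reduction k \<psi>"
      show "sz (sim_init M (enc_instance ?I)) \<le> Z0 \<phi>" unfolding Z0_def by (rule kz[OF Zb[OF \<psi>(1)]])
      have "sz (enc_instance ?I) \<le> (Z \<phi> + 2) ^ kw" by (rule kw[OF Zb[OF \<psi>(1)]])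
      then have "length (enc_instance ?I) \<le> (Z \<phi> + 2) ^ kw" using sz_bool_list[of "enc_instance ?I"] by linarith
      then have 1: "real (poly p (length (enc_instance ?I))) \<le> real (poly p ((Z \<phi> + 2) ^ kw))"
        by (intro of_nat_mono nat_poly_mono)
      let ?T = "lifetime (inst_digraph ?I)"
      have "?T \<le> 6 * n \<phi> + 2 * (1 + 2 * n \<phi> * (1 + d ^ 2 + d ^ 4))"
        unfolding n_def
        by (rule order.trans[OF lifetime_reduction]) (intro add_mono mult_le_mono2 leaf_size[OF \<psi> d(2)])
      also have "\<dots> = (6 + 4 * (1 + d ^ 2 + d ^ 4)) * n \<phi> + 2" by (simp add: algebra_simps)
      finally have "real ?T \<le> real ((6 + 4 * (1 + d ^ 2 + d ^ 4)) * n \<phi> + 2)" by (rule of_nat_mono)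
      then have "real ?T \<le> C * real (n \<phi>) + 2" unfolding of_nat_add[of _ 2] of_nat_mult C_def[symmetric] by simp
      then have "\<eta> * real ?T \<le> \<eta> * (C * real (n \<phi>) + 2)" using \<eta> by (intro mult_left_mono) auto
      also have "\<dots> = \<eta> * C * real (n \<phi>) + 2 * \<eta>" by (simp add: algebra_simps)
      finally have "f ?T \<le> \<epsilon> * real (n \<phi>) + (2 * \<eta> + c0)" using c0(2)[of ?T] unfolding \<eta>C by linarith
      then have "2 powr f ?T \<le> 2 powr (\<epsilon> * real (n \<phi>) + (2 * \<eta> + c0))" by (intro powr_mono) auto
      then have "real (poly p (length (enc_instance ?I))) * 2 powr f ?T \<le> R \<phi>"
        unfolding R_def using 1 by (intro mult_mono) auto
      also have "\<dots> \<le> real (S \<phi>)" unfolding S_def by (rule real_nat_ceiling_ge)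
      finally have b: "real (poly p (length (enc_instance ?I))) * 2 powr f ?T \<le> real (S \<phi>)" .
      show "outputs_within M (enc_instance ?I) [cnf_sat \<psi>] (real (S \<phi>))"
        using outputs_within_mono[OF run[OF reduction_restricted[OF k]] b] unfolding reduction_yes_iff[OF k] .
    qed
    have pm: "potential (2 * d ^ 2) (set ?U) (clause_sets ?\<psi>) \<le> int (m \<phi>)" unfolding m_def n_def by (rule st(3))
    have "sz ?U + sz ([] :: cnf list) + (m \<phi> + 1) * (Z \<phi> + 1) + (Z0 \<phi> + K * S \<phi> + 10) \<le> B \<phi>"
      unfolding B_def u_def by simp
    from search_loops[where k = k, OF M sK d(1) leaf Zb st(1) pm this]
    obtain i r where i: "loops (search_step k d M) searching (B \<phi>) i (?U, [?\<psi>], [], False) (?U, r, [], cnf_sat ?\<psi>)"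
      "\<not> cnf_sat ?\<psi> \<longrightarrow> r = []" "real i \<le> (real (S \<phi>) + 3) * (2 * (1 + 1 / real d ^ 3) ^ m \<phi> - 1)" by blast
    let ?s = "(?U, [?\<psi>], [] :: sim list, False)" and ?t = "(?U, r, [] :: sim list, cnf_sat ?\<psi>)"
    note fpw = loops_funpow[OF i(1)]
    \<comment> \<open>Either the flag is set, or the formula is unsatisfiable and the stack has
      become empty.\<close>
    have stop: "\<not> searching ?t" using i(2) by (auto simp: searching_def)
    have s: "start (decode_cnf ?w) = ?s" by (simp add: start_def decode_cnf)
    have t1: "tf cs (dcode ?w @ []) ((4 * length ?w + 1 + 2) ^ ks) (dcode ?s @ [])"
      using cs(2)[OF conjunct2[OF sz_bool_list[of ?w]], of "[]"] unfolding s .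
    have t2: "tf (while_com cb cg) (dcode ?s @ []) ((i + 1) * ((B \<phi> + 2) ^ kb + (B \<phi> + 2) ^ kg + 28 * B \<phi> + 66)) (dcode ?t @ [])"
      using tf_while_com[of cb kb searching cg kg "search_step k d M" i ?s "B \<phi>" "[]", OF cb(2) cg(2)] fpw stop by simp
    have "sz ?t \<le> B \<phi>"
      using fpw[THEN conjunct2, THEN conjunct2, THEN spec, of i, THEN mp, OF order.refl] unfolding conjunct1[OF fpw] .
    then have t3: "tf ce (dcode ?t @ []) ((B \<phi> + 2) ^ ke) (dcode [cnf_sat ?\<psi>] @ [])" using ce(2)[of ?t "B \<phi>" "[]"] by simp
    let ?m = "(4 * length ?w + 1 + 2) ^ ks + ((i + 1) * ((B \<phi> + 2) ^ kb + (B \<phi> + 2) ^ kg + 28 * B \<phi> + 66) + (B \<phi> + 2) ^ ke)"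
    have t: "tf prog (dcode ?w) ?m (dcode [satisfiable \<phi>])"
      using tf_Seq[OF t1 tf_Seq[OF t2 t3]] unfolding prog_def st(2) append_Nil2 .
    have iG: "real i + 1 \<le> G \<phi> + 1"
    proof -
      have "(real (S \<phi>) + 3) * (2 * (1 + 1 / real d ^ 3) ^ m \<phi> - 1) \<le> G \<phi>"
        unfolding G_def by (intro mult_left_mono) auto
      then show ?thesis using i(3) by linarith
    qed
    have H0: "0 \<le> H \<phi>" unfolding H_def by (intro add_nonneg_nonneg zero_le_power) auto
    have "real ?m = (4 * real (length ?w) + 3) ^ ks + ((real i + 1) * H \<phi> + (real (B \<phi>) + 2) ^ ke)"
      unfolding H_def by (simp add: algebra_simps)
    also have "\<dots> \<le> (4 * real (length ?w) + 3) ^ ks + ((G \<phi> + 1) * H \<phi> + (real (B \<phi>) + 2) ^ ke)"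
      by (intro add_mono mult_right_mono iG H0 order.refl)
    finally have m: "real ?m \<le> (4 * real (length ?w) + 3) ^ ks + (G \<phi> + 1) * H \<phi> + (real (B \<phi>) + 2) ^ ke"
      by (simp only: add.assoc)
    have "2 * (l + a + 9 * real (length [c]) + 4) \<le> 2 * (l + b + 13)" if "a \<le> b" for a b l :: real and c :: bool
      using that by simp
    from this[OF m] have "2 * (20 * real (length ?w) + real ?m + 9 * real (length [satisfiable \<phi>]) + 4) \<le> W \<phi>"
      unfolding W_def .
    then show ?thesis by (rule word_machine_outputs[OF wf t])
  qed
  obtain a where a: "\<And>\<phi>. W \<phi> \<le> (real (length (enc_cnf \<phi>)) + 2) ^ a * 2 powr (\<delta> * real (length (fvars \<phi>)))"
    using bW unfolding exp_bound_def by blast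
  have vars: "card (cnf_vars \<phi>) = length (fvars \<phi>)" for \<phi>
  proof -
    have v: "cnf_vars \<phi> = set (fvars \<phi>)" by (auto simp: cnf_vars_def fvars_def)
    have "distinct (fvars \<phi>)" by (simp add: fvars_def)
    then show ?thesis unfolding v by (rule distinct_card)
  qed
  show ?thesis
    unfolding three_sat_solvable_def
  proof (intro exI conjI allI impI)
    show "wf_tm (word_machine prog)" by (rule wf_word_machine[OF wf])
    fix \<phi> assume \<phi>: "three_cnf \<phi>"
    have "W \<phi> \<le> real (poly ([:2, 1:] ^ a) (length (enc_cnf \<phi>))) * 2 powr (\<delta> * real (card (cnf_vars \<phi>)))"
      using a[of \<phi>] by (simp add: vars poly_power add.commute)
    then show "outputs_within (word_machine prog) (enc_cnf \<phi>) [satisfiable \<phi>]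
        (real (poly ([:2, 1:] ^ a) (length (enc_cnf \<phi>))) * 2 powr (\<delta> * real (card (cnf_vars \<phi>))))"
      by (rule outputs_within_mono[OF main[OF \<phi>]])
  qed
qed

theorem theorem3:
  fixes k :: nat
  assumes "2 \<le> k"
  shows "NP_complete (edtsb_language (edtsb_instances k)) \<and>
    (\<exists>c. NP_complete (edtsb_language (restricted_instances k c)) \<and>
         (ETH \<longrightarrow> \<not> solvable_subexp_lifetime (restricted_instances k c)))"
proof -
  \<comment> \<open>Restricted instances are instances, so this one fact yields both hardness
    claims; the bound on the snapshots is \<open>c = 1\<close>.\<close>
  have r: "reduction k \<phi> \<in> restricted_instances k 1" for \<phi> :: "(bool \<times> nat list) list list"
    by (rule reduction_restricted[OF assms])
  then have r': "reduction k \<phi> \<in> edtsb_instances k" for \<phi> :: "(bool \<times> nat list) list list"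
    by (simp add: restricted_instances_def)
  have 1: "edtsb_language (edtsb_instances k) \<in> class_NP"
    by (rule edtsb_in_NP[OF fp_const[of True]]) (simp add: edtsb_instances_iff)
  have 2: "edtsb_language (restricted_instances k 1) \<in> class_NP"
    by (rule edtsb_in_NP[OF fp_star_ok]) (rule restricted_instances_iff)
  have 3: "ETH \<longrightarrow> \<not> solvable_subexp_lifetime (restricted_instances k 1)"
    unfolding ETH_def using three_sat_solvable_if[OF assms] by blast
  show ?thesis
    unfolding NP_complete_def using 1 2 3 NP_hard_edtsb[OF r assms] NP_hard_edtsb[OF r' assms] by blast
qed

end
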